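(* Let $k$ be a field of characteristic zero and let $\mathrm{Ch}(k)$ denote either bounded (i.e. non-negatively graded, $\mathrm{Ch}_{\ge0}(k)$) or unbounded chain complexes over $k$, with the projective (equivalently, the injective) model structure. Then for each $n\ge1$ and each object $X\in\mathrm{Ch}(k)^{\Sigma_n^{\mathrm{op}}}$, the function $f\mapsto X\otimes_{\Sigma_n}f^{\square n}$ on morphisms of $\mathrm{Ch}(k)$ preserves trivial cofibrations.
   Context: $\mathrm{Ch}(k)$ is symmetric monoidal under the usual tensor product over $k$. For a map $f:X\to Y$, $f^{\square n}$ is the $n$-fold iterated pushout product of $f$ with itself (where $f\square g$, for $f:X_0\to X_1$, $g:Y_0\to Y_1$, is the map $X_0\otimes Y_1\coprod_{X_0\otimes Y_0}X_1\otimes Y_0\to X_1\otimes Y_1$); it has target $Y^{\otimes n}$ and a natural left $\Sigma_n$-action. $\mathrm{Ch}(k)^{\Sigma_n^{\mathrm{op}}}$ is the category of complexes with right $\Sigma_n$-action, and $X\otimes_{\Sigma_n}(-)$ denotes $\Sigma_n$-coinvariants of $X\otimes(-)$. *)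

theory Defs
  imports "HOL-Algebra.Module" "HOL-Algebra.AbelCoset" "HOL-Combinatorics.Permutations"
begin

section \<open>Modules: linear maps, spans, quotients\<close>

definition linear_maps ::
  "('k, 'r) ring_scheme \<Rightarrow> ('k, 'a) module \<Rightarrow> ('k, 'b) module \<Rightarrow> ('a \<Rightarrow> 'b) set" where
  "linear_maps R M N =
    {h \<in> hom (add_monoid M) (add_monoid N).
       \<forall>c\<in>carrier R. \<forall>x\<in>carrier M. h (c \<odot>\<^bsub>M\<^esub> x) = c \<odot>\<^bsub>N\<^esub> h x}"

definition submodule_span ::
  "('k, 'r) ring_scheme \<Rightarrow> ('k, 'a) module \<Rightarrow> 'a set \<Rightarrow> 'a set" where
  "submodule_span R M S = \<Inter>{W. submodule W R M \<and> S \<subseteq> W}"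

text \<open>
  The library's record of modules extends the record of rings; the fields \<open>mult\<close> and \<open>one\<close>
  play no role for modules and are left undefined.
\<close>

definition quotient_module :: "('k, 'a) module \<Rightarrow> 'a set \<Rightarrow> ('k, 'a set) module" where
  "quotient_module M W =
    \<lparr>carrier = a_rcosets\<^bsub>M\<^esub> W, monoid.mult = undefined, monoid.one = undefined,
     ring.zero = W, ring.add = set_add M, module.smult = (\<lambda>c A. \<Union>a\<in>A. W +>\<^bsub>M\<^esub> (c \<odot>\<^bsub>M\<^esub> a))\<rparr>"

text \<open>
  The map into \<open>quotient_module N W\<close> induced by \<open>h\<close>: it sends a coset \<open>A\<close> to the coset of
  \<open>h a\<close>, for any \<open>a \<in> A\<close>.
\<close>

definition induced_map :: "('k, 'b) module \<Rightarrow> 'b set \<Rightarrow> ('a \<Rightarrow> 'b) \<Rightarrow> 'a set \<Rightarrow> 'b set" where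
  "induced_map N W h A = (\<Union>a\<in>A. W +>\<^bsub>N\<^esub> h a)"


section \<open>Modules presented by generators and relations\<close>

text \<open>
  A formal linear combination \<open>c\<^sub>1 g\<^sub>1 + \<dots> + c\<^sub>r g\<^sub>r\<close> of generators is the list
  \<open>[(c\<^sub>1, g\<^sub>1), \<dots>, (c\<^sub>r, g\<^sub>r)]\<close>, and \<open>rel_cong R G Rel\<close> is the congruence whose classes are the
  elements of the \<open>R\<close>-module with generators \<open>G\<close> and relations \<open>r = 0\<close> for \<open>r \<in> Rel\<close>.
\<close>

definition formal_combs :: "('k, 'r) ring_scheme \<Rightarrow> 'g set \<Rightarrow> ('k \<times> 'g) list set" where
  "formal_combs R G = lists (carrier R \<times> G)"

definition scale_comb :: "('k, 'r) ring_scheme \<Rightarrow> 'k \<Rightarrow> ('k \<times> 'g) list \<Rightarrow> ('k \<times> 'g) list" where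
  "scale_comb R c = map (\<lambda>(b, g). (c \<otimes>\<^bsub>R\<^esub> b, g))"

inductive rel_cong ::
  "('k, 'r) ring_scheme \<Rightarrow> 'g set \<Rightarrow> ('k \<times> 'g) list set \<Rightarrow> ('k \<times> 'g) list \<Rightarrow> ('k \<times> 'g) list \<Rightarrow> bool"
  for R G Rel where
  rc_refl: "xs \<in> formal_combs R G \<Longrightarrow> rel_cong R G Rel xs xs"
| rc_sym: "rel_cong R G Rel xs ys \<Longrightarrow> rel_cong R G Rel ys xs"
| rc_trans: "rel_cong R G Rel xs ys \<Longrightarrow> rel_cong R G Rel ys zs \<Longrightarrow> rel_cong R G Rel xs zs"
| rc_append: "rel_cong R G Rel xs ys \<Longrightarrow> rel_cong R G Rel xs' ys' \<Longrightarrow>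
    rel_cong R G Rel (xs @ xs') (ys @ ys')"
| rc_comm: "xs \<in> formal_combs R G \<Longrightarrow> ys \<in> formal_combs R G \<Longrightarrow>
    rel_cong R G Rel (xs @ ys) (ys @ xs)"
| rc_add: "a \<in> carrier R \<Longrightarrow> b \<in> carrier R \<Longrightarrow> g \<in> G \<Longrightarrow>
    rel_cong R G Rel [(a, g), (b, g)] [(a \<oplus>\<^bsub>R\<^esub> b, g)]"
| rc_zero: "g \<in> G \<Longrightarrow> rel_cong R G Rel [(\<zero>\<^bsub>R\<^esub>, g)] []"
| rc_rel: "r \<in> Rel \<Longrightarrow> r \<in> formal_combs R G \<Longrightarrow> c \<in> carrier R \<Longrightarrow>
    rel_cong R G Rel (scale_comb R c r) []"

definition comb_class ::
  "('k, 'r) ring_scheme \<Rightarrow> 'g set \<Rightarrow> ('k \<times> 'g) list set \<Rightarrow> ('k \<times> 'g) list \<Rightarrow> ('k \<times> 'g) list set" where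
  "comb_class R G Rel xs = {ys. rel_cong R G Rel xs ys}"

definition presented_module ::
  "('k, 'r) ring_scheme \<Rightarrow> 'g set \<Rightarrow> ('k \<times> 'g) list set \<Rightarrow> ('k, ('k \<times> 'g) list set) module" where
  "presented_module R G Rel =
    \<lparr>carrier = comb_class R G Rel ` formal_combs R G, monoid.mult = undefined, monoid.one = undefined,
     ring.zero = comb_class R G Rel [],
     ring.add = (\<lambda>A B. \<Union>a\<in>A. \<Union>b\<in>B. comb_class R G Rel (a @ b)),
     module.smult = (\<lambda>c A. \<Union>a\<in>A. comb_class R G Rel (scale_comb R c a))\<rparr>"

definition extend_linearly ::
  "('k, 'r) ring_scheme \<Rightarrow> ('g \<Rightarrow> ('k \<times> 'h) list) \<Rightarrow> ('k \<times> 'g) list \<Rightarrow> ('k \<times> 'h) list" where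
  "extend_linearly R F xs = concat (map (\<lambda>(c, g). scale_comb R c (F g)) xs)"

text \<open>The linear map into \<open>presented_module R H Rel\<close> given on generators by \<open>F\<close>.\<close>

definition presented_map ::
  "('k, 'r) ring_scheme \<Rightarrow> 'h set \<Rightarrow> ('k \<times> 'h) list set \<Rightarrow> ('g \<Rightarrow> ('k \<times> 'h) list) \<Rightarrow>
    ('k \<times> 'g) list set \<Rightarrow> ('k \<times> 'h) list set" where
  "presented_map R H Rel F A = (\<Union>a\<in>A. comb_class R H Rel (extend_linearly R F a))"


section \<open>Chain complexes\<close>

record ('k, 'a) cplx =
  grade :: "int \<Rightarrow> ('k, 'a) module"
  bdry :: "int \<Rightarrow> 'a \<Rightarrow> 'a"

definition chain_complex :: "('k, 'r) ring_scheme \<Rightarrow> ('k, 'a) cplx \<Rightarrow> bool" where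
  "chain_complex R C \<longleftrightarrow>
    (\<forall>p. module R (grade C p)) \<and>
    (\<forall>p. bdry C p \<in> linear_maps R (grade C p) (grade C (p - 1))) \<and>
    (\<forall>p. \<forall>x\<in>carrier (grade C p). bdry C (p - 1) (bdry C p x) = \<zero>\<^bsub>grade C (p - 2)\<^esub>)"

definition chain_map ::
  "('k, 'r) ring_scheme \<Rightarrow> ('k, 'a) cplx \<Rightarrow> ('k, 'b) cplx \<Rightarrow> (int \<Rightarrow> 'a \<Rightarrow> 'b) \<Rightarrow> bool" where
  "chain_map R C D f \<longleftrightarrow>
    (\<forall>p. f p \<in> linear_maps R (grade C p) (grade D p)) \<and>
    (\<forall>p. \<forall>x\<in>carrier (grade C p). bdry D p (f p x) = f (p - 1) (bdry C p x))"

datatype boundedness = Nonnegative | Unbounded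

definition in_Ch :: "('k, 'r) ring_scheme \<Rightarrow> boundedness \<Rightarrow> ('k, 'a) cplx \<Rightarrow> bool" where
  "in_Ch R b C \<longleftrightarrow>
    chain_complex R C \<and>
    (b = Nonnegative \<longrightarrow> (\<forall>p<0. carrier (grade C p) = {\<zero>\<^bsub>grade C p\<^esub>}))"

definition cycles :: "('k, 'a) cplx \<Rightarrow> int \<Rightarrow> 'a set" where
  "cycles C p = {x \<in> carrier (grade C p). bdry C p x = \<zero>\<^bsub>grade C (p - 1)\<^esub>}"

definition boundaries :: "('k, 'a) cplx \<Rightarrow> int \<Rightarrow> 'a set" where
  "boundaries C p = bdry C (p + 1) ` carrier (grade C (p + 1))"

definition homology :: "('k, 'a) cplx \<Rightarrow> int \<Rightarrow> ('k, 'a set) module" where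
  "homology C p = quotient_module (grade C p\<lparr>carrier := cycles C p\<rparr>) (boundaries C p)"

definition quasi_isomorphism ::
  "('k, 'a) cplx \<Rightarrow> ('k, 'b) cplx \<Rightarrow> (int \<Rightarrow> 'a \<Rightarrow> 'b) \<Rightarrow> bool" where
  "quasi_isomorphism C D f \<longleftrightarrow>
    (\<forall>p. bij_betw (induced_map (grade D p) (boundaries D p) (f p))
           (carrier (homology C p)) (carrier (homology D p)))"

text \<open>
  In the injective model structure the cofibrations are the monomorphisms and the weak
  equivalences are the quasi-isomorphisms.
\<close>

definition cofibration :: "('k, 'a) cplx \<Rightarrow> (int \<Rightarrow> 'a \<Rightarrow> 'b) \<Rightarrow> bool" where
  "cofibration C f \<longleftrightarrow> (\<forall>p. inj_on (f p) (carrier (grade C p)))"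

definition trivial_cofibration ::
  "('k, 'r) ring_scheme \<Rightarrow> boundedness \<Rightarrow> ('k, 'a) cplx \<Rightarrow> ('k, 'b) cplx \<Rightarrow>
    (int \<Rightarrow> 'a \<Rightarrow> 'b) \<Rightarrow> bool" where
  "trivial_cofibration R b C D f \<longleftrightarrow>
    in_Ch R b C \<and> in_Ch R b D \<and> chain_map R C D f \<and>
    cofibration C f \<and> quasi_isomorphism C D f"

definition presented_cplx ::
  "('k, 'r) ring_scheme \<Rightarrow> (int \<Rightarrow> 'g set) \<Rightarrow> (int \<Rightarrow> ('k \<times> 'g) list set) \<Rightarrow>
    ('g \<Rightarrow> ('k \<times> 'g) list) \<Rightarrow> ('k, ('k \<times> 'g) list set) cplx" where
  "presented_cplx R G Rel D =
    \<lparr>grade = (\<lambda>m. presented_module R (G m) (Rel m)),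
     bdry = (\<lambda>m. presented_map R (G (m - 1)) (Rel (m - 1)) D)\<rparr>"

definition parity_sign :: "('k, 'r) ring_scheme \<Rightarrow> int \<Rightarrow> 'k" where
  "parity_sign R p = (if even p then \<one>\<^bsub>R\<^esub> else \<ominus>\<^bsub>R\<^esub> \<one>\<^bsub>R\<^esub>)"


section \<open>The tensor product of two complexes\<close>

text \<open>A homogeneous element \<open>x\<close> of degree \<open>p\<close> is written as the pair \<open>(p, x)\<close>.\<close>

definition tensor_gens ::
  "('k, 'a) cplx \<Rightarrow> ('k, 'b) cplx \<Rightarrow> int \<Rightarrow> ((int \<times> 'a) \<times> (int \<times> 'b)) set" where
  "tensor_gens C D m =
    {((p, x), (q, y)) | p x q y.
       x \<in> carrier (grade C p) \<and> y \<in> carrier (grade D q) \<and> p + q = m}"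

definition tensor_rels ::
  "('k, 'r) ring_scheme \<Rightarrow> ('k, 'a) cplx \<Rightarrow> ('k, 'b) cplx \<Rightarrow> int \<Rightarrow>
    ('k \<times> ((int \<times> 'a) \<times> (int \<times> 'b))) list set" where
  "tensor_rels R C D m =
    {[(\<one>\<^bsub>R\<^esub>, ((p, x \<oplus>\<^bsub>grade C p\<^esub> x'), (q, y))),
      (\<ominus>\<^bsub>R\<^esub> \<one>\<^bsub>R\<^esub>, ((p, x), (q, y))), (\<ominus>\<^bsub>R\<^esub> \<one>\<^bsub>R\<^esub>, ((p, x'), (q, y)))] | p x x' q y.
       x \<in> carrier (grade C p) \<and> x' \<in> carrier (grade C p) \<and>
       y \<in> carrier (grade D q) \<and> p + q = m} \<union>
    {[(\<one>\<^bsub>R\<^esub>, ((p, x), (q, y \<oplus>\<^bsub>grade D q\<^esub> y'))),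
      (\<ominus>\<^bsub>R\<^esub> \<one>\<^bsub>R\<^esub>, ((p, x), (q, y))), (\<ominus>\<^bsub>R\<^esub> \<one>\<^bsub>R\<^esub>, ((p, x), (q, y')))] | p x q y y'.
       x \<in> carrier (grade C p) \<and> y \<in> carrier (grade D q) \<and>
       y' \<in> carrier (grade D q) \<and> p + q = m} \<union>
    {[(\<one>\<^bsub>R\<^esub>, ((p, c \<odot>\<^bsub>grade C p\<^esub> x), (q, y))), (\<ominus>\<^bsub>R\<^esub> c, ((p, x), (q, y)))] | c p x q y.
       c \<in> carrier R \<and> x \<in> carrier (grade C p) \<and> y \<in> carrier (grade D q) \<and> p + q = m} \<union>
    {[(\<one>\<^bsub>R\<^esub>, ((p, x), (q, c \<odot>\<^bsub>grade D q\<^esub> y))), (\<ominus>\<^bsub>R\<^esub> c, ((p, x), (q, y)))] | c p x q y.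
       c \<in> carrier R \<and> x \<in> carrier (grade C p) \<and> y \<in> carrier (grade D q) \<and> p + q = m}"

definition tensor_bdry ::
  "('k, 'r) ring_scheme \<Rightarrow> ('k, 'a) cplx \<Rightarrow> ('k, 'b) cplx \<Rightarrow> (int \<times> 'a) \<times> (int \<times> 'b) \<Rightarrow>
    ('k \<times> ((int \<times> 'a) \<times> (int \<times> 'b))) list" where
  "tensor_bdry R C D = (\<lambda>((p, x), (q, y)).
    [(\<one>\<^bsub>R\<^esub>, ((p - 1, bdry C p x), (q, y))), (parity_sign R p, ((p, x), (q - 1, bdry D q y)))])"

definition tensor_cplx ::
  "('k, 'r) ring_scheme \<Rightarrow> ('k, 'a) cplx \<Rightarrow> ('k, 'b) cplx \<Rightarrow>
    ('k, ('k \<times> ((int \<times> 'a) \<times> (int \<times> 'b))) list set) cplx" where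
  "tensor_cplx R C D =
    presented_cplx R (tensor_gens C D) (tensor_rels R C D) (tensor_bdry R C D)"

definition tensor_map ::
  "('k, 'r) ring_scheme \<Rightarrow> ('k, 'c) cplx \<Rightarrow> ('k, 'd) cplx \<Rightarrow>
    (int \<Rightarrow> 'a \<Rightarrow> 'c) \<Rightarrow> (int \<Rightarrow> 'b \<Rightarrow> 'd) \<Rightarrow> int \<Rightarrow>
    ('k \<times> ((int \<times> 'a) \<times> (int \<times> 'b))) list set \<Rightarrow>
    ('k \<times> ((int \<times> 'c) \<times> (int \<times> 'd))) list set" where
  "tensor_map R C' D' f g m =
    presented_map R (tensor_gens C' D' m) (tensor_rels R C' D' m)
      (\<lambda>((p, x), (q, y)). [(\<one>\<^bsub>R\<^esub>, ((p, f p x), (q, g q y)))])"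


section \<open>Pushout products\<close>

definition sum_module :: "('k, 'a) module \<Rightarrow> ('k, 'b) module \<Rightarrow> ('k, 'a \<times> 'b) module" where
  "sum_module M N =
    \<lparr>carrier = carrier M \<times> carrier N, monoid.mult = undefined, monoid.one = undefined,
     ring.zero = (\<zero>\<^bsub>M\<^esub>, \<zero>\<^bsub>N\<^esub>),
     ring.add = (\<lambda>(x, y) (x', y'). (x \<oplus>\<^bsub>M\<^esub> x', y \<oplus>\<^bsub>N\<^esub> y')),
     module.smult = (\<lambda>c (x, y). (c \<odot>\<^bsub>M\<^esub> x, c \<odot>\<^bsub>N\<^esub> y))\<rparr>"

definition pushout_rels ::
  "('k, 'c) cplx \<Rightarrow> ('k, 'b) cplx \<Rightarrow> (int \<Rightarrow> 'c \<Rightarrow> 'a) \<Rightarrow> (int \<Rightarrow> 'c \<Rightarrow> 'b) \<Rightarrow>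
    int \<Rightarrow> ('a \<times> 'b) set" where
  "pushout_rels E D u v m = (\<lambda>e. (u m e, \<ominus>\<^bsub>grade D m\<^esub> v m e)) ` carrier (grade E m)"

definition pushout_cplx ::
  "('k, 'c) cplx \<Rightarrow> ('k, 'a) cplx \<Rightarrow> ('k, 'b) cplx \<Rightarrow> (int \<Rightarrow> 'c \<Rightarrow> 'a) \<Rightarrow> (int \<Rightarrow> 'c \<Rightarrow> 'b) \<Rightarrow>
    ('k, ('a \<times> 'b) set) cplx" where
  "pushout_cplx E C D u v =
    \<lparr>grade = (\<lambda>m. quotient_module (sum_module (grade C m) (grade D m)) (pushout_rels E D u v m)),
     bdry = (\<lambda>m. induced_map (sum_module (grade C (m - 1)) (grade D (m - 1)))
                   (pushout_rels E D u v (m - 1)) (map_prod (bdry C m) (bdry D m)))\<rparr>"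

text \<open>The map out of a pushout into \<open>H\<close> given by \<open>h\<close> and \<open>k\<close> on the two summands.\<close>

definition pushout_map ::
  "('k, 'd) cplx \<Rightarrow> (int \<Rightarrow> 'a \<Rightarrow> 'd) \<Rightarrow> (int \<Rightarrow> 'b \<Rightarrow> 'd) \<Rightarrow> int \<Rightarrow> ('a \<times> 'b) set \<Rightarrow> 'd" where
  "pushout_map H h k m P = the_elem ((\<lambda>(a, b). h m a \<oplus>\<^bsub>grade H m\<^esub> k m b) ` P)"

text \<open>
  For \<open>f : A \<rightarrow> B\<close> and \<open>g : S \<rightarrow> T\<close>, the pushout product is the map from
  \<open>(A \<otimes> T) \<squnion> (B \<otimes> S)\<close>, glued along \<open>A \<otimes> S\<close>, to \<open>B \<otimes> T\<close>.
\<close>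

definition pushout_product_source where
  "pushout_product_source R A B f S T g =
    pushout_cplx (tensor_cplx R A S) (tensor_cplx R A T) (tensor_cplx R B S)
      (tensor_map R A T (\<lambda>_ x. x) g) (tensor_map R B S f (\<lambda>_ x. x))"

definition pushout_product where
  "pushout_product R A B f S T g =
    pushout_map (tensor_cplx R B T)
      (tensor_map R B T f (\<lambda>_ x. x)) (tensor_map R B T (\<lambda>_ x. x) g)"

definition cplx_iso ::
  "('k, 'r) ring_scheme \<Rightarrow> ('k, 'a) cplx \<Rightarrow> ('k, 'b) cplx \<Rightarrow> (int \<Rightarrow> 'a \<Rightarrow> 'b) \<Rightarrow> bool" where
  "cplx_iso R C D f \<longleftrightarrow>
    chain_map R C D f \<and> (\<forall>p. bij_betw (f p) (carrier (grade C p)) (carrier (grade D p)))"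

definition arrow_iso where
  "arrow_iso R A B f A' B' f' \<longleftrightarrow>
    (\<exists>\<phi> \<psi>. cplx_iso R A A' \<phi> \<and> cplx_iso R B B' \<psi> \<and>
       (\<forall>p. \<forall>x\<in>carrier (grade A p). \<psi> p (f p x) = f' p (\<phi> p x)))"

inductive iterated_pushout_product ::
  "('k, 'r) ring_scheme \<Rightarrow> ('k, 'a) cplx \<Rightarrow> ('k, 'b) cplx \<Rightarrow> (int \<Rightarrow> 'a \<Rightarrow> 'b) \<Rightarrow>
    nat \<Rightarrow> ('k, 's) cplx \<Rightarrow> ('k, 't) cplx \<Rightarrow> (int \<Rightarrow> 's \<Rightarrow> 't) \<Rightarrow> bool"
  for R A B f where
  "arrow_iso R S T g A B f \<Longrightarrow> iterated_pushout_product R A B f 1 S T g"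
| "iterated_pushout_product R A B f n S T g \<Longrightarrow>
   arrow_iso R S' T' g' (pushout_product_source R A B f S T g) (tensor_cplx R B T)
     (pushout_product R A B f S T g) \<Longrightarrow>
   iterated_pushout_product R A B f (Suc n) S' T' g'"


section \<open>The \<open>n\<close>-fold tensor product\<close>

text \<open>
  For complexes \<open>Z 0, \<dots>, Z (n - 1)\<close>, the elementary tensor
  \<open>z\<^sub>0 \<otimes> \<dots> \<otimes> z\<^sub>n\<^sub>-\<^sub>1\<close> is the word \<open>[(p\<^sub>0, z\<^sub>0), \<dots>, (p\<^sub>n\<^sub>-\<^sub>1, z\<^sub>n\<^sub>-\<^sub>1)]\<close>.
\<close>

definition words :: "(nat \<Rightarrow> ('k, 'a) cplx) \<Rightarrow> nat \<Rightarrow> int \<Rightarrow> (int \<times> 'a) list set" where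
  "words Z n m =
    {w. length w = n \<and> (\<forall>i<n. snd (w ! i) \<in> carrier (grade (Z i) (fst (w ! i)))) \<and>
        sum_list (map fst w) = m}"

definition multilinear_rels ::
  "('k, 'r) ring_scheme \<Rightarrow> (nat \<Rightarrow> ('k, 'a) cplx) \<Rightarrow> nat \<Rightarrow> int \<Rightarrow>
    ('k \<times> (int \<times> 'a) list) list set" where
  "multilinear_rels R Z n m =
    {[(\<one>\<^bsub>R\<^esub>, w[i := (p, x \<oplus>\<^bsub>grade (Z i) p\<^esub> y)]),
      (\<ominus>\<^bsub>R\<^esub> \<one>\<^bsub>R\<^esub>, w[i := (p, x)]), (\<ominus>\<^bsub>R\<^esub> \<one>\<^bsub>R\<^esub>, w[i := (p, y)])] | w i p x y.
       i < n \<and> w[i := (p, x)] \<in> words Z n m \<and> w[i := (p, y)] \<in> words Z n m} \<union>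
    {[(\<one>\<^bsub>R\<^esub>, w[i := (p, c \<odot>\<^bsub>grade (Z i) p\<^esub> x)]), (\<ominus>\<^bsub>R\<^esub> c, w[i := (p, x)])] | w i p c x.
       i < n \<and> c \<in> carrier R \<and> w[i := (p, x)] \<in> words Z n m}"

definition word_bdry ::
  "('k, 'r) ring_scheme \<Rightarrow> (nat \<Rightarrow> ('k, 'a) cplx) \<Rightarrow> (int \<times> 'a) list \<Rightarrow>
    ('k \<times> (int \<times> 'a) list) list" where
  "word_bdry R Z w =
    map (\<lambda>i. (parity_sign R (sum_list (map fst (take i w))),
              w[i := (fst (w ! i) - 1, bdry (Z i) (fst (w ! i)) (snd (w ! i)))]))
      [0..<length w]"

definition tensor_power ::
  "('k, 'r) ring_scheme \<Rightarrow> ('k, 'a) cplx \<Rightarrow> nat \<Rightarrow>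
    ('k, ('k \<times> (int \<times> 'a) list) list set) cplx" where
  "tensor_power R B n =
    presented_cplx R (words (\<lambda>_. B) n) (multilinear_rels R (\<lambda>_. B) n) (word_bdry R (\<lambda>_. B))"

text \<open>
  The left action of \<open>\<Sigma>\<^sub>n\<close> moves the \<open>i\<close>-th factor to position \<open>\<sigma> i\<close>, with the Koszul sign
  contributed by all pairs of factors whose order is reversed.
\<close>

definition permute_word :: "(nat \<Rightarrow> nat) \<Rightarrow> (int \<times> 'a) list \<Rightarrow> (int \<times> 'a) list" where
  "permute_word \<sigma> w = permute_list (inv_into UNIV \<sigma>) w"

definition koszul_sign ::
  "('k, 'r) ring_scheme \<Rightarrow> (nat \<Rightarrow> nat) \<Rightarrow> (int \<times> 'a) list \<Rightarrow> 'k" where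
  "koszul_sign R \<sigma> w =
    parity_sign R (\<Sum>(i, j)\<in>{(i, j). i < j \<and> j < length w \<and> \<sigma> j < \<sigma> i}. fst (w ! i) * fst (w ! j))"

definition tensor_power_action ::
  "('k, 'r) ring_scheme \<Rightarrow> ('k, 'a) cplx \<Rightarrow> nat \<Rightarrow> (nat \<Rightarrow> nat) \<Rightarrow> int \<Rightarrow>
    ('k \<times> (int \<times> 'a) list) list set \<Rightarrow> ('k \<times> (int \<times> 'a) list) list set" where
  "tensor_power_action R B n \<sigma> m =
    presented_map R (words (\<lambda>_. B) n m) (multilinear_rels R (\<lambda>_. B) n m)
      (\<lambda>w. [(koszul_sign R \<sigma> w, permute_word \<sigma> w)])"


section \<open>The \<open>n\<close>-fold pushout product with its action\<close>

text \<open>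
  For \<open>f : A \<rightarrow> B\<close>, a subset \<open>S\<close> of \<open>{..<n}\<close> is a vertex of the \<open>n\<close>-cube with value the tensor
  product of copies of \<open>B\<close> (at positions in \<open>S\<close>) and \<open>A\<close> (at the others).  The source of the
  \<open>n\<close>-fold pushout product is the colimit over the vertices \<open>S \<noteq> {..<n}\<close>, that is, the sum over
  these \<open>S\<close> modulo the relations identifying an element at \<open>S\<close> with its images at larger vertices.
\<close>

definition cube_vertex :: "('k, 'a) cplx \<Rightarrow> ('k, 'a) cplx \<Rightarrow> nat set \<Rightarrow> nat \<Rightarrow> ('k, 'a) cplx" where
  "cube_vertex A B S i = (if i \<in> S then B else A)"

definition cube_gens ::
  "('k, 'a) cplx \<Rightarrow> ('k, 'a) cplx \<Rightarrow> nat \<Rightarrow> int \<Rightarrow> (nat set \<times> (int \<times> 'a) list) set" where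
  "cube_gens A B n m = {(S, w). S \<subset> {..<n} \<and> w \<in> words (cube_vertex A B S) n m}"

definition cube_rels ::
  "('k, 'r) ring_scheme \<Rightarrow> ('k, 'a) cplx \<Rightarrow> ('k, 'a) cplx \<Rightarrow> (int \<Rightarrow> 'a \<Rightarrow> 'a) \<Rightarrow> nat \<Rightarrow> int \<Rightarrow>
    ('k \<times> (nat set \<times> (int \<times> 'a) list)) list set" where
  "cube_rels R A B f n m =
    {map (\<lambda>(c, w). (c, (S, w))) r | S r.
       S \<subset> {..<n} \<and> r \<in> multilinear_rels R (cube_vertex A B S) n m} \<union>
    {[(\<one>\<^bsub>R\<^esub>, (S, w)),
      (\<ominus>\<^bsub>R\<^esub> \<one>\<^bsub>R\<^esub>, (insert i S, w[i := (fst (w ! i), f (fst (w ! i)) (snd (w ! i)))]))] | S w i.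
       i < n \<and> i \<notin> S \<and> insert i S \<subset> {..<n} \<and> w \<in> words (cube_vertex A B S) n m}"

definition pushout_power_source ::
  "('k, 'r) ring_scheme \<Rightarrow> ('k, 'a) cplx \<Rightarrow> ('k, 'a) cplx \<Rightarrow> (int \<Rightarrow> 'a \<Rightarrow> 'a) \<Rightarrow> nat \<Rightarrow>
    ('k, ('k \<times> (nat set \<times> (int \<times> 'a) list)) list set) cplx" where
  "pushout_power_source R A B f n =
    presented_cplx R (cube_gens A B n) (cube_rels R A B f n)
      (\<lambda>(S, w). map (\<lambda>(c, w'). (c, (S, w'))) (word_bdry R (cube_vertex A B S) w))"

definition apply_off :: "(int \<Rightarrow> 'a \<Rightarrow> 'a) \<Rightarrow> nat set \<Rightarrow> (int \<times> 'a) list \<Rightarrow> (int \<times> 'a) list" where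
  "apply_off f S w =
    map (\<lambda>i. if i \<in> S then w ! i else (fst (w ! i), f (fst (w ! i)) (snd (w ! i)))) [0..<length w]"

definition pushout_power ::
  "('k, 'r) ring_scheme \<Rightarrow> ('k, 'a) cplx \<Rightarrow> (int \<Rightarrow> 'a \<Rightarrow> 'a) \<Rightarrow> nat \<Rightarrow> int \<Rightarrow>
    ('k \<times> (nat set \<times> (int \<times> 'a) list)) list set \<Rightarrow> ('k \<times> (int \<times> 'a) list) list set" where
  "pushout_power R B f n m =
    presented_map R (words (\<lambda>_. B) n m) (multilinear_rels R (\<lambda>_. B) n m)
      (\<lambda>(S, w). [(\<one>\<^bsub>R\<^esub>, apply_off f S w)])"

definition pushout_power_source_action ::
  "('k, 'r) ring_scheme \<Rightarrow> ('k, 'a) cplx \<Rightarrow> ('k, 'a) cplx \<Rightarrow> (int \<Rightarrow> 'a \<Rightarrow> 'a) \<Rightarrow> nat \<Rightarrow>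
    (nat \<Rightarrow> nat) \<Rightarrow> int \<Rightarrow>
    ('k \<times> (nat set \<times> (int \<times> 'a) list)) list set \<Rightarrow>
    ('k \<times> (nat set \<times> (int \<times> 'a) list)) list set" where
  "pushout_power_source_action R A B f n \<sigma> m =
    presented_map R (cube_gens A B n m) (cube_rels R A B f n m)
      (\<lambda>(S, w). [(koszul_sign R \<sigma> w, (\<sigma> ` S, permute_word \<sigma> w))])"


section \<open>Actions of the symmetric group and coinvariants\<close>

definition right_action ::
  "('k, 'r) ring_scheme \<Rightarrow> nat \<Rightarrow> ('k, 'a) cplx \<Rightarrow> ((nat \<Rightarrow> nat) \<Rightarrow> int \<Rightarrow> 'a \<Rightarrow> 'a) \<Rightarrow> bool" where
  "right_action R n X \<rho> \<longleftrightarrow>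
    (\<forall>\<sigma>. \<sigma> permutes {..<n} \<longrightarrow> chain_map R X X (\<rho> \<sigma>)) \<and>
    (\<forall>p. \<forall>x\<in>carrier (grade X p). \<rho> id p x = x) \<and>
    (\<forall>\<sigma> \<tau> p. \<forall>x\<in>carrier (grade X p). \<sigma> permutes {..<n} \<longrightarrow> \<tau> permutes {..<n} \<longrightarrow>
       \<rho> (\<sigma> \<circ> \<tau>) p x = \<rho> \<tau> p (\<rho> \<sigma> p x))"

definition coinvariant_rels ::
  "('k, 'r) ring_scheme \<Rightarrow> nat \<Rightarrow> ('k, 'a) cplx \<Rightarrow> ((nat \<Rightarrow> nat) \<Rightarrow> int \<Rightarrow> 'a \<Rightarrow> 'a) \<Rightarrow>
    int \<Rightarrow> 'a set" where
  "coinvariant_rels R n C \<alpha> m =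
    submodule_span R (grade C m)
      {\<alpha> \<sigma> m x \<ominus>\<^bsub>grade C m\<^esub> x | \<sigma> x. \<sigma> permutes {..<n} \<and> x \<in> carrier (grade C m)}"

definition coinvariants ::
  "('k, 'r) ring_scheme \<Rightarrow> nat \<Rightarrow> ('k, 'a) cplx \<Rightarrow> ((nat \<Rightarrow> nat) \<Rightarrow> int \<Rightarrow> 'a \<Rightarrow> 'a) \<Rightarrow>
    ('k, 'a set) cplx" where
  "coinvariants R n C \<alpha> =
    \<lparr>grade = (\<lambda>m. quotient_module (grade C m) (coinvariant_rels R n C \<alpha> m)),
     bdry = (\<lambda>m. induced_map (grade C (m - 1)) (coinvariant_rels R n C \<alpha> (m - 1)) (bdry C m))\<rparr>"

text \<open>
  For a right action \<open>\<rho>\<close> on \<open>X\<close> and a left action \<open>\<alpha>\<close> on \<open>Z\<close>, the left action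
  \<open>\<sigma> (x \<otimes> z) = x \<sigma>\<^sup>-\<^sup>1 \<otimes> \<sigma> z\<close>.
\<close>

definition tensor_action where
  "tensor_action R X \<rho> Z \<alpha> \<sigma> = tensor_map R X Z (\<rho> (inv_into UNIV \<sigma>)) (\<alpha> \<sigma>)"

definition tensor_over_Sigma where
  "tensor_over_Sigma R n X \<rho> Z \<alpha> =
    coinvariants R n (tensor_cplx R X Z) (tensor_action R X \<rho> Z \<alpha>)"

text \<open>The map \<open>X \<otimes>\<^bsub>\<Sigma>\<^sub>n\<^esub> g\<close> for an equivariant map \<open>g\<close> into \<open>Z\<close>.\<close>

definition tensor_over_Sigma_map where
  "tensor_over_Sigma_map R n X \<rho> Z \<alpha> g m =
    induced_map (grade (tensor_cplx R X Z) m)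
      (coinvariant_rels R n (tensor_cplx R X Z) (tensor_action R X \<rho> Z \<alpha>) m)
      (tensor_map R X Z (\<lambda>_ x. x) g m)"

end

theory Submission
  imports Defs
begin

text \<open>
  Over a field, \<open>f\<close> has a retraction \<open>r\<close> and a homotopy \<open>h\<close> with \<open>d h + h d = q\<close>, where
  \<open>q = 1 - f r\<close> is idempotent.  Let \<open>i\<close> be the \<open>n\<close>-fold pushout product.  Expanding
  \<open>1 = q + f r\<close> one factor after the other shows that \<open>1 - q\<^sup>\<otimes>\<^sup>n\<close> factors through \<open>i\<close>, as
  \<open>i s\<close> for a linear \<open>s\<close> with \<open>s i = 1\<close>.  Applying \<open>h\<close> in one factor, \<open>q\<close> in all factors, and
  averaging over the \<open>n\<close> positions (this needs \<open>1/n\<close>) is a homotopy \<open>K\<close> with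
  \<open>d K + K d = q\<^sup>\<otimes>\<^sup>n\<close> that commutes with \<open>\<Sigma>\<^sub>n\<close>.  As \<open>i\<close> is an injective equivariant chain map,
  \<open>i s = 1 - (d K + K d)\<close> forces \<open>s\<close> to be an equivariant chain map as well.  So \<open>i\<close> is the
  inclusion of an equivariant deformation retract, and this property survives \<open>X \<otimes> -\<close> and the
  passage to coinvariants.
\<close>

section \<open>Linear maps and quotient modules\<close>

text \<open>Both \<open>r\<close> and \<open>h\<close> come from one choice: in each degree, a
  complement of the elements whose boundary lies in the image of \<open>f\<close>. The obstacle is
  symmetry. The usual homotopy on a tensor power, with \<open>f r\<close> in the factors before
  \<open>h\<close> and 1 in those after it, depends on the order of the factors and does not pass to
  coinvariants. With \<open>q\<close> in all factors, every position of \<open>h\<close> gives a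
  homotopy for the same map, so that the mean does too, and permutations merely exchange the
  positions. The division by n is essential: in characteristic p take the acyclic complex with basis
  y, x in degrees 2, 1 and d y = x; in the coinvariants of its p-th tensor power y^p is a nonzero
  cycle, as d y^p = p y^(p-1) x, in the top degree, hence not a boundary. The other obstacle is that
  the source of \<open>i\<close> is given by generators and relations, which makes its boundary and
  its action hard to check there. The explicit \<open>s\<close> makes \<open>i\<close> injective
  before either is known to be well defined, so both can be checked inside the tensor power.\<close>

context abelian_group
begin

text \<open>Sorting a sum by commutativity can leave an element separated from its negative; these
  rules cancel the pair across one or two summands that stand between.\<close>

lemma add_minus_cancel1: "a \<in> carrier G \<Longrightarrow> b \<in> carrier G \<Longrightarrow> a \<oplus> (b \<oplus> \<ominus> a) = b"
  by (metis a_assoc a_comm a_inv_closed r_neg1)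

lemma add_minus_cancel2:
  "a \<in> carrier G \<Longrightarrow> b \<in> carrier G \<Longrightarrow> c \<in> carrier G \<Longrightarrow> a \<oplus> (b \<oplus> (\<ominus> a \<oplus> c)) = b \<oplus> c"
  by (metis a_lcomm a_closed a_inv_closed r_neg1 r_neg2)

lemma add_minus_cancel3:
  "a \<in> carrier G \<Longrightarrow> b \<in> carrier G \<Longrightarrow> c \<in> carrier G \<Longrightarrow> d \<in> carrier G \<Longrightarrow>
    a \<oplus> (b \<oplus> (c \<oplus> (\<ominus> a \<oplus> d))) = b \<oplus> (c \<oplus> d)"
  by (metis a_lcomm a_closed a_inv_closed add_minus_cancel2)

lemma neg_zero: "\<ominus> \<zero> = \<zero>"
  by (metis a_inv_closed l_zero r_neg zero_closed)

lemma diff_zero: "a \<in> carrier G \<Longrightarrow> a \<ominus> \<zero> = a"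
  by (simp add: a_minus_def neg_zero)

lemma diff_eq_zero_iff: "a \<in> carrier G \<Longrightarrow> b \<in> carrier G \<Longrightarrow> a \<ominus> b = \<zero> \<longleftrightarrow> a = b"
  by (metis a_inv_closed a_minus_def a_comm minus_equality minus_minus r_neg)

lemmas group_simps = a_minus_def minus_add a_ac r_neg1 r_neg2 r_neg l_neg
  add_minus_cancel1 add_minus_cancel2 add_minus_cancel3

end

lemma linear_mapsI:
  assumes "\<And>x. x \<in> carrier M \<Longrightarrow> h x \<in> carrier N"
    and "\<And>x y. x \<in> carrier M \<Longrightarrow> y \<in> carrier M \<Longrightarrow> h (x \<oplus>\<^bsub>M\<^esub> y) = h x \<oplus>\<^bsub>N\<^esub> h y"
    and "\<And>c x. c \<in> carrier R \<Longrightarrow> x \<in> carrier M \<Longrightarrow> h (c \<odot>\<^bsub>M\<^esub> x) = c \<odot>\<^bsub>N\<^esub> h x"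
  shows "h \<in> linear_maps R M N"
  using assms by (auto simp: linear_maps_def hom_def)

lemma linear_maps_closed: "h \<in> linear_maps R M N \<Longrightarrow> x \<in> carrier M \<Longrightarrow> h x \<in> carrier N"
  by (auto simp: linear_maps_def hom_def)

lemma linear_maps_add:
  "h \<in> linear_maps R M N \<Longrightarrow> x \<in> carrier M \<Longrightarrow> y \<in> carrier M \<Longrightarrow> h (x \<oplus>\<^bsub>M\<^esub> y) = h x \<oplus>\<^bsub>N\<^esub> h y"
  by (auto simp: linear_maps_def hom_def)

lemma linear_maps_smult:
  "h \<in> linear_maps R M N \<Longrightarrow> c \<in> carrier R \<Longrightarrow> x \<in> carrier M \<Longrightarrow> h (c \<odot>\<^bsub>M\<^esub> x) = c \<odot>\<^bsub>N\<^esub> h x"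
  by (auto simp: linear_maps_def)

text \<open>Membership in \<open>linear_maps\<close> mentions sums and multiples only; the zero is
  reached as the multiple of itself by the scalar zero.\<close>

lemma linear_maps_zero:
  assumes "h \<in> linear_maps R M N" "module R M" "module R N"
  shows "h \<zero>\<^bsub>M\<^esub> = \<zero>\<^bsub>N\<^esub>"
proof -
  interpret M: module R M by fact
  interpret N: module R N by fact
  have "h (\<zero>\<^bsub>R\<^esub> \<odot>\<^bsub>M\<^esub> \<zero>\<^bsub>M\<^esub>) = \<zero>\<^bsub>R\<^esub> \<odot>\<^bsub>N\<^esub> h \<zero>\<^bsub>M\<^esub>"
    by (rule linear_maps_smult[OF assms(1)]) auto
  then show ?thesis using linear_maps_closed[OF assms(1), of "\<zero>\<^bsub>M\<^esub>"] by simp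
qed

lemma module_minus_eq:
  assumes "module R M" "x \<in> carrier M"
  shows "(\<ominus>\<^bsub>R\<^esub> \<one>\<^bsub>R\<^esub>) \<odot>\<^bsub>M\<^esub> x = \<ominus>\<^bsub>M\<^esub> x"
proof -
  interpret M: module R M by fact
  show ?thesis using assms by (simp add: M.smult_l_minus)
qed

lemma linear_maps_neg:
  assumes "h \<in> linear_maps R M N" "module R M" "module R N" "x \<in> carrier M"
  shows "h (\<ominus>\<^bsub>M\<^esub> x) = \<ominus>\<^bsub>N\<^esub> h x"
proof -
  interpret M: module R M by fact
  show ?thesis
    using linear_maps_smult[OF assms(1) _ assms(4), of "\<ominus>\<^bsub>R\<^esub> \<one>\<^bsub>R\<^esub>"]
      module_minus_eq[OF assms(2,4)] module_minus_eq[OF assms(3) linear_maps_closed[OF assms(1,4)]]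
    by simp
qed

lemma linear_maps_diff:
  assumes "h \<in> linear_maps R M N" "module R M" "module R N" "x \<in> carrier M" "y \<in> carrier M"
  shows "h (x \<ominus>\<^bsub>M\<^esub> y) = h x \<ominus>\<^bsub>N\<^esub> h y"
proof -
  interpret M: module R M by fact
  show ?thesis
    using assms by (simp add: a_minus_def linear_maps_add linear_maps_neg)
qed

lemma linear_maps_comp:
  "h \<in> linear_maps R M N \<Longrightarrow> k \<in> linear_maps R N P \<Longrightarrow> (\<lambda>x. k (h x)) \<in> linear_maps R M P"
  by (rule linear_mapsI) (simp_all add: linear_maps_closed linear_maps_add linear_maps_smult)

lemma linear_maps_id: "(\<lambda>x. x) \<in> linear_maps R M M"
  by (rule linear_mapsI) auto

lemma linear_maps_plus:
  assumes "h \<in> linear_maps R M N" "k \<in> linear_maps R M N" "module R N"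
  shows "(\<lambda>x. h x \<oplus>\<^bsub>N\<^esub> k x) \<in> linear_maps R M N"
proof -
  interpret N: module R N by fact
  show ?thesis
    using assms(1,2)
    by (intro linear_mapsI)
      (simp_all add: linear_maps_closed linear_maps_add linear_maps_smult N.a_ac N.smult_r_distr)
qed

lemma linear_maps_scale:
  assumes "h \<in> linear_maps R M N" "c \<in> carrier R" "module R N"
  shows "(\<lambda>x. c \<odot>\<^bsub>N\<^esub> h x) \<in> linear_maps R M N"
proof -
  interpret N: module R N by fact
  show ?thesis
  proof (rule linear_mapsI)
    fix d x assume "d \<in> carrier R" "x \<in> carrier M"
    then show "c \<odot>\<^bsub>N\<^esub> h (d \<odot>\<^bsub>M\<^esub> x) = d \<odot>\<^bsub>N\<^esub> (c \<odot>\<^bsub>N\<^esub> h x)"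
      using assms(1,2)
      by (simp add: linear_maps_smult linear_maps_closed N.smult_assoc1[symmetric] N.R.m_comm)
  qed (use assms(1,2) in \<open>simp_all add: linear_maps_closed linear_maps_add N.smult_r_distr\<close>)
qed

lemma linear_maps_uminus:
  assumes "h \<in> linear_maps R M N" "module R N"
  shows "(\<lambda>x. \<ominus>\<^bsub>N\<^esub> h x) \<in> linear_maps R M N"
proof -
  interpret N: module R N by fact
  show ?thesis
    using assms(1)
    by (intro linear_mapsI)
      (simp_all add: linear_maps_closed linear_maps_add linear_maps_smult N.minus_add
          N.smult_r_minus)
qed

lemma linear_maps_minus:
  assumes "h \<in> linear_maps R M N" "k \<in> linear_maps R M N" "module R N"
  shows "(\<lambda>x. h x \<ominus>\<^bsub>N\<^esub> k x) \<in> linear_maps R M N"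
  unfolding a_minus_def using assms by (intro linear_maps_plus linear_maps_uminus)

lemma linear_maps_finsum:
  assumes "h \<in> linear_maps R M N" "module R M" "module R N" "finite I" "g \<in> I \<rightarrow> carrier M"
  shows "h (finsum M g I) = finsum N (\<lambda>i. h (g i)) I"
proof -
  interpret M: module R M by fact
  interpret N: module R N by fact
  show ?thesis using assms(4,5)
  proof (induction rule: finite_induct)
    case empty
    then show ?case using linear_maps_zero[OF assms(1-3)] by simp
  next
    case (insert i I)
    then have "(\<lambda>i. h (g i)) \<in> I \<rightarrow> carrier N" "g i \<in> carrier M" "g \<in> I \<rightarrow> carrier M"
      using linear_maps_closed[OF assms(1)] by auto
    then show ?case
      using insert linear_maps_add[OF assms(1)] linear_maps_closed[OF assms(1)] by simp
  qed
qed

lemma (in module) submodule_zero: "submodule H R M \<Longrightarrow> \<zero>\<^bsub>M\<^esub> \<in> H"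
  using subgroup.one_closed[OF submodule.axioms(1)] by fastforce

section \<open>Spans, images and preimages of submodules\<close>

lemma submodule_span:
  assumes "module R M" "S \<subseteq> carrier M"
  shows "submodule (submodule_span R M S) R M" "S \<subseteq> submodule_span R M S"
proof -
  interpret module R M by fact
  let ?F = "{W. submodule W R M \<and> S \<subseteq> W}"
  \<comment> \<open>The whole module belongs to the family, so the intersection is not taken over
    the empty family, where it would be all of \<open>UNIV\<close>.\<close>
  have c: "carrier M \<in> ?F" using carrier_is_submodule assms(2) by auto
  show "submodule (submodule_span R M S) R M"
    unfolding submodule_span_def
  proof (rule submoduleI)
    show "\<Inter>?F \<subseteq> carrier M" using c by (rule Inter_lower)
    show "\<zero>\<^bsub>M\<^esub> \<in> \<Inter>?F" using submodule_zero by simp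
  next
    fix a assume "a \<in> \<Inter>?F"
    then show "\<ominus>\<^bsub>M\<^esub> a \<in> \<Inter>?F" using submoduleE(3) by simp
  next
    fix a b assume "a \<in> \<Inter>?F" "b \<in> \<Inter>?F"
    then show "a \<oplus>\<^bsub>M\<^esub> b \<in> \<Inter>?F" using submoduleE(5) by simp
  next
    fix c a assume "c \<in> carrier R" "a \<in> \<Inter>?F"
    then show "c \<odot>\<^bsub>M\<^esub> a \<in> \<Inter>?F" using submoduleE(4) by simp
  qed
  show "S \<subseteq> submodule_span R M S" by (auto simp: submodule_span_def)
qed

lemma submodule_span_least:
  "submodule W R M \<Longrightarrow> S \<subseteq> W \<Longrightarrow> submodule_span R M S \<subseteq> W"
  by (auto simp: submodule_span_def)

lemma submodule_preimage:
  assumes "h \<in> linear_maps R M N" "module R M" "module R N" "submodule W R N"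
  shows "submodule {x \<in> carrier M. h x \<in> W} R M"
proof -
  interpret M: module R M by fact
  interpret N: module R N by fact
  show ?thesis
    by (rule M.submoduleI)
      (use assms N.submodule_zero N.submoduleE in
        \<open>auto simp: linear_maps_zero linear_maps_neg linear_maps_add linear_maps_smult\<close>)
qed

lemma submodule_image:
  assumes "h \<in> linear_maps R M N" "module R M" "module R N" "submodule W R M"
  shows "submodule (h ` W) R N"
proof -
  interpret M: module R M by fact
  interpret N: module R N by fact
  have W: "W \<subseteq> carrier M" using M.submoduleE(1)[OF assms(4)] .
  have WW: "x \<in> carrier M" if "x \<in> W" for x using W that by auto
  show ?thesis
  proof (rule N.submoduleI)
    show "h ` W \<subseteq> carrier N" using WW linear_maps_closed[OF assms(1)] by auto
    show "\<zero>\<^bsub>N\<^esub> \<in> h ` W"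
      using linear_maps_zero[OF assms(1-3)] M.submodule_zero[OF assms(4)] by (metis imageI)
  next
    fix a assume "a \<in> h ` W"
    then show "\<ominus>\<^bsub>N\<^esub> a \<in> h ` W"
      using linear_maps_neg[OF assms(1-3)] M.submoduleE(3)[OF assms(4)] WW
      by (metis (no_types, lifting) imageE imageI)
  next
    fix a b assume "a \<in> h ` W" "b \<in> h ` W"
    then obtain x y where "x \<in> W" "y \<in> W" "a = h x" "b = h y" by auto
    then show "a \<oplus>\<^bsub>N\<^esub> b \<in> h ` W"
      using linear_maps_add[OF assms(1)] M.submoduleE(5)[OF assms(4)] WW
      by (metis imageI)
  next
    fix c a assume "c \<in> carrier R" "a \<in> h ` W"
    then show "c \<odot>\<^bsub>N\<^esub> a \<in> h ` W"
      using linear_maps_smult[OF assms(1)] M.submoduleE(4)[OF assms(4)] WW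
      by (metis (no_types, lifting) imageE imageI)
  qed
qed

text \<open>The preimage of \<open>W\<close> is a submodule, so once it contains \<open>S\<close> it
  contains the span. A map on the relations of the coinvariants is thus tested on their
  generators.\<close>

lemma linear_maps_span:
  assumes "h \<in> linear_maps R M N" "module R M" "module R N" "submodule W R N"
    and "S \<subseteq> carrier M" "\<And>x. x \<in> S \<Longrightarrow> h x \<in> W" "x \<in> submodule_span R M S"
  shows "h x \<in> W"
  using submodule_span_least[OF submodule_preimage[OF assms(1-4)], of S] assms(5-7) by auto

section \<open>Cosets and quotient modules\<close>

lemma (in module) coset_self: "submodule W R M \<Longrightarrow> x \<in> carrier M \<Longrightarrow> x \<in> W +>\<^bsub>M\<^esub> x"
  using submodule_zero[of W] by (force simp: a_r_coset_def')

lemma (in module) coset_eq_iff: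
  assumes "submodule W R M" "x \<in> carrier M" "y \<in> carrier M"
  shows "W +>\<^bsub>M\<^esub> x = W +>\<^bsub>M\<^esub> y \<longleftrightarrow> x \<ominus>\<^bsub>M\<^esub> y \<in> W"
proof
  have W: "W \<subseteq> carrier M" using submoduleE(1)[OF assms(1)] .
  assume "W +>\<^bsub>M\<^esub> x = W +>\<^bsub>M\<^esub> y"
  moreover have "x \<in> W +>\<^bsub>M\<^esub> x"
    using coset_self assms(1,2) .
  ultimately obtain w where "w \<in> W" "x = w \<oplus>\<^bsub>M\<^esub> y" by (auto simp: a_r_coset_def')
  then show "x \<ominus>\<^bsub>M\<^esub> y \<in> W" using W assms(3) by (auto simp: M.group_simps subset_eq)
next
  have sub: "W +>\<^bsub>M\<^esub> x \<subseteq> W +>\<^bsub>M\<^esub> y"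
    if "x \<in> carrier M" "y \<in> carrier M" "x \<ominus>\<^bsub>M\<^esub> y \<in> W" for x y
  proof
    fix z assume "z \<in> W +>\<^bsub>M\<^esub> x"
    then obtain w where w: "w \<in> W" "z = w \<oplus>\<^bsub>M\<^esub> x" by (auto simp: a_r_coset_def')
    then have "w \<in> carrier M" using submoduleE(1)[OF assms(1)] by auto
    then have "z = (w \<oplus>\<^bsub>M\<^esub> (x \<ominus>\<^bsub>M\<^esub> y)) \<oplus>\<^bsub>M\<^esub> y" using w(2) that by (simp add: M.group_simps)
    moreover have "w \<oplus>\<^bsub>M\<^esub> (x \<ominus>\<^bsub>M\<^esub> y) \<in> W" using submoduleE(5)[OF assms(1)] w(1) that by auto
    ultimately show "z \<in> W +>\<^bsub>M\<^esub> y" by (auto simp: a_r_coset_def')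
  qed
  assume "x \<ominus>\<^bsub>M\<^esub> y \<in> W"
  moreover from this have "y \<ominus>\<^bsub>M\<^esub> x \<in> W"
    using submoduleE(3)[OF assms(1), of "x \<ominus>\<^bsub>M\<^esub> y"] assms(2,3) by (simp add: M.group_simps)
  ultimately show "W +>\<^bsub>M\<^esub> x = W +>\<^bsub>M\<^esub> y" using sub assms(2,3) by (simp add: subset_antisym)
qed

lemma (in module) mem_coset_iff:
  assumes "submodule W R M" "x \<in> carrier M"
  shows "y \<in> W +>\<^bsub>M\<^esub> x \<longleftrightarrow> y \<in> carrier M \<and> W +>\<^bsub>M\<^esub> y = W +>\<^bsub>M\<^esub> x"
proof
  have W: "W \<subseteq> carrier M" using submoduleE(1)[OF assms(1)] .
  assume "y \<in> W +>\<^bsub>M\<^esub> x"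
  then obtain w where w: "w \<in> W" "y = w \<oplus>\<^bsub>M\<^esub> x" by (auto simp: a_r_coset_def')
  then have "w \<in> carrier M" using W by auto
  then have "y \<in> carrier M" "y \<ominus>\<^bsub>M\<^esub> x = w" using w(2) assms(2) by (simp_all add: M.group_simps)
  then show "y \<in> carrier M \<and> W +>\<^bsub>M\<^esub> y = W +>\<^bsub>M\<^esub> x" using w(1) assms by (simp add: coset_eq_iff)
next
  assume "y \<in> carrier M \<and> W +>\<^bsub>M\<^esub> y = W +>\<^bsub>M\<^esub> x"
  then show "y \<in> W +>\<^bsub>M\<^esub> x" using coset_self[OF assms(1), of y] by metis
qed

lemma carrier_quotient:
  "carrier (quotient_module M W) = (\<lambda>x. W +>\<^bsub>M\<^esub> x) ` carrier M"
  by (auto simp: quotient_module_def A_RCOSETS_def')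

lemma zero_quotient:
  assumes "module R M" "submodule W R M"
  shows "\<zero>\<^bsub>quotient_module M W\<^esub> = W +>\<^bsub>M\<^esub> \<zero>\<^bsub>M\<^esub>"
proof -
  interpret M: module R M by fact
  have "W \<subseteq> carrier M" using M.submoduleE(1)[OF assms(2)] .
  then show ?thesis by (auto simp: quotient_module_def a_r_coset_def' subset_eq)
qed

text \<open>Operations on cosets are encoded as unions over all representatives. If the value is the
  same for all of them, the union is that value, and \<open>x\<close> itself shows that the union is
  not empty.\<close>

lemma UN_coset:
  assumes "module R M" "submodule W R M" "x \<in> carrier M"
    and "\<And>y. y \<in> carrier M \<Longrightarrow> y \<ominus>\<^bsub>M\<^esub> x \<in> W \<Longrightarrow> h y = h x"
  shows "(\<Union>a\<in>W +>\<^bsub>M\<^esub> x. h a) = h x"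
proof -
  interpret M: module R M by fact
  have "x \<in> W +>\<^bsub>M\<^esub> x" using M.coset_self[OF assms(2,3)] .
  moreover have "h a = h x" if "a \<in> W +>\<^bsub>M\<^esub> x" for a
  proof -
    have "a \<in> carrier M" "W +>\<^bsub>M\<^esub> a = W +>\<^bsub>M\<^esub> x" using that M.mem_coset_iff[OF assms(2,3)] by simp_all
    then show ?thesis using M.coset_eq_iff[OF assms(2) _ assms(3)] assms(4) by simp
  qed
  ultimately show ?thesis by blast
qed

lemma add_quotient:
  assumes "module R M" "submodule W R M" "x \<in> carrier M" "y \<in> carrier M"
  shows "(W +>\<^bsub>M\<^esub> x) \<oplus>\<^bsub>quotient_module M W\<^esub> (W +>\<^bsub>M\<^esub> y) = W +>\<^bsub>M\<^esub> (x \<oplus>\<^bsub>M\<^esub> y)"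
proof -
  interpret M: module R M by fact
  have "abelian_subgroup W M"
    using assms(2) M.abelian_group_axioms M.a_comm_group
    by (intro abelian_subgroupI3 additive_subgroup.intro) (auto dest: submodule.axioms)
  then show ?thesis
    using assms(3,4) by (simp add: quotient_module_def abelian_subgroup.a_rcos_sum)
qed

lemma smult_quotient:
  assumes "module R M" "submodule W R M" "x \<in> carrier M" "c \<in> carrier R"
  shows "c \<odot>\<^bsub>quotient_module M W\<^esub> (W +>\<^bsub>M\<^esub> x) = W +>\<^bsub>M\<^esub> (c \<odot>\<^bsub>M\<^esub> x)"
proof -
  interpret M: module R M by fact
  show ?thesis
    unfolding quotient_module_def module.simps
  proof (rule UN_coset[OF assms(1-3)])
    fix y assume y: "y \<in> carrier M" "y \<ominus>\<^bsub>M\<^esub> x \<in> W"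
    have "c \<odot>\<^bsub>M\<^esub> y \<ominus>\<^bsub>M\<^esub> c \<odot>\<^bsub>M\<^esub> x = c \<odot>\<^bsub>M\<^esub> (y \<ominus>\<^bsub>M\<^esub> x)"
      using y assms by (simp add: a_minus_def M.smult_r_distr M.smult_r_minus)
    then show "W +>\<^bsub>M\<^esub> (c \<odot>\<^bsub>M\<^esub> y) = W +>\<^bsub>M\<^esub> (c \<odot>\<^bsub>M\<^esub> x)"
      using y assms M.submoduleE(4)[OF assms(2)] by (simp add: M.coset_eq_iff)
  qed
qed

text \<open>Every module law is an equation between operations or the existence of an inverse, and a
  surjection that respects the operations carries these from \<open>M\<close> to
  \<open>N\<close>.\<close>

lemma module_of_surjection:
  assumes "module R M" "\<pi> ` carrier M = carrier N" "\<zero>\<^bsub>N\<^esub> = \<pi> \<zero>\<^bsub>M\<^esub>"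
    and add: "\<And>x y. x \<in> carrier M \<Longrightarrow> y \<in> carrier M \<Longrightarrow> \<pi> x \<oplus>\<^bsub>N\<^esub> \<pi> y = \<pi> (x \<oplus>\<^bsub>M\<^esub> y)"
    and smult: "\<And>c x. c \<in> carrier R \<Longrightarrow> x \<in> carrier M \<Longrightarrow> c \<odot>\<^bsub>N\<^esub> \<pi> x = \<pi> (c \<odot>\<^bsub>M\<^esub> x)"
  shows "module R N"
proof -
  interpret M: module R M by fact
  have ex: "\<exists>x\<in>carrier M. y = \<pi> x" if "y \<in> carrier N" for y using that assms(2) by auto
  have cl: "\<pi> x \<in> carrier N" if "x \<in> carrier M" for x using that assms(2) by auto
  have mod: "a \<odot>\<^bsub>N\<^esub> x \<in> carrier N \<and> (a \<oplus>\<^bsub>R\<^esub> b) \<odot>\<^bsub>N\<^esub> x = a \<odot>\<^bsub>N\<^esub> x \<oplus>\<^bsub>N\<^esub> b \<odot>\<^bsub>N\<^esub> x \<and>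
    a \<odot>\<^bsub>N\<^esub> (x \<oplus>\<^bsub>N\<^esub> y) = a \<odot>\<^bsub>N\<^esub> x \<oplus>\<^bsub>N\<^esub> a \<odot>\<^bsub>N\<^esub> y \<and>
    (a \<otimes>\<^bsub>R\<^esub> b) \<odot>\<^bsub>N\<^esub> x = a \<odot>\<^bsub>N\<^esub> (b \<odot>\<^bsub>N\<^esub> x) \<and> \<one>\<^bsub>R\<^esub> \<odot>\<^bsub>N\<^esub> x = x"
    if ab: "a \<in> carrier R" "b \<in> carrier R" and xy: "x \<in> carrier N" "y \<in> carrier N" for a b x y
  proof -
    obtain x' where "x' \<in> carrier M" "x = \<pi> x'" using ex[OF xy(1)] by blast
    moreover obtain y' where "y' \<in> carrier M" "y = \<pi> y'" using ex[OF xy(2)] by blast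
    ultimately show ?thesis
      using ab by (simp add: add smult cl M.smult_l_distr M.smult_r_distr M.smult_assoc1)
  qed
  show ?thesis
  proof (rule moduleI)
    show "cring R" by (rule M.is_cring)
    have mon: "x \<oplus>\<^bsub>N\<^esub> y \<in> carrier N \<and> x \<oplus>\<^bsub>N\<^esub> y \<oplus>\<^bsub>N\<^esub> z = x \<oplus>\<^bsub>N\<^esub> (y \<oplus>\<^bsub>N\<^esub> z) \<and>
        x \<oplus>\<^bsub>N\<^esub> y = y \<oplus>\<^bsub>N\<^esub> x \<and> \<zero>\<^bsub>N\<^esub> \<oplus>\<^bsub>N\<^esub> x = x"
      if xyz: "x \<in> carrier N" "y \<in> carrier N" "z \<in> carrier N" for x y z
    proof -
      obtain x' where "x' \<in> carrier M" "x = \<pi> x'" using ex[OF xyz(1)] by blast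
      moreover obtain y' where "y' \<in> carrier M" "y = \<pi> y'" using ex[OF xyz(2)] by blast
      moreover obtain z' where "z' \<in> carrier M" "z = \<pi> z'" using ex[OF xyz(3)] by blast
      ultimately show ?thesis by (simp add: assms(3) add cl M.a_ac)
    qed
    show "abelian_group N"
    proof (rule abelian_groupI)
      show "\<zero>\<^bsub>N\<^esub> \<in> carrier N" using assms(3) cl by simp
    next
      fix x assume "x \<in> carrier N"
      then obtain x' where x': "x' \<in> carrier M" "x = \<pi> x'" using ex by blast
      show "\<exists>y\<in>carrier N. y \<oplus>\<^bsub>N\<^esub> x = \<zero>\<^bsub>N\<^esub>"
        by (rule bexI[of _ "\<pi> (\<ominus>\<^bsub>M\<^esub> x')"]) (use x' add assms(3) cl in \<open>simp_all add: M.l_neg\<close>)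
    qed (use mon in blast)+
  qed (use mod in blast)+
qed

lemma module_quotient:
  assumes "module R M" "submodule W R M"
  shows "module R (quotient_module M W)"
  by (rule module_of_surjection[where \<pi> = "\<lambda>x. W +>\<^bsub>M\<^esub> x", OF assms(1)])
    (simp_all add: carrier_quotient zero_quotient[OF assms] add_quotient[OF assms]
        smult_quotient[OF assms])

lemma induced_map_coset:
  assumes "module R M" "module R N" "submodule W R M" "submodule V R N"
    and "h \<in> linear_maps R M N" "\<forall>w\<in>W. h w \<in> V" "x \<in> carrier M"
  shows "induced_map N V h (W +>\<^bsub>M\<^esub> x) = V +>\<^bsub>N\<^esub> h x"
proof -
  interpret N: module R N by fact
  show ?thesis
    unfolding induced_map_def
  proof (rule UN_coset[OF assms(1,3,7)])
    fix y assume "y \<in> carrier M" "y \<ominus>\<^bsub>M\<^esub> x \<in> W"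
    then show "V +>\<^bsub>N\<^esub> h y = V +>\<^bsub>N\<^esub> h x"
      using bspec[OF assms(6), of "y \<ominus>\<^bsub>M\<^esub> x"] assms(7)
      by (simp add: N.coset_eq_iff[OF assms(4)] linear_maps_closed[OF assms(5)]
          linear_maps_diff[OF assms(5,1,2)])
  qed
qed

lemma induced_map_linear:
  assumes "module R M" "module R N" "submodule W R M" "submodule V R N"
    and "h \<in> linear_maps R M N" "\<forall>w\<in>W. h w \<in> V"
  shows "induced_map N V h \<in> linear_maps R (quotient_module M W) (quotient_module N V)"
proof -
  interpret M: module R M by fact
  interpret N: module R N by fact
  note [simp] = induced_map_coset[OF assms] add_quotient[OF assms(1,3)]
      smult_quotient[OF assms(1,3)]
    add_quotient[OF assms(2,4)] smult_quotient[OF assms(2,4)] linear_maps_closed[OF assms(5)]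
    linear_maps_add[OF assms(5)] linear_maps_smult[OF assms(5)]
  show ?thesis by (rule linear_mapsI) (auto simp: carrier_quotient)
qed

section \<open>Presented modules\<close>

lemma UN_const_eq: "x \<in> A \<Longrightarrow> (\<And>a. a \<in> A \<Longrightarrow> F a = B) \<Longrightarrow> (\<Union>a\<in>A. F a) = B"
  by auto

text \<open>The value of a formal combination under the linear extension of \<open>F\<close> from
  generators. The free module on the generators is never formed; lists stand in for its
  elements.\<close>

definition comb_eval :: "('k, 'b) module \<Rightarrow> ('g \<Rightarrow> 'b) \<Rightarrow> ('k \<times> 'g) list \<Rightarrow> 'b" where
  "comb_eval N F xs = foldr (\<lambda>(c, g) y. c \<odot>\<^bsub>N\<^esub> F g \<oplus>\<^bsub>N\<^esub> y) xs \<zero>\<^bsub>N\<^esub>"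

lemma comb_eval_Nil [simp]: "comb_eval N F [] = \<zero>\<^bsub>N\<^esub>"
  and comb_eval_Cons [simp]: "comb_eval N F ((c, g) # xs) = c \<odot>\<^bsub>N\<^esub> F g \<oplus>\<^bsub>N\<^esub> comb_eval N F xs"
  by (simp_all add: comb_eval_def)

lemma comb_eval_closed:
  assumes "module R N" "F \<in> G \<rightarrow> carrier N" "xs \<in> formal_combs R G"
  shows "comb_eval N F xs \<in> carrier N"
proof -
  interpret N: module R N by fact
  have "\<forall>x\<in>set xs. fst x \<in> carrier R \<and> snd x \<in> G" using assms(3) by (auto simp: formal_combs_def)
  then show ?thesis using funcset_mem[OF assms(2)] by (induction xs) auto
qed

lemma comb_eval_cong:
  assumes "\<And>g. g \<in> G \<Longrightarrow> F g = F' g" "xs \<in> formal_combs R G"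
  shows "comb_eval N F xs = comb_eval N F' xs"
proof -
  have "\<forall>x\<in>set xs. snd x \<in> G" using assms(2) by (auto simp: formal_combs_def)
  then show ?thesis using assms(1) by (induction xs) auto
qed

lemma comb_eval_append:
  assumes "module R N" "F \<in> G \<rightarrow> carrier N" "xs \<in> formal_combs R G" "ys \<in> formal_combs R G"
  shows "comb_eval N F (xs @ ys) = comb_eval N F xs \<oplus>\<^bsub>N\<^esub> comb_eval N F ys"
proof -
  interpret N: module R N by fact
  have y: "comb_eval N F ys \<in> carrier N" using comb_eval_closed[OF assms(1,2,4)] .
  have "xs \<in> formal_combs R G \<Longrightarrow> ?thesis"
  proof (induction xs)
    case (Cons x xs)
    obtain c g where x: "x = (c, g)" by (cases x)
    have "xs \<in> formal_combs R G" "c \<in> carrier R" "F g \<in> carrier N"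
      using Cons.prems x assms(2) by (auto simp: formal_combs_def)
    then show ?case using Cons.IH x y comb_eval_closed[OF assms(1,2)] by (simp add: N.a_assoc)
  qed (use y in simp)
  then show ?thesis using assms(3) by simp
qed

lemma scale_comb_Cons [simp]:
    "scale_comb R c ((b, g) # xs) = (c \<otimes>\<^bsub>R\<^esub> b, g) # scale_comb R c xs"
  and scale_comb_Nil [simp]: "scale_comb R c [] = []"
  by (simp_all add: scale_comb_def)

lemma scale_comb_append: "scale_comb R c (xs @ ys) = scale_comb R c xs @ scale_comb R c ys"
  by (simp add: scale_comb_def)

lemma formal_combs_simps [simp]:
  "[] \<in> formal_combs R G"
  "(c, g) # xs \<in> formal_combs R G \<longleftrightarrow> c \<in> carrier R \<and> g \<in> G \<and> xs \<in> formal_combs R G"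
  "xs @ ys \<in> formal_combs R G \<longleftrightarrow> xs \<in> formal_combs R G \<and> ys \<in> formal_combs R G"
  by (auto simp: formal_combs_def)

lemma formal_combs_induct [consumes 1, case_names Nil Cons]:
  assumes "xs \<in> formal_combs R G" "P []"
    and "\<And>c g xs. c \<in> carrier R \<Longrightarrow> g \<in> G \<Longrightarrow> xs \<in> formal_combs R G \<Longrightarrow> P xs \<Longrightarrow> P ((c, g) # xs)"
  shows "P xs"
  using assms(1) by (induction xs) (auto intro: assms(2,3))

lemma (in cring) scale_comb_closed:
  assumes "c \<in> carrier R" "xs \<in> formal_combs R G"
  shows "scale_comb R c xs \<in> formal_combs R G"
  using assms(2) by (induction rule: formal_combs_induct) (use assms(1) in auto)

lemma (in cring) scale_comb_scale:
  assumes "a \<in> carrier R" "b \<in> carrier R" "xs \<in> formal_combs R G"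
  shows "scale_comb R a (scale_comb R b xs) = scale_comb R (a \<otimes> b) xs"
  using assms(3) by (induction rule: formal_combs_induct) (use assms(1,2) in \<open>auto simp: m_assoc\<close>)

lemma (in cring) scale_comb_one: "xs \<in> formal_combs R G \<Longrightarrow> scale_comb R \<one> xs = xs"
  by (induction rule: formal_combs_induct) auto

lemma comb_eval_scale:
  assumes "module R N" "F \<in> G \<rightarrow> carrier N" "xs \<in> formal_combs R G" "c \<in> carrier R"
  shows "comb_eval N F (scale_comb R c xs) = c \<odot>\<^bsub>N\<^esub> comb_eval N F xs"
proof -
  interpret N: module R N by fact
  show ?thesis using assms(3)
  proof (induction rule: formal_combs_induct)
    case (Cons b g xs)
    then show ?case using funcset_mem[OF assms(2)] assms(4) comb_eval_closed[OF assms(1,2)]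
      by (simp add: N.smult_assoc1 N.smult_r_distr)
  qed (use assms(4) in simp)
qed

section \<open>Presented modules and their universal property\<close>

definition pgen :: "('k, 'r) ring_scheme \<Rightarrow> 'g set \<Rightarrow> ('k \<times> 'g) list set \<Rightarrow> 'g \<Rightarrow> ('k \<times> 'g) list set"
    where
  "pgen R G Rel g = comb_class R G Rel [(\<one>\<^bsub>R\<^esub>, g)]"

text \<open>Unlike \<open>presented_map\<close>, which lands in a presented module, this allows an
  arbitrary module as target. The value is read off from an arbitrary representative, which is
  legitimate as soon as the relators evaluate to zero.\<close>

definition lin_ext :: "('k, 'b) module \<Rightarrow> ('g \<Rightarrow> 'b) \<Rightarrow> ('k \<times> 'g) list set \<Rightarrow> 'b" where
  "lin_ext N F A = comb_eval N F (SOME a. a \<in> A)"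

context
  fixes R :: "('k, 'r) ring_scheme" and G :: "'g set" and Rel :: "('k \<times> 'g) list set"
  assumes R: "cring R"
begin

interpretation R: cring R by (rule R)


lemma rel_cong_formal: "rel_cong R G Rel xs ys \<Longrightarrow> xs \<in> formal_combs R G \<and> ys \<in> formal_combs R G"
  by (induction rule: rel_cong.induct) (auto simp: R.scale_comb_closed)

text \<open>In the case of a relator the extra scalar is absorbed, because \<open>rc_rel\<close>
  already allows any scalar in front of it.\<close>

lemma rel_cong_scale:
  assumes "c \<in> carrier R" "rel_cong R G Rel xs ys"
  shows "rel_cong R G Rel (scale_comb R c xs) (scale_comb R c ys)"
  using assms(2)
proof (induction rule: rel_cong.induct)
  case (rc_refl xs)
  then show ?case using assms(1) by (intro rel_cong.rc_refl R.scale_comb_closed)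
next
  case (rc_sym xs ys)
  then show ?case by (blast intro: rel_cong.rc_sym)
next
  case (rc_trans xs ys zs)
  then show ?case by (blast intro: rel_cong.rc_trans)
next
  case (rc_append xs ys xs' ys')
  then show ?case by (simp add: scale_comb_append rel_cong.rc_append)
next
  case (rc_comm xs ys)
  then show ?case using assms(1) by (simp add: scale_comb_append rel_cong.rc_comm
      R.scale_comb_closed)
next
  case (rc_add a b g)
  then show ?case using assms(1) rel_cong.rc_add[of "c \<otimes>\<^bsub>R\<^esub> a" R "c \<otimes>\<^bsub>R\<^esub> b" g G Rel]
    by (simp add: R.r_distr)
next
  case (rc_zero g)
  then show ?case using assms(1) rel_cong.rc_zero[of g G R] by simp
next
  case (rc_rel r d)
  then show ?case using assms(1) rel_cong.rc_rel[of r Rel R G "c \<otimes>\<^bsub>R\<^esub> d"]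
    by (simp add: R.scale_comb_scale)
qed

lemma comb_class_eq: "rel_cong R G Rel xs ys \<Longrightarrow> comb_class R G Rel xs = comb_class R G Rel ys"
  unfolding comb_class_def by (auto intro: rc_sym rc_trans)

lemma comb_class_closed: "xs \<in> formal_combs R G \<Longrightarrow>
    comb_class R G Rel xs \<in> carrier (presented_module R G Rel)"
  by (simp add: presented_module_def)

lemma comb_class_zero: "\<zero>\<^bsub>presented_module R G Rel\<^esub> = comb_class R G Rel []"
  by (simp add: presented_module_def)

lemma comb_class_add:
  assumes "xs \<in> formal_combs R G" "ys \<in> formal_combs R G"
  shows "comb_class R G Rel xs \<oplus>\<^bsub>presented_module R G Rel\<^esub> comb_class R G Rel ys =
      comb_class R G Rel (xs @ ys)"
proof -
  have "comb_class R G Rel (a @ b) = comb_class R G Rel (xs @ ys)" if "a \<in> comb_class R G Rel xs"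
      "b \<in> comb_class R G Rel ys" for a b
    using that comb_class_eq[of "xs @ ys" "a @ b"] by (simp add: comb_class_def rc_append)
  moreover have "xs \<in> comb_class R G Rel xs" "ys \<in> comb_class R G Rel ys"
    using assms by (simp_all add: comb_class_def rc_refl)
  ultimately show ?thesis
    unfolding presented_module_def ring.simps by (intro UN_const_eq)
qed

lemma comb_class_smult:
  assumes "xs \<in> formal_combs R G" "c \<in> carrier R"
  shows "c \<odot>\<^bsub>presented_module R G Rel\<^esub> comb_class R G Rel xs = comb_class R G Rel (scale_comb R c xs)"
proof -
  have "comb_class R G Rel (scale_comb R c a) = comb_class R G Rel (scale_comb R c xs)"
      if "a \<in> comb_class R G Rel xs" for a
    using that comb_class_eq[OF rel_cong_scale[OF assms(2)], of xs a] by (simp add: comb_class_def)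
  moreover have "xs \<in> comb_class R G Rel xs" using assms by (simp add: comb_class_def rc_refl)
  ultimately show ?thesis
    unfolding presented_module_def module.simps by (intro UN_const_eq)
qed

lemma presented_carrier_cases:
  assumes "x \<in> carrier (presented_module R G Rel)"
  obtains xs where "xs \<in> formal_combs R G" "x = comb_class R G Rel xs"
  using assms by (auto simp: presented_module_def)

lemma module_presented: "module R (presented_module R G Rel)"
proof -
  note [simp] = comb_class_add comb_class_smult comb_class_zero comb_class_closed
      R.scale_comb_closed
  interpret P: abelian_monoid "presented_module R G Rel"
  proof (rule abelian_monoidI)
    fix x y
    assume xy: "x \<in> carrier (presented_module R G Rel)" "y \<in> carrier (presented_module R G Rel)"
    obtain xs where "xs \<in> formal_combs R G" "x = comb_class R G Rel xs"
      using xy(1) by (rule presented_carrier_cases)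
    moreover obtain ys where "ys \<in> formal_combs R G" "y = comb_class R G Rel ys"
      using xy(2) by (rule presented_carrier_cases)
    ultimately show "x \<oplus>\<^bsub>presented_module R G Rel\<^esub> y = y \<oplus>\<^bsub>presented_module R G Rel\<^esub> x"
        using comb_class_eq[OF rc_comm] by simp
  qed (auto elim!: presented_carrier_cases)
  have distr: "comb_class R G Rel (scale_comb R (a \<oplus>\<^bsub>R\<^esub> b) xs) =
      comb_class R G Rel (scale_comb R a xs) \<oplus>\<^bsub>presented_module R G Rel\<^esub> comb_class R G Rel
      (scale_comb R b xs)"
    if "a \<in> carrier R" "b \<in> carrier R" "xs \<in> formal_combs R G" for a b xs
    using that(3)
  proof (induction rule: formal_combs_induct)
    case (Cons c g xs)
    have app: "comb_class R G Rel ((d, h) # zs) = comb_class R G Rel [(d, h)]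
        \<oplus>\<^bsub>presented_module R G Rel\<^esub> comb_class R G Rel zs"
      if "d \<in> carrier R" "h \<in> G" "zs \<in> formal_combs R G" for d h zs
      using comb_class_add[of "[(d, h)]" zs] that by simp
    have gg: "comb_class R G Rel [((a \<oplus>\<^bsub>R\<^esub> b) \<otimes>\<^bsub>R\<^esub> c, g)] = comb_class R G Rel [(a \<otimes>\<^bsub>R\<^esub> c, g)]
        \<oplus>\<^bsub>presented_module R G Rel\<^esub> comb_class R G Rel [(b \<otimes>\<^bsub>R\<^esub> c, g)]"
      using comb_class_eq[OF rc_add[of "a \<otimes>\<^bsub>R\<^esub> c" R "b \<otimes>\<^bsub>R\<^esub> c" g G Rel]] that(1,2) Cons(1,2)
      by (simp add: R.l_distr)
    let ?A = "comb_class R G Rel [(a \<otimes>\<^bsub>R\<^esub> c, g)]" and ?B = "comb_class R G Rel [(b \<otimes>\<^bsub>R\<^esub> c, g)]"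
    have cl: "?A \<in> carrier (presented_module R G Rel)" "?B \<in> carrier (presented_module R G Rel)"
        "comb_class R G Rel (scale_comb R a xs) \<in> carrier (presented_module R G Rel)"
      "comb_class R G Rel (scale_comb R b xs) \<in> carrier (presented_module R G Rel)"
      using that Cons by simp_all
    have "comb_class R G Rel (scale_comb R (a \<oplus>\<^bsub>R\<^esub> b) ((c, g) # xs)) =
      (?A \<oplus>\<^bsub>presented_module R G Rel\<^esub> ?B) \<oplus>\<^bsub>presented_module R G Rel\<^esub>
          (comb_class R G Rel (scale_comb R a xs) \<oplus>\<^bsub>presented_module R G Rel\<^esub> comb_class R G Rel
          (scale_comb R b xs))"
      unfolding scale_comb_Cons using that Cons gg
      by (subst app) (simp_all del: comb_class_add)
    also have "\<dots> = (?A \<oplus>\<^bsub>presented_module R G Rel\<^esub> comb_class R G Rel (scale_comb R a xs))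
        \<oplus>\<^bsub>presented_module R G Rel\<^esub> (?B \<oplus>\<^bsub>presented_module R G Rel\<^esub> comb_class R G Rel
        (scale_comb R b xs))"
      using cl by (simp add: P.a_ac del: comb_class_add)
    finally show ?case using that Cons by simp
  qed simp
  have zero: "comb_class R G Rel (scale_comb R \<zero>\<^bsub>R\<^esub> xs) = comb_class R G Rel []"
      if "xs \<in> formal_combs R G" for xs
    using that
  proof (induction rule: formal_combs_induct)
    case (Cons c g xs)
    have "comb_class R G Rel [(\<zero>\<^bsub>R\<^esub>, g)] = comb_class R G Rel []" using comb_class_eq[OF rc_zero]
        Cons(2) .
    then show ?case
      using Cons comb_class_add[of "[(\<zero>\<^bsub>R\<^esub>, g)]" "scale_comb R \<zero>\<^bsub>R\<^esub> xs"] comb_class_add[of "[]" "[]"]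
          by simp
  qed simp
  have mod: "a \<odot>\<^bsub>presented_module R G Rel\<^esub> x \<in> carrier (presented_module R G Rel) \<and>
      (a \<oplus>\<^bsub>R\<^esub> b) \<odot>\<^bsub>presented_module R G Rel\<^esub> x = a \<odot>\<^bsub>presented_module R G Rel\<^esub> x
          \<oplus>\<^bsub>presented_module R G Rel\<^esub> b \<odot>\<^bsub>presented_module R G Rel\<^esub> x \<and>
      a \<odot>\<^bsub>presented_module R G Rel\<^esub> (x \<oplus>\<^bsub>presented_module R G Rel\<^esub> y) = a \<odot>\<^bsub>presented_module R G Rel\<^esub> x
          \<oplus>\<^bsub>presented_module R G Rel\<^esub> a \<odot>\<^bsub>presented_module R G Rel\<^esub> y \<and>
      (a \<otimes>\<^bsub>R\<^esub> b) \<odot>\<^bsub>presented_module R G Rel\<^esub> x = a \<odot>\<^bsub>presented_module R G Rel\<^esub>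
          (b \<odot>\<^bsub>presented_module R G Rel\<^esub> x) \<and> \<one>\<^bsub>R\<^esub> \<odot>\<^bsub>presented_module R G Rel\<^esub> x = x"
    if ab: "a \<in> carrier R" "b \<in> carrier R" and xy: "x \<in> carrier (presented_module R G Rel)"
        "y \<in> carrier (presented_module R G Rel)" for a b x y
  proof -
    obtain xs where "xs \<in> formal_combs R G" "x = comb_class R G Rel xs"
      using xy(1) by (rule presented_carrier_cases)
    moreover obtain ys where "ys \<in> formal_combs R G" "y = comb_class R G Rel ys"
      using xy(2) by (rule presented_carrier_cases)
    ultimately show ?thesis
      using ab distr by (simp add: R.scale_comb_scale R.scale_comb_one scale_comb_append)
  qed
  show ?thesis
  proof (rule moduleI[OF R])
    show "abelian_group (presented_module R G Rel)"
    proof (rule abelian_groupI)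
      fix x assume "x \<in> carrier (presented_module R G Rel)"
      then obtain xs where xs: "xs \<in> formal_combs R G" "x = comb_class R G Rel xs"
          by (rule presented_carrier_cases)
      let ?y = "comb_class R G Rel (scale_comb R (\<ominus>\<^bsub>R\<^esub> \<one>\<^bsub>R\<^esub>) xs)"
      have "?y \<oplus>\<^bsub>presented_module R G Rel\<^esub> x = comb_class R G Rel (scale_comb R (\<ominus>\<^bsub>R\<^esub> \<one>\<^bsub>R\<^esub> \<oplus>\<^bsub>R\<^esub> \<one>\<^bsub>R\<^esub>) xs)"
        using distr[of "\<ominus>\<^bsub>R\<^esub> \<one>\<^bsub>R\<^esub>" "\<one>\<^bsub>R\<^esub>" xs] xs by (simp add: R.scale_comb_one)
      also have "\<dots> = \<zero>\<^bsub>presented_module R G Rel\<^esub>" using zero[OF xs(1)] by (simp add: R.l_neg)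
      finally show "\<exists>y\<in>carrier (presented_module R G Rel).
          y \<oplus>\<^bsub>presented_module R G Rel\<^esub> x = \<zero>\<^bsub>presented_module R G Rel\<^esub>"
        by (rule bexI) (simp add: xs(1))
    qed (simp_all add: P.a_ac del: comb_class_zero)
  qed (metis mod R.one_closed)+
qed

lemma pgen_closed: "g \<in> G \<Longrightarrow> pgen R G Rel g \<in> carrier (presented_module R G Rel)"
  by (simp add: pgen_def comb_class_closed)

lemma comb_class_eval: "xs \<in> formal_combs R G \<Longrightarrow> comb_class R G Rel xs =
    comb_eval (presented_module R G Rel) (pgen R G Rel) xs"
proof (induction rule: formal_combs_induct)
  case (Cons c g xs)
  then show ?case
    using comb_class_add[of "[(c, g)]" xs] comb_class_smult[of "[(\<one>\<^bsub>R\<^esub>, g)]" c]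
    by (simp add: pgen_def)
qed (simp add: comb_class_zero)

lemma comb_eval_relator:
  assumes "r \<in> Rel" "r \<in> formal_combs R G"
  shows "comb_eval (presented_module R G Rel) (pgen R G Rel) r = \<zero>\<^bsub>presented_module R G Rel\<^esub>"
  using comb_class_eq[OF rc_rel[OF assms R.one_closed]] comb_class_eval[OF assms(2)]
  by (simp add: R.scale_comb_one[OF assms(2)] comb_class_zero)

lemma presented_induct [consumes 1, case_names zero gen add smult]:
  assumes "x \<in> carrier (presented_module R G Rel)" "Q \<zero>\<^bsub>presented_module R G Rel\<^esub>" "\<And>g. g \<in> G \<Longrightarrow>
      Q (pgen R G Rel g)"
    and "\<And>x y. x \<in> carrier (presented_module R G Rel) \<Longrightarrow> y \<in> carrier (presented_module R G Rel) \<Longrightarrow>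
        Q x \<Longrightarrow> Q y \<Longrightarrow> Q (x \<oplus>\<^bsub>presented_module R G Rel\<^esub> y)"
    and "\<And>c x. c \<in> carrier R \<Longrightarrow> x \<in> carrier (presented_module R G Rel) \<Longrightarrow> Q x \<Longrightarrow>
        Q (c \<odot>\<^bsub>presented_module R G Rel\<^esub> x)"
  shows "Q x"
proof -
  interpret P: module R "presented_module R G Rel" by (rule module_presented)
  obtain xs where xs: "xs \<in> formal_combs R G" "x = comb_class R G Rel xs" using assms(1)
      by (rule presented_carrier_cases)
  have "Q (comb_eval (presented_module R G Rel) (pgen R G Rel) xs)" using xs(1)
  proof (induction rule: formal_combs_induct)
    case (Cons c g xs)
    then show ?case
      using comb_eval_closed[OF module_presented, of "pgen R G Rel" G xs] pgen_closed
      by (auto intro!: assms(3-5))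
  qed (simp add: assms(2))
  then show ?thesis using xs comb_class_eval by simp
qed

text \<open>The uniqueness half of the universal property. It reduces every later identity between
  linear maps on tensor products to elementary tensors.\<close>

lemma presented_maps_eqI:
  assumes "module R N" "h \<in> linear_maps R (presented_module R G Rel) N"
      "k \<in> linear_maps R (presented_module R G Rel) N"
    and "\<And>g. g \<in> G \<Longrightarrow> h (pgen R G Rel g) = k (pgen R G Rel g)"
        "x \<in> carrier (presented_module R G Rel)"
  shows "h x = k x"
  using assms(5)
proof (induction rule: presented_induct)
  case zero
  show ?case using linear_maps_zero[OF assms(2) module_presented assms(1)]
      linear_maps_zero[OF assms(3) module_presented assms(1)] by simp
qed (use assms(2-4) in \<open>simp_all add: linear_maps_add linear_maps_smult\<close>)

text \<open>The congruence is generated by module laws and relators, so evaluation in a module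
  respects each of its rules. This is the existence half of the universal property, up to the choice
  of representatives.\<close>

lemma comb_eval_rel_cong:
  assumes "module R N" "F \<in> G \<rightarrow> carrier N"
    and "\<And>r. r \<in> Rel \<Longrightarrow> r \<in> formal_combs R G \<Longrightarrow> comb_eval N F r = \<zero>\<^bsub>N\<^esub>"
    and "rel_cong R G Rel xs ys"
  shows "comb_eval N F xs = comb_eval N F ys"
proof -
  interpret N: module R N by fact
  note cl = comb_eval_closed[OF assms(1,2)]
  show ?thesis using assms(4)
  proof (induction rule: rel_cong.induct)
    case (rc_append xs ys xs' ys')
    then show ?case using rel_cong_formal by (simp add: comb_eval_append[OF assms(1,2)])
  next
    case (rc_comm xs ys)
    then show ?case using cl by (simp add: comb_eval_append[OF assms(1,2)] N.a_comm)
  next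
    case (rc_add a b g)
    moreover from this have "F g \<in> carrier N" using assms(2) by auto
    ultimately show ?case by (simp add: N.smult_l_distr)
  next
    case (rc_zero g)
    moreover from this have "F g \<in> carrier N" using assms(2) by auto
    ultimately show ?case by simp
  next
    case (rc_rel r c)
    then show ?case using assms(3) by (simp add: comb_eval_scale[OF assms(1,2)])
  qed simp_all
qed

lemma lin_ext:
  assumes "module R N" "F \<in> G \<rightarrow> carrier N"
    and "\<And>r. r \<in> Rel \<Longrightarrow> r \<in> formal_combs R G \<Longrightarrow> comb_eval N F r = \<zero>\<^bsub>N\<^esub>"
  shows lin_ext_linear: "lin_ext N F \<in> linear_maps R (presented_module R G Rel) N"
    and lin_ext_pgen: "g \<in> G \<Longrightarrow> lin_ext N F (pgen R G Rel g) = F g"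
proof -
  interpret N: module R N by fact
  have ev: "lin_ext N F (comb_class R G Rel xs) = comb_eval N F xs" if "xs \<in> formal_combs R G"
      for xs
  proof -
    have "(SOME a. a \<in> comb_class R G Rel xs) \<in> comb_class R G Rel xs"
      by (rule someI[of _ xs]) (simp add: comb_class_def rc_refl that)
    then show ?thesis
      using comb_eval_rel_cong[OF assms] by (simp add: lin_ext_def comb_class_def)
  qed
  show "lin_ext N F (pgen R G Rel g) = F g" if "g \<in> G"
    using ev[of "[(\<one>\<^bsub>R\<^esub>, g)]"] that funcset_mem[OF assms(2) that] by (simp add: pgen_def)
  show "lin_ext N F \<in> linear_maps R (presented_module R G Rel) N"
    by (rule linear_mapsI)
      (auto elim!: presented_carrier_cases simp: ev comb_class_add comb_class_smult
          R.scale_comb_closed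
        comb_eval_append[OF assms(1,2)] comb_eval_scale[OF assms(1,2)]
            comb_eval_closed[OF assms(1,2)])
qed

end

section \<open>Maps between presented modules\<close>

lemma linear_comb_eval:
  assumes "h \<in> linear_maps R M N" "module R M" "module R N" "F \<in> G \<rightarrow> carrier M"
      "xs \<in> formal_combs R G"
  shows "h (comb_eval M F xs) = comb_eval N (\<lambda>g. h (F g)) xs"
proof -
  interpret M: module R M by fact
  show ?thesis using assms(5)
  proof (induction rule: formal_combs_induct)
    case (Cons c g xs)
    moreover have "F g \<in> carrier M" using Cons assms(4) by auto
    ultimately show ?case
      using comb_eval_closed[OF assms(2,4)] by (simp add: linear_maps_add[OF assms(1)]
          linear_maps_smult[OF assms(1)])
  qed (simp add: linear_maps_zero[OF assms(1-3)])
qed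

lemma extend_linearly_eval:
  assumes "cring R" "\<And>g. g \<in> G \<Longrightarrow> F g \<in> formal_combs R H" "xs \<in> formal_combs R G"
  shows "extend_linearly R F xs \<in> formal_combs R H \<and>
    comb_class R H Rel (extend_linearly R F xs) =
      comb_eval (presented_module R H Rel) (\<lambda>g. comb_class R H Rel (F g)) xs"
  using assms(3)
proof (induction rule: formal_combs_induct)
  case Nil
  then show ?case by (simp add: extend_linearly_def comb_class_zero[OF assms(1)])
next
  case (Cons c g xs)
  have "extend_linearly R F ((c, g) # xs) = scale_comb R c (F g) @ extend_linearly R F xs"
    by (simp add: extend_linearly_def)
  moreover have "F g \<in> formal_combs R H" using assms(2) Cons(2) .
  moreover from this have "scale_comb R c (F g) \<in> formal_combs R H"
    using cring.scale_comb_closed[OF assms(1)] Cons(1) by blast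
  ultimately show ?case
    using Cons by (simp add: comb_class_add[OF assms(1), symmetric] comb_class_smult[OF assms(1)])
qed

text \<open>\<open>presented_map\<close> works on lists and takes a union over representatives. Read
  in the target, the extended list becomes a \<open>comb_eval\<close>, which is constant on the
  class because the relators go to zero.\<close>

lemma presented_map_class:
  assumes "cring R" "\<And>g. g \<in> G \<Longrightarrow> F g \<in> formal_combs R H"
    and "\<And>r. r \<in> Rel \<Longrightarrow> r \<in> formal_combs R G \<Longrightarrow>
      comb_eval (presented_module R H Rel') (\<lambda>g. comb_class R H Rel' (F g)) r =
          \<zero>\<^bsub>presented_module R H Rel'\<^esub>"
    and "xs \<in> formal_combs R G"
  shows "presented_map R H Rel' F (comb_class R G Rel xs) =
    comb_eval (presented_module R H Rel') (\<lambda>g. comb_class R H Rel' (F g)) xs"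
proof -
  let ?F = "\<lambda>g. comb_class R H Rel' (F g)" and ?N = "presented_module R H Rel'"
  have F: "?F \<in> G \<rightarrow> carrier ?N" using assms(1,2) comb_class_closed by blast
  have "comb_class R H Rel' (extend_linearly R F a) = comb_eval ?N ?F xs"
    if "a \<in> comb_class R G Rel xs" for a
  proof -
    have a: "rel_cong R G Rel xs a" using that by (simp add: comb_class_def)
    then have "a \<in> formal_combs R G" using rel_cong_formal[OF assms(1)] by blast
    then have "comb_class R H Rel' (extend_linearly R F a) = comb_eval ?N ?F a"
      using extend_linearly_eval[OF assms(1,2), where xs = a] by simp
    also have "\<dots> = comb_eval ?N ?F xs"
      using comb_eval_rel_cong[OF assms(1) module_presented[OF assms(1)] F assms(3) a] by simp
    finally show ?thesis .
  qed
  moreover have "xs \<in> comb_class R G Rel xs" using rc_refl[OF assms(4)]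
      by (simp add: comb_class_def)
  ultimately show ?thesis unfolding presented_map_def by blast
qed

lemma presented_map:
  assumes "cring R" "\<And>g. g \<in> G \<Longrightarrow> F g \<in> formal_combs R H"
    and "\<And>r. r \<in> Rel \<Longrightarrow> r \<in> formal_combs R G \<Longrightarrow>
      comb_eval (presented_module R H Rel') (\<lambda>g. comb_class R H Rel' (F g)) r =
          \<zero>\<^bsub>presented_module R H Rel'\<^esub>"
  shows presented_map_linear:
      "presented_map R H Rel' F \<in> linear_maps R (presented_module R G Rel) (presented_module R H
          Rel')"
    and presented_map_pgen:
      "g \<in> G \<Longrightarrow> presented_map R H Rel' F (pgen R G Rel g) = comb_class R H Rel' (F g)"
proof -
  interpret R: cring R by fact
  let ?F = "\<lambda>g. comb_class R H Rel' (F g)" and ?N = "presented_module R H Rel'"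
  note m = module_presented[OF assms(1)]
  interpret N: module R ?N by (rule m)
  have F: "?F \<in> G \<rightarrow> carrier ?N" using assms(1,2) comb_class_closed by blast
  note c = presented_map_class[OF assms]
  show "presented_map R H Rel' F (pgen R G Rel g) = comb_class R H Rel' (F g)" if "g \<in> G"
    using c[where xs = "[(\<one>\<^bsub>R\<^esub>, g)]"] that funcset_mem[OF F that] by (simp add: pgen_def)
  show "presented_map R H Rel' F \<in> linear_maps R (presented_module R G Rel) ?N"
    by (rule linear_mapsI)
      (auto elim!: presented_carrier_cases[OF assms(1)] simp: c comb_class_add[OF assms(1)]
        comb_class_smult[OF assms(1)] R.scale_comb_closed
        comb_eval_append[OF m F] comb_eval_scale[OF m F] comb_eval_closed[OF m F])
qed

section \<open>Chain complexes and coinvariants\<close>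

text \<open>The variants with \<open>Suc\<close> state the same facts between the degrees
  \<open>p + 1\<close> and \<open>p\<close>: homotopies raise the degree, and instantiating
  \<open>p\<close> with \<open>p + 1\<close> would produce the degree
  \<open>p + 1 - 1\<close>.\<close>

lemma chain_complexD:
  assumes "chain_complex R C"
  shows cc_module: "module R (grade C p)"
    and cc_bdry: "bdry C p \<in> linear_maps R (grade C p) (grade C (p - 1))"
    and cc_bdry_Suc: "bdry C (p + 1) \<in> linear_maps R (grade C (p + 1)) (grade C p)"
    and cc_square: "x \<in> carrier (grade C p) \<Longrightarrow> bdry C (p - 1) (bdry C p x) = \<zero>\<^bsub>grade C (p - 2)\<^esub>"
    and cc_square_Suc: "y \<in> carrier (grade C (p + 1)) \<Longrightarrow> bdry C p (bdry C (p + 1) y) =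
        \<zero>\<^bsub>grade C (p - 1)\<^esub>"
proof -
  show b: "bdry C p \<in> linear_maps R (grade C p) (grade C (p - 1))" for p
    using assms by (simp add: chain_complex_def)
  show "bdry C (p + 1) \<in> linear_maps R (grade C (p + 1)) (grade C p)"
    using b[of "p + 1"] by simp
  show sq: "x \<in> carrier (grade C p) \<Longrightarrow> bdry C (p - 1) (bdry C p x) = \<zero>\<^bsub>grade C (p - 2)\<^esub>" for p x
    using assms by (simp add: chain_complex_def)
  show "y \<in> carrier (grade C (p + 1)) \<Longrightarrow> bdry C p (bdry C (p + 1) y) = \<zero>\<^bsub>grade C (p - 1)\<^esub>"
    using sq[of y "p + 1"] by (simp add: algebra_simps)
qed (use assms in \<open>simp add: chain_complex_def\<close>)

lemma chain_mapD:
  assumes "chain_map R C D f"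
  shows cm_linear: "f p \<in> linear_maps R (grade C p) (grade D p)"
    and cm_bdry: "x \<in> carrier (grade C p) \<Longrightarrow> bdry D p (f p x) = f (p - 1) (bdry C p x)"
    and cm_bdry_Suc: "y \<in> carrier (grade C (p + 1)) \<Longrightarrow> bdry D (p + 1) (f (p + 1) y) =
        f p (bdry C (p + 1) y)"
  using assms by (auto simp: chain_map_def)

section \<open>Homology and quasi-isomorphisms\<close>

lemma submodule_boundaries:
  assumes "chain_complex R C"
  shows "submodule (boundaries C p) R (grade C p)"
proof -
  interpret M: module R "grade C (p + 1)" by (rule cc_module[OF assms])
  show ?thesis
    unfolding boundaries_def
    by (rule submodule_image[OF cc_bdry_Suc[OF assms] cc_module[OF assms] cc_module[OF assms]
          M.carrier_is_submodule])
qed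

text \<open>Restricting the carrier to cycles leaves the addition alone, so the cosets can be formed
  in the whole of \<open>grade C p\<close>, which is known to be a module.\<close>

lemma carrier_homology:
  "carrier (homology C p) = (\<lambda>z. boundaries C p +>\<^bsub>grade C p\<^esub> z) ` cycles C p"
  by (simp add: homology_def carrier_quotient a_r_coset_def')

lemma cycles_diff:
  assumes "chain_complex R C" "x \<in> cycles C p" "y \<in> cycles C p"
  shows "x \<ominus>\<^bsub>grade C p\<^esub> y \<in> cycles C p"
proof -
  interpret M: module R "grade C p" by (rule cc_module[OF assms(1)])
  interpret N: module R "grade C (p - 1)" by (rule cc_module[OF assms(1)])
  show ?thesis
    using assms(2,3) linear_maps_diff[OF cc_bdry[OF assms(1)] cc_module[OF assms(1)]
        cc_module[OF assms(1)]]
    by (simp add: cycles_def N.diff_zero)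
qed

lemma cycles_zero:
  assumes "chain_complex R C"
  shows "\<zero>\<^bsub>grade C p\<^esub> \<in> cycles C p"
proof -
  interpret M: module R "grade C p" by (rule cc_module[OF assms(1)])
  show ?thesis
    using linear_maps_zero[OF cc_bdry[OF assms] cc_module[OF assms] cc_module[OF assms]]
    by (simp add: cycles_def)
qed

text \<open>For a linear map, injectivity on homology is a statement about the class of zero, and
  surjectivity says that each cycle differs from the image of a cycle by a boundary. In this form
  the homotopy formulas apply directly.\<close>

lemma quasi_isomorphism_iff:
  assumes C: "chain_complex R C" and D: "chain_complex R D" and f: "chain_map R C D f"
  shows "quasi_isomorphism C D f \<longleftrightarrow>
    (\<forall>p. (\<forall>z\<in>cycles C p. f p z \<in> boundaries D p \<longrightarrow> z \<in> boundaries C p) \<and>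
         (\<forall>y\<in>cycles D p. \<exists>z\<in>cycles C p. y \<ominus>\<^bsub>grade D p\<^esub> f p z \<in> boundaries D p))"
proof -
  have "bij_betw (induced_map (grade D p) (boundaries D p) (f p)) (carrier (homology C p))
      (carrier (homology D p))
    \<longleftrightarrow> (\<forall>z\<in>cycles C p. f p z \<in> boundaries D p \<longrightarrow> z \<in> boundaries C p) \<and>
         (\<forall>y\<in>cycles D p. \<exists>z\<in>cycles C p. y \<ominus>\<^bsub>grade D p\<^esub> f p z \<in> boundaries D p)"
    (is "bij_betw ?F ?A ?B \<longleftrightarrow> ?I \<and> ?S") for p
  proof -
    interpret M: module R "grade C p" by (rule cc_module[OF C])
    interpret N: module R "grade D p" by (rule cc_module[OF D])
    note bC = submodule_boundaries[OF C, of p] and bD = submodule_boundaries[OF D, of p]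
    note lin = cm_linear[OF f, of p]
    have cC: "z \<in> carrier (grade C p)" if "z \<in> cycles C p" for z using that
        by (simp add: cycles_def)
    have cD: "z \<in> carrier (grade D p)" if "z \<in> cycles D p" for z using that
        by (simp add: cycles_def)
    have fcl: "f p z \<in> carrier (grade D p)" if "z \<in> carrier (grade C p)" for z
      using linear_maps_closed[OF lin that] .
    have bd: "\<forall>w\<in>boundaries C p. f p w \<in> boundaries D p"
    proof
      fix w assume "w \<in> boundaries C p"
      then obtain y where y: "y \<in> carrier (grade C (p + 1))" "w = bdry C (p + 1) y"
        by (auto simp: boundaries_def)
      show "f p w \<in> boundaries D p"
        unfolding boundaries_def y(2) cm_bdry_Suc[OF f y(1), symmetric]
        by (rule imageI) (rule linear_maps_closed[OF cm_linear[OF f] y(1)])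
    qed
    have cyc: "f p z \<in> cycles D p" if "z \<in> cycles C p" for z
      using that cm_bdry[OF f, of z p] fcl
        linear_maps_zero[OF cm_linear[OF f] cc_module[OF C] cc_module[OF D]]
            by (simp add: cycles_def)
    have F: "?F (boundaries C p +>\<^bsub>grade C p\<^esub> z) = boundaries D p +>\<^bsub>grade D p\<^esub> f p z"
      if "z \<in> cycles C p" for z
      using induced_map_coset[OF cc_module[OF C] cc_module[OF D] bC bD lin bd cC[OF that]] .
    have "inj_on ?F ?A \<longleftrightarrow> ?I"
    proof
      assume inj: "inj_on ?F ?A"
      show ?I
      proof (intro ballI impI)
        fix z assume z: "z \<in> cycles C p" "f p z \<in> boundaries D p"
        have fz: "f p \<zero>\<^bsub>grade C p\<^esub> = \<zero>\<^bsub>grade D p\<^esub>"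
          by (rule linear_maps_zero[OF lin cc_module[OF C] cc_module[OF D]])
        have "?F (boundaries C p +>\<^bsub>grade C p\<^esub> z) = ?F (boundaries C p +>\<^bsub>grade C p\<^esub> \<zero>\<^bsub>grade C p\<^esub>)"
          using z F[OF z(1)] F[OF cycles_zero[OF C]] N.coset_eq_iff[OF bD fcl[OF cC[OF z(1)]], of
              "\<zero>\<^bsub>grade D p\<^esub>"]
            fcl[OF cC[OF z(1)]]
          by (simp add: fz N.diff_zero)
        then have "boundaries C p +>\<^bsub>grade C p\<^esub> z = boundaries C p +>\<^bsub>grade C p\<^esub> \<zero>\<^bsub>grade C p\<^esub>"
          using inj z(1) cycles_zero[OF C, of p] by (auto simp: carrier_homology dest: inj_onD)
        then show "z \<in> boundaries C p"
          using M.coset_eq_iff[OF bC cC[OF z(1)], of "\<zero>\<^bsub>grade C p\<^esub>"] cC[OF z(1)]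
              by (simp add: M.diff_zero)
      qed
    next
      assume I: ?I
      show "inj_on ?F ?A"
      proof (rule inj_onI)
        fix x y assume "x \<in> ?A" "y \<in> ?A" and eq: "?F x = ?F y"
        then obtain a b where a: "a \<in> cycles C p" "x = boundaries C p +>\<^bsub>grade C p\<^esub> a"
          and b: "b \<in> cycles C p" "y = boundaries C p +>\<^bsub>grade C p\<^esub> b"
          by (auto simp: carrier_homology)
        have "f p a \<ominus>\<^bsub>grade D p\<^esub> f p b \<in> boundaries D p"
          using eq a b F N.coset_eq_iff[OF bD fcl[OF cC[OF a(1)]] fcl[OF cC[OF b(1)]]] by simp
        then have "f p (a \<ominus>\<^bsub>grade C p\<^esub> b) \<in> boundaries D p"
          using linear_maps_diff[OF lin cc_module[OF C] cc_module[OF D]] a b cC by simp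
        then have "a \<ominus>\<^bsub>grade C p\<^esub> b \<in> boundaries C p"
          using I cycles_diff[OF C a(1) b(1)] by blast
        then show "x = y" using M.coset_eq_iff[OF bC cC[OF a(1)] cC[OF b(1)]] a b by simp
      qed
    qed
    moreover have "?F ` ?A = ?B \<longleftrightarrow> ?S"
    proof -
      have "?F ` ?A = (\<lambda>z. boundaries D p +>\<^bsub>grade D p\<^esub> f p z) ` cycles C p"
        by (simp add: carrier_homology image_image F cong: image_cong)
      moreover have "(\<lambda>z. boundaries D p +>\<^bsub>grade D p\<^esub> f p z) ` cycles C p \<subseteq> ?B"
        using cyc by (auto simp: carrier_homology)
      ultimately have "?F ` ?A = ?B \<longleftrightarrow> ?B \<subseteq> (\<lambda>z. boundaries D p +>\<^bsub>grade D p\<^esub> f p z) ` cycles C p"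
        by auto
      then have "?F ` ?A = ?B \<longleftrightarrow> (\<forall>y\<in>cycles D p. \<exists>z\<in>cycles C p.
          boundaries D p +>\<^bsub>grade D p\<^esub> y = boundaries D p +>\<^bsub>grade D p\<^esub> f p z)"
        by (simp add: carrier_homology image_subset_iff image_iff)
      also have "\<dots> \<longleftrightarrow> ?S" using N.coset_eq_iff[OF bD] cD fcl cC by simp
      finally show ?thesis .
    qed
    ultimately show ?thesis unfolding bij_betw_def by simp
  qed
  then show ?thesis unfolding quasi_isomorphism_def by simp
qed

lemma in_ChD: "in_Ch R b C \<Longrightarrow> chain_complex R C"
  by (simp add: in_Ch_def)

text \<open>On a cycle \<open>y\<close> the homotopy formula reads \<open>y - i s y = d K y\<close>,
  which is surjectivity on homology. If \<open>i z = d y\<close>, then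
  \<open>z = s i z = d s y\<close>, which is injectivity. The same \<open>s\<close> shows that
  \<open>i\<close> is injective in each degree.\<close>

lemma trivial_cofibration_retract:
  assumes "in_Ch R b C" "in_Ch R b D" "chain_map R C D i"
    and s: "\<And>p. s p \<in> linear_maps R (grade D p) (grade C p)"
    and sd: "\<And>p y. y \<in> carrier (grade D p) \<Longrightarrow> bdry C p (s p y) = s (p - 1) (bdry D p y)"
    and K: "\<And>p. K p \<in> linear_maps R (grade D p) (grade D (p + 1))"
    and si: "\<And>p x. x \<in> carrier (grade C p) \<Longrightarrow> s p (i p x) = x"
    and htpy: "\<And>p y. y \<in> carrier (grade D p) \<Longrightarrow>
      y = i p (s p y) \<oplus>\<^bsub>grade D p\<^esub> (bdry D (p + 1) (K p y) \<oplus>\<^bsub>grade D p\<^esub> K (p - 1) (bdry D p y))"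
  shows "trivial_cofibration R b C D i"
proof -
  note C = in_ChD[OF assms(1)] and D = in_ChD[OF assms(2)]
  have "quasi_isomorphism C D i"
    unfolding quasi_isomorphism_iff[OF C D assms(3)]
  proof (intro allI conjI ballI impI)
    fix p z assume z: "z \<in> cycles C p" "i p z \<in> boundaries D p"
    then obtain y where y: "y \<in> carrier (grade D (p + 1))" "i p z = bdry D (p + 1) y"
      by (auto simp: boundaries_def)
    have "z = s p (bdry D (p + 1) y)" using si z(1) y(2) by (metis (mono_tags, lifting) cycles_def
        mem_Collect_eq)
    also have "\<dots> = bdry C (p + 1) (s (p + 1) y)" using sd[OF y(1)] by simp
    finally show "z \<in> boundaries C p"
      using linear_maps_closed[OF s y(1)] unfolding boundaries_def by blast
  next
    fix p y assume y: "y \<in> cycles D p"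
    interpret N: module R "grade D p" by (rule cc_module[OF D])
    interpret N': module R "grade D (p - 1)" by (rule cc_module[OF D])
    have y': "y \<in> carrier (grade D p)" "bdry D p y = \<zero>\<^bsub>grade D (p - 1)\<^esub>" using y
        by (auto simp: cycles_def)
    have Ky: "K p y \<in> carrier (grade D (p + 1))" using linear_maps_closed[OF K y'(1)] .
    have sy: "s p y \<in> cycles C p"
      using y' sd[OF y'(1)] linear_maps_closed[OF s y'(1)] linear_maps_zero[OF s cc_module[OF D]
          cc_module[OF C]]
      by (simp add: cycles_def)
    have isy: "i p (s p y) \<in> carrier (grade D p)"
      using linear_maps_closed[OF cm_linear[OF assms(3)] linear_maps_closed[OF s y'(1)]] .
    have "K (p - 1) \<zero>\<^bsub>grade D (p - 1)\<^esub> = \<zero>\<^bsub>grade D p\<^esub>"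
      using linear_maps_zero[OF K[of "p - 1"] cc_module[OF D] cc_module[OF D]] by simp
    then have "y = i p (s p y) \<oplus>\<^bsub>grade D p\<^esub> bdry D (p + 1) (K p y)"
      using htpy[OF y'(1)] y'(2) linear_maps_closed[OF cc_bdry_Suc[OF D] Ky] by simp
    then have "y \<ominus>\<^bsub>grade D p\<^esub> i p (s p y) = bdry D (p + 1) (K p y)"
      using isy linear_maps_closed[OF cc_bdry_Suc[OF D] Ky]
          by (metis N.add_minus_cancel1 a_minus_def N.a_assoc N.a_inv_closed)
    then show "\<exists>z\<in>cycles C p. y \<ominus>\<^bsub>grade D p\<^esub> i p z \<in> boundaries D p"
      using sy Ky unfolding boundaries_def by blast
  qed
  moreover have "cofibration C i"
    unfolding cofibration_def by (metis inj_onI si)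
  ultimately show ?thesis using assms(1-3) by (simp add: trivial_cofibration_def)
qed

section \<open>Equivariant deformation retracts\<close>

definition chain_action where
  "chain_action R n C \<alpha> \<longleftrightarrow> (\<forall>\<sigma>. \<sigma> permutes {..<n} \<longrightarrow> chain_map R C C (\<alpha> \<sigma>))"

lemma chain_actionD: "chain_action R n C \<alpha> \<Longrightarrow> \<sigma> permutes {..<n} \<Longrightarrow> chain_map R C C (\<alpha> \<sigma>)"
  by (simp add: chain_action_def)

text \<open>
  That \<open>s\<close> is an equivariant chain map is not demanded because it follows from the other conditions.
\<close>

definition equivariant_retract where
  "equivariant_retract R b n C D \<alpha> \<beta> i s K \<longleftrightarrow>
    in_Ch R b C \<and> in_Ch R b D \<and> chain_map R C D i \<and>
    chain_action R n C \<alpha> \<and> chain_action R n D \<beta> \<and>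
    (\<forall>p. s p \<in> linear_maps R (grade D p) (grade C p)) \<and>
    (\<forall>p. K p \<in> linear_maps R (grade D p) (grade D (p + 1))) \<and>
    (\<forall>\<sigma> p. \<sigma> permutes {..<n} \<longrightarrow> (\<forall>x\<in>carrier (grade C p). i p (\<alpha> \<sigma> p x) = \<beta> \<sigma> p (i p x))) \<and>
    (\<forall>\<sigma> p. \<sigma> permutes {..<n} \<longrightarrow> (\<forall>y\<in>carrier (grade D p). K p (\<beta> \<sigma> p y) = \<beta> \<sigma> (p + 1) (K p y))) \<and>
    (\<forall>p. \<forall>x\<in>carrier (grade C p). s p (i p x) = x) \<and>
    (\<forall>p. \<forall>y\<in>carrier (grade D p).
      y = i p (s p y) \<oplus>\<^bsub>grade D p\<^esub> (bdry D (p + 1) (K p y) \<oplus>\<^bsub>grade D p\<^esub> K (p - 1) (bdry D p y)))"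

lemma equivariant_retractD:
  assumes "equivariant_retract R b n C D \<alpha> \<beta> i s K"
  shows "in_Ch R b C" "in_Ch R b D" "chain_map R C D i"
    "chain_action R n C \<alpha>" "chain_action R n D \<beta>"
    "\<And>p. s p \<in> linear_maps R (grade D p) (grade C p)"
    "\<And>p. K p \<in> linear_maps R (grade D p) (grade D (p + 1))"
    "\<And>\<sigma> p x. \<sigma> permutes {..<n} \<Longrightarrow> x \<in> carrier (grade C p) \<Longrightarrow> i p (\<alpha> \<sigma> p x) = \<beta> \<sigma> p (i p x)"
    "\<And>\<sigma> p y. \<sigma> permutes {..<n} \<Longrightarrow> y \<in> carrier (grade D p) \<Longrightarrow> K p (\<beta> \<sigma> p y) = \<beta> \<sigma> (p + 1) (K p y)"
    "\<And>p x. x \<in> carrier (grade C p) \<Longrightarrow> s p (i p x) = x"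
    "\<And>p y. y \<in> carrier (grade D p) \<Longrightarrow>
      y = i p (s p y) \<oplus>\<^bsub>grade D p\<^esub> (bdry D (p + 1) (K p y) \<oplus>\<^bsub>grade D p\<^esub> K (p - 1) (bdry D p y))"
  using assms unfolding equivariant_retract_def by blast+

lemma abelian_group_r_cancel:
  assumes "abelian_group M" "a \<in> carrier M" "b \<in> carrier M" "c \<in> carrier M" "a \<oplus>\<^bsub>M\<^esub> c = b \<oplus>\<^bsub>M\<^esub> c"
  shows "a = b"
proof -
  interpret M: abelian_group M by fact
  have "(a \<oplus>\<^bsub>M\<^esub> c) \<ominus>\<^bsub>M\<^esub> c = (b \<oplus>\<^bsub>M\<^esub> c) \<ominus>\<^bsub>M\<^esub> c" using assms(5) by simp
  then show ?thesis using assms(2-4) by (simp add: M.group_simps)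
qed

context
  fixes R b n C D \<alpha> \<beta> i s K
  assumes er: "equivariant_retract R b n C D \<alpha> \<beta> i s K"
begin

lemmas er_props = equivariant_retractD[OF er]

text \<open>The homotopy formula at \<open>d y\<close> and the boundary of the formula at
  \<open>y\<close> have the term \<open>d K d y\<close> in common. Cancelling it leaves
  \<open>i s d y = i d s y\<close>, and \<open>s i = 1\<close> removes \<open>i\<close>.\<close>

lemma er_retraction_chain:
  assumes y: "y \<in> carrier (grade D p)"
  shows "bdry C p (s p y) = s (p - 1) (bdry D p y)"
proof -
  note C = in_ChD[OF er_props(1)] and D = in_ChD[OF er_props(2)]
  interpret N: module R "grade D (p - 1)" by (rule cc_module[OF D])
  note dcl = linear_maps_closed[OF cc_bdry[OF D]] and dcl' =
      linear_maps_closed[OF cc_bdry_Suc[OF D]]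
  note scl = linear_maps_closed[OF er_props(6)] and icl =
      linear_maps_closed[OF cm_linear[OF er_props(3)]]
  note Kcl = linear_maps_closed[OF er_props(7)]
  have Kcl': "K (p - 1) z \<in> carrier (grade D p)" if "z \<in> carrier (grade D (p - 1))" for z
    using Kcl[OF that] by simp
  note dy = dcl[OF y]
  have 1: "bdry D p y = i (p - 1) (s (p - 1) (bdry D p y)) \<oplus>\<^bsub>grade D (p - 1)\<^esub> bdry D p
      (K (p - 1) (bdry D p y))"
    using er_props(11)[OF dy] cc_square[OF D y] dcl[OF Kcl'[OF dy]]
      linear_maps_zero[OF er_props(7)[of "p - 2"] cc_module[OF D] cc_module[OF D]]
    by simp
  have 2: "bdry D p y = i (p - 1) (bdry C p (s p y)) \<oplus>\<^bsub>grade D (p - 1)\<^esub> bdry D p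
      (K (p - 1) (bdry D p y))"
  proof -
    have "bdry D p y = bdry D p (i p (s p y) \<oplus>\<^bsub>grade D p\<^esub>
        (bdry D (p + 1) (K p y) \<oplus>\<^bsub>grade D p\<^esub> K (p - 1) (bdry D p y)))"
      using arg_cong[OF er_props(11)[OF y], of "bdry D p"] .
    also have "\<dots> = bdry D p (i p (s p y)) \<oplus>\<^bsub>grade D (p - 1)\<^esub>
        (bdry D p (bdry D (p + 1) (K p y)) \<oplus>\<^bsub>grade D (p - 1)\<^esub> bdry D p (K (p - 1) (bdry D p y)))"
    proof -
      interpret M: module R "grade D p" by (rule cc_module[OF D])
      show ?thesis
        using y dy icl scl Kcl Kcl' dcl' by (simp add: linear_maps_add[OF cc_bdry[OF D]])
    qed
    also have "\<dots> = i (p - 1) (bdry C p (s p y)) \<oplus>\<^bsub>grade D (p - 1)\<^esub> bdry D p (K (p - 1) (bdry D p y))"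
      using cc_square_Suc[OF D Kcl[OF y]] dcl[OF Kcl'[OF dy]] cm_bdry[OF er_props(3) scl[OF y]]
          by simp
    finally show ?thesis .
  qed
  have ds: "bdry C p (s p y) \<in> carrier (grade C (p - 1))"
    using linear_maps_closed[OF cc_bdry[OF C] scl[OF y]] .
  have "i (p - 1) (bdry C p (s p y)) = i (p - 1) (s (p - 1) (bdry D p y))"
    by (rule abelian_group_r_cancel[OF N.abelian_group_axioms icl[OF ds] icl[OF scl[OF dy]]
        dcl[OF Kcl'[OF dy]]])
      (use 1 2 in simp)
  then have "s (p - 1) (i (p - 1) (bdry C p (s p y))) =
      s (p - 1) (i (p - 1) (s (p - 1) (bdry D p y)))"
    by (rule arg_cong)
  then show ?thesis unfolding er_props(10)[OF ds] er_props(10)[OF scl[OF dy]] .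
qed

text \<open>The homotopy formula at \<open>\<sigma> y\<close> is compared with
  \<open>\<sigma>\<close> applied to the formula at \<open>y\<close>. The parts with
  \<open>K\<close> agree because \<open>K\<close> and the boundary commute with the action; what is
  left determines \<open>s\<close> through the injectivity of \<open>i\<close>.\<close>

lemma er_retraction_equivariant:
  assumes \<sigma>: "\<sigma> permutes {..<n}" and y: "y \<in> carrier (grade D p)"
  shows "s p (\<beta> \<sigma> p y) = \<alpha> \<sigma> p (s p y)"
proof -
  note C = in_ChD[OF er_props(1)] and D = in_ChD[OF er_props(2)]
  interpret N: module R "grade D p" by (rule cc_module[OF D])
  note dcl = linear_maps_closed[OF cc_bdry[OF D]] and dcl' =
      linear_maps_closed[OF cc_bdry_Suc[OF D]]
  note scl = linear_maps_closed[OF er_props(6)] and icl =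
      linear_maps_closed[OF cm_linear[OF er_props(3)]]
  note Kcl = linear_maps_closed[OF er_props(7)]
  note \<beta> = chain_actionD[OF er_props(5) \<sigma>] and \<alpha> = chain_actionD[OF er_props(4) \<sigma>]
  note bcl = linear_maps_closed[OF cm_linear[OF \<beta>]] and acl = linear_maps_closed[OF cm_linear[OF \<alpha>]]
  have Kcl': "K (p - 1) z \<in> carrier (grade D p)" if "z \<in> carrier (grade D (p - 1))" for z
    using Kcl[OF that] by simp
  have Keq': "K (p - 1) (\<beta> \<sigma> (p - 1) z) = \<beta> \<sigma> p (K (p - 1) z)" if "z \<in> carrier (grade D (p - 1))"
      for z
    using er_props(9)[OF \<sigma> that] by simp
  define c where "c = bdry D (p + 1) (K p y) \<oplus>\<^bsub>grade D p\<^esub> K (p - 1) (bdry D p y)"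
  have c: "c \<in> carrier (grade D p)" unfolding c_def using dcl'[OF Kcl[OF y]] Kcl'[OF dcl[OF y]]
      by simp
  have "\<beta> \<sigma> p y = i p (s p (\<beta> \<sigma> p y)) \<oplus>\<^bsub>grade D p\<^esub>
      (bdry D (p + 1) (K p (\<beta> \<sigma> p y)) \<oplus>\<^bsub>grade D p\<^esub> K (p - 1) (bdry D p (\<beta> \<sigma> p y)))"
    by (rule er_props(11)[OF bcl[OF y]])
  also have "bdry D (p + 1) (K p (\<beta> \<sigma> p y)) \<oplus>\<^bsub>grade D p\<^esub> K (p - 1) (bdry D p (\<beta> \<sigma> p y)) = \<beta> \<sigma> p c"
    unfolding c_def
    using y er_props(9)[OF \<sigma> y] cm_bdry_Suc[OF \<beta> Kcl[OF y]] cm_bdry[OF \<beta> y] Keq'[OF dcl[OF y]]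
      linear_maps_add[OF cm_linear[OF \<beta>] dcl'[OF Kcl[OF y]] Kcl'[OF dcl[OF y]]] by simp
  finally have 1: "\<beta> \<sigma> p y = i p (s p (\<beta> \<sigma> p y)) \<oplus>\<^bsub>grade D p\<^esub> \<beta> \<sigma> p c" .
  have "y = i p (s p y) \<oplus>\<^bsub>grade D p\<^esub> c" unfolding c_def by (rule er_props(11)[OF y])
  then have "\<beta> \<sigma> p y = \<beta> \<sigma> p (i p (s p y) \<oplus>\<^bsub>grade D p\<^esub> c)" by (rule arg_cong)
  also have "\<dots> = \<beta> \<sigma> p (i p (s p y)) \<oplus>\<^bsub>grade D p\<^esub> \<beta> \<sigma> p c"
    by (rule linear_maps_add[OF cm_linear[OF \<beta>] icl[OF scl[OF y]] c])
  finally have "\<beta> \<sigma> p y = \<beta> \<sigma> p (i p (s p y)) \<oplus>\<^bsub>grade D p\<^esub> \<beta> \<sigma> p c" .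
  then have 2: "\<beta> \<sigma> p y = i p (\<alpha> \<sigma> p (s p y)) \<oplus>\<^bsub>grade D p\<^esub> \<beta> \<sigma> p c"
    using er_props(8)[OF \<sigma> scl[OF y]] by simp
  have "i p (s p (\<beta> \<sigma> p y)) = i p (\<alpha> \<sigma> p (s p y))"
    by (rule abelian_group_r_cancel[OF N.abelian_group_axioms icl[OF scl[OF bcl[OF y]]]
          icl[OF acl[OF scl[OF y]]] bcl[OF c]]) (use 1 2 in simp)
  then have "s p (i p (s p (\<beta> \<sigma> p y))) = s p (i p (\<alpha> \<sigma> p (s p y)))" by (rule arg_cong)
  then show ?thesis unfolding er_props(10)[OF scl[OF bcl[OF y]]]
      er_props(10)[OF acl[OF scl[OF y]]] .
qed

end

section \<open>Passage to coinvariants\<close>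

lemma coinvariant_rels_submodule:
  assumes "chain_complex R C" "chain_action R n C \<alpha>"
  shows "submodule (coinvariant_rels R n C \<alpha> m) R (grade C m)"
    and "\<sigma> permutes {..<n} \<Longrightarrow> x \<in> carrier (grade C m) \<Longrightarrow>
      \<alpha> \<sigma> m x \<ominus>\<^bsub>grade C m\<^esub> x \<in> coinvariant_rels R n C \<alpha> m"
    and "{\<alpha> \<sigma> m x \<ominus>\<^bsub>grade C m\<^esub> x | \<sigma> x. \<sigma> permutes {..<n} \<and> x \<in> carrier (grade C m)} \<subseteq> carrier
        (grade C m)"
proof -
  interpret M: module R "grade C m" by (rule cc_module[OF assms(1)])
  show S: "{\<alpha> \<sigma> m x \<ominus>\<^bsub>grade C m\<^esub> x | \<sigma> x. \<sigma> permutes {..<n} \<and> x \<in> carrier (grade C m)} \<subseteq> carrier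
      (grade C m)"
    using linear_maps_closed[OF cm_linear[OF chain_actionD[OF assms(2)]]] by auto
  show "submodule (coinvariant_rels R n C \<alpha> m) R (grade C m)"
    unfolding coinvariant_rels_def by (rule submodule_span(1)[OF M.module_axioms S])
  show "\<sigma> permutes {..<n} \<Longrightarrow> x \<in> carrier (grade C m) \<Longrightarrow>
      \<alpha> \<sigma> m x \<ominus>\<^bsub>grade C m\<^esub> x \<in> coinvariant_rels R n C \<alpha> m"
    unfolding coinvariant_rels_def using submodule_span(2)[OF M.module_axioms S] by blast
qed

text \<open>An equivariant linear map sends \<open>\<sigma> x - x\<close> to
  \<open>\<sigma> h x - h x\<close>. The target degree \<open>m'\<close> is free, so that the
  boundary and the homotopy are covered along with the maps of degree zero.\<close>

lemma coinvariant_rels_map: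
  assumes "chain_complex R C" "chain_action R n C \<alpha>"
    and "chain_complex R D" "chain_action R n D \<beta>"
    and "h \<in> linear_maps R (grade C m) (grade D m')"
    and "\<And>\<sigma> x. \<sigma> permutes {..<n} \<Longrightarrow> x \<in> carrier (grade C m) \<Longrightarrow> h (\<alpha> \<sigma> m x) = \<beta> \<sigma> m' (h x)"
    and "w \<in> coinvariant_rels R n C \<alpha> m"
  shows "h w \<in> coinvariant_rels R n D \<beta> m'"
proof (rule linear_maps_span[OF assms(5) cc_module[OF assms(1)] cc_module[OF assms(3)]
      coinvariant_rels_submodule(1)[OF assms(3,4)] coinvariant_rels_submodule(3)[OF assms(1,2)]])
  fix x assume "x \<in> {\<alpha> \<sigma> m x \<ominus>\<^bsub>grade C m\<^esub> x | \<sigma> x. \<sigma> permutes {..<n} \<and> x \<in> carrier (grade C m)}"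
  then obtain \<sigma> y where "x = \<alpha> \<sigma> m y \<ominus>\<^bsub>grade C m\<^esub> y" "\<sigma> permutes {..<n}" "y \<in> carrier (grade C m)"
      by blast
  then show "h x \<in> coinvariant_rels R n D \<beta> m'"
    using linear_maps_diff[OF assms(5) cc_module[OF assms(1)] cc_module[OF assms(3)]]
      linear_maps_closed[OF cm_linear[OF chain_actionD[OF assms(2)]]] linear_maps_closed[OF
          assms(5)] assms(6)
      coinvariant_rels_submodule(2)[OF assms(3,4)] by simp
qed (use assms(7) in \<open>simp add: coinvariant_rels_def\<close>)

lemma grade_coinvariants:
  "grade (coinvariants R n C \<alpha>) m = quotient_module (grade C m) (coinvariant_rels R n C \<alpha> m)"
  and bdry_coinvariants: "bdry (coinvariants R n C \<alpha>) m =
    induced_map (grade C (m - 1)) (coinvariant_rels R n C \<alpha> (m - 1)) (bdry C m)"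
  by (simp_all add: coinvariants_def)

lemma in_Ch_coinvariants:
  assumes "in_Ch R b C" "chain_action R n C \<alpha>"
  shows "in_Ch R b (coinvariants R n C \<alpha>)"
    and "x \<in> carrier (grade C m) \<Longrightarrow>
      bdry (coinvariants R n C \<alpha>) m (coinvariant_rels R n C \<alpha> m +>\<^bsub>grade C m\<^esub> x) =
      coinvariant_rels R n C \<alpha> (m - 1) +>\<^bsub>grade C (m - 1)\<^esub> bdry C m x"
proof -
  note C = in_ChD[OF assms(1)]
  note M = cc_module[OF C] and W = coinvariant_rels_submodule(1)[OF C assms(2)]
  have dW: "\<forall>w\<in>coinvariant_rels R n C \<alpha> m. bdry C m w \<in> coinvariant_rels R n C \<alpha> (m - 1)" for m
    by (intro ballI coinvariant_rels_map[OF C assms(2) C assms(2) cc_bdry[OF C]])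
      (use cm_bdry[OF chain_actionD[OF assms(2)]] in auto)
  show b: "bdry (coinvariants R n C \<alpha>) m (coinvariant_rels R n C \<alpha> m +>\<^bsub>grade C m\<^esub> x) =
      coinvariant_rels R n C \<alpha> (m - 1) +>\<^bsub>grade C (m - 1)\<^esub> bdry C m x" if "x \<in> carrier (grade C m)"
          for x m
    unfolding bdry_coinvariants by (rule induced_map_coset[OF M M W W cc_bdry[OF C] dW that])
  have lin: "bdry (coinvariants R n C \<alpha>) m \<in>
      linear_maps R (grade (coinvariants R n C \<alpha>) m) (grade (coinvariants R n C \<alpha>) (m - 1))" for m
    unfolding bdry_coinvariants grade_coinvariants
        by (rule induced_map_linear[OF M M W W cc_bdry[OF C] dW])
  have mo: "module R (grade (coinvariants R n C \<alpha>) m)" for m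
    unfolding grade_coinvariants by (rule module_quotient[OF M W])
  have sq: "bdry (coinvariants R n C \<alpha>) (m - 1) (bdry (coinvariants R n C \<alpha>) m x) =
      \<zero>\<^bsub>grade (coinvariants R n C \<alpha>) (m - 2)\<^esub>" if x: "x \<in> carrier (grade (coinvariants R n C \<alpha>) m)"
          for x m
  proof -
    obtain y where "y \<in> carrier (grade C m)" "x = coinvariant_rels R n C \<alpha> m +>\<^bsub>grade C m\<^esub> y"
      using x by (auto simp: grade_coinvariants carrier_quotient)
    then show ?thesis
      using linear_maps_closed[OF cc_bdry[OF C]]
      by (simp add: b cc_square[OF C] grade_coinvariants zero_quotient[OF M W])
  qed
  have "carrier (grade (coinvariants R n C \<alpha>) m) = {\<zero>\<^bsub>grade (coinvariants R n C \<alpha>) m\<^esub>}"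
    if "b = Nonnegative" "m < 0" for m
  proof -
    have "carrier (grade C m) = {\<zero>\<^bsub>grade C m\<^esub>}" using assms(1) that by (simp add: in_Ch_def)
    then show ?thesis by (simp add: grade_coinvariants carrier_quotient zero_quotient[OF M W])
  qed
  then show "in_Ch R b (coinvariants R n C \<alpha>)"
    using mo lin sq by (simp add: in_Ch_def chain_complex_def)
qed

text \<open>\<open>i\<close>, \<open>s\<close>, \<open>K\<close> and the boundaries commute with the
  action, so each descends to cosets. The identities between them descend as well, and the
  equivariant retract becomes a deformation retract of the coinvariants.\<close>

lemma coinvariants_trivial_cofibration:
  assumes er: "equivariant_retract R b n C D \<alpha> \<beta> i s K"
  shows "trivial_cofibration R b (coinvariants R n C \<alpha>) (coinvariants R n D \<beta>)
    (\<lambda>m. induced_map (grade D m) (coinvariant_rels R n D \<beta> m) (i m))"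
proof -
  note pr = equivariant_retractD[OF er]
  note C = in_ChD[OF pr(1)] and D = in_ChD[OF pr(2)]
  note MC = cc_module[OF C] and MD = cc_module[OF D]
  note \<alpha> = pr(4) and \<beta> = pr(5)
  note WC = coinvariant_rels_submodule(1)[OF C \<alpha>] and WD = coinvariant_rels_submodule(1)[OF D \<beta>]
  let ?C = "coinvariants R n C \<alpha>" and ?D = "coinvariants R n D \<beta>"
  let ?cC = "\<lambda>m x. coinvariant_rels R n C \<alpha> m +>\<^bsub>grade C m\<^esub> x"
  let ?cD = "\<lambda>m x. coinvariant_rels R n D \<beta> m +>\<^bsub>grade D m\<^esub> x"
  let ?i = "\<lambda>m. induced_map (grade D m) (coinvariant_rels R n D \<beta> m) (i m)"
  let ?s = "\<lambda>m. induced_map (grade C m) (coinvariant_rels R n C \<alpha> m) (s m)"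
  let ?K = "\<lambda>m. induced_map (grade D (m + 1)) (coinvariant_rels R n D \<beta> (m + 1)) (K m)"
  note bC = in_Ch_coinvariants(2)[OF pr(1,4)] and bD = in_Ch_coinvariants(2)[OF pr(2,5)]
  have iW: "\<forall>w\<in>coinvariant_rels R n C \<alpha> m. i m w \<in> coinvariant_rels R n D \<beta> m" for m
    by (rule ballI) (rule coinvariant_rels_map[OF C \<alpha> D \<beta> cm_linear[OF pr(3)] pr(8)])
  have sW: "\<forall>w\<in>coinvariant_rels R n D \<beta> m. s m w \<in> coinvariant_rels R n C \<alpha> m" for m
    by (rule ballI) (rule coinvariant_rels_map[OF D \<beta> C \<alpha> pr(6) er_retraction_equivariant[OF er]])
  have KW: "\<forall>w\<in>coinvariant_rels R n D \<beta> m. K m w \<in> coinvariant_rels R n D \<beta> (m + 1)" for m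
    by (rule ballI) (rule coinvariant_rels_map[OF D \<beta> D \<beta> pr(7) pr(9)])
  note il = induced_map_linear[OF MC MD WC WD cm_linear[OF pr(3)] iW]
    and ic = induced_map_coset[OF MC MD WC WD cm_linear[OF pr(3)] iW]
  note sl = induced_map_linear[OF MD MC WD WC pr(6) sW] and sc =
      induced_map_coset[OF MD MC WD WC pr(6) sW]
  note Kl = induced_map_linear[OF MD MD WD WD pr(7) KW] and Kc =
      induced_map_coset[OF MD MD WD WD pr(7) KW]
  have Kc': "?K (m - 1) (?cD (m - 1) y) = ?cD m (K (m - 1) y)" if "y \<in> carrier (grade D (m - 1))"
      for m y
    using Kc[OF that] by simp
  have bD': "bdry ?D (m + 1) (?cD (m + 1) y) = ?cD m (bdry D (m + 1) y)"
      if "y \<in> carrier (grade D (m + 1))" for m y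
    using bD[OF that] by simp
  note icl = linear_maps_closed[OF cm_linear[OF pr(3)]] and scl = linear_maps_closed[OF pr(6)]
    and Kcl = linear_maps_closed[OF pr(7)]
    and dC = linear_maps_closed[OF cc_bdry[OF C]] and dD = linear_maps_closed[OF cc_bdry[OF D]]
    and dD' = linear_maps_closed[OF cc_bdry_Suc[OF D]]
  have Kcl': "K (m - 1) z \<in> carrier (grade D m)" if "z \<in> carrier (grade D (m - 1))" for z m
    using Kcl[OF that] by simp
  have casesC: "\<exists>y\<in>carrier (grade C m). x = ?cC m y" if "x \<in> carrier (grade ?C m)" for x m
    using that by (auto simp: grade_coinvariants carrier_quotient)
  have casesD: "\<exists>y\<in>carrier (grade D m). x = ?cD m y" if "x \<in> carrier (grade ?D m)" for x m
    using that by (auto simp: grade_coinvariants carrier_quotient)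
  show ?thesis
  proof (rule trivial_cofibration_retract[where s = ?s and K = ?K])
    show "in_Ch R b ?C" by (rule in_Ch_coinvariants(1)[OF pr(1,4)])
    show "in_Ch R b ?D" by (rule in_Ch_coinvariants(1)[OF pr(2,5)])
    show "chain_map R ?C ?D ?i"
      unfolding chain_map_def
    proof (intro conjI allI ballI)
      fix p show "?i p \<in> linear_maps R (grade ?C p) (grade ?D p)" unfolding grade_coinvariants
          by (rule il)
      fix x assume "x \<in> carrier (grade ?C p)"
      then obtain y where "y \<in> carrier (grade C p)" "x = ?cC p y" using casesC by blast
      then show "bdry ?D p (?i p x) = ?i (p - 1) (bdry ?C p x)"
        using icl dC by (simp add: ic bC bD cm_bdry[OF pr(3)])
    qed
    fix p
    show "?s p \<in> linear_maps R (grade ?D p) (grade ?C p)" unfolding grade_coinvariants by (rule sl)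
    show "?K p \<in> linear_maps R (grade ?D p) (grade ?D (p + 1))" unfolding grade_coinvariants
        by (rule Kl)
  next
    fix p y assume "y \<in> carrier (grade ?D p)"
    then obtain z where z: "z \<in> carrier (grade D p)" "y = ?cD p z" using casesD by blast
    then show "bdry ?C p (?s p y) = ?s (p - 1) (bdry ?D p y)"
      using scl dD by (simp add: sc bC bD er_retraction_chain[OF er])
    show "y = ?i p (?s p y) \<oplus>\<^bsub>grade ?D p\<^esub> (bdry ?D (p + 1) (?K p y) \<oplus>\<^bsub>grade ?D p\<^esub> ?K (p - 1)
        (bdry ?D p y))"
    proof -
      have cl: "bdry D (p + 1) (K p z) \<in> carrier (grade D p)" "K (p - 1) (bdry D p z) \<in> carrier
          (grade D p)"
        "i p (s p z) \<in> carrier (grade D p)"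
        using dD'[OF Kcl[OF z(1)]] Kcl'[OF dD[OF z(1)]] icl[OF scl[OF z(1)]] by auto
      interpret N: module R "grade D p" by (rule MD)
      have a: "?i p (?s p y) = ?cD p (i p (s p z))" using z scl by (simp add: sc ic)
      have b: "bdry ?D (p + 1) (?K p y) = ?cD p (bdry D (p + 1) (K p z))"
        using z(2) Kc[OF z(1)] bD'[OF Kcl[OF z(1)]] by simp
      have c: "?K (p - 1) (bdry ?D p y) = ?cD p (K (p - 1) (bdry D p z))"
        using z(2) bD[OF z(1)] Kc'[OF dD[OF z(1)]] by simp
      have "?cD p (i p (s p z)) \<oplus>\<^bsub>grade ?D p\<^esub>
          (?cD p (bdry D (p + 1) (K p z)) \<oplus>\<^bsub>grade ?D p\<^esub> ?cD p (K (p - 1) (bdry D p z))) =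
        ?cD p (i p (s p z) \<oplus>\<^bsub>grade D p\<^esub> (bdry D (p + 1) (K p z) \<oplus>\<^bsub>grade D p\<^esub> K (p - 1) (bdry D p z)))"
        using cl by (simp add: grade_coinvariants add_quotient[OF MD WD])
      also have "\<dots> = y" using pr(11)[OF z(1)] z(2) by simp
      finally show ?thesis unfolding a b c by simp
    qed
  next
    fix p x assume "x \<in> carrier (grade ?C p)"
    then obtain y where "y \<in> carrier (grade C p)" "x = ?cC p y" using casesC by blast
    then show "?s p (?i p x) = x" using icl by (simp add: ic sc pr(10))
  qed
qed

section \<open>Tensor products of complexes\<close>

context cring
begin

lemma parity_sign_closed [simp]: "parity_sign R p \<in> carrier R"
  by (simp add: parity_sign_def)

lemma parity_sign_add: "parity_sign R (p + q) = parity_sign R p \<otimes> parity_sign R q"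
  by (auto simp: parity_sign_def l_minus r_minus)

lemma parity_sign_self: "parity_sign R p \<otimes> parity_sign R p = \<one>"
  by (auto simp: parity_sign_def l_minus r_minus)

lemma parity_sign_flip: "odd (p - q) \<Longrightarrow> parity_sign R p = \<ominus> parity_sign R q"
  by (auto simp: parity_sign_def)

lemma parity_sign_cong: "even (p - q) \<Longrightarrow> parity_sign R p = parity_sign R q"
  by (auto simp: parity_sign_def)

end

text \<open>The part of degree \<open>m\<close> of a tensor product is the sum over all
  \<open>p + q = m\<close>, so a linear map out of it is a family of bilinear maps indexed by these
  pairs.\<close>

definition bilinear_on where
  "bilinear_on R X Z m N \<Phi> \<longleftrightarrow> (\<forall>p q. p + q = m \<longrightarrow>
    (\<forall>x\<in>carrier (grade X p). (\<lambda>y. \<Phi> p x q y) \<in> linear_maps R (grade Z q) N) \<and>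
    (\<forall>y\<in>carrier (grade Z q). (\<lambda>x. \<Phi> p x q y) \<in> linear_maps R (grade X p) N))"

lemma bilinear_onD:
  assumes "bilinear_on R X Z m N \<Phi>" "p + q = m"
  shows "x \<in> carrier (grade X p) \<Longrightarrow> (\<lambda>y. \<Phi> p x q y) \<in> linear_maps R (grade Z q) N"
    and "y \<in> carrier (grade Z q) \<Longrightarrow> (\<lambda>x. \<Phi> p x q y) \<in> linear_maps R (grade X p) N"
  using assms by (auto simp: bilinear_on_def)

lemma bilinear_on_plus:
  assumes "bilinear_on R X Z m N \<Phi>" "bilinear_on R X Z m N \<Psi>" "module R N"
  shows "bilinear_on R X Z m N (\<lambda>p x q y. \<Phi> p x q y \<oplus>\<^bsub>N\<^esub> \<Psi> p x q y)"
  using assms unfolding bilinear_on_def by (auto intro!: linear_maps_plus)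

lemma bilinear_on_scale:
  assumes "bilinear_on R X Z m N \<Phi>" "\<And>p. c p \<in> carrier R" "module R N"
  shows "bilinear_on R X Z m N (\<lambda>p x q y. c p \<odot>\<^bsub>N\<^esub> \<Phi> p x q y)"
  using assms unfolding bilinear_on_def by (auto intro!: linear_maps_scale)

text \<open>\<open>u\<close> and \<open>v\<close> are homogeneous of degrees \<open>a\<close> and
  \<open>b\<close>. Signs are kept apart: a Koszul sign depends only on the degree of the left
  factor and enters through \<open>bilinear_on_scale\<close>.\<close>

lemma bilinear_on_comp:
  assumes "bilinear_on R X' Z' m' N \<Phi>" "m' = m + a + b"
    and u: "\<And>p. u p \<in> linear_maps R (grade X p) (grade X' (p + a))"
    and v: "\<And>q. v q \<in> linear_maps R (grade Z q) (grade Z' (q + b))"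
  shows "bilinear_on R X Z m N (\<lambda>p x q y. \<Phi> (p + a) (u p x) (q + b) (v q y))"
  unfolding bilinear_on_def
proof (intro allI impI conjI ballI)
  fix p q assume "p + q = m"
  then have pq: "p + a + (q + b) = m'" using assms(2) by simp
  show "(\<lambda>y. \<Phi> (p + a) (u p x) (q + b) (v q y)) \<in> linear_maps R (grade Z q) N"
    if "x \<in> carrier (grade X p)" for x
    by (rule linear_maps_comp[OF v bilinear_onD(1)[OF assms(1) pq linear_maps_closed[OF u that]]])
  show "(\<lambda>x. \<Phi> (p + a) (u p x) (q + b) (v q y)) \<in> linear_maps R (grade X p) N"
    if "y \<in> carrier (grade Z q)" for y
    by (rule linear_maps_comp[OF u bilinear_onD(2)[OF assms(1) pq linear_maps_closed[OF v that]]])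
qed

lemma tensor_gensI:
  "x \<in> carrier (grade X p) \<Longrightarrow> y \<in> carrier (grade Z q) \<Longrightarrow> p + q = m \<Longrightarrow>
      ((p, x), (q, y)) \<in> tensor_gens X Z m"
  by (simp add: tensor_gens_def)

lemma tensor_gensE:
  assumes "g \<in> tensor_gens X Z m"
  obtains p x q y where "g = ((p, x), (q, y))" "x \<in> carrier (grade X p)" "y \<in> carrier (grade Z q)"
      "p + q = m"
  using assms by (auto simp: tensor_gens_def)

text \<open>The left side is what \<open>comb_eval\<close> yields on a relator for additivity;
  \<open>module_relation2\<close> is the counterpart for scalars. The two equivalences below recover
  the equation from the vanishing of the relator.\<close>

lemma module_relation3:
  assumes "module R N" "b \<in> carrier N" "c \<in> carrier N"
  shows "\<one>\<^bsub>R\<^esub> \<odot>\<^bsub>N\<^esub> (b \<oplus>\<^bsub>N\<^esub> c) \<oplus>\<^bsub>N\<^esub> ((\<ominus>\<^bsub>R\<^esub> \<one>\<^bsub>R\<^esub>) \<odot>\<^bsub>N\<^esub> b \<oplus>\<^bsub>N\<^esub> ((\<ominus>\<^bsub>R\<^esub> \<one>\<^bsub>R\<^esub>) \<odot>\<^bsub>N\<^esub> c \<oplus>\<^bsub>N\<^esub> \<zero>\<^bsub>N\<^esub>)) = \<zero>\<^bsub>N\<^esub>"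
proof -
  interpret N: module R N by fact
  show ?thesis using assms by (simp add: module_minus_eq[OF assms(1)] N.group_simps)
qed

lemma module_relation2:
  assumes "module R N" "b \<in> carrier N" "c \<in> carrier R"
  shows "\<one>\<^bsub>R\<^esub> \<odot>\<^bsub>N\<^esub> (c \<odot>\<^bsub>N\<^esub> b) \<oplus>\<^bsub>N\<^esub> ((\<ominus>\<^bsub>R\<^esub> c) \<odot>\<^bsub>N\<^esub> b \<oplus>\<^bsub>N\<^esub> \<zero>\<^bsub>N\<^esub>) = \<zero>\<^bsub>N\<^esub>"
proof -
  interpret N: module R N by fact
  show ?thesis using assms by (simp add: N.smult_l_minus N.group_simps)
qed

lemma module_relation3_iff:
  assumes "module R N" "a \<in> carrier N" "b \<in> carrier N" "c \<in> carrier N"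
  shows "\<one>\<^bsub>R\<^esub> \<odot>\<^bsub>N\<^esub> a \<oplus>\<^bsub>N\<^esub> ((\<ominus>\<^bsub>R\<^esub> \<one>\<^bsub>R\<^esub>) \<odot>\<^bsub>N\<^esub> b \<oplus>\<^bsub>N\<^esub> ((\<ominus>\<^bsub>R\<^esub> \<one>\<^bsub>R\<^esub>) \<odot>\<^bsub>N\<^esub> c \<oplus>\<^bsub>N\<^esub> \<zero>\<^bsub>N\<^esub>)) = \<zero>\<^bsub>N\<^esub>
    \<longleftrightarrow> a = b \<oplus>\<^bsub>N\<^esub> c"
proof -
  interpret N: module R N by fact
  have "\<one>\<^bsub>R\<^esub> \<odot>\<^bsub>N\<^esub> a \<oplus>\<^bsub>N\<^esub> ((\<ominus>\<^bsub>R\<^esub> \<one>\<^bsub>R\<^esub>) \<odot>\<^bsub>N\<^esub> b \<oplus>\<^bsub>N\<^esub> ((\<ominus>\<^bsub>R\<^esub> \<one>\<^bsub>R\<^esub>) \<odot>\<^bsub>N\<^esub> c \<oplus>\<^bsub>N\<^esub> \<zero>\<^bsub>N\<^esub>)) = a \<ominus>\<^bsub>N\<^esub> (b \<oplus>\<^bsub>N\<^esub> c)"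
    using assms by (simp add: module_minus_eq[OF assms(1)] N.group_simps)
  then show ?thesis using assms by (simp add: N.diff_eq_zero_iff)
qed

lemma module_relation2_iff:
  assumes "module R N" "a \<in> carrier N" "b \<in> carrier N" "c \<in> carrier R"
  shows "\<one>\<^bsub>R\<^esub> \<odot>\<^bsub>N\<^esub> a \<oplus>\<^bsub>N\<^esub> ((\<ominus>\<^bsub>R\<^esub> c) \<odot>\<^bsub>N\<^esub> b \<oplus>\<^bsub>N\<^esub> \<zero>\<^bsub>N\<^esub>) = \<zero>\<^bsub>N\<^esub> \<longleftrightarrow> a = c \<odot>\<^bsub>N\<^esub> b"
proof -
  interpret N: module R N by fact
  have "\<one>\<^bsub>R\<^esub> \<odot>\<^bsub>N\<^esub> a \<oplus>\<^bsub>N\<^esub> ((\<ominus>\<^bsub>R\<^esub> c) \<odot>\<^bsub>N\<^esub> b \<oplus>\<^bsub>N\<^esub> \<zero>\<^bsub>N\<^esub>) = a \<ominus>\<^bsub>N\<^esub> c \<odot>\<^bsub>N\<^esub> b"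
    using assms by (simp add: N.smult_l_minus N.group_simps)
  then show ?thesis using assms by (simp add: N.diff_eq_zero_iff)
qed

abbreviation uncurry_gen where
  "uncurry_gen \<Phi> \<equiv> (\<lambda>((p, x), (q, y)). \<Phi> p x q y)"

lemma tensor_relator_eval:
  assumes "bilinear_on R X Z m N \<Phi>" "module R N" "r \<in> tensor_rels R X Z m"
  shows "comb_eval N (uncurry_gen \<Phi>) r = \<zero>\<^bsub>N\<^esub>"
proof -
  note b1 = bilinear_onD(1)[OF assms(1)] and b2 = bilinear_onD(2)[OF assms(1)]
  show ?thesis
    using assms(3) unfolding tensor_rels_def
    by (auto simp: linear_maps_add[OF b1] linear_maps_add[OF b2] linear_maps_smult[OF b1]
        linear_maps_smult[OF b2] linear_maps_closed[OF b1] module_relation3[OF assms(2)]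
        module_relation2[OF assms(2)])
qed

abbreviation tgen where
  "tgen R X Z m p x q y \<equiv> pgen R (tensor_gens X Z m) (tensor_rels R X Z m) ((p, x), (q, y))"

lemma grade_tensor: "grade (tensor_cplx R X Z) m = presented_module R (tensor_gens X Z m)
    (tensor_rels R X Z m)"
  by (simp add: tensor_cplx_def presented_cplx_def)

lemma module_tensor: "cring R \<Longrightarrow> module R (grade (tensor_cplx R X Z) m)"
  unfolding grade_tensor by (rule module_presented)

text \<open>Each of the four bilinearity equations is the vanishing of a relator from one of the
  four families in \<open>tensor_rels\<close>.\<close>

lemma bilinear_tgen:
  assumes "cring R" and X: "\<And>p. module R (grade X p)" and Z: "\<And>p. module R (grade Z p)"
  shows "bilinear_on R X Z m (grade (tensor_cplx R X Z) m) (tgen R X Z m)"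
  unfolding bilinear_on_def grade_tensor
proof (intro allI impI conjI ballI)
  fix p q assume pq: "p + q = m"
  let ?N = "presented_module R (tensor_gens X Z m) (tensor_rels R X Z m)"
  interpret R: cring R by fact
  interpret X: module R "grade X p" by (rule X)
  interpret Z: module R "grade Z q" by (rule Z)
  note M = module_presented[OF assms(1)]
  have cl: "tgen R X Z m p x q y \<in> carrier ?N" if "x \<in> carrier (grade X p)"
      "y \<in> carrier (grade Z q)" for x y
    by (rule pgen_closed[OF assms(1) tensor_gensI[OF that pq]])
  note rel = comb_eval_relator[OF assms(1)]
  note iffs = module_relation3_iff[OF M] module_relation2_iff[OF M]
  fix x assume x: "x \<in> carrier (grade X p)"
  show "(\<lambda>y. tgen R X Z m p x q y) \<in> linear_maps R (grade Z q) ?N"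
  proof (rule linear_mapsI)
    fix y y' assume y: "y \<in> carrier (grade Z q)" "y' \<in> carrier (grade Z q)"
    let ?r = "[(\<one>\<^bsub>R\<^esub>, ((p, x), (q, y \<oplus>\<^bsub>grade Z q\<^esub> y'))),
      (\<ominus>\<^bsub>R\<^esub> \<one>\<^bsub>R\<^esub>, ((p, x), (q, y))), (\<ominus>\<^bsub>R\<^esub> \<one>\<^bsub>R\<^esub>, ((p, x), (q, y')))]"
    have "?r \<in> tensor_rels R X Z m" using x y pq unfolding tensor_rels_def by blast
    moreover have "?r \<in> formal_combs R (tensor_gens X Z m)" using x y pq by (simp add: tensor_gensI)
    ultimately have "comb_eval ?N (pgen R (tensor_gens X Z m) (tensor_rels R X Z m)) ?r = \<zero>\<^bsub>?N\<^esub>"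
        by (rule rel)
    then show "tgen R X Z m p x q (y \<oplus>\<^bsub>grade Z q\<^esub> y') = tgen R X Z m p x q y \<oplus>\<^bsub>?N\<^esub> tgen R X Z m p x q
        y'"
      using cl x y by (simp add: iffs)
  next
    fix c y assume y: "c \<in> carrier R" "y \<in> carrier (grade Z q)"
    let ?r = "[(\<one>\<^bsub>R\<^esub>, ((p, x), (q, c \<odot>\<^bsub>grade Z q\<^esub> y))), (\<ominus>\<^bsub>R\<^esub> c, ((p, x), (q, y)))]"
    have "?r \<in> tensor_rels R X Z m" using x y pq unfolding tensor_rels_def by blast
    moreover have "?r \<in> formal_combs R (tensor_gens X Z m)" using x y pq by (simp add: tensor_gensI)
    ultimately have "comb_eval ?N (pgen R (tensor_gens X Z m) (tensor_rels R X Z m)) ?r = \<zero>\<^bsub>?N\<^esub>"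
        by (rule rel)
    then show "tgen R X Z m p x q (c \<odot>\<^bsub>grade Z q\<^esub> y) = c \<odot>\<^bsub>?N\<^esub> tgen R X Z m p x q y"
      using cl x y by (simp add: iffs)
  qed (use cl x in blast)
next
  fix p q assume pq: "p + q = m"
  let ?N = "presented_module R (tensor_gens X Z m) (tensor_rels R X Z m)"
  interpret R: cring R by fact
  interpret X: module R "grade X p" by (rule X)
  interpret Z: module R "grade Z q" by (rule Z)
  note M = module_presented[OF assms(1)]
  have cl: "tgen R X Z m p x q y \<in> carrier ?N" if "x \<in> carrier (grade X p)"
      "y \<in> carrier (grade Z q)" for x y
    by (rule pgen_closed[OF assms(1) tensor_gensI[OF that pq]])
  note rel = comb_eval_relator[OF assms(1)]
  note iffs = module_relation3_iff[OF M] module_relation2_iff[OF M]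
  fix y assume y: "y \<in> carrier (grade Z q)"
  show "(\<lambda>x. tgen R X Z m p x q y) \<in> linear_maps R (grade X p) ?N"
  proof (rule linear_mapsI)
    fix x x' assume x: "x \<in> carrier (grade X p)" "x' \<in> carrier (grade X p)"
    let ?r = "[(\<one>\<^bsub>R\<^esub>, ((p, x \<oplus>\<^bsub>grade X p\<^esub> x'), (q, y))),
      (\<ominus>\<^bsub>R\<^esub> \<one>\<^bsub>R\<^esub>, ((p, x), (q, y))), (\<ominus>\<^bsub>R\<^esub> \<one>\<^bsub>R\<^esub>, ((p, x'), (q, y)))]"
    have "?r \<in> tensor_rels R X Z m" using x y pq unfolding tensor_rels_def by blast
    moreover have "?r \<in> formal_combs R (tensor_gens X Z m)" using x y pq by (simp add: tensor_gensI)
    ultimately have "comb_eval ?N (pgen R (tensor_gens X Z m) (tensor_rels R X Z m)) ?r = \<zero>\<^bsub>?N\<^esub>"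
        by (rule rel)
    then show "tgen R X Z m p (x \<oplus>\<^bsub>grade X p\<^esub> x') q y = tgen R X Z m p x q y \<oplus>\<^bsub>?N\<^esub> tgen R X Z m p x' q
        y"
      using cl x y by (simp add: iffs)
  next
    fix c x assume x: "c \<in> carrier R" "x \<in> carrier (grade X p)"
    let ?r = "[(\<one>\<^bsub>R\<^esub>, ((p, c \<odot>\<^bsub>grade X p\<^esub> x), (q, y))), (\<ominus>\<^bsub>R\<^esub> c, ((p, x), (q, y)))]"
    have "?r \<in> tensor_rels R X Z m" using x y pq unfolding tensor_rels_def by blast
    moreover have "?r \<in> formal_combs R (tensor_gens X Z m)" using x y pq by (simp add: tensor_gensI)
    ultimately have "comb_eval ?N (pgen R (tensor_gens X Z m) (tensor_rels R X Z m)) ?r = \<zero>\<^bsub>?N\<^esub>"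
        by (rule rel)
    then show "tgen R X Z m p (c \<odot>\<^bsub>grade X p\<^esub> x) q y = c \<odot>\<^bsub>?N\<^esub> tgen R X Z m p x q y"
      using cl x y by (simp add: iffs)
  qed (use cl y in blast)
qed

text \<open>The universal property of the tensor product in degree \<open>m\<close>, with
  \<open>tensor_eqI\<close> for uniqueness. It serves to construct the homotopy, which is not given
  in advance by lists on generators.\<close>

lemma tensor_lift:
  assumes "cring R" "module R N" "bilinear_on R X Z m N \<Phi>"
  shows tensor_lift_linear: "lin_ext N (uncurry_gen \<Phi>) \<in> linear_maps R (grade (tensor_cplx R X Z)
      m) N"
    and tensor_lift_tgen: "x \<in> carrier (grade X p) \<Longrightarrow> y \<in> carrier (grade Z q) \<Longrightarrow> p + q = m \<Longrightarrow>
      lin_ext N (uncurry_gen \<Phi>) (tgen R X Z m p x q y) = \<Phi> p x q y"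
proof -
  have F: "uncurry_gen \<Phi> \<in> tensor_gens X Z m \<rightarrow> carrier N"
    using linear_maps_closed[OF bilinear_onD(1)[OF assms(3)]] by (auto elim!: tensor_gensE)
  show "lin_ext N (uncurry_gen \<Phi>) \<in> linear_maps R (grade (tensor_cplx R X Z) m) N"
    unfolding grade_tensor
    by (rule lin_ext_linear[OF assms(1,2) F tensor_relator_eval[OF assms(3,2)]])
  show "x \<in> carrier (grade X p) \<Longrightarrow> y \<in> carrier (grade Z q) \<Longrightarrow> p + q = m \<Longrightarrow>
      lin_ext N (uncurry_gen \<Phi>) (tgen R X Z m p x q y) = \<Phi> p x q y"
    using lin_ext_pgen[OF assms(1,2) F tensor_relator_eval[OF assms(3,2)] tensor_gensI[of x X p y
        Z q m]]
    by simp
qed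

lemma tensor_eqI:
  assumes "cring R" "module R N" "h \<in> linear_maps R (grade (tensor_cplx R X Z) m) N"
    and "k \<in> linear_maps R (grade (tensor_cplx R X Z) m) N"
    and "\<And>p x q y. x \<in> carrier (grade X p) \<Longrightarrow> y \<in> carrier (grade Z q) \<Longrightarrow> p + q = m \<Longrightarrow>
      h (tgen R X Z m p x q y) = k (tgen R X Z m p x q y)"
    and "t \<in> carrier (grade (tensor_cplx R X Z) m)"
  shows "h t = k t"
  by (rule presented_maps_eqI[OF assms(1,2) assms(3,4)[unfolded grade_tensor] _
      assms(6)[unfolded grade_tensor]])
    (erule tensor_gensE, simp only: assms(5))

text \<open>The boundary and the maps of tensor products are prescribed by lists on generators. They
  are well defined as soon as the classes of these lists are bilinear in the two entries.\<close>

lemma tensor_presented_map: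
  fixes F :: "(int \<times> 'a) \<times> (int \<times> 'b) \<Rightarrow> ('k \<times> 'h) list"
  assumes "cring R" "bilinear_on R X Z m (presented_module R H Rel) (\<lambda>p x q y. comb_class R H Rel
      (F ((p, x), (q, y))))"
    and "\<And>p x q y. x \<in> carrier (grade X p) \<Longrightarrow> y \<in> carrier (grade Z q) \<Longrightarrow> p + q = m \<Longrightarrow>
      F ((p, x), (q, y)) \<in> formal_combs R H"
  shows "presented_map R H Rel F \<in> linear_maps R (grade (tensor_cplx R X Z) m)
      (presented_module R H Rel)"
    and "x \<in> carrier (grade X p) \<Longrightarrow> y \<in> carrier (grade Z q) \<Longrightarrow> p + q = m \<Longrightarrow>
      presented_map R H Rel F (tgen R X Z m p x q y) = comb_class R H Rel (F ((p, x), (q, y)))"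
proof -
  have F: "F g \<in> formal_combs R H" if "g \<in> tensor_gens X Z m" for g
    using that assms(3) by (auto elim!: tensor_gensE)
  have eq: "(\<lambda>g. comb_class R H Rel (F g)) =
      uncurry_gen (\<lambda>p x q y. comb_class R H Rel (F ((p, x), (q, y))))"
    by auto
  have rel: "comb_eval (presented_module R H Rel) (\<lambda>g. comb_class R H Rel (F g)) r =
      \<zero>\<^bsub>presented_module R H Rel\<^esub>"
    if "r \<in> tensor_rels R X Z m" for r
    unfolding eq by (rule tensor_relator_eval[OF assms(2) module_presented[OF assms(1)] that])
  show "presented_map R H Rel F \<in> linear_maps R (grade (tensor_cplx R X Z) m)
      (presented_module R H Rel)"
    unfolding grade_tensor by (rule presented_map_linear[OF assms(1) F rel])
  show "x \<in> carrier (grade X p) \<Longrightarrow> y \<in> carrier (grade Z q) \<Longrightarrow> p + q = m \<Longrightarrow>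
      presented_map R H Rel F (tgen R X Z m p x q y) = comb_class R H Rel (F ((p, x), (q, y)))"
    by (rule presented_map_pgen[OF assms(1) F rel tensor_gensI])
qed

lemma tensor_map_props:
  assumes "cring R" and X': "\<And>p. module R (grade X' p)" and Z': "\<And>p. module R (grade Z' p)"
    and f: "\<And>p. f p \<in> linear_maps R (grade X p) (grade X' p)"
    and g: "\<And>p. g p \<in> linear_maps R (grade Z p) (grade Z' p)"
  shows tensor_map_linear: "tensor_map R X' Z' f g m \<in>
      linear_maps R (grade (tensor_cplx R X Z) m) (grade (tensor_cplx R X' Z') m)"
    and tensor_map_tgen: "x \<in> carrier (grade X p) \<Longrightarrow> y \<in> carrier (grade Z q) \<Longrightarrow> p + q = m \<Longrightarrow>
      tensor_map R X' Z' f g m (tgen R X Z m p x q y) = tgen R X' Z' m p (f p x) q (g q y)"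
proof -
  interpret R: cring R by fact
  let ?F = "\<lambda>((p, x), (q, y)). [(\<one>\<^bsub>R\<^esub>, ((p, f p x), (q, g q y)))]"
  let ?c = "\<lambda>p x q y. comb_class R (tensor_gens X' Z' m) (tensor_rels R X' Z' m)
      (?F ((p, x), (q, y)))"
  have "bilinear_on R X Z m (grade (tensor_cplx R X' Z') m)
      (\<lambda>p x q y. tgen R X' Z' m (p + 0) (f p x) (q + 0) (g q y))"
    by (rule bilinear_on_comp[OF bilinear_tgen[OF assms(1) X' Z']]) (use f g in simp_all)
  then have b: "bilinear_on R X Z m (presented_module R (tensor_gens X' Z' m) (tensor_rels R X' Z'
      m)) ?c"
    by (simp add: pgen_def grade_tensor)
  have F: "?F ((p, x), (q, y)) \<in> formal_combs R (tensor_gens X' Z' m)"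
    if "x \<in> carrier (grade X p)" "y \<in> carrier (grade Z q)" "p + q = m" for p x q y
    using that linear_maps_closed[OF f] linear_maps_closed[OF g] by (simp add: tensor_gensI)
  show "tensor_map R X' Z' f g m \<in>
      linear_maps R (grade (tensor_cplx R X Z) m) (grade (tensor_cplx R X' Z') m)"
    unfolding tensor_map_def grade_tensor[of R X' Z']
        by (rule tensor_presented_map(1)[OF assms(1) b F])
  show "x \<in> carrier (grade X p) \<Longrightarrow> y \<in> carrier (grade Z q) \<Longrightarrow> p + q = m \<Longrightarrow>
      tensor_map R X' Z' f g m (tgen R X Z m p x q y) = tgen R X' Z' m p (f p x) q (g q y)"
    unfolding tensor_map_def using tensor_presented_map(2)[OF assms(1) b F, of x p y q]
    by (simp add: pgen_def)
qed

lemma tensor_bdry_props: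
  assumes "cring R" and X: "chain_complex R X" and Z: "chain_complex R Z"
  shows tensor_bdry_linear: "bdry (tensor_cplx R X Z) m \<in>
      linear_maps R (grade (tensor_cplx R X Z) m) (grade (tensor_cplx R X Z) (m - 1))"
    and tensor_bdry_tgen: "x \<in> carrier (grade X p) \<Longrightarrow> y \<in> carrier (grade Z q) \<Longrightarrow> p + q = m \<Longrightarrow>
      bdry (tensor_cplx R X Z) m (tgen R X Z m p x q y) =
        tgen R X Z (m - 1) (p - 1) (bdry X p x) q y \<oplus>\<^bsub>grade (tensor_cplx R X Z) (m - 1)\<^esub>
        parity_sign R p \<odot>\<^bsub>grade (tensor_cplx R X Z) (m - 1)\<^esub> tgen R X Z (m - 1) p x (q - 1)
            (bdry Z q y)"
proof -
  interpret R: cring R by fact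
  let ?G = "tensor_gens X Z (m - 1)" and ?Rel = "tensor_rels R X Z (m - 1)"
  let ?N = "presented_module R ?G ?Rel"
  note M = module_presented[OF assms(1)]
  interpret N: module R ?N by (rule M)
  note bt = bilinear_tgen[OF assms(1) cc_module[OF X] cc_module[OF Z]]
  have ev: "comb_class R ?G ?Rel (tensor_bdry R X Z ((p, x), (q, y))) =
      tgen R X Z (m - 1) (p - 1) (bdry X p x) q y \<oplus>\<^bsub>?N\<^esub>
      parity_sign R p \<odot>\<^bsub>?N\<^esub> tgen R X Z (m - 1) p x (q - 1) (bdry Z q y)
      \<and> tensor_bdry R X Z ((p, x), (q, y)) \<in> formal_combs R ?G"
    if "x \<in> carrier (grade X p)" "y \<in> carrier (grade Z q)" "p + q = m" for p x q y
  proof -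
    have g: "((p - 1, bdry X p x), (q, y)) \<in> ?G" "((p, x), (q - 1, bdry Z q y)) \<in> ?G"
      using that linear_maps_closed[OF cc_bdry[OF X]] linear_maps_closed[OF cc_bdry[OF Z]]
      by (auto intro!: tensor_gensI)
    then have fc: "tensor_bdry R X Z ((p, x), (q, y)) \<in> formal_combs R ?G"
        by (simp add: tensor_bdry_def)
    show ?thesis
      using fc g pgen_closed[OF assms(1), of _ ?G ?Rel] comb_class_eval[OF assms(1) fc]
      by (simp add: tensor_bdry_def)
  qed
  let ?\<Psi> = "\<lambda>p x q y. tgen R X Z (m - 1) (p - 1) (bdry X p x) q y \<oplus>\<^bsub>?N\<^esub>
      parity_sign R p \<odot>\<^bsub>?N\<^esub> tgen R X Z (m - 1) p x (q - 1) (bdry Z q y)"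
  \<comment> \<open>The two terms of the Leibniz rule are compositions with operators of degrees
    (-1, 0) and (0, -1); the shifts by zero are written out to match
    \<open>bilinear_on_comp\<close>.\<close>
  have "bilinear_on R X Z m ?N (\<lambda>p x q y. tgen R X Z (m - 1) (p + - 1) (bdry X p x) (q + 0) y \<oplus>\<^bsub>?N\<^esub>
      parity_sign R p \<odot>\<^bsub>?N\<^esub> tgen R X Z (m - 1) (p + 0) x (q + - 1) (bdry Z q y))"
    by (rule bilinear_on_plus[OF _ bilinear_on_scale];
        (rule bilinear_on_comp[OF bt[unfolded grade_tensor]])?)
      (use cc_bdry[OF X] cc_bdry[OF Z] in \<open>simp_all add: linear_maps_id M\<close>)
  then have b: "bilinear_on R X Z m ?N ?\<Psi>" by simp
  have "bilinear_on R X Z m ?N (\<lambda>p x q y. comb_class R ?G ?Rel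
      (tensor_bdry R X Z ((p, x), (q, y))))"
    unfolding bilinear_on_def
  proof (intro allI impI conjI ballI)
    fix p q assume pq: "p + q = m"
    show "(\<lambda>y. comb_class R ?G ?Rel (tensor_bdry R X Z ((p, x), (q, y)))) \<in> linear_maps R
        (grade Z q) ?N"
      if "x \<in> carrier (grade X p)" for x
    proof -
      interpret Z: module R "grade Z q" by (rule cc_module[OF Z])
      show ?thesis
        using bilinear_onD(1)[OF b pq that] ev[OF that _ pq] by (simp add: linear_maps_def hom_def
            Pi_def)
    qed
    show "(\<lambda>x. comb_class R ?G ?Rel (tensor_bdry R X Z ((p, x), (q, y)))) \<in> linear_maps R
        (grade X p) ?N"
      if "y \<in> carrier (grade Z q)" for y
    proof -
      interpret X: module R "grade X p" by (rule cc_module[OF X])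
      show ?thesis
        using bilinear_onD(2)[OF b pq that] ev[OF _ that pq] by (simp add: linear_maps_def hom_def
            Pi_def)
    qed
  qed
  note t = tensor_presented_map[OF assms(1) this conjunct2[OF ev]]
  show "bdry (tensor_cplx R X Z) m \<in>
      linear_maps R (grade (tensor_cplx R X Z) m) (grade (tensor_cplx R X Z) (m - 1))"
    using t(1) by (simp add: tensor_cplx_def presented_cplx_def)
  show "x \<in> carrier (grade X p) \<Longrightarrow> y \<in> carrier (grade Z q) \<Longrightarrow> p + q = m \<Longrightarrow>
      bdry (tensor_cplx R X Z) m (tgen R X Z m p x q y) =
        tgen R X Z (m - 1) (p - 1) (bdry X p x) q y \<oplus>\<^bsub>grade (tensor_cplx R X Z) (m - 1)\<^esub>
        parity_sign R p \<odot>\<^bsub>grade (tensor_cplx R X Z) (m - 1)\<^esub> tgen R X Z (m - 1) p x (q - 1)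
            (bdry Z q y)"
    using t(2)[of x p y q] ev[of x p y q] by (simp add: tensor_cplx_def presented_cplx_def)
qed

text \<open>\<open>f\<close> and \<open>g\<close> preserve degrees, so the sign in the Leibniz rule
  is the same on both sides, and the two terms are matched by the chain map equations for
  \<open>f\<close> and \<open>g\<close>.\<close>

lemma tensor_map_chain_map:
  assumes R: "cring R" and X: "chain_complex R X" and X': "chain_complex R X'"
    and Z: "chain_complex R Z" and Z': "chain_complex R Z'"
    and f: "chain_map R X X' f" and g: "chain_map R Z Z' g"
  shows "chain_map R (tensor_cplx R X Z) (tensor_cplx R X' Z') (tensor_map R X' Z' f g)"
  unfolding chain_map_def
proof (intro allI conjI ballI)
  fix m
  note MX = cc_module[OF X'] and MZ = cc_module[OF Z']
  note fl = cm_linear[OF f] and gl = cm_linear[OF g]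
  note tl = tensor_map_linear[OF R MX MZ fl gl] and tg = tensor_map_tgen[OF R MX MZ fl gl]
  note bl = tensor_bdry_linear[OF R X Z] and bg = tensor_bdry_tgen[OF R X Z]
  note bl' = tensor_bdry_linear[OF R X' Z'] and bg' = tensor_bdry_tgen[OF R X' Z']
  show "tensor_map R X' Z' f g m \<in> linear_maps R (grade (tensor_cplx R X Z) m)
      (grade (tensor_cplx R X' Z') m)"
    by (rule tl)
  interpret R: cring R by fact
  interpret N: module R "grade (tensor_cplx R X Z) (m - 1)" by (rule module_tensor[OF R])
  fix t assume "t \<in> carrier (grade (tensor_cplx R X Z) m)"
  then show "bdry (tensor_cplx R X' Z') m (tensor_map R X' Z' f g m t) =
      tensor_map R X' Z' f g (m - 1) (bdry (tensor_cplx R X Z) m t)"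
  proof (rule tensor_eqI[OF R module_tensor[OF R] linear_maps_comp[OF tl bl']
      linear_maps_comp[OF bl tl], rotated])
    fix p x q y
    assume x: "x \<in> carrier (grade X p)" and y: "y \<in> carrier (grade Z q)" and pq: "p + q = m"
    have dx: "bdry X p x \<in> carrier (grade X (p - 1))"
        by (rule linear_maps_closed[OF cc_bdry[OF X] x])
    have dy: "bdry Z q y \<in> carrier (grade Z (q - 1))"
        by (rule linear_maps_closed[OF cc_bdry[OF Z] y])
    have fx: "f p x \<in> carrier (grade X' p)" by (rule linear_maps_closed[OF fl x])
    have gy: "g q y \<in> carrier (grade Z' q)" by (rule linear_maps_closed[OF gl y])
    note bt = bilinear_tgen[OF R cc_module[OF X] cc_module[OF Z], of "m - 1"]
    have c1: "tgen R X Z (m - 1) (p - 1) (bdry X p x) q y \<in> carrier (grade (tensor_cplx R X Z)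
        (m - 1))"
      by (rule linear_maps_closed[OF bilinear_onD(1)[OF bt _ dx] y]) (use pq in simp)
    have c2: "tgen R X Z (m - 1) p x (q - 1) (bdry Z q y) \<in> carrier (grade (tensor_cplx R X Z)
        (m - 1))"
      by (rule linear_maps_closed[OF bilinear_onD(1)[OF bt _ x] dy]) (use pq in simp)
    show "bdry (tensor_cplx R X' Z') m (tensor_map R X' Z' f g m (tgen R X Z m p x q y)) =
        tensor_map R X' Z' f g (m - 1) (bdry (tensor_cplx R X Z) m (tgen R X Z m p x q y))"
      using x y pq dx dy fx gy c1 c2
      by (simp add: bg bg' tg linear_maps_add[OF tl] linear_maps_smult[OF tl] cm_bdry[OF f]
          cm_bdry[OF g])
  qed
qed

text \<open>Applying the boundary twice to \<open>x \<otimes> y\<close> leaves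
  \<open>dx \<otimes> dy\<close> twice, with the opposite signs belonging to \<open>p - 1\<close>
  and \<open>p\<close>. In the bounded case a negative total degree forces one of the two degrees to
  be negative.\<close>

lemma tensor_in_Ch:
  assumes R: "cring R" and "in_Ch R b X" "in_Ch R b Z"
  shows "in_Ch R b (tensor_cplx R X Z)"
proof -
  note X = in_ChD[OF assms(2)] and Z = in_ChD[OF assms(3)]
  let ?T = "tensor_cplx R X Z"
  interpret R: cring R by fact
  note M = module_tensor[OF R]
  note bl = tensor_bdry_linear[OF R X Z] and bg = tensor_bdry_tgen[OF R X Z]
  note bt = bilinear_tgen[OF R cc_module[OF X] cc_module[OF Z]]
  have tg_closed: "tgen R X Z m p x q y \<in> carrier (grade ?T m)"
    if "x \<in> carrier (grade X p)" "y \<in> carrier (grade Z q)" "p + q = m" for m p x q y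
    by (rule linear_maps_closed[OF bilinear_onD(1)[OF bt that(3,1)] that(2)])
  have tg_zero1: "tgen R X Z m p \<zero>\<^bsub>grade X p\<^esub> q y = \<zero>\<^bsub>grade ?T m\<^esub>"
    if "y \<in> carrier (grade Z q)" "p + q = m" for m p q y
    by (rule linear_maps_zero[OF bilinear_onD(2)[OF bt that(2,1)] cc_module[OF X] M])
  have tg_zero2: "tgen R X Z m p x q \<zero>\<^bsub>grade Z q\<^esub> = \<zero>\<^bsub>grade ?T m\<^esub>"
    if "x \<in> carrier (grade X p)" "p + q = m" for m p x q
    by (rule linear_maps_zero[OF bilinear_onD(1)[OF bt that(2,1)] cc_module[OF Z] M])
  have "bdry ?T (m - 1) (bdry ?T m t) = \<zero>\<^bsub>grade ?T (m - 2)\<^esub>" if t: "t \<in> carrier (grade ?T m)" for m t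
  proof -
    interpret N1: module R "grade ?T (m - 1)" by (rule M)
    interpret N2: module R "grade ?T (m - 2)" by (rule M)
    have bl': "bdry ?T (m - 1) \<in> linear_maps R (grade ?T (m - 1)) (grade ?T (m - 2))"
      using bl[of "m - 1"] by simp
    have z: "(\<lambda>t. \<zero>\<^bsub>grade ?T (m - 2)\<^esub>) \<in> linear_maps R (grade ?T m) (grade ?T (m - 2))"
      by (rule linear_mapsI) simp_all
    show ?thesis using t
    proof (rule tensor_eqI[OF R M linear_maps_comp[OF bl bl'] z, rotated])
      fix p x q y
      assume x: "x \<in> carrier (grade X p)" and y: "y \<in> carrier (grade Z q)" and pq: "p + q = m"
      have dx: "bdry X p x \<in> carrier (grade X (p - 1))"
          by (rule linear_maps_closed[OF cc_bdry[OF X] x])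
      have dy: "bdry Z q y \<in> carrier (grade Z (q - 1))"
          by (rule linear_maps_closed[OF cc_bdry[OF Z] y])
      let ?a = "tgen R X Z (m - 2) (p - 1) (bdry X p x) (q - 1) (bdry Z q y)"
      have a: "?a \<in> carrier (grade ?T (m - 2))" using dx dy pq by (intro tg_closed) auto
      have d1: "bdry ?T (m - 1) (tgen R X Z (m - 1) (p - 1) (bdry X p x) q y) =
          parity_sign R (p - 1) \<odot>\<^bsub>grade ?T (m - 2)\<^esub> ?a"
        using bg[OF dx y, of "m - 1"] pq y a by (simp add: cc_square[OF X x] tg_zero1)
      have d2: "bdry ?T (m - 1) (tgen R X Z (m - 1) p x (q - 1) (bdry Z q y)) = ?a"
        using bg[OF x dy, of "m - 1"] pq x a by (simp add: cc_square[OF Z y] tg_zero2)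
      have c1: "tgen R X Z (m - 1) (p - 1) (bdry X p x) q y \<in> carrier (grade ?T (m - 1))"
        using dx y pq by (intro tg_closed) auto
      have c2: "tgen R X Z (m - 1) p x (q - 1) (bdry Z q y) \<in> carrier (grade ?T (m - 1))"
        using x dy pq by (intro tg_closed) auto
      have "bdry ?T (m - 1) (bdry ?T m (tgen R X Z m p x q y)) =
          parity_sign R (p - 1) \<odot>\<^bsub>grade ?T (m - 2)\<^esub> ?a \<oplus>\<^bsub>grade ?T (m - 2)\<^esub> parity_sign R p
              \<odot>\<^bsub>grade ?T (m - 2)\<^esub> ?a"
        using c1 c2 by (simp add: bg[OF x y pq] linear_maps_add[OF bl'] linear_maps_smult[OF bl']
            d1 d2)
      also have "\<dots> = \<zero>\<^bsub>grade ?T (m - 2)\<^esub>"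
        using a by (simp add: R.parity_sign_flip[of "p - 1" p] N2.smult_l_minus N2.l_neg)
      finally show "bdry ?T (m - 1) (bdry ?T m (tgen R X Z m p x q y)) = \<zero>\<^bsub>grade ?T (m - 2)\<^esub>" .
    qed
  qed
  moreover have "carrier (grade ?T m) = {\<zero>\<^bsub>grade ?T m\<^esub>}" if b: "b = Nonnegative" "m < 0" for m
  proof -
    interpret N: module R "grade ?T m" by (rule M)
    have "t = \<zero>\<^bsub>grade ?T m\<^esub>" if "t \<in> carrier (grade ?T m)" for t
    proof (rule tensor_eqI[OF R M linear_maps_id _ _ that])
      show "(\<lambda>t. \<zero>\<^bsub>grade ?T m\<^esub>) \<in> linear_maps R (grade ?T m) (grade ?T m)"
        by (rule linear_mapsI) simp_all
      fix p x q y
      assume x: "x \<in> carrier (grade X p)" and y: "y \<in> carrier (grade Z q)" and pq: "p + q = m"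
      then consider "p < 0" | "q < 0" using b(2) by linarith
      then show "tgen R X Z m p x q y = \<zero>\<^bsub>grade ?T m\<^esub>"
      proof cases
        case 1
        then have "x = \<zero>\<^bsub>grade X p\<^esub>" using assms(2) b(1) x by (auto simp: in_Ch_def)
        then show ?thesis using tg_zero1[OF y pq] by simp
      next
        case 2
        then have "y = \<zero>\<^bsub>grade Z q\<^esub>" using assms(3) b(1) y by (auto simp: in_Ch_def)
        then show ?thesis using tg_zero2[OF x pq] by simp
      qed
    qed
    then show ?thesis by auto
  qed
  ultimately show ?thesis using bl by (simp add: in_Ch_def chain_complex_def M)
qed

text \<open>The new homotopy sends \<open>x \<otimes> y\<close> to \<open>x \<otimes> K y\<close>
  with the sign of the degree of \<open>x\<close>. With this sign the terms
  \<open>dx \<otimes> K y\<close> cancel in the sum of the two compositions with the boundary, and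
  in the remaining terms the signs square to one. It commutes with the action because
  \<open>\<sigma>\<close> acts on the two entries separately and by maps of degree zero.\<close>

lemma tensor_equivariant_retract:
  assumes R: "cring R" and X: "in_Ch R b X" and \<rho>: "right_action R n X \<rho>"
    and er: "equivariant_retract R b n C D \<alpha> \<beta> i s K"
  obtains s' K' where "equivariant_retract R b n (tensor_cplx R X C) (tensor_cplx R X D)
    (tensor_action R X \<rho> C \<alpha>) (tensor_action R X \<rho> D \<beta>) (tensor_map R X D (\<lambda>_ x. x) i) s' K'"
proof -
  interpret R: cring R by fact
  note pr = equivariant_retractD[OF er]
  note Xc = in_ChD[OF X] and C = in_ChD[OF pr(1)] and D = in_ChD[OF pr(2)]
  note MX = cc_module[OF Xc] and MC = cc_module[OF C] and MD = cc_module[OF D]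
  let ?C = "tensor_cplx R X C" and ?D = "tensor_cplx R X D"
  let ?i = "tensor_map R X D (\<lambda>_ x. x) i" and ?s = "tensor_map R X C (\<lambda>_ x. x) s"
  let ?\<Phi> = "\<lambda>m p x q y. parity_sign R p \<odot>\<^bsub>grade ?D (m + 1)\<^esub> tgen R X D (m + 1) p x (q + 1) (K q y)"
  define K' where "K' = (\<lambda>m. lin_ext (grade ?D (m + 1)) (uncurry_gen (?\<Phi> m)))"
  have \<rho>': "chain_map R X X (\<rho> (inv_into UNIV \<sigma>))" if "\<sigma> permutes {..<n}" for \<sigma>
    using \<rho> permutes_inv[OF that] by (simp add: right_action_def)
  have idm: "chain_map R X X (\<lambda>_ x. x)" by (simp add: chain_map_def linear_maps_id)
  note M = module_tensor[OF R]
  note btD = bilinear_tgen[OF R MX MD] and btC = bilinear_tgen[OF R MX MC]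
  have b\<Phi>: "bilinear_on R X D m (grade ?D (m + 1)) (?\<Phi> m)" for m
  proof -
    have "bilinear_on R X D m (grade ?D (m + 1)) (\<lambda>p x q y. tgen R X D (m + 1) (p + 0) x (q + 1)
        (K q y))"
      by (rule bilinear_on_comp[OF btD]) (simp_all add: linear_maps_id pr(7))
    then show ?thesis using bilinear_on_scale[OF _ _ M, where c = "parity_sign R"] by simp
  qed
  have Kl: "K' m \<in> linear_maps R (grade ?D m) (grade ?D (m + 1))" for m
    unfolding K'_def by (rule tensor_lift_linear[OF R M b\<Phi>])
  have Kg: "K' m (tgen R X D m p x q y) = ?\<Phi> m p x q y"
    if "x \<in> carrier (grade X p)" "y \<in> carrier (grade D q)" "p + q = m" for m p x q y
    unfolding K'_def by (rule tensor_lift_tgen[OF R M b\<Phi> that])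
  note idl = linear_maps_id
  note il = tensor_map_linear[OF R MX MD idl cm_linear[OF pr(3)]] and ig =
      tensor_map_tgen[OF R MX MD idl cm_linear[OF pr(3)]]
  note sl = tensor_map_linear[OF R MX MC idl pr(6)] and sg = tensor_map_tgen[OF R MX MC idl pr(6)]
  note bl = tensor_bdry_linear[OF R Xc D] and bg = tensor_bdry_tgen[OF R Xc D]
  have bl': "bdry ?D (m + 1) \<in> linear_maps R (grade ?D (m + 1)) (grade ?D m)" for m
    using bl[of "m + 1"] by simp
  have Kl': "K' (m - 1) \<in> linear_maps R (grade ?D (m - 1)) (grade ?D m)" for m
    using Kl[of "m - 1"] by simp
  have tgD: "tgen R X D m p x q y \<in> carrier (grade ?D m)"
    if "x \<in> carrier (grade X p)" "y \<in> carrier (grade D q)" "p + q = m" for m p x q y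
    by (rule linear_maps_closed[OF bilinear_onD(1)[OF btD that(3,1)] that(2)])
  have tact: "chain_action R n (tensor_cplx R X Z) (tensor_action R X \<rho> Z \<gamma>)"
    if "chain_complex R Z" "chain_action R n Z \<gamma>" for Z :: "('a, 'z) cplx" and \<gamma>
    unfolding chain_action_def tensor_action_def
    using tensor_map_chain_map[OF R Xc Xc that(1) that(1) \<rho>' chain_actionD[OF that(2)]] by auto
  note icl = linear_maps_closed[OF cm_linear[OF pr(3)]] and scl = linear_maps_closed[OF pr(6)]
    and Kcl = linear_maps_closed[OF pr(7)]
  have "equivariant_retract R b n ?C ?D (tensor_action R X \<rho> C \<alpha>) (tensor_action R X \<rho> D \<beta>) ?i ?s
      K'"
    unfolding equivariant_retract_def
  proof (intro conjI allI impI ballI)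
    show "in_Ch R b ?C" by (rule tensor_in_Ch[OF R X pr(1)])
    show "in_Ch R b ?D" by (rule tensor_in_Ch[OF R X pr(2)])
    show "chain_map R ?C ?D ?i" by (rule tensor_map_chain_map[OF R Xc Xc C D idm pr(3)])
    show "chain_action R n ?C (tensor_action R X \<rho> C \<alpha>)" by (rule tact[OF C pr(4)])
    show "chain_action R n ?D (tensor_action R X \<rho> D \<beta>)" by (rule tact[OF D pr(5)])
  next
    fix p
    show "?s p \<in> linear_maps R (grade ?D p) (grade ?C p)" by (rule sl)
    show "K' p \<in> linear_maps R (grade ?D p) (grade ?D (p + 1))" by (rule Kl)
  next
    fix \<sigma> m t assume \<sigma>: "\<sigma> permutes {..<n}" and t: "t \<in> carrier (grade ?C m)"
    note \<rho>l = cm_linear[OF \<rho>'[OF \<sigma>]] and \<alpha>l = cm_linear[OF chain_actionD[OF pr(4) \<sigma>]]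
      and \<beta>l = cm_linear[OF chain_actionD[OF pr(5) \<sigma>]]
    note al = tensor_map_linear[OF R MX MC \<rho>l \<alpha>l] and ag = tensor_map_tgen[OF R MX MC \<rho>l \<alpha>l]
    note bel = tensor_map_linear[OF R MX MD \<rho>l \<beta>l] and beg = tensor_map_tgen[OF R MX MD \<rho>l \<beta>l]
    show "?i m (tensor_action R X \<rho> C \<alpha> \<sigma> m t) = tensor_action R X \<rho> D \<beta> \<sigma> m (?i m t)"
      unfolding tensor_action_def
      by (rule tensor_eqI[OF R M linear_maps_comp[OF al il] linear_maps_comp[OF il bel] _ t])
        (use linear_maps_closed[OF \<rho>l] linear_maps_closed[OF \<alpha>l] icl pr(8)[OF \<sigma>] in
            \<open>simp add: ag ig beg\<close>)
  next
    fix \<sigma> m t assume \<sigma>: "\<sigma> permutes {..<n}" and t: "t \<in> carrier (grade ?D m)"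
    note \<rho>l = cm_linear[OF \<rho>'[OF \<sigma>]] and \<beta>l = cm_linear[OF chain_actionD[OF pr(5) \<sigma>]]
    note bel = tensor_map_linear[OF R MX MD \<rho>l \<beta>l] and beg = tensor_map_tgen[OF R MX MD \<rho>l \<beta>l]
    show "K' m (tensor_action R X \<rho> D \<beta> \<sigma> m t) = tensor_action R X \<rho> D \<beta> \<sigma> (m + 1) (K' m t)"
      unfolding tensor_action_def
    proof (rule tensor_eqI[OF R M linear_maps_comp[OF bel Kl] linear_maps_comp[OF Kl bel] _ t])
      fix p x q y
      assume x: "x \<in> carrier (grade X p)" and y: "y \<in> carrier (grade D q)" and pq: "p + q = m"
      have g: "tgen R X D (m + 1) p x (q + 1) (K q y) \<in> carrier (grade ?D (m + 1))"
        using pq by (intro tgD[OF x Kcl[OF y]]) simp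
      show "K' m (tensor_map R X D (\<rho> (inv_into UNIV \<sigma>)) (\<beta> \<sigma>) m (tgen R X D m p x q y)) =
        tensor_map R X D (\<rho> (inv_into UNIV \<sigma>)) (\<beta> \<sigma>) (m + 1) (K' m (tgen R X D m p x q y))"
        using x y pq linear_maps_closed[OF \<rho>l x] linear_maps_closed[OF \<beta>l y] Kcl[OF y] g
        by (simp add: beg Kg linear_maps_smult[OF bel] pr(9)[OF \<sigma> y])
    qed
  next
    fix m t assume t: "t \<in> carrier (grade ?C m)"
    show "?s m (?i m t) = t"
      by (rule tensor_eqI[OF R M linear_maps_comp[OF il sl] linear_maps_id _ t])
        (use icl in \<open>simp add: ig sg pr(10)\<close>)
  next
    fix m t assume t: "t \<in> carrier (grade ?D m)"
    interpret N: module R "grade ?D m" by (rule M)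
    interpret N1: module R "grade ?D (m - 1)" by (rule M)
    show "t = ?i m (?s m t) \<oplus>\<^bsub>grade ?D m\<^esub> (bdry ?D (m + 1) (K' m t) \<oplus>\<^bsub>grade ?D m\<^esub> K' (m - 1)
        (bdry ?D m t))"
    proof (rule tensor_eqI[OF R M linear_maps_id linear_maps_plus[OF linear_maps_comp[OF sl il]
          linear_maps_plus[OF linear_maps_comp[OF Kl bl'] linear_maps_comp[OF bl Kl'] M] M] _ t])
      fix p x q y
      assume x: "x \<in> carrier (grade X p)" and y: "y \<in> carrier (grade D q)" and pq: "p + q = m"
      let ?t = "tgen R X D m p x q y" and ?G = "tgen R X D m p x q"
      have dx: "bdry X p x \<in> carrier (grade X (p - 1))"
          by (rule linear_maps_closed[OF cc_bdry[OF Xc] x])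
      have dy: "bdry D q y \<in> carrier (grade D (q - 1))"
          by (rule linear_maps_closed[OF cc_bdry[OF D] y])
      have Ky: "K q y \<in> carrier (grade D (q + 1))" by (rule Kcl[OF y])
      have dKy: "bdry D (q + 1) (K q y) \<in> carrier (grade D q)"
          by (rule linear_maps_closed[OF cc_bdry_Suc[OF D] Ky])
      have Kdy: "K (q - 1) (bdry D q y) \<in> carrier (grade D q)" using Kcl[OF dy] by simp
      have isy: "i q (s q y) \<in> carrier (grade D q)" by (rule icl[OF scl[OF y]])
      note Gl = bilinear_onD(1)[OF btD pq x]
      let ?e = "tgen R X D m (p - 1) (bdry X p x) (q + 1) (K q y)"
      have e: "?e \<in> carrier (grade ?D m)" using pq by (intro tgD[OF dx Ky]) simp
      have g1: "?G (bdry D (q + 1) (K q y)) \<in> carrier (grade ?D m)" by (rule tgD[OF x dKy pq])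
      have g2: "?G (K (q - 1) (bdry D q y)) \<in> carrier (grade ?D m)" by (rule tgD[OF x Kdy pq])
      have g3: "?G (i q (s q y)) \<in> carrier (grade ?D m)" by (rule tgD[OF x isy pq])
      have c1: "tgen R X D (m + 1) p x (q + 1) (K q y) \<in> carrier (grade ?D (m + 1))"
        using pq by (intro tgD[OF x Ky]) simp
      have c2: "tgen R X D (m - 1) (p - 1) (bdry X p x) q y \<in> carrier (grade ?D (m - 1))"
        using pq by (intro tgD[OF dx y]) simp
      have c3: "tgen R X D (m - 1) p x (q - 1) (bdry D q y) \<in> carrier (grade ?D (m - 1))"
        using pq by (intro tgD[OF x dy]) simp
      have A: "?i m (?s m ?t) = ?G (i q (s q y))"
        using x y pq scl[OF y] by (simp add: sg ig)
      have ss: "parity_sign R p \<odot>\<^bsub>grade ?D m\<^esub> (parity_sign R p \<odot>\<^bsub>grade ?D m\<^esub> z) = z"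
        if "z \<in> carrier (grade ?D m)" for z
        using that by (simp add: N.smult_assoc1[symmetric] R.parity_sign_self)
      have B: "bdry ?D (m + 1) (K' m ?t) =
          parity_sign R p \<odot>\<^bsub>grade ?D m\<^esub> ?e \<oplus>\<^bsub>grade ?D m\<^esub> ?G (bdry D (q + 1) (K q y))"
        using bg[OF x Ky, of "m + 1"] pq e g1 c1
        by (simp add: Kg[OF x y pq] linear_maps_smult[OF bl'] N.smult_r_distr ss)
      have k1: "K' (m - 1) (tgen R X D (m - 1) (p - 1) (bdry X p x) q y) =
          parity_sign R (p - 1) \<odot>\<^bsub>grade ?D m\<^esub> ?e"
        using Kg[OF dx y, of "m - 1"] pq by simp
      have k2: "K' (m - 1) (tgen R X D (m - 1) p x (q - 1) (bdry D q y)) =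
          parity_sign R p \<odot>\<^bsub>grade ?D m\<^esub> ?G (K (q - 1) (bdry D q y))"
        using Kg[OF x dy, of "m - 1"] pq by simp
      have C: "K' (m - 1) (bdry ?D m ?t) =
          parity_sign R (p - 1) \<odot>\<^bsub>grade ?D m\<^esub> ?e \<oplus>\<^bsub>grade ?D m\<^esub> ?G (K (q - 1) (bdry D q y))"
        using c2 c3 g2
        by (simp add: bg[OF x y pq] linear_maps_add[OF Kl'] linear_maps_smult[OF Kl'] k1 k2 ss)
      have "?t = ?G (i q (s q y) \<oplus>\<^bsub>grade D q\<^esub> (bdry D (q + 1) (K q y) \<oplus>\<^bsub>grade D q\<^esub> K (q - 1)
          (bdry D q y)))"
        using pr(11)[OF y] by simp
      also have "\<dots> = ?G (i q (s q y)) \<oplus>\<^bsub>grade ?D m\<^esub>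
          (?G (bdry D (q + 1) (K q y)) \<oplus>\<^bsub>grade ?D m\<^esub> ?G (K (q - 1) (bdry D q y)))"
      proof -
        interpret Dq: module R "grade D q" by (rule MD)
        show ?thesis using isy dKy Kdy by (simp add: linear_maps_add[OF Gl])
      qed
      also have "\<dots> = ?i m (?s m ?t) \<oplus>\<^bsub>grade ?D m\<^esub> (bdry ?D (m + 1) (K' m ?t) \<oplus>\<^bsub>grade ?D m\<^esub> K' (m - 1)
          (bdry ?D m ?t))"
        unfolding A B C using e g1 g2 g3
        by (simp add: R.parity_sign_flip[of "p - 1" p] N.smult_l_minus N.group_simps)
      finally show "?t = ?i m (?s m ?t) \<oplus>\<^bsub>grade ?D m\<^esub>
          (bdry ?D (m + 1) (K' m ?t) \<oplus>\<^bsub>grade ?D m\<^esub> K' (m - 1) (bdry ?D m ?t))" .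
    qed
  qed
  then show ?thesis by (rule that)
qed

section \<open>Contracting a trivial cofibration over a field\<close>

text \<open>Closure under addition is where the chain is used: of the two members that contain the
  summands one contains the other. The lemma supplies the upper bounds for Zorn's lemma.\<close>

lemma submodule_Union_chain:
  assumes "module R M" "\<C> \<noteq> {}" "subset.chain \<A> \<C>" "\<And>U. U \<in> \<A> \<Longrightarrow> submodule U R M"
  shows "submodule (\<Union>\<C>) R M"
proof -
  interpret M: module R M by fact
  have sub: "submodule U R M" if "U \<in> \<C>" for U
    using assms(3,4) that by (auto simp: subset.chain_def)
  show ?thesis
  proof (rule M.submoduleI)
    show "\<Union>\<C> \<subseteq> carrier M" using M.submoduleE(1)[OF sub] by blast
    show "\<zero>\<^bsub>M\<^esub> \<in> \<Union>\<C>" using assms(2) M.submodule_zero[OF sub] by blast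
  next
    fix a assume "a \<in> \<Union>\<C>"
    then show "\<ominus>\<^bsub>M\<^esub> a \<in> \<Union>\<C>" using M.submoduleE(3)[OF sub] by blast
  next
    fix a b assume "a \<in> \<Union>\<C>" "b \<in> \<Union>\<C>"
    then obtain U V where UV: "U \<in> \<C>" "V \<in> \<C>" "a \<in> U" "b \<in> V" by blast
    then have "U \<subseteq> V \<or> V \<subseteq> U" using assms(3) by (auto simp: subset_chain_def)
    then obtain W where "W \<in> \<C>" "a \<in> W" "b \<in> W" using UV by blast
    then show "a \<oplus>\<^bsub>M\<^esub> b \<in> \<Union>\<C>" using M.submoduleE(5)[OF sub] by blast
  next
    fix c a assume "c \<in> carrier R" "a \<in> \<Union>\<C>"
    then show "c \<odot>\<^bsub>M\<^esub> a \<in> \<Union>\<C>" using M.submoduleE(4)[OF sub] by blast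
  qed
qed

lemma submodule_adjoin:
  assumes "module R M" "submodule U R M" "x \<in> carrier M"
  shows "submodule {u \<oplus>\<^bsub>M\<^esub> c \<odot>\<^bsub>M\<^esub> x | u c. u \<in> U \<and> c \<in> carrier R} R M" (is "submodule ?V R M")
proof -
  interpret M: module R M by fact
  have U: "u \<in> carrier M" if "u \<in> U" for u using M.submoduleE(1)[OF assms(2)] that by auto
  show ?thesis
  proof (rule M.submoduleI)
    show "?V \<subseteq> carrier M" using U assms(3) by auto
    have "\<zero>\<^bsub>M\<^esub> = \<zero>\<^bsub>M\<^esub> \<oplus>\<^bsub>M\<^esub> \<zero>\<^bsub>R\<^esub> \<odot>\<^bsub>M\<^esub> x" using assms(3) by simp
    then show "\<zero>\<^bsub>M\<^esub> \<in> ?V" using M.submodule_zero[OF assms(2)] by blast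
  next
    fix a assume "a \<in> ?V"
    then obtain u c where a: "a = u \<oplus>\<^bsub>M\<^esub> c \<odot>\<^bsub>M\<^esub> x" "u \<in> U" "c \<in> carrier R" by blast
    then have "\<ominus>\<^bsub>M\<^esub> a = \<ominus>\<^bsub>M\<^esub> u \<oplus>\<^bsub>M\<^esub> (\<ominus>\<^bsub>R\<^esub> c) \<odot>\<^bsub>M\<^esub> x"
      using assms(3) U by (simp add: M.minus_add M.smult_l_minus)
    then show "\<ominus>\<^bsub>M\<^esub> a \<in> ?V" using a M.submoduleE(3)[OF assms(2)] by blast
  next
    fix a b assume "a \<in> ?V" "b \<in> ?V"
    then obtain u c v d where a: "a = u \<oplus>\<^bsub>M\<^esub> c \<odot>\<^bsub>M\<^esub> x" "u \<in> U" "c \<in> carrier R"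
      and b: "b = v \<oplus>\<^bsub>M\<^esub> d \<odot>\<^bsub>M\<^esub> x" "v \<in> U" "d \<in> carrier R" by blast
    then have "a \<oplus>\<^bsub>M\<^esub> b = (u \<oplus>\<^bsub>M\<^esub> v) \<oplus>\<^bsub>M\<^esub> (c \<oplus>\<^bsub>R\<^esub> d) \<odot>\<^bsub>M\<^esub> x"
      using assms(3) U by (simp add: M.smult_l_distr M.group_simps)
    then show "a \<oplus>\<^bsub>M\<^esub> b \<in> ?V" using a b M.submoduleE(5)[OF assms(2)] by blast
  next
    fix e a assume e: "e \<in> carrier R" "a \<in> ?V"
    then obtain u c where a: "a = u \<oplus>\<^bsub>M\<^esub> c \<odot>\<^bsub>M\<^esub> x" "u \<in> U" "c \<in> carrier R" by blast
    then have "e \<odot>\<^bsub>M\<^esub> a = e \<odot>\<^bsub>M\<^esub> u \<oplus>\<^bsub>M\<^esub> (e \<otimes>\<^bsub>R\<^esub> c) \<odot>\<^bsub>M\<^esub> x"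
      using assms(3) U e by (simp add: M.smult_r_distr M.smult_assoc1)
    then show "e \<odot>\<^bsub>M\<^esub> a \<in> ?V" using a e M.submoduleE(4)[OF assms(2)] by blast
  qed
qed

text \<open>Zorn's lemma gives a submodule \<open>U\<close> maximal among those meeting
  \<open>W\<close> only in zero. If \<open>x\<close> were outside \<open>U + W\<close>, then
  \<open>U\<close> could be enlarged by the multiples of \<open>x\<close>: an element of
  \<open>W\<close> of the form \<open>u + c x\<close> with nonzero \<open>c\<close> could be divided
  by \<open>c\<close>, which would put \<open>x\<close> into \<open>U + W\<close> after all.\<close>

lemma submodule_complement:
  assumes "field R" "module R M" "submodule W R M"
  obtains U where "submodule U R M" "\<And>x. x \<in> U \<Longrightarrow> x \<in> W \<Longrightarrow> x = \<zero>\<^bsub>M\<^esub>"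
    "\<And>x. x \<in> carrier M \<Longrightarrow> \<exists>u\<in>U. \<exists>w\<in>W. x = u \<oplus>\<^bsub>M\<^esub> w"
proof -
  interpret R: field R by fact
  interpret M: module R M by fact
  let ?A = "{U. submodule U R M \<and> U \<inter> W \<subseteq> {\<zero>\<^bsub>M\<^esub>}}"
  have "submodule {\<zero>\<^bsub>M\<^esub>} R M" by (rule M.submoduleI) (auto simp: M.neg_zero)
  then have "?A \<noteq> {}" by blast
  moreover have "\<Union>\<C> \<in> ?A" if "\<C> \<noteq> {}" "subset.chain ?A \<C>" for \<C>
  proof -
    have "submodule (\<Union>\<C>) R M" by (rule submodule_Union_chain[OF assms(2) that]) blast
    moreover have "\<Union>\<C> \<inter> W \<subseteq> {\<zero>\<^bsub>M\<^esub>}" using that(2) by (auto simp: subset_chain_def)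
    ultimately show ?thesis by blast
  qed
  ultimately have "\<exists>U\<in>?A. \<forall>V\<in>?A. U \<subseteq> V \<longrightarrow> V = U" by (rule subset_Zorn_nonempty)
  then obtain U where U: "U \<in> ?A" and max: "\<forall>V\<in>?A. U \<subseteq> V \<longrightarrow> V = U" by (rule bexE)
  have Us: "submodule U R M" and UW: "\<And>x. x \<in> U \<Longrightarrow> x \<in> W \<Longrightarrow> x = \<zero>\<^bsub>M\<^esub>" using U by auto
  have Uc: "u \<in> carrier M" if "u \<in> U" for u using M.submoduleE(1)[OF Us] that by auto
  have Wc: "w \<in> carrier M" if "w \<in> W" for w using M.submoduleE(1)[OF assms(3)] that by auto
  have "\<exists>u\<in>U. \<exists>w\<in>W. x = u \<oplus>\<^bsub>M\<^esub> w" if x: "x \<in> carrier M" for x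
  proof (rule ccontr)
    assume no: "\<not> (\<exists>u\<in>U. \<exists>w\<in>W. x = u \<oplus>\<^bsub>M\<^esub> w)"
    let ?V = "{u \<oplus>\<^bsub>M\<^esub> c \<odot>\<^bsub>M\<^esub> x | u c. u \<in> U \<and> c \<in> carrier R}"
    have "?V \<inter> W \<subseteq> {\<zero>\<^bsub>M\<^esub>}"
    proof
      fix w assume w: "w \<in> ?V \<inter> W"
      then obtain u c where uc: "w = u \<oplus>\<^bsub>M\<^esub> c \<odot>\<^bsub>M\<^esub> x" "u \<in> U" "c \<in> carrier R" by blast
      have "c = \<zero>\<^bsub>R\<^esub>"
      proof (rule ccontr)
        assume "c \<noteq> \<zero>\<^bsub>R\<^esub>"
        then have ci: "inv\<^bsub>R\<^esub> c \<in> carrier R" "inv\<^bsub>R\<^esub> c \<otimes>\<^bsub>R\<^esub> c = \<one>\<^bsub>R\<^esub>"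
          using uc(3) R.field_Units R.Units_l_inv by auto
        have "c \<odot>\<^bsub>M\<^esub> x = \<ominus>\<^bsub>M\<^esub> u \<oplus>\<^bsub>M\<^esub> w" using uc x Uc by (simp add: M.group_simps)
        then have "inv\<^bsub>R\<^esub> c \<odot>\<^bsub>M\<^esub> (c \<odot>\<^bsub>M\<^esub> x) = inv\<^bsub>R\<^esub> c \<odot>\<^bsub>M\<^esub> (\<ominus>\<^bsub>M\<^esub> u \<oplus>\<^bsub>M\<^esub> w)" by (rule arg_cong)
        also have "\<dots> = inv\<^bsub>R\<^esub> c \<odot>\<^bsub>M\<^esub> (\<ominus>\<^bsub>M\<^esub> u) \<oplus>\<^bsub>M\<^esub> inv\<^bsub>R\<^esub> c \<odot>\<^bsub>M\<^esub> w"
          by (rule M.smult_r_distr) (use ci uc(2) Uc w Wc in auto)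
        finally have "x = inv\<^bsub>R\<^esub> c \<odot>\<^bsub>M\<^esub> (\<ominus>\<^bsub>M\<^esub> u) \<oplus>\<^bsub>M\<^esub> inv\<^bsub>R\<^esub> c \<odot>\<^bsub>M\<^esub> w"
          using ci uc x by (simp add: M.smult_assoc1[symmetric])
        moreover have "inv\<^bsub>R\<^esub> c \<odot>\<^bsub>M\<^esub> (\<ominus>\<^bsub>M\<^esub> u) \<in> U" "inv\<^bsub>R\<^esub> c \<odot>\<^bsub>M\<^esub> w \<in> W"
          using ci uc w M.submoduleE(3,4)[OF Us] M.submoduleE(4)[OF assms(3)] by auto
        ultimately show False using no by blast
      qed
      then have "w = u" using uc x Uc by simp
      then show "w \<in> {\<zero>\<^bsub>M\<^esub>}" using UW uc(2) w by simp
    qed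
    then have "?V \<in> ?A" using submodule_adjoin[OF assms(2) Us x] by simp
    moreover have "U \<subseteq> ?V"
    proof
      fix u assume "u \<in> U"
      then have "u = u \<oplus>\<^bsub>M\<^esub> \<zero>\<^bsub>R\<^esub> \<odot>\<^bsub>M\<^esub> x" using x Uc by simp
      then show "u \<in> ?V" using \<open>u \<in> U\<close> by blast
    qed
    ultimately have "?V = U" using max by (metis (no_types, lifting))
    moreover have "x = \<zero>\<^bsub>M\<^esub> \<oplus>\<^bsub>M\<^esub> \<one>\<^bsub>R\<^esub> \<odot>\<^bsub>M\<^esub> x" using x by simp
    then have "x \<in> ?V" using M.submodule_zero[OF Us] by blast
    ultimately have "x \<in> U" by simp
    moreover have "x = x \<oplus>\<^bsub>M\<^esub> \<zero>\<^bsub>M\<^esub>" using x by simp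
    ultimately show False using no M.submodule_zero[OF assms(3)] by blast
  qed
  then show ?thesis using that[OF Us UW] by blast
qed

text \<open>Every \<open>y\<close> of degree \<open>p\<close> is a sum \<open>f a + d e + e'\<close>
  with \<open>e\<close>, \<open>e'\<close> in chosen complements in degrees \<open>p + 1\<close> and
  \<open>p\<close>, where \<open>a\<close> and \<open>e\<close> are unique; then
  \<open>r y = a\<close> and \<open>h y = e\<close>. Taking the boundary gives
  \<open>d y = f (d a) + d e' + 0\<close>, which is a decomposition of the same kind one degree
  lower. Hence \<open>r d y = d a\<close>, so \<open>r\<close> is a chain map, and
  \<open>h d y = e'\<close>, so the decomposition of \<open>y\<close> is the homotopy formula
  itself.\<close>

lemma trivial_cofibration_contraction:
  assumes R: "field R" and tc: "trivial_cofibration R b A B f"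
  obtains r h where "\<And>p. r p \<in> linear_maps R (grade B p) (grade A p)"
    "\<And>p. h p \<in> linear_maps R (grade B p) (grade B (p + 1))"
    "\<And>p x. x \<in> carrier (grade A p) \<Longrightarrow> r p (f p x) = x"
    "\<And>p y. y \<in> carrier (grade B p) \<Longrightarrow> bdry A p (r p y) = r (p - 1) (bdry B p y)"
    "\<And>p y. y \<in> carrier (grade B p) \<Longrightarrow>
      y = f p (r p y) \<oplus>\<^bsub>grade B p\<^esub> (bdry B (p + 1) (h p y) \<oplus>\<^bsub>grade B p\<^esub> h (p - 1) (bdry B p y))"
proof -
  interpret R: field R by fact
  have A: "chain_complex R A" and B: "chain_complex R B" and f: "chain_map R A B f"
    using tc by (auto simp: trivial_cofibration_def in_Ch_def)
  have finj: "inj_on (f p) (carrier (grade A p))" for p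
    using tc by (simp add: trivial_cofibration_def cofibration_def)
  have "quasi_isomorphism A B f" using tc by (simp add: trivial_cofibration_def)
  then have qinj: "\<And>p z. z \<in> cycles A p \<Longrightarrow> f p z \<in> boundaries B p \<Longrightarrow> z \<in> boundaries A p"
    and qsurj: "\<And>p y. y \<in> cycles B p \<Longrightarrow> \<exists>z\<in>cycles A p. y \<ominus>\<^bsub>grade B p\<^esub> f p z \<in> boundaries B p"
    unfolding quasi_isomorphism_iff[OF A B f] by blast+
  note MA = cc_module[OF A] and MB = cc_module[OF B]
  note fl = cm_linear[OF f] and dA = cc_bdry[OF A] and dB = cc_bdry[OF B]
    and dA' = cc_bdry_Suc[OF A] and dB' = cc_bdry_Suc[OF B]
  note fcl = linear_maps_closed[OF fl] and dAcl = linear_maps_closed[OF dA]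
    and dBcl = linear_maps_closed[OF dB] and dBcl' = linear_maps_closed[OF dB']
    and dAcl' = linear_maps_closed[OF dA']
  define I where "I p = f p ` carrier (grade A p)" for p
  \<comment> \<open>\<open>Z p\<close> is the preimage of the cycles of the cokernel of
    \<open>f\<close>.\<close>
  define Z where "Z p = {y \<in> carrier (grade B p). bdry B p y \<in> I (p - 1)}" for p
  have Isub: "submodule (I p) R (grade B p)" for p
    unfolding I_def by (rule submodule_image[OF fl MA MB module.carrier_is_submodule[OF MA]])
  have Zsub: "submodule (Z p) R (grade B p)" for p
    unfolding Z_def by (rule submodule_preimage[OF dB MB MB Isub])
  \<comment> \<open>Acyclicity of the cokernel, read in \<open>B\<close>. If
    \<open>d y = f a\<close>, then \<open>a\<close> is a cycle because \<open>f\<close> is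
    injective, and a boundary \<open>d a'\<close> because its image is one; the cycle
    \<open>y - f a'\<close> differs from the image of a cycle by a boundary.\<close>
  have Zdec: "\<exists>a\<in>carrier (grade A p). \<exists>y'\<in>carrier (grade B (p + 1)). y =
      f p a \<oplus>\<^bsub>grade B p\<^esub> bdry B (p + 1) y'"
    if y: "y \<in> Z p" for y p
  proof -
    interpret Bp: module R "grade B p" by (rule MB)
    interpret Bp1: module R "grade B (p - 1)" by (rule MB)
    interpret Ap: module R "grade A p" by (rule MA)
    have yc: "y \<in> carrier (grade B p)" using y by (simp add: Z_def)
    obtain a where a: "a \<in> carrier (grade A (p - 1))" "bdry B p y = f (p - 1) a"
      using y by (auto simp: Z_def I_def)
    have "f (p - 2) (bdry A (p - 1) a) = \<zero>\<^bsub>grade B (p - 2)\<^esub>"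
      using cc_square[OF B yc] a cm_bdry[OF f a(1)] by simp
    also have "\<dots> = f (p - 2) \<zero>\<^bsub>grade A (p - 2)\<^esub>" using linear_maps_zero[OF fl MA MB] by simp
    finally have "bdry A (p - 1) a = \<zero>\<^bsub>grade A (p - 2)\<^esub>"
      using inj_onD[OF finj] dAcl[OF a(1)] abelian_monoid.zero_closed
        module.axioms(2)[OF MA, THEN abelian_group.axioms(1)] by fastforce
    then have "a \<in> cycles A (p - 1)" using a(1) by (simp add: cycles_def)
    moreover have "f (p - 1) a \<in> boundaries B (p - 1)" using imageI[OF yc, of "bdry B p"] a(2)
        by (simp add: boundaries_def)
    ultimately have "a \<in> boundaries A (p - 1)" by (rule qinj)
    then obtain a' where a': "a' \<in> carrier (grade A p)" "a = bdry A p a'"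
        by (auto simp: boundaries_def)
    let ?z = "y \<ominus>\<^bsub>grade B p\<^esub> f p a'"
    have "bdry B p ?z = f (p - 1) a \<ominus>\<^bsub>grade B (p - 1)\<^esub> f (p - 1) a"
      using linear_maps_diff[OF dB MB MB yc fcl[OF a'(1)]] a(2) a'(2) cm_bdry[OF f a'(1)] by simp
    also have "\<dots> = \<zero>\<^bsub>grade B (p - 1)\<^esub>" using fcl[OF a(1)] by (simp add: Bp1.diff_eq_zero_iff)
    finally have "?z \<in> cycles B p" using yc fcl[OF a'(1)] by (simp add: cycles_def)
    then obtain w where w: "w \<in> cycles A p" "?z \<ominus>\<^bsub>grade B p\<^esub> f p w \<in> boundaries B p" using qsurj
        by blast
    then obtain y' where y': "y' \<in> carrier (grade B (p + 1))" "?z \<ominus>\<^bsub>grade B p\<^esub> f p w =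
        bdry B (p + 1) y'"
      by (auto simp: boundaries_def)
    have wc: "w \<in> carrier (grade A p)" using w(1) by (simp add: cycles_def)
    have "y = f p (a' \<oplus>\<^bsub>grade A p\<^esub> w) \<oplus>\<^bsub>grade B p\<^esub> (?z \<ominus>\<^bsub>grade B p\<^esub> f p w)"
      using yc fcl[OF a'(1)] fcl[OF wc] a'(1) wc by (simp add: linear_maps_add[OF fl]
          Bp.group_simps)
    then show ?thesis using y' a'(1) wc by (metis Ap.a_closed)
  qed
  have "\<forall>p. \<exists>U. submodule U R (grade B p) \<and> (\<forall>x. x \<in> U \<longrightarrow> x \<in> Z p \<longrightarrow> x = \<zero>\<^bsub>grade B p\<^esub>) \<and>
      (\<forall>x\<in>carrier (grade B p). \<exists>u\<in>U. \<exists>w\<in>Z p. x = u \<oplus>\<^bsub>grade B p\<^esub> w)"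
    by (metis submodule_complement[OF R MB Zsub])
  then obtain E where Esub: "\<And>p. submodule (E p) R (grade B p)"
    and EZ: "\<And>p x. x \<in> E p \<Longrightarrow> x \<in> Z p \<Longrightarrow> x = \<zero>\<^bsub>grade B p\<^esub>"
    and Edec: "\<And>p x. x \<in> carrier (grade B p) \<Longrightarrow> \<exists>u\<in>E p. \<exists>w\<in>Z p. x = u \<oplus>\<^bsub>grade B p\<^esub> w"
    by metis
  have Ec: "x \<in> carrier (grade B p)" if "x \<in> E p" for x p
    using module.submoduleE(1)[OF MB Esub] that by auto
  define dec where "dec p y a e e' \<longleftrightarrow> a \<in> carrier (grade A p) \<and> e \<in> E (p + 1) \<and> e' \<in> E p \<and>
    y = f p a \<oplus>\<^bsub>grade B p\<^esub> (bdry B (p + 1) e \<oplus>\<^bsub>grade B p\<^esub> e')" for p y a e e'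
  \<comment> \<open>Split \<open>y\<close> along \<open>E p\<close> and \<open>Z p\<close>, write
    the second part as \<open>f a + d v\<close>, and split \<open>v\<close> one degree higher. The
    part of \<open>v\<close> in \<open>Z (p + 1)\<close> has its boundary in the image of
    \<open>f\<close>, so it is absorbed into \<open>a\<close>.\<close>
  have dec_ex: "\<exists>a e e'. dec p y a e e'" if y: "y \<in> carrier (grade B p)" for p y
  proof -
    interpret Bp: module R "grade B p" by (rule MB)
    interpret Ap: module R "grade A p" by (rule MA)
    interpret Bp1: module R "grade B (p + 1)" by (rule MB)
    obtain e' w where e': "e' \<in> E p" "w \<in> Z p" "y = e' \<oplus>\<^bsub>grade B p\<^esub> w" using Edec[OF y] by blast
    obtain a v where a: "a \<in> carrier (grade A p)" "v \<in> carrier (grade B (p + 1))"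
      "w = f p a \<oplus>\<^bsub>grade B p\<^esub> bdry B (p + 1) v" using Zdec[OF e'(2)] by blast
    obtain e u where e: "e \<in> E (p + 1)" "u \<in> Z (p + 1)" "v = e \<oplus>\<^bsub>grade B (p + 1)\<^esub> u"
        using Edec[OF a(2)] by blast
    have uc: "u \<in> carrier (grade B (p + 1))" using e(2) by (simp add: Z_def)
    obtain a' where a': "a' \<in> carrier (grade A p)" "bdry B (p + 1) u = f p a'"
      using e(2) by (auto simp: Z_def I_def)
    have "y = f p (a \<oplus>\<^bsub>grade A p\<^esub> a') \<oplus>\<^bsub>grade B p\<^esub> (bdry B (p + 1) e \<oplus>\<^bsub>grade B p\<^esub> e')"
      using e'(3) a(3) e(3) a' uc Ec[OF e(1)] Ec[OF e'(1)] fcl[OF a(1)] fcl[OF a'(1)]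
          dBcl'[OF Ec[OF e(1)]] a(1)
      by (simp add: linear_maps_add[OF dB'] linear_maps_add[OF fl] Bp.group_simps)
    then have "dec p y (a \<oplus>\<^bsub>grade A p\<^esub> a') e e'" using a(1) a'(1) e(1) e'(1) by (simp add: dec_def)
    then show ?thesis by blast
  qed
  \<comment> \<open>Taking the boundary puts \<open>e'\<close> into \<open>Z p\<close>, so
    \<open>e' = 0\<close>. Then the boundary of \<open>e\<close> lies in the image of
    \<open>f\<close>, which puts \<open>e\<close> into \<open>Z (p + 1)\<close>, so
    \<open>e = 0\<close>; what remains is \<open>f a = 0\<close>.\<close>
  have dec_zero: "a = \<zero>\<^bsub>grade A p\<^esub> \<and> e = \<zero>\<^bsub>grade B (p + 1)\<^esub>" if d: "dec p \<zero>\<^bsub>grade B p\<^esub> a e e'"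
      for p a e e'
  proof -
    interpret Bp: module R "grade B p" by (rule MB)
    interpret Bp1: module R "grade B (p - 1)" by (rule MB)
    interpret Ap: module R "grade A p" by (rule MA)
    interpret Ap1: module R "grade A (p - 1)" by (rule MA)
    have ac: "a \<in> carrier (grade A p)" and e: "e \<in> E (p + 1)" "e' \<in> E p"
      and eq: "\<zero>\<^bsub>grade B p\<^esub> = f p a \<oplus>\<^bsub>grade B p\<^esub> (bdry B (p + 1) e \<oplus>\<^bsub>grade B p\<^esub> e')"
      using d by (auto simp: dec_def)
    note ec = Ec[OF e(1)] Ec[OF e(2)]
    note cl = fcl[OF ac] dBcl'[OF ec(1)] ec(2)
    have "bdry B p \<zero>\<^bsub>grade B p\<^esub> = f (p - 1) (bdry A p a) \<oplus>\<^bsub>grade B (p - 1)\<^esub> bdry B p e'"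
      using cl cc_square_Suc[OF B ec(1)] dBcl[OF ec(2)] cm_bdry[OF f ac]
      by (subst eq) (simp add: linear_maps_add[OF dB])
    then have 0: "\<zero>\<^bsub>grade B (p - 1)\<^esub> = f (p - 1) (bdry A p a) \<oplus>\<^bsub>grade B (p - 1)\<^esub> bdry B p e'"
      using linear_maps_zero[OF dB MB MB] by simp
    have "bdry B p e' = \<ominus>\<^bsub>grade B (p - 1)\<^esub> f (p - 1) (bdry A p a)"
      using Bp1.minus_equality[OF _ fcl[OF dAcl[OF ac]] dBcl[OF ec(2)]] 0 fcl[OF dAcl[OF ac]]
          dBcl[OF ec(2)]
      by (simp add: Bp1.a_comm)
    also have "\<dots> = f (p - 1) (\<ominus>\<^bsub>grade A (p - 1)\<^esub> bdry A p a)"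
      using linear_maps_neg[OF fl MA MB dAcl[OF ac]] by simp
    finally have "e' \<in> Z p" using ec(2) dAcl[OF ac] by (simp add: Z_def I_def)
    then have e'0: "e' = \<zero>\<^bsub>grade B p\<^esub>" using EZ e(2) by blast
    then have 1: "\<zero>\<^bsub>grade B p\<^esub> = f p a \<oplus>\<^bsub>grade B p\<^esub> bdry B (p + 1) e"
      using eq cl(1,2) unfolding e'0 by simp
    have "bdry B (p + 1) e = \<ominus>\<^bsub>grade B p\<^esub> f p a"
      using Bp.minus_equality[OF _ cl(1,2)] 1 cl by (simp add: Bp.a_comm)
    also have "\<dots> = f p (\<ominus>\<^bsub>grade A p\<^esub> a)" using linear_maps_neg[OF fl MA MB ac] by simp
    finally have "e \<in> Z (p + 1)" using ec(1) ac by (simp add: Z_def I_def)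
    then have e0: "e = \<zero>\<^bsub>grade B (p + 1)\<^esub>" using EZ e(1) by blast
    then have "f p a = f p \<zero>\<^bsub>grade A p\<^esub>"
      using 1 linear_maps_zero[OF dB' MB MB] linear_maps_zero[OF fl MA MB] cl by simp
    then have "a = \<zero>\<^bsub>grade A p\<^esub>" using inj_onD[OF finj _ ac] by simp
    then show ?thesis using e0 by simp
  qed
  have dec_add: "dec p (y \<oplus>\<^bsub>grade B p\<^esub> z) (a \<oplus>\<^bsub>grade A p\<^esub> a1) (e \<oplus>\<^bsub>grade B (p + 1)\<^esub> e1)
      (e' \<oplus>\<^bsub>grade B p\<^esub> e1')"
    if "dec p y a e e'" "dec p z a1 e1 e1'" for p y z a a1 e e1 e' e1'
  proof -
    interpret Bp: module R "grade B p" by (rule MB)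
    interpret Ap: module R "grade A p" by (rule MA)
    have *: "a \<in> carrier (grade A p)" "e \<in> E (p + 1)" "e' \<in> E p" "a1 \<in> carrier (grade A p)"
        "e1 \<in> E (p + 1)" "e1' \<in> E p"
      using that by (auto simp: dec_def)
    then show ?thesis
      using that module.submoduleE(5)[OF MB Esub] fcl dBcl' Ec
      by (simp add: dec_def linear_maps_add[OF fl] linear_maps_add[OF dB'] Bp.group_simps)
  qed
  have dec_smult: "dec p (c \<odot>\<^bsub>grade B p\<^esub> y) (c \<odot>\<^bsub>grade A p\<^esub> a) (c \<odot>\<^bsub>grade B (p + 1)\<^esub> e) (c \<odot>\<^bsub>grade B p\<^esub> e')"
    if "dec p y a e e'" "c \<in> carrier R" for p y a e e' c
  proof -
    interpret Bp: module R "grade B p" by (rule MB)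
    interpret Ap: module R "grade A p" by (rule MA)
    have *: "a \<in> carrier (grade A p)" "e \<in> E (p + 1)" "e' \<in> E p"
      using that by (auto simp: dec_def)
    then show ?thesis
      using that module.submoduleE(4)[OF MB Esub] fcl dBcl' Ec
      by (simp add: dec_def linear_maps_smult[OF fl] linear_maps_smult[OF dB'] Bp.smult_r_distr)
  qed
  \<comment> \<open>The difference of two decompositions of \<open>y\<close> decomposes zero. It is
    formed with the scalar -1, so that \<open>dec_add\<close> and \<open>dec_smult\<close>
    apply.\<close>
  have dec_uniq: "a = a1 \<and> e = e1" if d: "dec p y a e e'" "dec p y a1 e1 e1'" for p y a a1 e e1 e'
      e1'
  proof -
    interpret Bp: module R "grade B p" by (rule MB)
    interpret Bp1: module R "grade B (p + 1)" by (rule MB)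
    interpret Ap: module R "grade A p" by (rule MA)
    have *: "a \<in> carrier (grade A p)" "e \<in> E (p + 1)" "a1 \<in> carrier (grade A p)" "e1 \<in> E (p + 1)"
      "e1' \<in> E p" using d by (auto simp: dec_def)
    have yc: "y \<in> carrier (grade B p)"
      using d(2) * fcl dBcl' Ec by (auto simp: dec_def)
    have "dec p (y \<oplus>\<^bsub>grade B p\<^esub> (\<ominus>\<^bsub>R\<^esub> \<one>\<^bsub>R\<^esub>) \<odot>\<^bsub>grade B p\<^esub> y)
      (a \<oplus>\<^bsub>grade A p\<^esub> (\<ominus>\<^bsub>R\<^esub> \<one>\<^bsub>R\<^esub>) \<odot>\<^bsub>grade A p\<^esub> a1)
      (e \<oplus>\<^bsub>grade B (p + 1)\<^esub> (\<ominus>\<^bsub>R\<^esub> \<one>\<^bsub>R\<^esub>) \<odot>\<^bsub>grade B (p + 1)\<^esub> e1)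
      (e' \<oplus>\<^bsub>grade B p\<^esub> (\<ominus>\<^bsub>R\<^esub> \<one>\<^bsub>R\<^esub>) \<odot>\<^bsub>grade B p\<^esub> e1')"
      by (rule dec_add[OF d(1) dec_smult[OF d(2)]]) simp
    then have "dec p \<zero>\<^bsub>grade B p\<^esub> (a \<ominus>\<^bsub>grade A p\<^esub> a1) (e \<ominus>\<^bsub>grade B (p + 1)\<^esub> e1)
      (e' \<oplus>\<^bsub>grade B p\<^esub> (\<ominus>\<^bsub>R\<^esub> \<one>\<^bsub>R\<^esub>) \<odot>\<^bsub>grade B p\<^esub> e1')"
      using yc * Ec by (simp add: module_minus_eq[OF MA] module_minus_eq[OF MB] a_minus_def
          Bp.r_neg)
    then have "a \<ominus>\<^bsub>grade A p\<^esub> a1 = \<zero>\<^bsub>grade A p\<^esub> \<and> e \<ominus>\<^bsub>grade B (p + 1)\<^esub> e1 = \<zero>\<^bsub>grade B (p + 1)\<^esub>"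
      by (rule dec_zero)
    then show ?thesis using * Ec by (simp add: Ap.diff_eq_zero_iff Bp1.diff_eq_zero_iff)
  qed
  \<comment> \<open>Linearity of the chosen values will follow from uniqueness, since sums and
    multiples of decompositions are again decompositions.\<close>
  define r where "r p y = (SOME a. \<exists>e e'. dec p y a e e')" for p y
  define h where "h p y = (SOME e. \<exists>a e'. dec p y a e e')" for p y
  have rh: "r p y = a \<and> h p y = e" if "dec p y a e e'" for p y a e e'
  proof -
    have "\<exists>e e'. dec p y (r p y) e e'" unfolding r_def by (rule someI[of _ a]) (use that in blast)
    moreover have "\<exists>a e'. dec p y a (h p y) e'" unfolding h_def by (rule someI[of _ e])
        (use that in blast)
    ultimately show ?thesis using dec_uniq[OF _ that] by blast
  qed
  have decr: "\<exists>e'. dec p y (r p y) (h p y) e'" if "y \<in> carrier (grade B p)" for p y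
    using dec_ex[OF that] rh by metis
  have rh_add: "r p (y \<oplus>\<^bsub>grade B p\<^esub> z) = r p y \<oplus>\<^bsub>grade A p\<^esub> r p z \<and>
      h p (y \<oplus>\<^bsub>grade B p\<^esub> z) = h p y \<oplus>\<^bsub>grade B (p + 1)\<^esub> h p z"
    if y: "y \<in> carrier (grade B p)" and z: "z \<in> carrier (grade B p)" for p y z
  proof -
    obtain e' where "dec p y (r p y) (h p y) e'" using decr[OF y] by (rule exE)
    moreover obtain e1' where "dec p z (r p z) (h p z) e1'" using decr[OF z] by (rule exE)
    ultimately show ?thesis by (rule rh[OF dec_add])
  qed
  have rh_smult: "r p (c \<odot>\<^bsub>grade B p\<^esub> y) = c \<odot>\<^bsub>grade A p\<^esub> r p y \<and>
      h p (c \<odot>\<^bsub>grade B p\<^esub> y) = c \<odot>\<^bsub>grade B (p + 1)\<^esub> h p y"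
    if c: "c \<in> carrier R" and y: "y \<in> carrier (grade B p)" for p y c
  proof -
    obtain e' where "dec p y (r p y) (h p y) e'" using decr[OF y] by (rule exE)
    then show ?thesis by (rule rh[OF dec_smult[OF _ c]])
  qed
  show ?thesis
  proof (rule that)
    fix p
    show "r p \<in> linear_maps R (grade B p) (grade A p)"
      by (rule linear_mapsI) (use decr rh_add rh_smult in \<open>auto simp: dec_def\<close>)
    show "h p \<in> linear_maps R (grade B p) (grade B (p + 1))"
      by (rule linear_mapsI) (use decr Ec rh_add rh_smult in \<open>auto simp: dec_def\<close>)
  next
    fix p x assume x: "x \<in> carrier (grade A p)"
    interpret Bp: module R "grade B p" by (rule MB)
    have "dec p (f p x) x \<zero>\<^bsub>grade B (p + 1)\<^esub> \<zero>\<^bsub>grade B p\<^esub>"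
      using x fcl[OF x] module.submodule_zero[OF MB Esub] linear_maps_zero[OF dB' MB MB]
          by (simp add: dec_def)
    then show "r p (f p x) = x" using rh by blast
  next
    fix p y assume y: "y \<in> carrier (grade B p)"
    interpret Bp: module R "grade B p" by (rule MB)
    interpret Bp1: module R "grade B (p - 1)" by (rule MB)
    interpret Ap1: module R "grade A (p - 1)" by (rule MA)
    obtain e' where d: "dec p y (r p y) (h p y) e'" using decr[OF y] by blast
    then have c: "r p y \<in> carrier (grade A p)" "h p y \<in> E (p + 1)" "e' \<in> E p"
      and y_eq: "y = f p (r p y) \<oplus>\<^bsub>grade B p\<^esub> (bdry B (p + 1) (h p y) \<oplus>\<^bsub>grade B p\<^esub> e')"
      by (auto simp: dec_def)
    note ec = Ec[OF c(2)] Ec[OF c(3)]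
    have "bdry B p y = bdry B p (f p (r p y) \<oplus>\<^bsub>grade B p\<^esub> (bdry B (p + 1) (h p y) \<oplus>\<^bsub>grade B p\<^esub> e'))"
      by (rule arg_cong[OF y_eq])
    also have "\<dots> = f (p - 1) (bdry A p (r p y)) \<oplus>\<^bsub>grade B (p - 1)\<^esub>
        (bdry B p e' \<oplus>\<^bsub>grade B (p - 1)\<^esub> \<zero>\<^bsub>grade B (p - 1)\<^esub>)"
      using fcl[OF c(1)] dBcl'[OF ec(1)] ec(2) dBcl[OF ec(2)] cc_square_Suc[OF B ec(1)]
          cm_bdry[OF f c(1)]
      by (simp add: linear_maps_add[OF dB])
    \<comment> \<open>One degree lower the component \<open>e'\<close> takes the place of
      \<open>e\<close>, and the component in the complement \<open>E (p - 1)\<close> is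
      zero.\<close>
    finally have "dec (p - 1) (bdry B p y) (bdry A p (r p y)) e' \<zero>\<^bsub>grade B (p - 1)\<^esub>"
      using dAcl[OF c(1)] c(3) module.submodule_zero[OF MB Esub] by (simp add: dec_def)
    then have "r (p - 1) (bdry B p y) = bdry A p (r p y) \<and> h (p - 1) (bdry B p y) = e'" by (rule rh)
    then show "bdry A p (r p y) = r (p - 1) (bdry B p y)"
      and "y = f p (r p y) \<oplus>\<^bsub>grade B p\<^esub> (bdry B (p + 1) (h p y) \<oplus>\<^bsub>grade B p\<^esub> h (p - 1) (bdry B p y))"
      using y_eq by simp_all
  qed
qed

section \<open>Multilinear functions on words\<close>

lemma words_iff:
  "w \<in> words Z n m \<longleftrightarrow> length w = n \<and> (\<forall>i<n. snd (w ! i) \<in> carrier (grade (Z i) (fst (w ! i)))) \<and>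
    (\<Sum>i<n. fst (w ! i)) = m"
  by (auto simp: words_def sum_list_sum_nth atLeast0LessThan)

lemma words_length: "w \<in> words Z n m \<Longrightarrow> length w = n"
  and words_nth: "w \<in> words Z n m \<Longrightarrow> i < n \<Longrightarrow> snd (w ! i) \<in> carrier (grade (Z i) (fst (w ! i)))"
  by (simp_all add: words_iff)

text \<open>The tensor product of homogeneous operators \<open>u i\<close> of degrees
  \<open>\<delta> i\<close>, one in each factor, without Koszul signs.\<close>

definition slot_map ::
  "(nat \<Rightarrow> int) \<Rightarrow> (nat \<Rightarrow> int \<Rightarrow> 'a \<Rightarrow> 'b) \<Rightarrow> (int \<times> 'a) list \<Rightarrow> (int \<times> 'b) list" where
  "slot_map \<delta> u w = map (\<lambda>i. (fst (w ! i) + \<delta> i, u i (fst (w ! i)) (snd (w ! i)))) [0..<length w]"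

lemma length_slot_map [simp]: "length (slot_map \<delta> u w) = length w"
  by (simp add: slot_map_def)

lemma nth_slot_map [simp]:
  "i < length w \<Longrightarrow> slot_map \<delta> u w ! i = (fst (w ! i) + \<delta> i, u i (fst (w ! i)) (snd (w ! i)))"
  by (simp add: slot_map_def)

lemma slot_map_update:
  "i < length w \<Longrightarrow> slot_map \<delta> u (w[i := (p, x)]) = (slot_map \<delta> u w)[i := (p + \<delta> i, u i p x)]"
  by (rule nth_equalityI) (auto simp: nth_list_update)

lemma slot_map_slot_map:
  "slot_map \<delta> u (slot_map \<epsilon> v w) = slot_map (\<lambda>i. \<epsilon> i + \<delta> i) (\<lambda>i p x. u i (p + \<epsilon> i) (v i p x)) w"
  by (rule nth_equalityI) (auto simp: add.assoc)

lemma slot_map_cong: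
  assumes "\<And>i. i < length w \<Longrightarrow> \<delta> i = \<delta>' i \<and> u i (fst (w ! i)) (snd (w ! i)) =
      u' i (fst (w ! i)) (snd (w ! i))"
  shows "slot_map \<delta> u w = slot_map \<delta>' u' w"
  by (rule nth_equalityI) (auto simp: assms)

lemma slot_map_words:
  assumes "w \<in> words Z n m" "m' = m + (\<Sum>i<n. \<delta> i)"
    and u: "\<And>i p. i < n \<Longrightarrow> u i p \<in> linear_maps R (grade (Z i) p) (grade (Z' i) (p + \<delta> i))"
  shows "slot_map \<delta> u w \<in> words Z' n m'"
  using assms(1,2) linear_maps_closed[OF u] by (auto simp: words_iff sum.distrib)

lemma word_update:
  assumes "w \<in> words Z n m" "i < n" "x \<in> carrier (grade (Z i) (fst (w ! i)))"
  shows "w[i := (fst (w ! i), x)] \<in> words Z n m"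
proof -
  have l: "length w = n" using assms(1) by (simp add: words_iff)
  have "(\<Sum>j<n. fst (w[i := (fst (w ! i), x)] ! j)) = (\<Sum>j<n. fst (w ! j))"
    by (rule sum.cong) (use l assms(2) in \<open>auto simp: nth_list_update\<close>)
  moreover have "snd (w[i := (fst (w ! i), x)] ! j) \<in> carrier
      (grade (Z j) (fst (w[i := (fst (w ! i), x)] ! j)))"
    if "j < n" for j
    using assms that l by (auto simp: words_iff nth_list_update)
  ultimately show ?thesis using assms(1) l by (simp add: words_iff)
qed

text \<open>Only the element in slot \<open>i\<close> varies, while its degree
  \<open>fst (w ! i)\<close> stays fixed. Coefficients that depend on the degrees alone, such as
  signs, therefore preserve multilinearity; this is \<open>multilinear_scale\<close>.\<close>

definition multilinear where
  "multilinear R Z n m N F \<longleftrightarrow> (\<forall>w\<in>words Z n m. F w \<in> carrier N \<and>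
    (\<forall>i<n. (\<lambda>x. F (w[i := (fst (w ! i), x)])) \<in> linear_maps R (grade (Z i) (fst (w ! i))) N))"

lemma multilinear_closed: "multilinear R Z n m N F \<Longrightarrow> w \<in> words Z n m \<Longrightarrow> F w \<in> carrier N"
  by (simp add: multilinear_def)

lemma multilinear_slot:
  "multilinear R Z n m N F \<Longrightarrow> w \<in> words Z n m \<Longrightarrow> i < n \<Longrightarrow>
    (\<lambda>x. F (w[i := (fst (w ! i), x)])) \<in> linear_maps R (grade (Z i) (fst (w ! i))) N"
  by (simp add: multilinear_def)

lemma linear_maps_cong:
  assumes "module R M" "\<And>x. x \<in> carrier M \<Longrightarrow> h x = k x" "h \<in> linear_maps R M N"
  shows "k \<in> linear_maps R M N"
proof -
  interpret M: module R M by fact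
  show ?thesis
    by (rule linear_mapsI)
      (use assms(2)[symmetric] in \<open>simp_all add: linear_maps_closed[OF assms(3)]
          linear_maps_add[OF assms(3)]
        linear_maps_smult[OF assms(3)]\<close>)
qed

lemma multilinear_cong:
  assumes "multilinear R Z n m N F" "\<And>w. w \<in> words Z n m \<Longrightarrow>
      F w = G w" "\<And>i p. module R (grade (Z i) p)"
  shows "multilinear R Z n m N G"
  unfolding multilinear_def
proof (intro ballI conjI allI impI)
  fix w i assume w: "w \<in> words Z n m" and i: "i < n"
  show "(\<lambda>x. G (w[i := (fst (w ! i), x)])) \<in> linear_maps R (grade (Z i) (fst (w ! i))) N"
    by (rule linear_maps_cong[OF assms(3) _ multilinear_slot[OF assms(1) w i]])
      (use assms(2) word_update[OF w i] in simp)
qed (use multilinear_closed[OF assms(1)] assms(2) in force)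

lemma multilinear_plus:
  assumes "multilinear R Z n m N F" "multilinear R Z n m N G" "module R N"
  shows "multilinear R Z n m N (\<lambda>w. F w \<oplus>\<^bsub>N\<^esub> G w)"
proof -
  interpret N: module R N by fact
  show ?thesis using assms by (auto simp: multilinear_def intro!: linear_maps_plus)
qed

lemma multilinear_zero:
  assumes "module R N"
  shows "multilinear R Z n m N (\<lambda>w. \<zero>\<^bsub>N\<^esub>)"
proof -
  interpret N: module R N by fact
  show ?thesis by (auto simp: multilinear_def intro!: linear_mapsI)
qed

lemma multilinear_finsum:
  assumes "module R N" "finite I" "\<And>k. k \<in> I \<Longrightarrow> multilinear R Z n m N (F k)"
      "\<And>i p. module R (grade (Z i) p)"
  shows "multilinear R Z n m N (\<lambda>w. finsum N (\<lambda>k. F k w) I)"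
  using assms(2,3)
proof (induction rule: finite_induct)
  case empty
  interpret N: module R N by fact
  show ?case using multilinear_zero[OF assms(1)] by simp
next
  case (insert k I)
  interpret N: module R N by fact
  have "multilinear R Z n m N (\<lambda>w. F k w \<oplus>\<^bsub>N\<^esub> finsum N (\<lambda>k. F k w) I)"
    using insert by (intro multilinear_plus assms(1)) auto
  then show ?case
    by (rule multilinear_cong)
      (use insert(1,2) in \<open>auto simp: assms(4) intro!: N.finsum_insert[symmetric]
          multilinear_closed[OF insert.prems]\<close>)
qed

lemma map_fst_update: "map fst (w[i := (fst (w ! i), x)]) = map fst w"
  by (cases "i < length w") (simp_all add: map_update list_update_same_conv list_update_beyond)

lemma multilinear_scale:
  assumes "multilinear R Z n m N F" "module R N" "\<And>d. c d \<in> carrier R"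
  shows "multilinear R Z n m N (\<lambda>w. c (map fst w) \<odot>\<^bsub>N\<^esub> F w)"
proof -
  interpret N: module R N by fact
  show ?thesis
    using assms unfolding multilinear_def map_fst_update by (auto intro!: linear_maps_scale)
qed

lemma multilinear_slot_map:
  assumes F: "multilinear R Z' n m' N F" and m': "m' = m + (\<Sum>i<n. \<delta> i)"
    and u: "\<And>i p. i < n \<Longrightarrow> u i p \<in> linear_maps R (grade (Z i) p) (grade (Z' i) (p + \<delta> i))"
  shows "multilinear R Z n m N (\<lambda>w. F (slot_map \<delta> u w))"
  unfolding multilinear_def
proof (intro ballI conjI allI impI)
  fix w assume w: "w \<in> words Z n m"
  note sw = slot_map_words[OF w m' u]
  show "F (slot_map \<delta> u w) \<in> carrier N" by (rule multilinear_closed[OF F sw])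
  fix i assume i: "i < n"
  have l: "i < length w" using w i by (simp add: words_iff)
  have "(\<lambda>x. F ((slot_map \<delta> u w)[i := (fst (w ! i) + \<delta> i, u i (fst (w ! i)) x)])) \<in>
      linear_maps R (grade (Z i) (fst (w ! i))) N"
    using linear_maps_comp[OF u[OF i, of "fst (w ! i)"], of
        "\<lambda>x. F ((slot_map \<delta> u w)[i := (fst (w ! i) + \<delta> i, x)])" N]
      multilinear_slot[OF F sw i] l by simp
  then show "(\<lambda>x. F (slot_map \<delta> u (w[i := (fst (w ! i), x)]))) \<in> linear_maps R
      (grade (Z i) (fst (w ! i))) N"
    using l by (simp add: slot_map_update)
qed

lemma multilinear_add_slot:
  assumes "multilinear R Z n m N F" "w \<in> words Z n m" "i < n"
    and "x \<in> carrier (grade (Z i) (fst (w ! i)))" "y \<in> carrier (grade (Z i) (fst (w ! i)))"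
  shows "F (w[i := (fst (w ! i), x \<oplus>\<^bsub>grade (Z i) (fst (w ! i))\<^esub> y)]) =
    F (w[i := (fst (w ! i), x)]) \<oplus>\<^bsub>N\<^esub> F (w[i := (fst (w ! i), y)])"
  by (rule linear_maps_add[OF multilinear_slot[OF assms(1-3)] assms(4,5)])

lemma multilinear_zero_slot:
  assumes "multilinear R Z n m N F" "w \<in> words Z n m" "i < n" "module R N"
    and "module R (grade (Z i) (fst (w ! i)))" "snd (w ! i) = \<zero>\<^bsub>grade (Z i) (fst (w ! i))\<^esub>"
  shows "F w = \<zero>\<^bsub>N\<^esub>"
proof -
  have "w[i := (fst (w ! i), \<zero>\<^bsub>grade (Z i) (fst (w ! i))\<^esub>)] = w"
    using assms(6) by (metis list_update_id prod.collapse)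
  then show ?thesis
    using linear_maps_zero[OF multilinear_slot[OF assms(1-3)] assms(5,4)] by simp
qed

text \<open>Step \<open>k\<close> splits slot \<open>k\<close> as \<open>q + e\<close>: the part
  with \<open>e\<close> is the next summand, and the part with \<open>q\<close> is carried on. The
  operators may depend on the slot, because on a vertex of the cube some slots hold elements of
  \<open>A\<close> and others elements of \<open>B\<close>, and these are split differently.\<close>

lemma multilinear_telescope:
  assumes F: "multilinear R Z n m N F" and N: "module R N" and Z: "\<And>i p. module R (grade (Z i) p)"
    and w: "w \<in> words Z n m"
    and q: "\<And>i p. i < n \<Longrightarrow> q i p \<in> linear_maps R (grade (Z i) p) (grade (Z i) p)"
    and e: "\<And>i p. i < n \<Longrightarrow> e i p \<in> linear_maps R (grade (Z i) p) (grade (Z i) p)"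
    and qe: "\<And>i p x. i < n \<Longrightarrow> x \<in> carrier (grade (Z i) p) \<Longrightarrow> q i p x \<oplus>\<^bsub>grade (Z i) p\<^esub> e i p x = x"
    and "k \<le> n"
  shows "finsum N (\<lambda>i. F (slot_map (\<lambda>_. 0) (\<lambda>j. if j < i then q j else if j =
      i then e j else (\<lambda>_ x. x)) w)) {..<k}
      \<oplus>\<^bsub>N\<^esub> F (slot_map (\<lambda>_. 0) (\<lambda>j. if j < k then q j else (\<lambda>_ x. x)) w) = F w"
  using \<open>k \<le> n\<close>
proof (induction k)
  case 0
  interpret N: module R N by fact
  have "slot_map (\<lambda>_. 0) (\<lambda>j _ x. x) w = w" by (rule nth_equalityI) auto
  then show ?case using multilinear_closed[OF F w] by simp
next
  case (Suc k)
  interpret N: module R N by fact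
  let ?E = "\<lambda>i. slot_map (\<lambda>_. 0) (\<lambda>j. if j < i then q j else if j = i then e j else (\<lambda>_ x. x)) w"
  let ?Q = "\<lambda>k. slot_map (\<lambda>_. 0) (\<lambda>j. if j < k then q j else (\<lambda>_ x. x)) w"
  have Ew: "?E i \<in> words Z n m" for i
    by (rule slot_map_words[OF w]) (use q e linear_maps_id in auto)
  have Qw: "?Q i \<in> words Z n m" for i
    by (rule slot_map_words[OF w]) (use q linear_maps_id in auto)
  have k: "k < n" "k < length w" using Suc.prems words_length[OF w] by auto
  let ?p = "fst (w ! k)" and ?x = "snd (w ! k)"
  have x: "?x \<in> carrier (grade (Z k) ?p)" using words_nth[OF w k(1)] .
  have qx: "q k ?p ?x \<in> carrier (grade (Z k) ?p)" and ex: "e k ?p ?x \<in> carrier (grade (Z k) ?p)"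
    using linear_maps_closed[OF q[OF k(1)] x] linear_maps_closed[OF e[OF k(1)] x] by auto
  have fp: "fst (?Q k ! k) = ?p" using k by simp
  have "?Q k = (?Q k)[k := (?p, q k ?p ?x \<oplus>\<^bsub>grade (Z k) ?p\<^esub> e k ?p ?x)]"
    unfolding qe[OF k(1) x] using k by (intro nth_equalityI) (auto simp: nth_list_update)
  then have "F (?Q k) = F ((?Q k)[k := (?p, q k ?p ?x \<oplus>\<^bsub>grade (Z k) ?p\<^esub> e k ?p ?x)])"
      by (rule arg_cong)
  also have "\<dots> = F ((?Q k)[k := (?p, q k ?p ?x)]) \<oplus>\<^bsub>N\<^esub> F ((?Q k)[k := (?p, e k ?p ?x)])"
    by (rule multilinear_add_slot[OF F Qw[of k] k(1), unfolded fp, OF qx ex])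
  also have "(?Q k)[k := (?p, q k ?p ?x)] = ?Q (Suc k)"
    using k by (intro nth_equalityI) (auto simp: nth_list_update less_Suc_eq)
  also have "(?Q k)[k := (?p, e k ?p ?x)] = ?E k"
    using k by (intro nth_equalityI) (auto simp: nth_list_update)
  finally have step: "F (?Q k) = F (?Q (Suc k)) \<oplus>\<^bsub>N\<^esub> F (?E k)" .
  have cl: "F (?E i) \<in> carrier N" "F (?Q i) \<in> carrier N" for i
    using multilinear_closed[OF F Ew] multilinear_closed[OF F Qw] by auto
  have "finsum N (\<lambda>i. F (?E i)) {..<Suc k} = F (?E k) \<oplus>\<^bsub>N\<^esub> finsum N (\<lambda>i. F (?E i)) {..<k}"
    unfolding lessThan_Suc by (rule N.finsum_insert) (use cl in auto)
  moreover have "finsum N (\<lambda>i. F (?E i)) {..<k} \<in> carrier N" by (rule N.finsum_closed)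
      (use cl in auto)
  ultimately show ?case using Suc step cl by (simp add: N.a_ac)
qed

text \<open>Read from right to left, this makes the generators of the presented module multilinear
  in the word; read from left to right, it lets a multilinear function factor through the
  presentation.\<close>

lemma multilinear_iff_relators:
  assumes N: "module R N" and Z: "\<And>i p. module R (grade (Z i) p)"
    and F: "\<And>w. w \<in> words Z n m \<Longrightarrow> F w \<in> carrier N"
  shows "multilinear R Z n m N F \<longleftrightarrow>
    (\<forall>r\<in>multilinear_rels R Z n m. comb_eval N F r = \<zero>\<^bsub>N\<^esub>)"
proof
  assume ml: "multilinear R Z n m N F"
  show "\<forall>r\<in>multilinear_rels R Z n m. comb_eval N F r = \<zero>\<^bsub>N\<^esub>"
  proof
    fix r assume "r \<in> multilinear_rels R Z n m"
    then consider
      w i p x y where "r = [(\<one>\<^bsub>R\<^esub>, w[i := (p, x \<oplus>\<^bsub>grade (Z i) p\<^esub> y)]),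
          (\<ominus>\<^bsub>R\<^esub> \<one>\<^bsub>R\<^esub>, w[i := (p, x)]), (\<ominus>\<^bsub>R\<^esub> \<one>\<^bsub>R\<^esub>, w[i := (p, y)])]"
        "i < n" "w[i := (p, x)] \<in> words Z n m" "w[i := (p, y)] \<in> words Z n m"
    | w i p c x where "r = [(\<one>\<^bsub>R\<^esub>, w[i := (p, c \<odot>\<^bsub>grade (Z i) p\<^esub> x)]), (\<ominus>\<^bsub>R\<^esub> c, w[i := (p, x)])]"
        "i < n" "c \<in> carrier R" "w[i := (p, x)] \<in> words Z n m"
      unfolding multilinear_rels_def by blast
    then show "comb_eval N F r = \<zero>\<^bsub>N\<^esub>"
    proof cases
      case (1 w i p x y)
      have l: "i < length w" using 1 words_length by fastforce
      have xy: "x \<in> carrier (grade (Z i) p)" "y \<in> carrier (grade (Z i) p)"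
        using words_nth[OF 1(3,2)] words_nth[OF 1(4,2)] l by auto
      have "F (w[i := (p, x \<oplus>\<^bsub>grade (Z i) p\<^esub> y)]) = F (w[i := (p, x)]) \<oplus>\<^bsub>N\<^esub> F (w[i := (p, y)])"
        using multilinear_add_slot[OF ml 1(3,2)] l xy by simp
      then show ?thesis
        using 1 F by (simp add: module_relation3[OF N])
    next
      case (2 w i p c x)
      have l: "i < length w" using 2 words_length by fastforce
      have x: "x \<in> carrier (grade (Z i) p)" using words_nth[OF 2(4,2)] l by auto
      have "F (w[i := (p, c \<odot>\<^bsub>grade (Z i) p\<^esub> x)]) = c \<odot>\<^bsub>N\<^esub> F (w[i := (p, x)])"
        using linear_maps_smult[OF multilinear_slot[OF ml 2(4,2)] 2(3)] l x by simp
      then show ?thesis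
        using 2 F by (simp add: module_relation2[OF N])
    qed
  qed
next
  assume rel: "\<forall>r\<in>multilinear_rels R Z n m. comb_eval N F r = \<zero>\<^bsub>N\<^esub>"
  show "multilinear R Z n m N F"
    unfolding multilinear_def
  proof (intro ballI conjI allI impI linear_mapsI)
    fix w i assume w: "w \<in> words Z n m" and i: "i < n"
    let ?p = "fst (w ! i)"
    interpret Zi: module R "grade (Z i) ?p" by (rule Z)
    note wu = word_update[OF w i]
    show "x \<in> carrier (grade (Z i) ?p) \<Longrightarrow> F (w[i := (?p, x)]) \<in> carrier N" for x using F[OF wu] .
    fix x assume x: "x \<in> carrier (grade (Z i) ?p)"
    show "F (w[i := (?p, x \<oplus>\<^bsub>grade (Z i) ?p\<^esub> y)]) = F (w[i := (?p, x)]) \<oplus>\<^bsub>N\<^esub> F (w[i := (?p, y)])"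
      if y: "y \<in> carrier (grade (Z i) ?p)" for y
    proof -
      let ?r = "[(\<one>\<^bsub>R\<^esub>, w[i := (?p, x \<oplus>\<^bsub>grade (Z i) ?p\<^esub> y)]),
          (\<ominus>\<^bsub>R\<^esub> \<one>\<^bsub>R\<^esub>, w[i := (?p, x)]), (\<ominus>\<^bsub>R\<^esub> \<one>\<^bsub>R\<^esub>, w[i := (?p, y)])]"
      have "?r \<in> multilinear_rels R Z n m" using wu[OF x] wu[OF y] i unfolding
          multilinear_rels_def by blast
      then have "comb_eval N F ?r = \<zero>\<^bsub>N\<^esub>" using rel by blast
      then show ?thesis
        using F[OF wu[OF x]] F[OF wu[OF y]] F[OF wu[OF Zi.M.a_closed[OF x y]]]
        by (simp add: module_relation3_iff[OF N])
    qed
    show "F (w[i := (?p, c \<odot>\<^bsub>grade (Z i) ?p\<^esub> x)]) = c \<odot>\<^bsub>N\<^esub> F (w[i := (?p, x)])"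
      if c: "c \<in> carrier R" for c
    proof -
      let ?r = "[(\<one>\<^bsub>R\<^esub>, w[i := (?p, c \<odot>\<^bsub>grade (Z i) ?p\<^esub> x)]), (\<ominus>\<^bsub>R\<^esub> c, w[i := (?p, x)])]"
      have "?r \<in> multilinear_rels R Z n m" using wu[OF x] c i unfolding multilinear_rels_def
          by blast
      then have "comb_eval N F ?r = \<zero>\<^bsub>N\<^esub>" using rel by blast
      then show ?thesis
        using F[OF wu[OF x]] F[OF wu[OF Zi.smult_closed[OF c x]]] c
        by (simp add: module_relation2_iff[OF N])
    qed
  qed (use F in blast)
qed

text \<open>The definition of the relators demands only that the words with \<open>x\<close> and
  \<open>y\<close> are admissible. For the word with the sum or the multiple this follows from
  closure of the carrier.\<close>

lemma multilinear_relators_formal: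
  assumes "cring R" "\<And>i p. module R (grade (Z i) p)" "r \<in> multilinear_rels R Z n m"
  shows "r \<in> formal_combs R (words Z n m)"
proof -
  interpret R: cring R by fact
  from assms(3) consider
      w i p x y where "r = [(\<one>\<^bsub>R\<^esub>, w[i := (p, x \<oplus>\<^bsub>grade (Z i) p\<^esub> y)]),
          (\<ominus>\<^bsub>R\<^esub> \<one>\<^bsub>R\<^esub>, w[i := (p, x)]), (\<ominus>\<^bsub>R\<^esub> \<one>\<^bsub>R\<^esub>, w[i := (p, y)])]"
        "i < n" "w[i := (p, x)] \<in> words Z n m" "w[i := (p, y)] \<in> words Z n m"
    | w i p c x where "r = [(\<one>\<^bsub>R\<^esub>, w[i := (p, c \<odot>\<^bsub>grade (Z i) p\<^esub> x)]), (\<ominus>\<^bsub>R\<^esub> c, w[i := (p, x)])]"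
        "i < n" "c \<in> carrier R" "w[i := (p, x)] \<in> words Z n m"
      unfolding multilinear_rels_def by blast
  then show ?thesis
  proof cases
    case (1 w i p x y)
    interpret Zi: module R "grade (Z i) p" by (rule assms(2))
    have l: "i < length w" using 1 words_length by fastforce
    have "x \<oplus>\<^bsub>grade (Z i) p\<^esub> y \<in> carrier (grade (Z i) p)"
      using words_nth[OF 1(3,2)] words_nth[OF 1(4,2)] l by auto
    then show ?thesis using 1 word_update[OF 1(3,2)] l by simp
  next
    case (2 w i p c x)
    interpret Zi: module R "grade (Z i) p" by (rule assms(2))
    have l: "i < length w" using 2 words_length by fastforce
    have "c \<odot>\<^bsub>grade (Z i) p\<^esub> x \<in> carrier (grade (Z i) p)"
      using words_nth[OF 2(4,2)] l 2 by auto
    then show ?thesis using 2 word_update[OF 2(4,2)] l by simp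
  qed
qed

section \<open>Koszul signs\<close>

text \<open>The sign rule for moving an operator of odd degree in slot \<open>i\<close> past
  \<open>\<sigma>\<close>. Changing the degree in slot \<open>i\<close> by \<open>\<delta>\<close>
  changes the exponent \<open>\<kappa>\<close> by \<open>\<delta>\<close> times the degrees of the
  slots that \<open>\<sigma>\<close> inverts with \<open>i\<close>: those before \<open>i\<close>
  sum to \<open>Y\<close>, those after it to \<open>Z\<close>. With \<open>X\<close> for the slots
  before \<open>i\<close> that are not inverted, the prefix degree is \<open>X + Y\<close> at
  \<open>i\<close> and \<open>X + Z\<close> at \<open>\<sigma> i\<close>. The total difference is
  \<open>(1 + \<delta>) Y + (\<delta> - 1) Z\<close>, which is even.\<close>

lemma koszul_exponent_parity:
  fixes d :: "nat \<Rightarrow> int"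
  assumes \<sigma>: "\<sigma> permutes {..<n}" and i: "i < n" and \<delta>: "odd \<delta>"
  defines "\<kappa> \<equiv> (\<lambda>d. \<Sum>(a, b)\<in>{(a, b). a < b \<and> b < n \<and> \<sigma> b < \<sigma> a}. d a * d b)"
  shows "even ((\<Sum>j<i. d j) + \<kappa> (d(i := d i + \<delta>)) - (\<kappa> d + (\<Sum>k<\<sigma> i. d (inv_into UNIV \<sigma> k))))"
proof -
  let ?I = "{(a, b). a < b \<and> b < n \<and> \<sigma> b < \<sigma> a}"
  have fin: "finite ?I" by (rule finite_subset[of _ "{..<n} \<times> {..<n}"]) auto
  have inj: "\<sigma> a = \<sigma> b \<longleftrightarrow> a = b" for a b using permutes_inj[OF \<sigma>] by (auto dest: injD)
  define X where "X = (\<Sum>j\<in>{j. j < i \<and> \<sigma> j < \<sigma> i}. d j)"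
  define Y where "Y = (\<Sum>j\<in>{j. j < i \<and> \<sigma> i < \<sigma> j}. d j)"
  define Z where "Z = (\<Sum>j\<in>{j. i < j \<and> j < n \<and> \<sigma> j < \<sigma> i}. d j)"
  have "\<kappa> (d(i := d i + \<delta>)) =
      (\<Sum>x\<in>?I. d (fst x) * d (snd x) + (if fst x = i then \<delta> * d (snd x) else 0) + (if snd x =
          i then \<delta> * d (fst x) else 0))"
    unfolding \<kappa>_def by (rule sum.cong) (auto simp: algebra_simps)
  also have "\<dots> = \<kappa> d + (\<Sum>x\<in>?I. if fst x = i then \<delta> * d (snd x) else 0) + (\<Sum>x\<in>?I. if snd x =
      i then \<delta> * d (fst x) else 0)"
    by (simp add: \<kappa>_def sum.distrib case_prod_beta)
  also have "(\<Sum>x\<in>?I. if fst x = i then \<delta> * d (snd x) else 0) =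
      (\<Sum>x\<in>{x\<in>?I. fst x = i}. \<delta> * d (snd x))"
    by (rule sum.inter_filter[OF fin, symmetric])
  also have "{x\<in>?I. fst x = i} = Pair i ` {j. i < j \<and> j < n \<and> \<sigma> j < \<sigma> i}" by auto
  also have "(\<Sum>x\<in>Pair i ` {j. i < j \<and> j < n \<and> \<sigma> j < \<sigma> i}. \<delta> * d (snd x)) = \<delta> * Z"
    by (subst sum.reindex) (auto simp: inj_on_def Z_def sum_distrib_left)
  also have "(\<Sum>x\<in>?I. if snd x = i then \<delta> * d (fst x) else 0) =
      (\<Sum>x\<in>{x\<in>?I. snd x = i}. \<delta> * d (fst x))"
    by (rule sum.inter_filter[OF fin, symmetric])
  also have "{x\<in>?I. snd x = i} = (\<lambda>j. (j, i)) ` {j. j < i \<and> \<sigma> i < \<sigma> j}" using i by auto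
  also have "(\<Sum>x\<in>(\<lambda>j. (j, i)) ` {j. j < i \<and> \<sigma> i < \<sigma> j}. \<delta> * d (fst x)) = \<delta> * Y"
    by (subst sum.reindex) (auto simp: inj_on_def Y_def sum_distrib_left)
  finally have 1: "\<kappa> (d(i := d i + \<delta>)) = \<kappa> d + \<delta> * Z + \<delta> * Y" .
  have split: "{..<i} = {j. j < i \<and> \<sigma> j < \<sigma> i} \<union> {j. j < i \<and> \<sigma> i < \<sigma> j}"
    using inj by (auto simp: not_less le_less)
  have 2: "(\<Sum>j<i. d j) = X + Y"
    unfolding split X_def Y_def by (rule sum.union_disjoint) auto
  have \<sigma>i: "\<sigma> i < n" using permutes_in_image[OF \<sigma>, of i] i by simp
  have "{..<\<sigma> i} = \<sigma> ` {j. j < n \<and> \<sigma> j < \<sigma> i}"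
  proof (intro Set.set_eqI iffI)
    fix k assume k: "k \<in> {..<\<sigma> i}"
    then have "inv_into UNIV \<sigma> k < n"
      using permutes_in_image[OF permutes_inv[OF \<sigma>], of k] \<sigma>i by simp
    then show "k \<in> \<sigma> ` {j. j < n \<and> \<sigma> j < \<sigma> i}"
      using k permutes_inverses(1)[OF \<sigma>, of k] by (intro image_eqI[of _ _ "inv_into UNIV \<sigma> k"]) auto
  qed auto
  then have "(\<Sum>k<\<sigma> i. d (inv_into UNIV \<sigma> k)) = (\<Sum>j\<in>{j. j < n \<and> \<sigma> j < \<sigma> i}. d j)"
    using permutes_inj[OF \<sigma>] permutes_inverses(2)[OF \<sigma>]
    by (simp add: sum.reindex inj_on_subset[OF _ subset_UNIV])
  also have "{j. j < n \<and> \<sigma> j < \<sigma> i} = {j. j < i \<and> \<sigma> j < \<sigma> i} \<union> {j. i < j \<and> j < n \<and> \<sigma> j < \<sigma> i}"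
    using i by (auto simp: neq_iff) (metis less_irrefl linorder_neqE_nat)
  also have "sum d \<dots> = X + Z" unfolding X_def Z_def by (rule sum.union_disjoint) auto
  finally have 3: "(\<Sum>k<\<sigma> i. d (inv_into UNIV \<sigma> k)) = X + Z" .
  have "X + Y + (\<kappa> d + \<delta> * Z + \<delta> * Y) - (\<kappa> d + (X + Z)) = (1 + \<delta>) * Y + (\<delta> - 1) * Z"
    by (simp add: algebra_simps)
  then show ?thesis unfolding 1 2 3 using \<delta> by simp
qed

section \<open>Permutation of the factors of a word\<close>

lemma length_permute_word [simp]: "length (permute_word \<sigma> w) = length w"
  by (simp add: permute_word_def)

lemma nth_permute_word:
  "i < length w \<Longrightarrow> permute_word \<sigma> w ! i = w ! inv_into UNIV \<sigma> i"
  by (simp add: permute_word_def permute_list_def)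

lemma permute_word_update:
  assumes "\<sigma> permutes {..<length w}" "i < length w"
  shows "permute_word \<sigma> (w[i := v]) = (permute_word \<sigma> w)[\<sigma> i := v]"
proof (rule nth_equalityI)
  fix k assume "k < length (permute_word \<sigma> (w[i := v]))"
  then have k: "k < length w" by simp
  have "inv_into UNIV \<sigma> k < length w"
    using permutes_in_image[OF permutes_inv[OF assms(1)], of k] k by simp
  moreover have "i = inv_into UNIV \<sigma> k \<longleftrightarrow> \<sigma> i = k"
    using permutes_inverses[OF assms(1)] by metis
  moreover have "\<sigma> i < length w" using permutes_in_image[OF assms(1), of i] assms(2) by simp
  ultimately show "permute_word \<sigma> (w[i := v]) ! k = (permute_word \<sigma> w)[\<sigma> i := v] ! k"
    using k assms(2) by (cases "\<sigma> i = k") (auto simp: nth_permute_word)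
qed simp

lemma permute_word_words:
  assumes "\<sigma> permutes {..<n}" "w \<in> words (\<lambda>_. B) n m"
  shows "permute_word \<sigma> w \<in> words (\<lambda>_. B) n m"
proof -
  have inv: "inv_into UNIV \<sigma> permutes {..<n}" by (rule permutes_inv[OF assms(1)])
  have "inv_into UNIV \<sigma> i < n" if "i < n" for i using permutes_in_image[OF inv, of i] that by simp
  moreover have "(\<Sum>i<n. fst (w ! inv_into UNIV \<sigma> i)) = (\<Sum>i<n. fst (w ! i))"
    using sum.permute[OF inv, of "\<lambda>i. fst (w ! i)"] by (simp add: comp_def)
  ultimately show ?thesis
    using assms(2) by (auto simp: words_iff nth_permute_word)
qed

text \<open>Varying slot \<open>i\<close> of a word varies slot \<open>\<sigma> i\<close> of the
  permuted word, in the same degree.\<close>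

lemma multilinear_permute:
  assumes \<sigma>: "\<sigma> permutes {..<n}" and F: "multilinear R (\<lambda>_. B) n m N F"
  shows "multilinear R (\<lambda>_. B) n m N (\<lambda>w. F (permute_word \<sigma> w))"
  unfolding multilinear_def
proof (intro ballI conjI allI impI)
  fix w assume w: "w \<in> words (\<lambda>_. B) n m"
  note pw = permute_word_words[OF \<sigma> w]
  show "F (permute_word \<sigma> w) \<in> carrier N" by (rule multilinear_closed[OF F pw])
  fix i assume i: "i < n"
  have l: "length w = n" by (rule words_length[OF w])
  have \<sigma>i: "\<sigma> i < n" using permutes_in_image[OF \<sigma>, of i] i by simp
  have "permute_word \<sigma> w ! \<sigma> i = w ! i" using \<sigma>i l permutes_inverses(2)[OF \<sigma>]
      by (simp add: nth_permute_word)
  then show "(\<lambda>x. F (permute_word \<sigma> (w[i := (fst (w ! i), x)]))) \<in> linear_maps R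
      (grade B (fst (w ! i))) N"
    using multilinear_slot[OF F pw \<sigma>i] permute_word_update[of \<sigma> w i] \<sigma> i l by simp
qed

section \<open>Finite sums in modules\<close>

lemma finsum_swap:
  assumes "abelian_monoid N" "finite I" "finite J" "\<And>i j. i \<in> I \<Longrightarrow> j \<in> J \<Longrightarrow> t i j \<in> carrier N"
  shows "finsum N (\<lambda>i. finsum N (\<lambda>j. t i j) J) I = finsum N (\<lambda>j. finsum N (\<lambda>i. t i j) I) J"
proof -
  interpret N: abelian_monoid N by fact
  show ?thesis using assms(2,4)
  proof (induction rule: finite_induct)
    case empty
    then show ?case by (simp add: N.finsum_zero)
  next
    case (insert i I)
    have "finsum N (\<lambda>i. finsum N (t i) J) (insert i I) = finsum N (t i) J \<oplus>\<^bsub>N\<^esub> finsum N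
        (\<lambda>i. finsum N (t i) J) I"
      using insert by (intro N.finsum_insert) (auto intro!: N.finsum_closed)
    also have "\<dots> = finsum N (t i) J \<oplus>\<^bsub>N\<^esub> finsum N (\<lambda>j. finsum N (\<lambda>i. t i j) I) J"
      using insert by simp
    also have "\<dots> = finsum N (\<lambda>j. t i j \<oplus>\<^bsub>N\<^esub> finsum N (\<lambda>i. t i j) I) J"
      using insert by (intro N.finsum_addf[symmetric]) (auto intro!: N.finsum_closed)
    also have "\<dots> = finsum N (\<lambda>j. finsum N (\<lambda>i. t i j) (insert i I)) J"
      using insert by (intro N.finsum_cong') (auto intro!: N.finsum_insert[symmetric]
          N.finsum_closed)
    finally show ?case .
  qed
qed

text \<open>Once the order of summation in the second double sum is exchanged, \<open>t i j\<close>
  stands next to \<open>t' j i\<close>, and off the diagonal these cancel. The double sums will be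
  two sums of one-slot operators composed in both orders.\<close>

lemma finsum_anticommuting:
  assumes "abelian_group N" "finite I"
    and t: "\<And>i j. i \<in> I \<Longrightarrow> j \<in> I \<Longrightarrow> t i j \<in> carrier N" "\<And>i j. i \<in> I \<Longrightarrow> j \<in> I \<Longrightarrow> t' i j \<in> carrier N"
    and anti: "\<And>i j. i \<in> I \<Longrightarrow> j \<in> I \<Longrightarrow> i \<noteq> j \<Longrightarrow> t i j \<oplus>\<^bsub>N\<^esub> t' j i = \<zero>\<^bsub>N\<^esub>"
  shows "finsum N (\<lambda>i. finsum N (t i) I) I \<oplus>\<^bsub>N\<^esub> finsum N (\<lambda>j. finsum N (t' j) I) I =
    finsum N (\<lambda>i. t i i \<oplus>\<^bsub>N\<^esub> t' i i) I"
proof -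
  interpret N: abelian_group N by fact
  have "finsum N (\<lambda>j. finsum N (t' j) I) I = finsum N (\<lambda>i. finsum N (\<lambda>j. t' j i) I) I"
    by (rule finsum_swap[OF N.abelian_monoid_axioms assms(2,2) t(2)])
  then have "finsum N (\<lambda>i. finsum N (t i) I) I \<oplus>\<^bsub>N\<^esub> finsum N (\<lambda>j. finsum N (t' j) I) I =
      finsum N (\<lambda>i. finsum N (t i) I \<oplus>\<^bsub>N\<^esub> finsum N (\<lambda>j. t' j i) I) I"
    using t by (simp add: N.finsum_addf N.finsum_closed Pi_def)
  also have "\<dots> = finsum N (\<lambda>i. t i i \<oplus>\<^bsub>N\<^esub> t' i i) I"
  proof (rule N.finsum_cong')
    fix i assume i: "i \<in> I"
    have "finsum N (t i) I \<oplus>\<^bsub>N\<^esub> finsum N (\<lambda>j. t' j i) I = finsum N (\<lambda>j. t i j \<oplus>\<^bsub>N\<^esub> t' j i) I"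
      using t i by (intro N.finsum_addf[symmetric]) auto
    also have "\<dots> = finsum N (\<lambda>j. if i = j then t i i \<oplus>\<^bsub>N\<^esub> t' i i else \<zero>\<^bsub>N\<^esub>) I"
      using t i anti by (intro N.finsum_cong') auto
    also have "\<dots> = t i i \<oplus>\<^bsub>N\<^esub> t' i i"
      using N.finsum_singleton[OF i assms(2), of "\<lambda>j. t i i \<oplus>\<^bsub>N\<^esub> t' i i"] t i by simp
    finally show "finsum N (t i) I \<oplus>\<^bsub>N\<^esub> finsum N (\<lambda>j. t' j i) I = t i i \<oplus>\<^bsub>N\<^esub> t' i i" .
  qed (use t in auto)
  finally show ?thesis .
qed

text \<open>The origin of the integer \<open>n\<close> that the homotopy has to be divided
  by.\<close>

lemma finsum_const_smult:
  assumes "module R N" "y \<in> carrier N"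
  shows "finsum N (\<lambda>i. y) {..<n::nat} = ([n] \<cdot>\<^bsub>R\<^esub> \<one>\<^bsub>R\<^esub>) \<odot>\<^bsub>N\<^esub> y"
proof -
  interpret N: module R N by fact
  show ?thesis
  proof (induction n)
    case 0
    then show ?case using assms(2) by simp
  next
    case (Suc n)
    have "finsum N (\<lambda>i. y) {..<Suc n} = y \<oplus>\<^bsub>N\<^esub> finsum N (\<lambda>i. y) {..<n}"
      unfolding lessThan_Suc by (rule N.finsum_insert) (use assms(2) in auto)
    then show ?case using Suc assms(2) by (simp add: N.smult_l_distr N.M.a_comm)
  qed
qed

text \<open>Connects the boundary of a word, a list indexed by the slots, with the finite sums in
  which sign cancellation and reindexing take place.\<close>

lemma comb_eval_map_upt:
  assumes "module R N" "\<And>i. i < k \<Longrightarrow> c i \<in> carrier R" "\<And>i. i < k \<Longrightarrow> F (g i) \<in> carrier N"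
  shows "comb_eval N F (map (\<lambda>i. (c i, g i)) [0..<k]) = finsum N (\<lambda>i. c i \<odot>\<^bsub>N\<^esub> F (g i)) {..<k}"
  using assms(2,3)
proof (induction k)
  case 0
  interpret N: module R N by fact
  show ?case by simp
next
  case (Suc k)
  interpret N: module R N by fact
  have "comb_eval N F (map (\<lambda>i. (c i, g i)) [0..<Suc k]) =
      comb_eval N F (map (\<lambda>i. (c i, g i)) [0..<k]) \<oplus>\<^bsub>N\<^esub> comb_eval N F [(c k, g k)]"
    unfolding upt_Suc_append[OF le0] map_append
    by (subst comb_eval_append[OF assms(1), where G = "g ` {..<Suc k}"])
      (use Suc.prems in \<open>auto simp: formal_combs_def\<close>)
  moreover have "finsum N (\<lambda>i. c i \<odot>\<^bsub>N\<^esub> F (g i)) {..<Suc k} =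
      c k \<odot>\<^bsub>N\<^esub> F (g k) \<oplus>\<^bsub>N\<^esub> finsum N (\<lambda>i. c i \<odot>\<^bsub>N\<^esub> F (g i)) {..<k}"
    unfolding lessThan_Suc by (rule N.finsum_insert) (use Suc.prems in auto)
  moreover have "finsum N (\<lambda>i. c i \<odot>\<^bsub>N\<^esub> F (g i)) {..<k} \<in> carrier N"
    by (rule N.finsum_closed) (use Suc.prems in auto)
  ultimately show ?case using Suc by (simp add: N.M.a_comm)
qed

section \<open>Operators on tensor powers\<close>

text \<open>The operator \<open>a\<close> of degree \<open>\<delta>\<close> in slot \<open>i\<close>
  and the identity in all others, without sign.\<close>

definition upd :: "int \<Rightarrow> (int \<Rightarrow> 'a \<Rightarrow> 'a) \<Rightarrow> nat \<Rightarrow> (int \<times> 'a) list \<Rightarrow> (int \<times> 'a) list" where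
  "upd \<delta> a i w = w[i := (fst (w ! i) + \<delta>, a (fst (w ! i)) (snd (w ! i)))]"

lemma length_upd [simp]: "length (upd \<delta> a i w) = length w"
  by (simp add: upd_def)

lemma nth_upd:
  "i < length w \<Longrightarrow> upd \<delta> a i w ! j =
      (if i = j then (fst (w ! i) + \<delta>, a (fst (w ! i)) (snd (w ! i))) else w ! j)"
  by (simp add: upd_def nth_list_update)

lemma upd_slot_map:
  "i < length w \<Longrightarrow> upd \<delta> a i w =
    slot_map (\<lambda>j. if j = i then \<delta> else 0) (\<lambda>j. if j = i then a else (\<lambda>_ x. x)) w"
  by (rule nth_equalityI) (auto simp: nth_upd)

lemma upd_commute: "i \<noteq> j \<Longrightarrow> upd \<delta> a i (upd \<epsilon> b j w) = upd \<epsilon> b j (upd \<delta> a i w)"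
  by (simp add: upd_def list_update_swap)

text \<open>An operator in slot \<open>i\<close> changes the prefix degrees, and so the signs, of
  later slots only. This asymmetry is why odd operators in different slots anticommute.\<close>

lemma prefix_degree_upd:
  assumes "i < length w"
  shows "(\<Sum>j<k. fst (upd \<delta> a i w ! j)) = (\<Sum>j<k. fst (w ! j)) + (if i < k then \<delta> else 0)"
proof -
  have "(\<Sum>j<k. fst (upd \<delta> a i w ! j)) = (\<Sum>j<k. fst (w ! j) + (if j = i then \<delta> else 0))"
    using assms by (intro sum.cong) (auto simp: nth_upd)
  then show ?thesis by (simp add: sum.distrib)
qed

locale tensor_power_complex = R: cring R for R :: "('k, 'r) ring_scheme" +
  fixes B :: "('k, 'a) cplx" and n :: nat
  assumes B: "chain_complex R B"
begin

abbreviation T where "T \<equiv> tensor_power R B n"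
abbreviation W where "W \<equiv> words (\<lambda>_. B) n"
abbreviation wg where "wg m \<equiv> pgen R (words (\<lambda>_. B) n m) (multilinear_rels R (\<lambda>_. B) n m)"
abbreviation linear_family where
  "linear_family \<delta> a \<equiv> (\<forall>p. a p \<in> linear_maps R (grade B p) (grade B (p + \<delta>)))"

lemmas B_module = cc_module[OF B]

lemma grade_T: "grade T m = presented_module R (W m) (multilinear_rels R (\<lambda>_. B) n m)"
  by (simp add: tensor_power_def presented_cplx_def)

lemma T_module: "module R (grade T m)"
  unfolding grade_T by (rule module_presented[OF R.is_cring])

lemma wg_closed: "w \<in> W m \<Longrightarrow> wg m w \<in> carrier (grade T m)"
  unfolding grade_T by (rule pgen_closed[OF R.is_cring])

lemma wg_multilinear: "multilinear R (\<lambda>_. B) n m (grade T m) (wg m)"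
  using multilinear_iff_relators[OF T_module, of "\<lambda>_. B" n m "wg m" m] B_module wg_closed
    comb_eval_relator[OF R.is_cring] multilinear_relators_formal[OF R.is_cring, of "\<lambda>_. B"]
  unfolding grade_T by blast

text \<open>The universal property of the tensor power, through which \<open>Der\<close>,
  \<open>tpow\<close> and \<open>ret\<close> are defined.\<close>

lemma T_lift:
  assumes "module R N" "multilinear R (\<lambda>_. B) n m N F"
  shows T_lift_linear: "lin_ext N F \<in> linear_maps R (grade T m) N"
    and T_lift_wg: "w \<in> W m \<Longrightarrow> lin_ext N F (wg m w) = F w"
proof -
  have F: "F \<in> W m \<rightarrow> carrier N" using multilinear_closed[OF assms(2)] by blast
  have rel: "comb_eval N F r = \<zero>\<^bsub>N\<^esub>" if "r \<in> multilinear_rels R (\<lambda>_. B) n m" for r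
    using multilinear_iff_relators[OF assms(1), of "\<lambda>_. B" n m F] B_module
      multilinear_closed[OF assms(2)] assms(2) that by blast
  show "lin_ext N F \<in> linear_maps R (grade T m) N"
    unfolding grade_T by (rule lin_ext_linear[OF R.is_cring assms(1) F rel])
  show "w \<in> W m \<Longrightarrow> lin_ext N F (wg m w) = F w"
    by (rule lin_ext_pgen[OF R.is_cring assms(1) F rel])
qed

lemma T_eqI:
  assumes "module R N" "h \<in> linear_maps R (grade T m) N" "k \<in> linear_maps R (grade T m) N"
    and "\<And>w. w \<in> W m \<Longrightarrow> h (wg m w) = k (wg m w)" "t \<in> carrier (grade T m)"
  shows "h t = k t"
  by (rule presented_maps_eqI[OF R.is_cring assms(1) assms(2,3)[unfolded grade_T] assms(4)
        assms(5)[unfolded grade_T]])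

lemma T_presented_map:
  assumes F: "\<And>w. w \<in> W m \<Longrightarrow> F w \<in> formal_combs R H \<and> comb_class R H Rel (F w) = \<Phi> w"
    and \<Phi>: "multilinear R (\<lambda>_. B) n m (presented_module R H Rel) \<Phi>"
  shows "presented_map R H Rel F \<in> linear_maps R (grade T m) (presented_module R H Rel)"
    and "w \<in> W m \<Longrightarrow> presented_map R H Rel F (wg m w) = \<Phi> w"
proof -
  let ?N = "presented_module R H Rel"
  note N = module_presented[OF R.is_cring, of H Rel]
  have F1: "F w \<in> formal_combs R H" if "w \<in> W m" for w using F[OF that] by simp
  have rel: "comb_eval ?N (\<lambda>w. comb_class R H Rel (F w)) r = \<zero>\<^bsub>?N\<^esub>"
    if r: "r \<in> multilinear_rels R (\<lambda>_. B) n m" for r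
  proof -
    have "comb_eval ?N (\<lambda>w. comb_class R H Rel (F w)) r = comb_eval ?N \<Phi> r"
      by (rule comb_eval_cong[OF _ multilinear_relators_formal[OF R.is_cring B_module r]])
        (use F in simp)
    also have "\<dots> = \<zero>\<^bsub>?N\<^esub>"
      using multilinear_iff_relators[OF N, of "\<lambda>_. B" n m \<Phi>] B_module
        multilinear_closed[OF \<Phi>] \<Phi> r by blast
    finally show ?thesis .
  qed
  show "presented_map R H Rel F \<in> linear_maps R (grade T m) ?N"
    unfolding grade_T by (rule presented_map_linear[OF R.is_cring F1 rel])
  show "w \<in> W m \<Longrightarrow> presented_map R H Rel F (wg m w) = \<Phi> w"
    using presented_map_pgen[OF R.is_cring F1 rel, where g = w] F by simp
qed

lemma upd_words:
  assumes "w \<in> W m" "i < n" "linear_family \<delta> a"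
  shows "upd \<delta> a i w \<in> W (m + \<delta>)"
proof -
  have "slot_map (\<lambda>j. if j = i then \<delta> else 0) (\<lambda>j. if j = i then a else (\<lambda>_ x. x)) w \<in> W (m + \<delta>)"
    by (rule slot_map_words[where R = R, OF assms(1)]) (use assms(2,3) linear_maps_id in auto)
  then show ?thesis using assms(2) words_length[OF assms(1)] by (simp add: upd_slot_map)
qed

lemma multilinear_upd:
  assumes "multilinear R (\<lambda>_. B) n (m + \<delta>) N F" "i < n" "linear_family \<delta> a"
  shows "multilinear R (\<lambda>_. B) n m N (\<lambda>w. F (upd \<delta> a i w))"
proof (rule multilinear_cong[where Z = "\<lambda>_. B"])
  show "multilinear R (\<lambda>_. B) n m N
      (\<lambda>w. F (slot_map (\<lambda>j. if j = i then \<delta> else 0) (\<lambda>j. if j = i then a else (\<lambda>_ x. x)) w))"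
    by (rule multilinear_slot_map[OF assms(1)]) (use assms(2,3) linear_maps_id in auto)
  fix w assume "w \<in> W m"
  then have "i < length w" using words_length assms(2) by blast
  then show "F (slot_map (\<lambda>j. if j = i then \<delta> else 0) (\<lambda>j. if j = i then a else (\<lambda>_ x. x)) w) =
      F (upd \<delta> a i w)"
    by (simp add: upd_slot_map)
qed (rule B_module)

text \<open>For odd \<open>\<delta>\<close> this extends \<open>a\<close> to the tensor power by the
  graded Leibniz rule: passing the factors before slot \<open>i\<close> costs the parity of their
  total degree.\<close>

definition Der_term where
  "Der_term \<delta> a m w = finsum (grade T (m + \<delta>))
    (\<lambda>i. parity_sign R (\<Sum>j<i. fst (w ! j)) \<odot>\<^bsub>grade T (m + \<delta>)\<^esub> wg (m + \<delta>) (upd \<delta> a i w)) {..<n}"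

text \<open>
  The differential (\<open>\<delta> = -1\<close>) and the homotopy (\<open>\<delta> = 1\<close>) are both of this kind, so that
  well-definedness, equivariance and the sign cancellations are proved only once.
\<close>

definition Der where
  "Der \<delta> a m = lin_ext (grade T (m + \<delta>)) (Der_term \<delta> a m)"

lemma Der_term_multilinear:
  assumes "linear_family \<delta> a"
  shows "multilinear R (\<lambda>_. B) n m (grade T (m + \<delta>)) (Der_term \<delta> a m)"
proof -
  have "multilinear R (\<lambda>_. B) n m (grade T (m + \<delta>))
      (\<lambda>w. parity_sign R (\<Sum>j<i. fst (w ! j)) \<odot>\<^bsub>grade T (m + \<delta>)\<^esub> wg (m + \<delta>) (upd \<delta> a i w))"
    if i: "i < n" for i
  proof (rule multilinear_cong)
    \<comment> \<open>Here the sign is written as a function of the list of degrees, which does not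
      change when the element in a slot is varied.\<close>
    show "multilinear R (\<lambda>_. B) n m (grade T (m + \<delta>))
      (\<lambda>w. parity_sign R (\<Sum>j<i. map fst w ! j) \<odot>\<^bsub>grade T (m + \<delta>)\<^esub> wg (m + \<delta>) (upd \<delta> a i w))"
      by (rule multilinear_scale[OF multilinear_upd[OF wg_multilinear i assms] T_module,
            where c = "\<lambda>d. parity_sign R (\<Sum>j<i. d ! j)"]) simp
    fix w assume "w \<in> W m"
    then have "length w = n" by (rule words_length)
    then have "(\<Sum>j<i. map fst w ! j) = (\<Sum>j<i. fst (w ! j))" using i by (intro sum.cong) auto
    then show "parity_sign R (\<Sum>j<i. map fst w ! j) \<odot>\<^bsub>grade T (m + \<delta>)\<^esub> wg (m + \<delta>) (upd \<delta> a i w) =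
        parity_sign R (\<Sum>j<i. fst (w ! j)) \<odot>\<^bsub>grade T (m + \<delta>)\<^esub> wg (m + \<delta>) (upd \<delta> a i w)"
      by simp
  qed (rule B_module)
  then show ?thesis
    unfolding Der_term_def[abs_def] by (intro multilinear_finsum[OF T_module])
        (use B_module in auto)
qed

lemma Der_linear: "linear_family \<delta> a \<Longrightarrow> Der \<delta> a m \<in> linear_maps R (grade T m) (grade T (m + \<delta>))"
  unfolding Der_def by (rule T_lift_linear[OF T_module Der_term_multilinear])

lemma Der_wg: "linear_family \<delta> a \<Longrightarrow> w \<in> W m \<Longrightarrow> Der \<delta> a m (wg m w) = Der_term \<delta> a m w"
  unfolding Der_def by (rule T_lift_wg[OF T_module Der_term_multilinear])

lemma word_bdry_eq:
  "word_bdry R Z w = map (\<lambda>i. (parity_sign R (\<Sum>j<i. fst (w ! j)), upd (- 1) (bdry (Z i)) i w))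
      [0..<length w]"
  unfolding word_bdry_def upd_def
  by (rule map_cong) (auto simp: sum_list_sum_nth atLeast0LessThan min_def intro!: sum.cong
      arg_cong[of _ _ "parity_sign R"])

lemma bdry_family: "linear_family (- 1) (bdry B)"
  using cc_bdry[OF B] by simp

text \<open>Once the boundary is a \<open>Der\<close>, its square and its equivariance are instances
  of general statements. The equation is asserted on the carrier only, since the two sides are built
  differently as functions on sets.\<close>

lemma T_bdry:
  shows T_bdry_linear: "bdry T m \<in> linear_maps R (grade T m) (grade T (m - 1))"
    and T_bdry_eq: "t \<in> carrier (grade T m) \<Longrightarrow> bdry T m t = Der (- 1) (bdry B) m t"
proof -
  let ?H = "W (m - 1)" and ?Rel = "multilinear_rels R (\<lambda>_. B) n (m - 1)"
  have bd: "bdry T m = presented_map R ?H ?Rel (word_bdry R (\<lambda>_. B))"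
    by (simp add: tensor_power_def presented_cplx_def)
  have F: "word_bdry R (\<lambda>_. B) w \<in> formal_combs R ?H \<and>
      comb_class R ?H ?Rel (word_bdry R (\<lambda>_. B) w) = Der_term (- 1) (bdry B) m w" if w: "w \<in> W
          m" for w
  proof -
    have u: "upd (- 1) (bdry B) i w \<in> ?H" if "i < n" for i
      using upd_words[OF w that bdry_family] by simp
    then have fc: "word_bdry R (\<lambda>_. B) w \<in> formal_combs R ?H"
      using words_length[OF w] by (auto simp: word_bdry_eq formal_combs_def)
    have "comb_class R ?H ?Rel (word_bdry R (\<lambda>_. B) w) = comb_eval (grade T (m - 1)) (wg (m - 1))
        (word_bdry R (\<lambda>_. B) w)"
      unfolding grade_T by (rule comb_class_eval[OF R.is_cring fc])
    also have "\<dots> = Der_term (- 1) (bdry B) m w"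
      unfolding word_bdry_eq words_length[OF w] Der_term_def
      using comb_eval_map_upt[OF T_module, of n _ "wg (m - 1)" _ "m - 1"] wg_closed[OF u] by simp
    finally show ?thesis using fc by simp
  qed
  have ml: "multilinear R (\<lambda>_. B) n m (presented_module R ?H ?Rel) (Der_term (- 1) (bdry B) m)"
    using Der_term_multilinear[OF bdry_family] by (simp add: grade_T)
  show l: "bdry T m \<in> linear_maps R (grade T m) (grade T (m - 1))"
    unfolding bd grade_T[of "m - 1"] by (rule T_presented_map(1)[OF F ml])
  have Dl: "Der (- 1) (bdry B) m \<in> linear_maps R (grade T m) (grade T (m - 1))"
    using Der_linear[OF bdry_family] by simp
  show "t \<in> carrier (grade T m) \<Longrightarrow> bdry T m t = Der (- 1) (bdry B) m t"
    by (rule T_eqI[OF T_module l Dl])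
      (simp_all add: Der_wg[OF bdry_family] bd T_presented_map(2)[OF F ml])
qed

lemma Der_Der_wg:
  assumes a: "linear_family \<delta> a" and b: "linear_family \<epsilon> b" and w: "w \<in> W m"
  shows "Der \<delta> a (m + \<epsilon>) (Der \<epsilon> b m (wg m w)) = finsum (grade T (m + \<epsilon> + \<delta>))
      (\<lambda>i. finsum (grade T (m + \<epsilon> + \<delta>)) (\<lambda>j.
      parity_sign R (\<Sum>k<i. fst (w ! k)) \<odot>\<^bsub>grade T (m + \<epsilon> + \<delta>)\<^esub>
      (parity_sign R (\<Sum>k<j. fst (upd \<epsilon> b i w ! k)) \<odot>\<^bsub>grade T (m + \<epsilon> + \<delta>)\<^esub>
        wg (m + \<epsilon> + \<delta>) (upd \<delta> a j (upd \<epsilon> b i w)))) {..<n}) {..<n}"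
proof -
  let ?N = "grade T (m + \<epsilon> + \<delta>)" and ?M = "grade T (m + \<epsilon>)"
  interpret N: module R ?N by (rule T_module)
  interpret M: module R ?M by (rule T_module)
  note Dl = Der_linear[OF a, of "m + \<epsilon>"]
  have u: "upd \<epsilon> b i w \<in> W (m + \<epsilon>)" if "i < n" for i by (rule upd_words[OF w that b])
  have uu: "upd \<delta> a j (upd \<epsilon> b i w) \<in> W (m + \<epsilon> + \<delta>)" if "i < n" "j < n" for i j
    by (rule upd_words[OF u[OF that(1)] that(2) a])
  have "Der \<delta> a (m + \<epsilon>) (Der \<epsilon> b m (wg m w)) = Der \<delta> a (m + \<epsilon>) (Der_term \<epsilon> b m w)"
    by (simp add: Der_wg[OF b w])
  also have "\<dots> = finsum ?N (\<lambda>i. Der \<delta> a (m + \<epsilon>)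
      (parity_sign R (\<Sum>k<i. fst (w ! k)) \<odot>\<^bsub>?M\<^esub> wg (m + \<epsilon>) (upd \<epsilon> b i w))) {..<n}"
    unfolding Der_term_def
    by (rule linear_maps_finsum[OF Dl T_module T_module]) (use wg_closed[OF u] in auto)
  also have "\<dots> = finsum ?N (\<lambda>i. finsum ?N (\<lambda>j. parity_sign R (\<Sum>k<i. fst (w ! k)) \<odot>\<^bsub>?N\<^esub>
      (parity_sign R (\<Sum>k<j. fst (upd \<epsilon> b i w ! k)) \<odot>\<^bsub>?N\<^esub> wg (m + \<epsilon> + \<delta>) (upd \<delta> a j (upd \<epsilon> b i w))))
          {..<n}) {..<n}"
  proof (rule N.finsum_cong')
    fix i assume "i \<in> {..<n}"
    then have i: "i < n" by simp
    have "Der \<delta> a (m + \<epsilon>) (parity_sign R (\<Sum>k<i. fst (w ! k)) \<odot>\<^bsub>?M\<^esub> wg (m + \<epsilon>) (upd \<epsilon> b i w)) =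
        parity_sign R (\<Sum>k<i. fst (w ! k)) \<odot>\<^bsub>?N\<^esub> Der_term \<delta> a (m + \<epsilon>) (upd \<epsilon> b i w)"
      using linear_maps_smult[OF Dl R.parity_sign_closed wg_closed[OF u[OF i]]]
          Der_wg[OF a u[OF i]] by simp
    also have "\<dots> = finsum ?N (\<lambda>j. parity_sign R (\<Sum>k<i. fst (w ! k)) \<odot>\<^bsub>?N\<^esub>
      (parity_sign R (\<Sum>k<j. fst (upd \<epsilon> b i w ! k)) \<odot>\<^bsub>?N\<^esub> wg (m + \<epsilon> + \<delta>) (upd \<delta> a j (upd \<epsilon> b i w))))
          {..<n}"
      unfolding Der_term_def
      by (rule N.finsum_smult_ldistr) (use wg_closed[OF uu[OF i]] in auto)
    finally show "Der \<delta> a (m + \<epsilon>) (parity_sign R (\<Sum>k<i. fst (w ! k)) \<odot>\<^bsub>?M\<^esub> wg (m + \<epsilon>) (upd \<epsilon> b i w))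
        = \<dots>" .
  qed (use wg_closed[OF uu] in \<open>auto intro!: N.finsum_closed\<close>)
  finally show ?thesis .
qed

text \<open>Odd operators in different slots anticommute, so only compositions in one and the same
  slot survive. There the sign occurs twice and squares to one, and the two compositions add up by
  linearity in the slot. The remaining operator has even degree, hence carries no sign.\<close>

lemma Der_anticommutator:
  assumes a: "linear_family \<delta> a" and b: "linear_family \<epsilon> b" and w: "w \<in> W m" and odd: "odd \<delta>"
      "odd \<epsilon>"
  shows "Der \<delta> a (m + \<epsilon>) (Der \<epsilon> b m (wg m w)) \<oplus>\<^bsub>grade T (m + \<epsilon> + \<delta>)\<^esub> Der \<epsilon> b (m + \<delta>)
      (Der \<delta> a m (wg m w)) =
    finsum (grade T (m + \<epsilon> + \<delta>)) (\<lambda>i. wg (m + \<epsilon> + \<delta>)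
      (upd (\<epsilon> + \<delta>) (\<lambda>p x. a (p + \<epsilon>) (b p x) \<oplus>\<^bsub>grade B (p + \<epsilon> + \<delta>)\<^esub> b (p + \<delta>) (a p x)) i w)) {..<n}"
proof -
  let ?m = "m + \<epsilon> + \<delta>"
  let ?N = "grade T ?m"
  interpret N: module R ?N by (rule T_module)
  let ?s = "\<lambda>i w. parity_sign R (\<Sum>k<i. fst (w ! k))"
  let ?t = "\<lambda>i j. ?s i w \<odot>\<^bsub>?N\<^esub> (?s j (upd \<epsilon> b i w) \<odot>\<^bsub>?N\<^esub> wg ?m (upd \<delta> a j (upd \<epsilon> b i w)))"
  let ?t' = "\<lambda>i j. ?s i w \<odot>\<^bsub>?N\<^esub> (?s j (upd \<delta> a i w) \<odot>\<^bsub>?N\<^esub> wg ?m (upd \<epsilon> b j (upd \<delta> a i w)))"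
  have meq: "m + \<delta> + \<epsilon> = ?m" by simp
  have l: "length w = n" by (rule words_length[OF w])
  have c1: "wg ?m (upd \<delta> a j (upd \<epsilon> b i w)) \<in> carrier ?N" if "i < n" "j < n" for i j
    by (rule wg_closed[OF upd_words[OF upd_words[OF w that(1) b] that(2) a]])
  have c2: "wg ?m (upd \<epsilon> b j (upd \<delta> a i w)) \<in> carrier ?N" if "i < n" "j < n" for i j
    using wg_closed[OF upd_words[OF upd_words[OF w that(1) a] that(2) b]] unfolding meq .
  have anti: "?t i j \<oplus>\<^bsub>?N\<^esub> ?t' j i = \<zero>\<^bsub>?N\<^esub>" if ij: "i < n" "j < n" "i \<noteq> j" for i j
  proof -
    let ?v = "wg ?m (upd \<delta> a j (upd \<epsilon> b i w))"
    have v: "?v \<in> carrier ?N" by (rule c1[OF ij(1,2)])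
    have v': "wg ?m (upd \<epsilon> b i (upd \<delta> a j w)) = ?v" using ij(3) upd_commute[of i j \<epsilon> b \<delta> a w]
        by simp
    \<comment> \<open>Of the two orders of composition exactly one applies the operator of the
      earlier slot first. There it shifts the prefix degree of the later slot by an odd number,
      while in the other order both prefix degrees are those of \<open>w\<close>.\<close>
    have sgn: "?s i w \<otimes>\<^bsub>R\<^esub> ?s j (upd \<epsilon> b i w) = \<ominus>\<^bsub>R\<^esub> (?s j w \<otimes>\<^bsub>R\<^esub> ?s i (upd \<delta> a j w))"
    proof (cases "i < j")
      case True
      have "?s j (upd \<epsilon> b i w) = \<ominus>\<^bsub>R\<^esub> ?s j w"
        by (rule R.parity_sign_flip) (use True ij l odd in \<open>simp add: prefix_degree_upd\<close>)
      moreover have "?s i (upd \<delta> a j w) = ?s i w" using True ij l by (simp add: prefix_degree_upd)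
      ultimately show ?thesis by (simp add: R.r_minus R.m_comm)
    next
      case False
      then have ji: "j < i" using ij by simp
      have "?s i (upd \<delta> a j w) = \<ominus>\<^bsub>R\<^esub> ?s i w"
        by (rule R.parity_sign_flip) (use ji ij l odd in \<open>simp add: prefix_degree_upd\<close>)
      moreover have "?s j (upd \<epsilon> b i w) = ?s j w" using ji ij l by (simp add: prefix_degree_upd)
      ultimately show ?thesis by (simp add: R.r_minus R.m_comm)
    qed
    have "?t i j = (?s i w \<otimes>\<^bsub>R\<^esub> ?s j (upd \<epsilon> b i w)) \<odot>\<^bsub>?N\<^esub> ?v"
      using v by (simp add: N.smult_assoc1)
    moreover have "?t' j i = (?s j w \<otimes>\<^bsub>R\<^esub> ?s i (upd \<delta> a j w)) \<odot>\<^bsub>?N\<^esub> ?v"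
      unfolding v' using v by (simp add: N.smult_assoc1)
    ultimately show ?thesis unfolding sgn using v by (simp add: N.smult_l_minus N.M.l_neg)
  qed
  have diag: "?t i i \<oplus>\<^bsub>?N\<^esub> ?t' i i =
      wg ?m (upd (\<epsilon> + \<delta>) (\<lambda>p x. a (p + \<epsilon>) (b p x) \<oplus>\<^bsub>grade B (p + \<epsilon> + \<delta>)\<^esub> b (p + \<delta>) (a p x)) i w)"
    if i: "i < n" for i
  proof -
    let ?p = "fst (w ! i)" and ?x = "snd (w ! i)"
    let ?q = "?p + \<epsilon> + \<delta>"
    let ?y = "a (?p + \<epsilon>) (b ?p ?x)" and ?z = "b (?p + \<delta>) (a ?p ?x)"
    have x: "?x \<in> carrier (grade B ?p)" by (rule words_nth[OF w i])
    have y: "?y \<in> carrier (grade B ?q)"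
      using linear_maps_closed[OF a[rule_format] linear_maps_closed[OF b[rule_format] x]] .
    have z: "?z \<in> carrier (grade B ?q)"
      using linear_maps_closed[OF b[rule_format] linear_maps_closed[OF a[rule_format] x]]
      by (simp add: algebra_simps)
    have ss: "?s i (upd \<epsilon> b i w) = ?s i w" "?s i (upd \<delta> a i w) = ?s i w"
      using i l by (simp_all add: prefix_degree_upd)
    have ts: "?s i w \<odot>\<^bsub>?N\<^esub> (?s i w \<odot>\<^bsub>?N\<^esub> v) = v" if "v \<in> carrier ?N" for v
      using that by (simp add: N.smult_assoc1[symmetric] R.parity_sign_self)
    have e1: "upd \<delta> a i (upd \<epsilon> b i w) = w[i := (?q, ?y)]"
      and e2: "upd \<epsilon> b i (upd \<delta> a i w) = w[i := (?q, ?z)]"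
      and e3: "upd (\<epsilon> + \<delta>) (\<lambda>p x. a (p + \<epsilon>) (b p x) \<oplus>\<^bsub>grade B (p + \<epsilon> + \<delta>)\<^esub> b (p + \<delta>) (a p x)) i w =
        w[i := (?q, ?y \<oplus>\<^bsub>grade B ?q\<^esub> ?z)]"
      using i l by (simp_all add: upd_def algebra_simps)
    let ?w = "w[i := (?q, ?y)]"
    have ww: "?w \<in> W ?m" using upd_words[OF upd_words[OF w i b] i a] by (simp add: e1)
    have fw: "fst (?w ! i) = ?q" using i l by simp
    have "wg ?m (?w[i := (?q, ?y \<oplus>\<^bsub>grade B ?q\<^esub> ?z)]) = wg ?m (?w[i := (?q, ?y)]) \<oplus>\<^bsub>?N\<^esub> wg ?m
        (?w[i := (?q, ?z)])"
      by (rule multilinear_add_slot[OF wg_multilinear ww i, unfolded fw, OF y z])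
    then show ?thesis
      unfolding ss e3 using ts[OF c1[OF i i]] ts[OF c2[OF i i]] by (simp add: e1 e2)
  qed
  have "Der \<delta> a (m + \<epsilon>) (Der \<epsilon> b m (wg m w)) \<oplus>\<^bsub>?N\<^esub> Der \<epsilon> b (m + \<delta>) (Der \<delta> a m (wg m w)) =
      finsum ?N (\<lambda>i. finsum ?N (?t i) {..<n}) {..<n} \<oplus>\<^bsub>?N\<^esub> finsum ?N (\<lambda>i. finsum ?N (?t' i) {..<n})
          {..<n}"
    unfolding Der_Der_wg[OF a b w] Der_Der_wg[OF b a w] meq by (rule refl)
  also have "\<dots> = finsum ?N (\<lambda>i. ?t i i \<oplus>\<^bsub>?N\<^esub> ?t' i i) {..<n}"
    by (rule finsum_anticommuting[OF N.M.abelian_group_axioms]) (use c1 c2 anti in auto)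
  also have "\<dots> = finsum ?N (\<lambda>i. wg ?m (upd (\<epsilon> + \<delta>) (\<lambda>p x. a (p + \<epsilon>) (b p x) \<oplus>\<^bsub>grade B (p + \<epsilon> + \<delta>)\<^esub> b
      (p + \<delta>) (a p x)) i w)) {..<n}"
  proof (rule N.finsum_cong'[OF refl])
    have "?t i i \<oplus>\<^bsub>?N\<^esub> ?t' i i \<in> carrier ?N" if "i < n" for i using c1[OF that that]
        c2[OF that that] by simp
    then show "(\<lambda>i. wg ?m (upd (\<epsilon> + \<delta>) (\<lambda>p x. a (p + \<epsilon>) (b p x) \<oplus>\<^bsub>grade B (p + \<epsilon> + \<delta>)\<^esub> b (p + \<delta>)
        (a p x)) i w)) \<in> {..<n} \<rightarrow> carrier ?N"
      using diag by auto
  qed (use diag in simp)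
  finally show ?thesis .
qed

end

section \<open>The action of the symmetric group on the tensor power\<close>

context tensor_power_complex
begin

abbreviation act where "act \<equiv> tensor_power_action R B n"

text \<open>Exhibits the sign as a function of the list of degrees alone. This makes it a constant
  coefficient for multilinearity and leaves it unchanged under operators of degree zero.\<close>

lemma koszul_sign_degrees:
  "koszul_sign R \<sigma> w = parity_sign R (\<Sum>(i, j)\<in>{(i, j). i < j \<and> j < length (map fst w) \<and>
      \<sigma> j < \<sigma> i}. map fst w ! i * map fst w ! j)"
  unfolding koszul_sign_def by (intro arg_cong[of _ _ "parity_sign R"] sum.cong) auto

lemma koszul_sign_cong:
  "map fst v = map fst w \<Longrightarrow> koszul_sign R \<sigma> v = koszul_sign R \<sigma> w"
  by (simp only: koszul_sign_degrees)

lemma koszul_sign_closed [simp]: "koszul_sign R \<sigma> w \<in> carrier R"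
  by (simp add: koszul_sign_def)

lemma koszul_sign_upd:
  assumes \<sigma>: "\<sigma> permutes {..<n}" and i: "i < n" and l: "length w = n" and \<delta>: "odd \<delta>"
  shows "parity_sign R (\<Sum>j<i. fst (w ! j)) \<otimes>\<^bsub>R\<^esub> koszul_sign R \<sigma> (upd \<delta> a i w) =
    koszul_sign R \<sigma> w \<otimes>\<^bsub>R\<^esub> parity_sign R (\<Sum>k<\<sigma> i. fst (permute_word \<sigma> w ! k))"
proof -
  let ?d = "\<lambda>j. fst (w ! j)" and ?I = "{(a, b). a < b \<and> b < n \<and> \<sigma> b < \<sigma> a}"
  let ?d' = "?d(i := ?d i + \<delta>)"
  have "(\<Sum>(x, y)\<in>?I. fst (upd \<delta> a i w ! x) * fst (upd \<delta> a i w ! y)) = (\<Sum>(x, y)\<in>?I. ?d' x * ?d' y)"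
    using i l by (intro sum.cong) (auto simp: nth_upd)
  then have 1: "koszul_sign R \<sigma> (upd \<delta> a i w) = parity_sign R (\<Sum>(x, y)\<in>?I. ?d' x * ?d' y)"
    by (simp add: koszul_sign_def l)
  have \<sigma>i: "\<sigma> i < n" using permutes_in_image[OF \<sigma>, of i] i by simp
  have 2: "(\<Sum>k<\<sigma> i. fst (permute_word \<sigma> w ! k)) = (\<Sum>k<\<sigma> i. ?d (inv_into UNIV \<sigma> k))"
    using \<sigma>i l by (intro sum.cong) (auto simp: nth_permute_word)
  show ?thesis
    unfolding 1 2 unfolding koszul_sign_def l R.parity_sign_add[symmetric]
    by (rule R.parity_sign_cong[OF koszul_exponent_parity[OF \<sigma> i \<delta>]])
qed

lemma act_multilinear:
  assumes "\<sigma> permutes {..<n}"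
  shows "multilinear R (\<lambda>_. B) n m (grade T m) (\<lambda>w. koszul_sign R \<sigma> w \<odot>\<^bsub>grade T m\<^esub> wg m
      (permute_word \<sigma> w))"
  unfolding koszul_sign_degrees
  by (rule multilinear_scale[OF multilinear_permute[OF assms wg_multilinear] T_module,
        where c = "\<lambda>d. parity_sign R (\<Sum>(i, j)\<in>{(i, j). i < j \<and> j < length d \<and> \<sigma> j < \<sigma> i}. d ! i *
            d ! j)"]) simp

lemma act:
  assumes \<sigma>: "\<sigma> permutes {..<n}"
  shows act_linear: "act \<sigma> m \<in> linear_maps R (grade T m) (grade T m)"
    and act_wg: "w \<in> W m \<Longrightarrow> act \<sigma> m (wg m w) = koszul_sign R \<sigma> w \<odot>\<^bsub>grade T m\<^esub> wg m (permute_word \<sigma> w)"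
proof -
  interpret N: module R "grade T m" by (rule T_module)
  let ?Rel = "multilinear_rels R (\<lambda>_. B) n m"
  have F: "[(koszul_sign R \<sigma> w, permute_word \<sigma> w)] \<in> formal_combs R (W m) \<and>
      comb_class R (W m) ?Rel [(koszul_sign R \<sigma> w, permute_word \<sigma> w)] =
        koszul_sign R \<sigma> w \<odot>\<^bsub>grade T m\<^esub> wg m (permute_word \<sigma> w)" if w: "w \<in> W m" for w
  proof -
    note pw = permute_word_words[OF \<sigma> w]
    have fc: "[(koszul_sign R \<sigma> w, permute_word \<sigma> w)] \<in> formal_combs R (W m)" using pw by simp
    show ?thesis using comb_class_eval[OF R.is_cring fc, of ?Rel] fc wg_closed[OF pw]
        by (simp add: grade_T[symmetric])
  qed
  note ml = act_multilinear[OF \<sigma>, of m, unfolded grade_T[of m]]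
  note F' = F[unfolded grade_T[of m]]
  show "act \<sigma> m \<in> linear_maps R (grade T m) (grade T m)"
    unfolding tensor_power_action_def using T_presented_map(1)[OF F' ml] by (simp add: grade_T)
  show "w \<in> W m \<Longrightarrow> act \<sigma> m (wg m w) = koszul_sign R \<sigma> w \<odot>\<^bsub>grade T m\<^esub> wg m (permute_word \<sigma> w)"
    unfolding tensor_power_action_def using T_presented_map(2)[OF F' ml, of w]
        by (simp add: grade_T)
qed

lemma permute_upd:
  assumes "\<sigma> permutes {..<n}" "i < n" "length w = n"
  shows "permute_word \<sigma> (upd \<delta> a i w) = upd \<delta> a (\<sigma> i) (permute_word \<sigma> w)"
proof -
  have "\<sigma> i < n" using permutes_in_image[OF assms(1), of i] assms(2) by simp
  then have "permute_word \<sigma> w ! \<sigma> i = w ! i"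
    using assms(3) permutes_inverses(2)[OF assms(1)] by (simp add: nth_permute_word)
  then show ?thesis using permute_word_update[of \<sigma> w i] assms by (simp add: upd_def)
qed

text \<open>\<open>\<sigma>\<close> carries the summand for slot \<open>i\<close> to the summand for
  slot \<open>\<sigma> i\<close> of the permuted word, and \<open>koszul_sign_upd\<close> matches
  the signs. Since all slots occur in the sum, reindexing by \<open>\<sigma>\<close> restores
  it.\<close>

lemma Der_act:
  assumes \<sigma>: "\<sigma> permutes {..<n}" and a: "linear_family \<delta> a" and \<delta>: "odd \<delta>"
      and t: "t \<in> carrier (grade T m)"
  shows "Der \<delta> a m (act \<sigma> m t) = act \<sigma> (m + \<delta>) (Der \<delta> a m t)"
proof (rule T_eqI[OF T_module linear_maps_comp[OF act_linear[OF \<sigma>] Der_linear[OF a]]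
      linear_maps_comp[OF Der_linear[OF a] act_linear[OF \<sigma>]] _ t])
  fix w assume w: "w \<in> W m"
  let ?N = "grade T (m + \<delta>)" and ?v = "permute_word \<sigma> w"
  interpret N: module R ?N by (rule T_module)
  have v: "?v \<in> W m" by (rule permute_word_words[OF \<sigma> w])
  have l: "length w = n" by (rule words_length[OF w])
  have uw: "upd \<delta> a i w \<in> W (m + \<delta>)" if "i < n" for i by (rule upd_words[OF w that a])
  have uv: "upd \<delta> a i ?v \<in> W (m + \<delta>)" if "i < n" for i by (rule upd_words[OF v that a])
  have \<sigma>n: "\<sigma> i < n" if "i < n" for i using permutes_in_image[OF \<sigma>, of i] that by simp
  let ?s = "\<lambda>i w. parity_sign R (\<Sum>k<i. fst (w ! k))"
  have "act \<sigma> (m + \<delta>) (Der \<delta> a m (wg m w)) =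
      finsum ?N (\<lambda>i. act \<sigma> (m + \<delta>) (?s i w \<odot>\<^bsub>?N\<^esub> wg (m + \<delta>) (upd \<delta> a i w))) {..<n}"
    unfolding Der_wg[OF a w] Der_term_def
    by (rule linear_maps_finsum[OF act_linear[OF \<sigma>] T_module T_module]) (use wg_closed[OF uw] in
        auto)
  also have "\<dots> = finsum ?N (\<lambda>i. koszul_sign R \<sigma> w \<odot>\<^bsub>?N\<^esub> (?s (\<sigma> i) ?v \<odot>\<^bsub>?N\<^esub> wg (m + \<delta>)
      (upd \<delta> a (\<sigma> i) ?v))) {..<n}"
  proof (rule N.finsum_cong'[OF refl])
    fix i assume "i \<in> {..<n}"
    then have i: "i < n" by simp
    have c: "wg (m + \<delta>) (upd \<delta> a (\<sigma> i) ?v) \<in> carrier ?N" by (rule wg_closed[OF uv[OF \<sigma>n[OF i]]])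
    have "act \<sigma> (m + \<delta>) (?s i w \<odot>\<^bsub>?N\<^esub> wg (m + \<delta>) (upd \<delta> a i w)) =
        ?s i w \<odot>\<^bsub>?N\<^esub> (koszul_sign R \<sigma> (upd \<delta> a i w) \<odot>\<^bsub>?N\<^esub> wg (m + \<delta>) (upd \<delta> a (\<sigma> i) ?v))"
      using linear_maps_smult[OF act_linear[OF \<sigma>] R.parity_sign_closed wg_closed[OF uw[OF i]]]
        act_wg[OF \<sigma> uw[OF i]] permute_upd[OF \<sigma> i l] by simp
    also have "\<dots> = (?s i w \<otimes>\<^bsub>R\<^esub> koszul_sign R \<sigma> (upd \<delta> a i w)) \<odot>\<^bsub>?N\<^esub> wg (m + \<delta>) (upd \<delta> a (\<sigma> i) ?v)"
      using c by (simp add: N.smult_assoc1)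
    also have "\<dots> = koszul_sign R \<sigma> w \<odot>\<^bsub>?N\<^esub> (?s (\<sigma> i) ?v \<odot>\<^bsub>?N\<^esub> wg (m + \<delta>) (upd \<delta> a (\<sigma> i) ?v))"
      unfolding koszul_sign_upd[OF \<sigma> i l \<delta>] using c by (simp add: N.smult_assoc1)
    finally show "act \<sigma> (m + \<delta>) (?s i w \<odot>\<^bsub>?N\<^esub> wg (m + \<delta>) (upd \<delta> a i w)) = \<dots>" .
  qed (use wg_closed[OF uv] \<sigma>n in auto)
  also have "\<dots> = koszul_sign R \<sigma> w \<odot>\<^bsub>?N\<^esub> finsum ?N (\<lambda>i. ?s (\<sigma> i) ?v \<odot>\<^bsub>?N\<^esub> wg (m + \<delta>)
      (upd \<delta> a (\<sigma> i) ?v)) {..<n}"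
    by (rule N.finsum_smult_ldistr[symmetric]) (use wg_closed[OF uv] \<sigma>n in auto)
  also have "finsum ?N (\<lambda>i. ?s (\<sigma> i) ?v \<odot>\<^bsub>?N\<^esub> wg (m + \<delta>) (upd \<delta> a (\<sigma> i) ?v)) {..<n} =
      finsum ?N (\<lambda>k. ?s k ?v \<odot>\<^bsub>?N\<^esub> wg (m + \<delta>) (upd \<delta> a k ?v)) (\<sigma> ` {..<n})"
    by (rule N.finsum_reindex[symmetric])
      (use wg_closed[OF uv] \<sigma>n permutes_inj_on[OF \<sigma>] in auto)
  also have "\<sigma> ` {..<n} = {..<n}" by (rule permutes_image[OF \<sigma>])
  also have "koszul_sign R \<sigma> w \<odot>\<^bsub>?N\<^esub> finsum ?N (\<lambda>k. ?s k ?v \<odot>\<^bsub>?N\<^esub> wg (m + \<delta>) (upd \<delta> a k ?v)) {..<n} =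
      Der \<delta> a m (act \<sigma> m (wg m w))"
    unfolding act_wg[OF \<sigma> w] linear_maps_smult[OF Der_linear[OF a] koszul_sign_closed
        wg_closed[OF v]]
      Der_wg[OF a v] Der_term_def by (rule refl)
  finally show "Der \<delta> a m (act \<sigma> m (wg m w)) = act \<sigma> (m + \<delta>) (Der \<delta> a m (wg m w))" by simp
qed

section \<open>Tensor powers of an operator of degree zero\<close>

definition tpow where
  "tpow q m = lin_ext (grade T m) (\<lambda>w. wg m (slot_map (\<lambda>_. 0) (\<lambda>_. q) w))"

lemma tpow_words: "linear_family 0 q \<Longrightarrow> w \<in> W m \<Longrightarrow> slot_map (\<lambda>_. 0) (\<lambda>_. q) w \<in> W m"
  by (rule slot_map_words[where R = R]) auto

lemma tpow_multilinear:
  "linear_family 0 q \<Longrightarrow> multilinear R (\<lambda>_. B) n m (grade T m)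
      (\<lambda>w. wg m (slot_map (\<lambda>_. 0) (\<lambda>_. q) w))"
  by (rule multilinear_slot_map[OF wg_multilinear]) auto

lemma tpow_linear: "linear_family 0 q \<Longrightarrow> tpow q m \<in> linear_maps R (grade T m) (grade T m)"
  unfolding tpow_def by (rule T_lift_linear[OF T_module tpow_multilinear])

lemma tpow_wg: "linear_family 0 q \<Longrightarrow> w \<in> W m \<Longrightarrow> tpow q m (wg m w) = wg m (slot_map (\<lambda>_. 0) (\<lambda>_. q) w)"
  unfolding tpow_def by (rule T_lift_wg[OF T_module tpow_multilinear])

lemma tpow_act:
  assumes \<sigma>: "\<sigma> permutes {..<n}" and q: "linear_family 0 q" and t: "t \<in> carrier (grade T m)"
  shows "tpow q m (act \<sigma> m t) = act \<sigma> m (tpow q m t)"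
proof (rule T_eqI[OF T_module linear_maps_comp[OF act_linear[OF \<sigma>] tpow_linear[OF q]]
      linear_maps_comp[OF tpow_linear[OF q] act_linear[OF \<sigma>]] _ t])
  fix w assume w: "w \<in> W m"
  have l: "length w = n" by (rule words_length[OF w])
  have v: "permute_word \<sigma> w \<in> W m" by (rule permute_word_words[OF \<sigma> w])
  have "inv_into UNIV \<sigma> i < n" if "i < n" for i
    using permutes_in_image[OF permutes_inv[OF \<sigma>], of i] that by simp
  then have 1: "permute_word \<sigma> (slot_map (\<lambda>_. 0) (\<lambda>_. q) w) =
      slot_map (\<lambda>_. 0) (\<lambda>_. q) (permute_word \<sigma> w)"
    using l by (intro nth_equalityI) (auto simp: nth_permute_word)
  have 2: "koszul_sign R \<sigma> (slot_map (\<lambda>_. 0) (\<lambda>_. q) w) = koszul_sign R \<sigma> w"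
    by (rule koszul_sign_cong, rule nth_equalityI) auto
  show "tpow q m (act \<sigma> m (wg m w)) = act \<sigma> m (tpow q m (wg m w))"
    using linear_maps_smult[OF tpow_linear[OF q] koszul_sign_closed wg_closed[OF v]]
    by (simp add: act_wg[OF \<sigma> w] tpow_wg[OF q w] tpow_wg[OF q v] act_wg[OF \<sigma> tpow_words[OF q w]] 1
        2)
qed

text \<open>\<open>q\<close> commutes with \<open>a\<close> in the slot where \<open>a\<close> acts
  and passes through the other slots freely. As it has degree zero, the prefix degrees and hence the
  signs stay the same.\<close>

lemma tpow_Der:
  assumes q: "linear_family 0 q" and a: "linear_family \<delta> a"
    and qa: "\<And>p x. x \<in> carrier (grade B p) \<Longrightarrow> q (p + \<delta>) (a p x) = a p (q p x)"
    and t: "t \<in> carrier (grade T m)"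
  shows "tpow q (m + \<delta>) (Der \<delta> a m t) = Der \<delta> a m (tpow q m t)"
proof (rule T_eqI[OF T_module linear_maps_comp[OF Der_linear[OF a] tpow_linear[OF q]]
      linear_maps_comp[OF tpow_linear[OF q] Der_linear[OF a]] _ t])
  fix w assume w: "w \<in> W m"
  let ?N = "grade T (m + \<delta>)" and ?v = "slot_map (\<lambda>_. 0) (\<lambda>_. q) w"
  interpret N: module R ?N by (rule T_module)
  have l: "length w = n" by (rule words_length[OF w])
  have v: "?v \<in> W m" by (rule tpow_words[OF q w])
  have uw: "upd \<delta> a i w \<in> W (m + \<delta>)" if "i < n" for i by (rule upd_words[OF w that a])
  have uv: "upd \<delta> a i ?v \<in> W (m + \<delta>)" if "i < n" for i by (rule upd_words[OF v that a])
  let ?s = "\<lambda>i w. parity_sign R (\<Sum>k<i. fst (w ! k))"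
  have "tpow q (m + \<delta>) (Der \<delta> a m (wg m w)) =
      finsum ?N (\<lambda>i. tpow q (m + \<delta>) (?s i w \<odot>\<^bsub>?N\<^esub> wg (m + \<delta>) (upd \<delta> a i w))) {..<n}"
    unfolding Der_wg[OF a w] Der_term_def
    by (rule linear_maps_finsum[OF tpow_linear[OF q] T_module T_module]) (use wg_closed[OF uw] in
        auto)
  also have "\<dots> = finsum ?N (\<lambda>i. ?s i ?v \<odot>\<^bsub>?N\<^esub> wg (m + \<delta>) (upd \<delta> a i ?v)) {..<n}"
  proof (rule N.finsum_cong'[OF refl])
    fix i assume "i \<in> {..<n}"
    then have i: "i < n" by simp
    have "slot_map (\<lambda>_. 0) (\<lambda>_. q) (upd \<delta> a i w) = upd \<delta> a i ?v"
      using i l qa[OF words_nth[OF w i]] by (intro nth_equalityI) (auto simp: nth_upd)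
    moreover have "?s i w = ?s i ?v" using i l by (intro arg_cong[of _ _ "parity_sign R"]
        sum.cong) auto
    ultimately show "tpow q (m + \<delta>) (?s i w \<odot>\<^bsub>?N\<^esub> wg (m + \<delta>) (upd \<delta> a i w)) =
        ?s i ?v \<odot>\<^bsub>?N\<^esub> wg (m + \<delta>) (upd \<delta> a i ?v)"
      using linear_maps_smult[OF tpow_linear[OF q] R.parity_sign_closed wg_closed[OF uw[OF i]]]
        tpow_wg[OF q uw[OF i]] by simp
  qed (use wg_closed[OF uv] in auto)
  also have "\<dots> = Der \<delta> a m (tpow q m (wg m w))"
    unfolding tpow_wg[OF q w] Der_wg[OF a v] Der_term_def by (rule refl)
  finally show "tpow q (m + \<delta>) (Der \<delta> a m (wg m w)) = Der \<delta> a m (tpow q m (wg m w))" .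
qed

text \<open>The anticommutator of the boundary with itself is twice its square. By
  \<open>Der_anticommutator\<close> it is a sum of words in which one slot holds
  \<open>d d + d d = 0\<close>; the hypothesis \<open>two\<close> then removes the factor 2.\<close>

lemma T_bdry_square:
  assumes two: "\<And>m y. y \<in> carrier (grade T m) \<Longrightarrow> y \<oplus>\<^bsub>grade T m\<^esub> y = \<zero>\<^bsub>grade T m\<^esub> \<Longrightarrow> y = \<zero>\<^bsub>grade T m\<^esub>"
    and t: "t \<in> carrier (grade T m)"
  shows "bdry T (m - 1) (bdry T m t) = \<zero>\<^bsub>grade T (m - 2)\<^esub>"
proof -
  interpret N: module R "grade T (m - 2)" by (rule T_module)
  let ?d = "bdry B" and ?N = "grade T (m - 2)"
  have bl: "bdry T (m - 1) \<in> linear_maps R (grade T (m - 1)) ?N" using T_bdry_linear[of "m - 1"]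
      by simp
  have z: "(\<lambda>t. \<zero>\<^bsub>?N\<^esub>) \<in> linear_maps R (grade T m) ?N" by (rule linear_mapsI) simp_all
  show ?thesis
  proof (rule T_eqI[OF T_module linear_maps_comp[OF T_bdry_linear bl] z _ t])
    fix w assume w: "w \<in> W m"
    let ?D = "Der (- 1) ?d (m + - 1) (Der (- 1) ?d m (wg m w))"
    have Dc: "Der (- 1) ?d m (wg m w) \<in> carrier (grade T (m - 1))"
      using linear_maps_closed[OF Der_linear[OF bdry_family] wg_closed[OF w]] by simp
    have D: "bdry T (m - 1) (bdry T m (wg m w)) = ?D"
      using T_bdry_eq[OF wg_closed[OF w]] T_bdry_eq[OF Dc] by simp
    have cl: "?D \<in> carrier ?N"
      using linear_maps_closed[OF Der_linear[OF bdry_family, of "m - 1"] Dc] by simp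
    have "?D \<oplus>\<^bsub>?N\<^esub> ?D = finsum ?N (\<lambda>i. wg (m - 2)
      (upd (- 2) (\<lambda>p x. ?d (p + - 1) (?d p x) \<oplus>\<^bsub>grade B (p + - 1 + - 1)\<^esub> ?d (p + - 1) (?d p x)) i
          w)) {..<n}"
      using Der_anticommutator[OF bdry_family bdry_family w] by simp
    also have "\<dots> = finsum ?N (\<lambda>i. \<zero>\<^bsub>?N\<^esub>) {..<n}"
    proof (rule N.finsum_cong'[OF refl])
      fix i assume "i \<in> {..<n}"
      then have i: "i < n" by simp
      let ?a = "\<lambda>p x. ?d (p + - 1) (?d p x) \<oplus>\<^bsub>grade B (p + - 1 + - 1)\<^esub> ?d (p + - 1) (?d p x)"
      have l: "length w = n" by (rule words_length[OF w])
      interpret Bi: module R "grade B (fst (w ! i) - 2)" by (rule B_module)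
      have lf: "linear_family (- 2) ?a"
      proof
        fix p
        have "?d (p - 1) \<in> linear_maps R (grade B (p - 1)) (grade B (p - 2))"
            using cc_bdry[OF B, of "p - 1"] by simp
        from linear_maps_plus[OF linear_maps_comp[OF cc_bdry[OF B, of p] this]
            linear_maps_comp[OF cc_bdry[OF B, of p] this] B_module]
        show "?a p \<in> linear_maps R (grade B p) (grade B (p + - 2))" by simp
      qed
      have az: "?a (fst (w ! i)) (snd (w ! i)) = \<zero>\<^bsub>grade B (fst (w ! i) - 2)\<^esub>"
        using cc_square[OF B words_nth[OF w i]] by simp
      have u: "upd (- 2) ?a i w \<in> W (m - 2)" using upd_words[OF w i lf] by simp
      have ui: "upd (- 2) ?a i w ! i = (fst (w ! i) - 2, \<zero>\<^bsub>grade B (fst (w ! i) - 2)\<^esub>)"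
        unfolding az[symmetric] using i l by (simp add: nth_upd)
      show "wg (m - 2) (upd (- 2) ?a i w) = \<zero>\<^bsub>?N\<^esub>"
        by (rule multilinear_zero_slot[OF wg_multilinear u i T_module B_module])
            (simp only: ui fst_conv snd_conv)
    qed simp
    also have "\<dots> = \<zero>\<^bsub>?N\<^esub>" by (simp add: N.finsum_zero)
    finally show "bdry T (m - 1) (bdry T m (wg m w)) = \<zero>\<^bsub>?N\<^esub>" unfolding D by (rule two[OF cl])
  qed
qed

text \<open>After \<open>q\<close> has been applied in all slots, the anticommutator of
  \<open>h\<close> with the boundary, being \<open>q\<close>, changes nothing in any slot, because
  \<open>q\<close> is idempotent. So all \<open>n\<close> summands of
  \<open>Der_anticommutator\<close> equal the same element, and \<open>c\<close> cancels the factor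
  \<open>n\<close>. Equivariance is inherited from \<open>tpow\<close> and
  \<open>Der\<close>.\<close>

lemma T_homotopy:
  assumes h: "linear_family 1 h" and q: "linear_family 0 q"
    and hq: "\<And>p y. y \<in> carrier (grade B p) \<Longrightarrow>
        bdry B (p + 1) (h p y) \<oplus>\<^bsub>grade B p\<^esub> h (p - 1) (bdry B p y) = q p y"
    and qq: "\<And>p y. y \<in> carrier (grade B p) \<Longrightarrow> q p (q p y) = q p y"
    and qd: "\<And>p y. y \<in> carrier (grade B p) \<Longrightarrow> q (p - 1) (bdry B p y) = bdry B p (q p y)"
    and c: "c \<in> carrier R" "c \<otimes>\<^bsub>R\<^esub> ([n] \<cdot>\<^bsub>R\<^esub> \<one>\<^bsub>R\<^esub>) = \<one>\<^bsub>R\<^esub>"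
  defines "K \<equiv> (\<lambda>m t. c \<odot>\<^bsub>grade T (m + 1)\<^esub> Der 1 h m (tpow q m t))"
  shows "K m \<in> linear_maps R (grade T m) (grade T (m + 1))"
    and "t \<in> carrier (grade T m) \<Longrightarrow>
      bdry T (m + 1) (K m t) \<oplus>\<^bsub>grade T m\<^esub> K (m - 1) (bdry T m t) = tpow q m t"
    and "\<sigma> permutes {..<n} \<Longrightarrow> t \<in> carrier (grade T m) \<Longrightarrow> K m (act \<sigma> m t) = act \<sigma> (m + 1) (K m t)"
proof -
  let ?D = "Der 1 h"
  have Kl: "K m \<in> linear_maps R (grade T m) (grade T (m + 1))" for m
    unfolding K_def
    by (rule linear_maps_scale[OF linear_maps_comp[OF tpow_linear[OF q] Der_linear[OF h]] c(1)
        T_module])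
  show "K m \<in> linear_maps R (grade T m) (grade T (m + 1))" by (rule Kl)
  have Kl': "K (m - 1) \<in> linear_maps R (grade T (m - 1)) (grade T m)" using Kl[of "m - 1"] by simp
  have bl': "bdry T (m + 1) \<in> linear_maps R (grade T (m + 1)) (grade T m)"
      using T_bdry_linear[of "m + 1"] by simp
  interpret N: module R "grade T m" by (rule T_module)
  interpret N1: module R "grade T (m + 1)" by (rule T_module)
  show "bdry T (m + 1) (K m t) \<oplus>\<^bsub>grade T m\<^esub> K (m - 1) (bdry T m t) = tpow q m t"
    if t: "t \<in> carrier (grade T m)"
  proof (rule T_eqI[OF T_module linear_maps_plus[OF linear_maps_comp[OF Kl bl']
          linear_maps_comp[OF T_bdry_linear Kl'] T_module] tpow_linear[OF q] _ t])
    fix w assume w: "w \<in> W m"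
    let ?v = "slot_map (\<lambda>_. 0) (\<lambda>_. q) w"
    have v: "?v \<in> W m" by (rule tpow_words[OF q w])
    have l: "length ?v = n" by (rule words_length[OF v])
    have gv: "wg m ?v \<in> carrier (grade T m)" by (rule wg_closed[OF v])
    have hv: "?D m (wg m ?v) \<in> carrier (grade T (m + 1))"
        by (rule linear_maps_closed[OF Der_linear[OF h] gv])
    have dw: "bdry T m (wg m w) \<in> carrier (grade T (m - 1))"
      by (rule linear_maps_closed[OF T_bdry_linear wg_closed[OF w]])
    have dv: "Der (- 1) (bdry B) m (wg m ?v) \<in> carrier (grade T (m - 1))"
      using linear_maps_closed[OF Der_linear[OF bdry_family] gv] by simp
    have hdv: "?D (m - 1) (Der (- 1) (bdry B) m (wg m ?v)) \<in> carrier (grade T m)"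
      using linear_maps_closed[OF Der_linear[OF h] dv] by simp
    have dhv: "Der (- 1) (bdry B) (m + 1) (?D m (wg m ?v)) \<in> carrier (grade T m)"
      using linear_maps_closed[OF Der_linear[OF bdry_family] hv] by simp
    have 1: "bdry T (m + 1) (K m (wg m w)) = c \<odot>\<^bsub>grade T m\<^esub> Der (- 1) (bdry B) (m + 1)
        (?D m (wg m ?v))"
      using linear_maps_smult[OF bl' c(1) hv] T_bdry_eq[OF hv] by (simp add: K_def tpow_wg[OF q w])
    \<comment> \<open>\<open>q\<close> commutes with the boundary, so it can be applied first; then
      both compositions start from the same word \<open>?v\<close>.\<close>
    have "tpow q (m - 1) (bdry T m (wg m w)) = Der (- 1) (bdry B) m (tpow q m (wg m w))"
      using tpow_Der[OF q bdry_family _ wg_closed[OF w]] qd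
          by (simp add: T_bdry_eq[OF wg_closed[OF w]])
    then have 2: "K (m - 1) (bdry T m (wg m w)) = c \<odot>\<^bsub>grade T m\<^esub> ?D (m - 1) (Der (- 1) (bdry B) m
        (wg m ?v))"
      by (simp add: K_def tpow_wg[OF q w])
    have "Der (- 1) (bdry B) (m + 1) (?D m (wg m ?v)) \<oplus>\<^bsub>grade T m\<^esub> ?D (m - 1) (Der (- 1) (bdry B) m
        (wg m ?v)) =
        finsum (grade T m) (\<lambda>i. wg m (upd 0 (\<lambda>p x. bdry B (p + 1) (h p x) \<oplus>\<^bsub>grade B p\<^esub> h (p + - 1)
            (bdry B p x)) i ?v)) {..<n}"
      using Der_anticommutator[OF bdry_family h v] by simp
    also have "\<dots> = finsum (grade T m) (\<lambda>i. wg m ?v) {..<n}"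
    proof (rule N.finsum_cong'[OF refl])
      fix i assume "i \<in> {..<n}"
      then have i: "i < n" by simp
      \<comment> \<open>The operator in slot \<open>i\<close> is \<open>q\<close>, and the entry
        there already lies in the image of \<open>q\<close>.\<close>
      have "upd 0 (\<lambda>p x. bdry B (p + 1) (h p x) \<oplus>\<^bsub>grade B p\<^esub> h (p + - 1) (bdry B p x)) i ?v = ?v"
      proof (rule nth_equalityI)
        fix j assume "j < length (upd 0 (\<lambda>p x. bdry B (p + 1) (h p x) \<oplus>\<^bsub>grade B p\<^esub> h (p + - 1)
            (bdry B p x)) i ?v)"
        then have j: "j < length w" by simp
        have iw: "i < length w" using i l by simp
        show "upd 0 (\<lambda>p x. bdry B (p + 1) (h p x) \<oplus>\<^bsub>grade B p\<^esub> h (p + - 1) (bdry B p x)) i ?v ! j =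
            ?v ! j"
          using hq[OF words_nth[OF v i]] qq[OF words_nth[OF w i]] j iw by (cases "i = j")
              (simp_all add: nth_upd)
      qed simp
      then show "wg m (upd 0 (\<lambda>p x. bdry B (p + 1) (h p x) \<oplus>\<^bsub>grade B p\<^esub> h (p + - 1) (bdry B p x)) i
          ?v) = wg m ?v"
        by (rule arg_cong)
    qed (use gv in auto)
    also have "\<dots> = ([n] \<cdot>\<^bsub>R\<^esub> \<one>\<^bsub>R\<^esub>) \<odot>\<^bsub>grade T m\<^esub> wg m ?v" by (rule finsum_const_smult[OF T_module gv])
    finally have "c \<odot>\<^bsub>grade T m\<^esub> (Der (- 1) (bdry B) (m + 1) (?D m (wg m ?v)) \<oplus>\<^bsub>grade T m\<^esub> ?D (m - 1)
        (Der (- 1) (bdry B) m (wg m ?v))) =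
        c \<odot>\<^bsub>grade T m\<^esub> (([n] \<cdot>\<^bsub>R\<^esub> \<one>\<^bsub>R\<^esub>) \<odot>\<^bsub>grade T m\<^esub> wg m ?v)" by (rule arg_cong)
    also have "\<dots> = wg m ?v" using c gv by (simp add: N.smult_assoc1[symmetric])
    finally show "bdry T (m + 1) (K m (wg m w)) \<oplus>\<^bsub>grade T m\<^esub> K (m - 1) (bdry T m (wg m w)) =
        tpow q m (wg m w)"
      unfolding 1 2 tpow_wg[OF q w] using dhv hdv c(1) by (simp add: N.smult_r_distr)
  qed
  show "K m (act \<sigma> m t) = act \<sigma> (m + 1) (K m t)" if \<sigma>: "\<sigma> permutes {..<n}"
      and t: "t \<in> carrier (grade T m)"
  proof -
    have qt: "tpow q m t \<in> carrier (grade T m)" by (rule linear_maps_closed[OF tpow_linear[OF q] t])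
    have hqt: "?D m (tpow q m t) \<in> carrier (grade T (m + 1))"
        by (rule linear_maps_closed[OF Der_linear[OF h] qt])
    show ?thesis
      using tpow_act[OF \<sigma> q t] Der_act[OF \<sigma> h _ qt] linear_maps_smult[OF act_linear[OF \<sigma>] c(1) hqt]
      by (simp add: K_def)
  qed
qed

text \<open>A word of negative total degree has an entry of negative degree, which is zero in the
  bounded case.\<close>

lemma T_in_Ch:
  assumes two: "\<And>m y. y \<in> carrier (grade T m) \<Longrightarrow> y \<oplus>\<^bsub>grade T m\<^esub> y = \<zero>\<^bsub>grade T m\<^esub> \<Longrightarrow> y = \<zero>\<^bsub>grade T m\<^esub>"
    and b: "in_Ch R b B"
  shows "in_Ch R b T"
proof -
  have "carrier (grade T m) = {\<zero>\<^bsub>grade T m\<^esub>}" if bm: "b = Nonnegative" "m < 0" for m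
  proof -
    interpret N: module R "grade T m" by (rule T_module)
    have "t = \<zero>\<^bsub>grade T m\<^esub>" if "t \<in> carrier (grade T m)" for t
    proof (rule T_eqI[OF T_module linear_maps_id _ _ that])
      show "(\<lambda>t. \<zero>\<^bsub>grade T m\<^esub>) \<in> linear_maps R (grade T m) (grade T m)" by (rule linear_mapsI)
          simp_all
      fix w assume w: "w \<in> W m"
      have "\<exists>i<n. fst (w ! i) < 0"
      proof (rule ccontr)
        assume "\<not> (\<exists>i<n. fst (w ! i) < 0)"
        then have "0 \<le> (\<Sum>i<n. fst (w ! i))" by (intro sum_nonneg) (metis lessThan_iff not_less)
        then show False using w bm(2) by (simp add: words_iff)
      qed
      then obtain i where i: "i < n" "fst (w ! i) < 0" by blast
      then have "snd (w ! i) = \<zero>\<^bsub>grade B (fst (w ! i))\<^esub>"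
        using words_nth[OF w i(1)] b bm(1) by (simp add: in_Ch_def)
      then show "wg m w = \<zero>\<^bsub>grade T m\<^esub>"
        by (rule multilinear_zero_slot[OF wg_multilinear w i(1) T_module B_module])
    qed
    then show ?thesis by auto
  qed
  then show ?thesis using T_bdry_square[OF two] T_bdry_linear T_module
      by (simp add: in_Ch_def chain_complex_def)
qed

lemma act_chain_action: "chain_action R n T act"
  unfolding chain_action_def chain_map_def
proof (intro allI impI conjI ballI)
  fix \<sigma> m assume \<sigma>: "\<sigma> permutes {..<n}"
  show "act \<sigma> m \<in> linear_maps R (grade T m) (grade T m)" by (rule act_linear[OF \<sigma>])
  fix t assume t: "t \<in> carrier (grade T m)"
  show "bdry T m (act \<sigma> m t) = act \<sigma> (m - 1) (bdry T m t)"
    using Der_act[OF \<sigma> bdry_family _ t] T_bdry_eq[OF t]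
        T_bdry_eq[OF linear_maps_closed[OF act_linear[OF \<sigma>] t]]
    by simp
qed

end

section \<open>The source of the pushout power\<close>

lemma upd_zero: "upd 0 a i w = w[i := (fst (w ! i), a (fst (w ! i)) (snd (w ! i)))]"
  by (simp add: upd_def)

lemma comb_eval_map: "comb_eval N F (map (\<lambda>(c, w). (c, g w)) r) = comb_eval N (\<lambda>w. F (g w)) r"
  by (induction r) auto

text \<open>The data produced by \<open>trivial_cofibration_contraction\<close>, together with the
  inverse \<open>c\<close> of \<open>n\<close> in the base ring.\<close>

locale contracted_embedding = tensor_power_complex R B n
  for R :: "('k, 'r) ring_scheme" and B :: "('k, 'a) cplx" and n :: nat +
  fixes A :: "('k, 'a) cplx" and f r h :: "int \<Rightarrow> 'a \<Rightarrow> 'a" and c :: 'k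
  assumes A: "chain_complex R A" and f: "chain_map R A B f"
    and r: "\<And>p. r p \<in> linear_maps R (grade B p) (grade A p)"
    and h: "\<And>p. h p \<in> linear_maps R (grade B p) (grade B (p + 1))"
    and rf: "\<And>p x. x \<in> carrier (grade A p) \<Longrightarrow> r p (f p x) = x"
    and rd: "\<And>p y. y \<in> carrier (grade B p) \<Longrightarrow> bdry A p (r p y) = r (p - 1) (bdry B p y)"
    and frh: "\<And>p y. y \<in> carrier (grade B p) \<Longrightarrow>
      y = f p (r p y) \<oplus>\<^bsub>grade B p\<^esub> (bdry B (p + 1) (h p y) \<oplus>\<^bsub>grade B p\<^esub> h (p - 1) (bdry B p y))"
    and c: "c \<in> carrier R" "c \<otimes>\<^bsub>R\<^esub> ([n] \<cdot>\<^bsub>R\<^esub> \<one>\<^bsub>R\<^esub>) = \<one>\<^bsub>R\<^esub>"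
begin

abbreviation e where "e p y \<equiv> f p (r p y)"
text \<open>The projector along the image of \<open>f\<close> onto the kernel of
  \<open>r\<close>.\<close>

definition q where "q p y = y \<ominus>\<^bsub>grade B p\<^esub> e p y"

lemmas A_module = cc_module[OF A]
lemmas f_linear = cm_linear[OF f]
lemmas f_closed = linear_maps_closed[OF f_linear] and r_closed = linear_maps_closed[OF r]
  and dB_closed = linear_maps_closed[OF cc_bdry[OF B]] and dA_closed =
      linear_maps_closed[OF cc_bdry[OF A]]

lemma e_linear: "(\<lambda>y. e p y) \<in> linear_maps R (grade B p) (grade B p)"
  by (rule linear_maps_comp[OF r f_linear])

lemma q_linear: "q p \<in> linear_maps R (grade B p) (grade B p)"
  unfolding q_def[abs_def] by (rule linear_maps_minus[OF linear_maps_id e_linear B_module])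

lemmas q_closed = linear_maps_closed[OF q_linear]

lemma q_family: "linear_family 0 q"
  using q_linear by simp

lemma q_plus_e: "y \<in> carrier (grade B p) \<Longrightarrow> q p y \<oplus>\<^bsub>grade B p\<^esub> e p y = y"
proof -
  interpret M: module R "grade B p" by (rule B_module)
  show "y \<in> carrier (grade B p) \<Longrightarrow> q p y \<oplus>\<^bsub>grade B p\<^esub> e p y = y"
    using f_closed[OF r_closed] by (simp add: q_def M.group_simps)
qed

lemma q_f: "x \<in> carrier (grade A p) \<Longrightarrow> q p (f p x) = \<zero>\<^bsub>grade B p\<^esub>"
proof -
  interpret M: module R "grade B p" by (rule B_module)
  show "x \<in> carrier (grade A p) \<Longrightarrow> q p (f p x) = \<zero>\<^bsub>grade B p\<^esub>"
    using f_closed by (simp add: q_def rf M.diff_eq_zero_iff)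
qed

lemma q_q:
  assumes y: "y \<in> carrier (grade B p)"
  shows "q p (q p y) = q p y"
proof -
  interpret M: module R "grade B p" by (rule B_module)
  have ey: "e p y \<in> carrier (grade B p)" using f_closed[OF r_closed[OF y]] .
  have "q p (q p y) = q p (y \<ominus>\<^bsub>grade B p\<^esub> e p y)" by (simp only: q_def[of p y])
  also have "\<dots> = q p y \<ominus>\<^bsub>grade B p\<^esub> q p (e p y)"
    by (rule linear_maps_diff[OF q_linear B_module B_module y ey])
  finally show ?thesis using q_f[OF r_closed[OF y]] q_closed[OF y] by (simp add: M.diff_zero)
qed

lemma q_bdry:
  assumes y: "y \<in> carrier (grade B p)"
  shows "q (p - 1) (bdry B p y) = bdry B p (q p y)"
  using linear_maps_diff[OF cc_bdry[OF B] B_module B_module y f_closed[OF r_closed[OF y]]]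
  by (simp add: q_def rd[OF y, symmetric] cm_bdry[OF f r_closed[OF y]])

lemma homotopy_q:
  assumes y: "y \<in> carrier (grade B p)"
  shows "bdry B (p + 1) (h p y) \<oplus>\<^bsub>grade B p\<^esub> h (p - 1) (bdry B p y) = q p y"
proof -
  interpret M: module R "grade B p" by (rule B_module)
  let ?z = "bdry B (p + 1) (h p y) \<oplus>\<^bsub>grade B p\<^esub> h (p - 1) (bdry B p y)"
  have "h (p - 1) (bdry B p y) \<in> carrier (grade B p)"
    using linear_maps_closed[OF h[of "p - 1"] dB_closed[OF y]] by simp
  then have z: "?z \<in> carrier (grade B p)"
    using linear_maps_closed[OF cc_bdry_Suc[OF B] linear_maps_closed[OF h y]] by simp
  have "q p y = (e p y \<oplus>\<^bsub>grade B p\<^esub> ?z) \<ominus>\<^bsub>grade B p\<^esub> e p y"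
    unfolding frh[OF y, symmetric] by (simp add: q_def)
  also have "\<dots> = ?z" using z f_closed[OF r_closed[OF y]]
      by (simp add: M.group_simps del: M.a_closed)
  finally show ?thesis by simp
qed

lemma h_family: "linear_family 1 h"
  using h by simp

section \<open>The cube presentation and its map to the tensor power\<close>

abbreviation Q where "Q \<equiv> pushout_power_source R A B f n"
abbreviation cv where "cv \<equiv> cube_vertex A B"
abbreviation CG where "CG \<equiv> cube_gens A B n"
abbreviation CR where "CR \<equiv> cube_rels R A B f n"
abbreviation qg where "qg m S w \<equiv> pgen R (cube_gens A B n m) (cube_rels R A B f n m) (S, w)"
abbreviation incl where "incl \<equiv> pushout_power R B f n"

lemma grade_Q: "grade Q m = presented_module R (CG m) (CR m)"
  by (simp add: pushout_power_source_def presented_cplx_def)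

lemma Q_module: "module R (grade Q m)"
  unfolding grade_Q by (rule module_presented[OF R.is_cring])

lemma cv_module: "module R (grade (cv S i) p)"
  using A_module B_module by (simp add: cube_vertex_def)

lemma cube_gensI: "S \<subset> {..<n} \<Longrightarrow> w \<in> words (cv S) n m \<Longrightarrow> (S, w) \<in> CG m"
  by (simp add: cube_gens_def)

lemma qg_closed: "S \<subset> {..<n} \<Longrightarrow> w \<in> words (cv S) n m \<Longrightarrow> qg m S w \<in> carrier (grade Q m)"
  unfolding grade_Q by (rule pgen_closed[OF R.is_cring cube_gensI])

text \<open>The multilinear relators of each single vertex occur among \<open>cube_rels\<close>,
  tagged with that vertex.\<close>

lemma qg_multilinear:
  assumes S: "S \<subset> {..<n}"
  shows "multilinear R (cv S) n m (grade Q m) (qg m S)"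
proof -
  have "comb_eval (grade Q m) (qg m S) \<rho> = \<zero>\<^bsub>grade Q m\<^esub>" if \<rho>: "\<rho> \<in> multilinear_rels R (cv S) n m"
      for \<rho>
  proof -
    let ?\<rho> = "map (\<lambda>(c, w). (c, (S, w))) \<rho>"
    have fc: "\<rho> \<in> formal_combs R (words (cv S) n m)"
      by (rule multilinear_relators_formal[OF R.is_cring cv_module \<rho>])
    have "?\<rho> \<in> CR m" using S \<rho> unfolding cube_rels_def by blast
    moreover have "?\<rho> \<in> formal_combs R (CG m)"
      using fc by (induction rule: formal_combs_induct) (simp_all add: cube_gensI[OF S])
    ultimately have "comb_eval (presented_module R (CG m) (CR m)) (pgen R (CG m) (CR m)) ?\<rho> =
        \<zero>\<^bsub>presented_module R (CG m) (CR m)\<^esub>"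
      by (rule comb_eval_relator[OF R.is_cring])
    then show ?thesis unfolding comb_eval_map grade_Q .
  qed
  then show ?thesis
    using multilinear_iff_relators[where Z = "cv S" and n = n and m = m and F = "qg m S",
        OF Q_module cv_module qg_closed[OF S]] by blast
qed

lemma upd_f_words:
  assumes i: "i < n" "i \<notin> S" and w: "w \<in> words (cv S) n m"
  shows "upd 0 f i w \<in> words (cv (insert i S)) n m"
proof -
  have l: "length w = n" by (rule words_length[OF w])
  have "slot_map (\<lambda>j. if j = i then 0 else 0) (\<lambda>j. if j = i then f else (\<lambda>_ x. x)) w \<in> words
      (cv (insert i S)) n m"
    by (rule slot_map_words[where R = R, OF w]) (use i f_linear linear_maps_id in
        \<open>auto simp: cube_vertex_def\<close>)
  then show ?thesis using i l by (simp add: upd_slot_map)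
qed

lemma qg_push:
  assumes i: "i < n" "i \<notin> S" "insert i S \<subset> {..<n}" and w: "w \<in> words (cv S) n m"
  shows "qg m S w = qg m (insert i S) (upd 0 f i w)"
proof -
  let ?r = "[(\<one>\<^bsub>R\<^esub>, (S, w)), (\<ominus>\<^bsub>R\<^esub> \<one>\<^bsub>R\<^esub>, (insert i S, upd 0 f i w))]"
  let ?N = "presented_module R (CG m) (CR m)"
  note N = Q_module[of m, unfolded grade_Q]
  have S: "S \<subset> {..<n}" using i(3) by auto
  note uw = upd_f_words[OF i(1,2) w]
  have "?r \<in> CR m" unfolding cube_rels_def upd_zero by (rule UnI2) (use i w in blast)
  moreover have "?r \<in> formal_combs R (CG m)" using cube_gensI[OF S w] cube_gensI[OF i(3) uw] by simp
  ultimately have "comb_eval ?N (pgen R (CG m) (CR m)) ?r = \<zero>\<^bsub>?N\<^esub>"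
      by (rule comb_eval_relator[OF R.is_cring])
  then have "qg m S w = \<one>\<^bsub>R\<^esub> \<odot>\<^bsub>?N\<^esub> qg m (insert i S) (upd 0 f i w)"
    using qg_closed[OF S w] qg_closed[OF i(3) uw] by (simp add: module_relation2_iff[OF N] grade_Q)
  then show ?thesis
    using module.smult_one[OF N] qg_closed[OF i(3) uw] by (simp add: grade_Q)
qed

text \<open>A relation of the cube adds one position to the vertex; iterating it gives the
  identification along any inclusion of proper subsets.\<close>

lemma qg_push_set:
  assumes "finite D" "D \<inter> S = {}" "S \<union> D \<subset> {..<n}" "w \<in> words (cv S) n m"
  shows "qg m S w = qg m (S \<union> D) (slot_map (\<lambda>_. 0) (\<lambda>j. if j \<in> D then f else (\<lambda>_ x. x)) w)"
  using assms(1-3)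
proof (induction rule: finite_induct)
  case empty
  have "slot_map (\<lambda>_. 0) (\<lambda>j _ x. x) w = w" by (rule nth_equalityI) auto
  then show ?case by simp
next
  case (insert d D)
  let ?v = "slot_map (\<lambda>_. 0) (\<lambda>j. if j \<in> D then f else (\<lambda>_ x. x)) w"
  have v: "?v \<in> words (cv (S \<union> D)) n m"
    by (rule slot_map_words[where R = R, OF assms(4)])
      (use insert f_linear linear_maps_id in \<open>auto simp: cube_vertex_def\<close>)
  have d: "d < n" "d \<notin> S \<union> D" "insert d (S \<union> D) \<subset> {..<n}" using insert by auto
  have l: "length w = n" by (rule words_length[OF assms(4)])
  have "qg m S w = qg m (S \<union> D) ?v" using insert by (intro insert.IH) auto
  also have "\<dots> = qg m (insert d (S \<union> D)) (upd 0 f d ?v)" by (rule qg_push[OF d v])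
  also have "upd 0 f d ?v = slot_map (\<lambda>_. 0) (\<lambda>j. if j \<in> insert d D then f else (\<lambda>_ x. x)) w"
    using d l insert(2) by (intro nth_equalityI) (auto simp: nth_upd)
  finally show ?case by simp
qed

lemma apply_off_slot_map: "apply_off f S w = slot_map (\<lambda>_. 0) (\<lambda>j. if j \<in> S then (\<lambda>_ x. x) else f)
    w"
  by (rule nth_equalityI) (auto simp: apply_off_def)

lemma apply_off_words:
  assumes "w \<in> words (cv S) n m"
  shows "apply_off f S w \<in> W m"
  unfolding apply_off_slot_map
  by (rule slot_map_words[where R = R, OF assms]) (use f_linear linear_maps_id in
      \<open>auto simp: cube_vertex_def\<close>)

text \<open>The relations along the edges of the cube hold in the tensor power because
  \<open>f\<close> ends up in all slots outside \<open>S\<close>, whether or not slot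
  \<open>i\<close> received it earlier.\<close>

lemma incl_props:
  shows incl_linear: "incl m \<in> linear_maps R (grade Q m) (grade T m)"
    and incl_qg: "S \<subset> {..<n} \<Longrightarrow> w \<in> words (cv S) n m \<Longrightarrow> incl m (qg m S w) = wg m (apply_off f S w)"
proof -
  let ?F = "\<lambda>(S, w). [(\<one>\<^bsub>R\<^esub>, apply_off f S w)]"
  let ?Rel = "multilinear_rels R (\<lambda>_. B) n m"
  have F: "?F g \<in> formal_combs R (W m)" if "g \<in> CG m" for g
    using that apply_off_words by (auto simp: cube_gens_def)
  have cls: "(\<lambda>g. comb_class R (W m) ?Rel (?F g)) = (\<lambda>(S, w). wg m (apply_off f S w))"
    by (auto simp: pgen_def)
  have rel: "comb_eval (grade T m) (\<lambda>g. comb_class R (W m) ?Rel (?F g)) \<rho> = \<zero>\<^bsub>grade T m\<^esub>"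
    if \<rho>: "\<rho> \<in> CR m" for \<rho>
  proof -
    interpret N: module R "grade T m" by (rule T_module)
    from \<rho> consider S \<rho>' where "\<rho> = map (\<lambda>(c, w). (c, (S, w))) \<rho>'" "S \<subset> {..<n}"
        "\<rho>' \<in> multilinear_rels R (cv S) n m"
      | S w i where "\<rho> = [(\<one>\<^bsub>R\<^esub>, (S, w)), (\<ominus>\<^bsub>R\<^esub> \<one>\<^bsub>R\<^esub>, (insert i S, upd 0 f i w))]"
        "i < n" "i \<notin> S" "insert i S \<subset> {..<n}" "w \<in> words (cv S) n m"
      unfolding cube_rels_def upd_zero by blast
    then show ?thesis
    proof cases
      case (1 S \<rho>')
      have "multilinear R (cv S) n m (grade T m) (\<lambda>w. wg m (apply_off f S w))"
        unfolding apply_off_slot_map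
        by (rule multilinear_slot_map[OF wg_multilinear])
          (use f_linear linear_maps_id in \<open>auto simp: cube_vertex_def\<close>)
      then have "comb_eval (grade T m) (\<lambda>w. wg m (apply_off f S w)) \<rho>' = \<zero>\<^bsub>grade T m\<^esub>"
        using multilinear_iff_relators[where Z = "cv S" and n = n and m = m
            and F = "\<lambda>w. wg m (apply_off f S w)", OF T_module cv_module
                wg_closed[OF apply_off_words]] 1(3)
        by blast
      then show ?thesis unfolding cls 1(1) comb_eval_map by simp
    next
      case (2 S w i)
      have l: "length w = n" by (rule words_length[OF 2(5)])
      have "apply_off f (insert i S) (upd 0 f i w) = apply_off f S w"
        unfolding apply_off_slot_map using 2(2,3) l by (intro nth_equalityI) (auto simp: nth_upd)
      then show ?thesis
        unfolding cls 2(1) using wg_closed[OF apply_off_words[OF 2(5)]]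
        by (simp add: module_minus_eq[OF T_module] N.group_simps)
    qed
  qed
  note rel' = rel[unfolded grade_T]
  show "incl m \<in> linear_maps R (grade Q m) (grade T m)"
    unfolding pushout_power_def grade_T grade_Q by (rule presented_map_linear[OF R.is_cring F rel'])
  show "S \<subset> {..<n} \<Longrightarrow> w \<in> words (cv S) n m \<Longrightarrow> incl m (qg m S w) = wg m (apply_off f S w)"
    unfolding pushout_power_def using presented_map_pgen[OF R.is_cring F rel' cube_gensI[of S w m]]
    by (simp add: pgen_def)
qed

lemma Q_eqI:
  assumes "module R N" "u \<in> linear_maps R (grade Q m) N" "v \<in> linear_maps R (grade Q m) N"
    and "\<And>S w. S \<subset> {..<n} \<Longrightarrow> w \<in> words (cv S) n m \<Longrightarrow> u (qg m S w) = v (qg m S w)"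
    and "x \<in> carrier (grade Q m)"
  shows "u x = v x"
  by (rule presented_maps_eqI[OF R.is_cring assms(1) assms(2,3)[unfolded grade_Q] _
      assms(5)[unfolded grade_Q]])
    (use assms(4) in \<open>auto simp: cube_gens_def\<close>)

text \<open>A summand of the expansion with \<open>r\<close> in place of \<open>f r\<close> in slot
  \<open>i\<close>. The entry there lies in \<open>A\<close>, so the word belongs to the vertex that
  misses only \<open>i\<close>, and applying \<open>f\<close> off this vertex gives the summand
  back.\<close>

definition ret_word where
  "ret_word i = slot_map (\<lambda>_. 0) (\<lambda>j. if j < i then q else if j = i then r else (\<lambda>_ x. x))"

text \<open>
  Splitting the identity as \<open>q + f r\<close> one factor after the other gives
  \<open>1 = q\<^sup>\<otimes>\<^sup>n + \<Sum>\<^sub>i q\<^sup>\<otimes>\<^sup>i \<otimes> f r \<otimes> 1\<^sup>\<otimes>\<^sup>n\<^sup>-\<^sup>1\<^sup>-\<^sup>i\<close>; the \<open>i\<close>-th summand factors through the vertex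
  \<open>{..<n} - {i}\<close> of the cube.
\<close>

definition ret where
  "ret m = lin_ext (grade Q m) (\<lambda>w. finsum (grade Q m) (\<lambda>i. qg m ({..<n} - {i}) (ret_word i w))
      {..<n})"

lemma punctured: "i < n \<Longrightarrow> {..<n} - {i} \<subset> {..<n}"
  by auto

lemma ret_word_words: "i < n \<Longrightarrow> w \<in> W m \<Longrightarrow> ret_word i w \<in> words (cv ({..<n} - {i})) n m"
  unfolding ret_word_def
  by (rule slot_map_words[where R = R]) (use q_linear r linear_maps_id in
      \<open>auto simp: cube_vertex_def\<close>)

lemma ret_multilinear:
  "multilinear R (\<lambda>_. B) n m (grade Q m) (\<lambda>w. finsum (grade Q m) (\<lambda>i. qg m ({..<n} - {i})
      (ret_word i w)) {..<n})"
proof (rule multilinear_finsum[OF Q_module])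
  fix i assume "i \<in> {..<n}"
  then have i: "i < n" by simp
  show "multilinear R (\<lambda>_. B) n m (grade Q m) (\<lambda>w. qg m ({..<n} - {i}) (ret_word i w))"
    unfolding ret_word_def
    by (rule multilinear_slot_map[OF qg_multilinear[OF punctured[OF i]]])
      (use q_linear r linear_maps_id i in \<open>auto simp: cube_vertex_def\<close>)
qed (use B_module in auto)

lemma ret_linear: "ret m \<in> linear_maps R (grade T m) (grade Q m)"
  unfolding ret_def by (rule T_lift_linear[OF Q_module ret_multilinear])

lemma ret_wg:
  "w \<in> W m \<Longrightarrow> ret m (wg m w) = finsum (grade Q m) (\<lambda>i. qg m ({..<n} - {i}) (ret_word i w)) {..<n}"
  unfolding ret_def by (rule T_lift_wg[OF Q_module ret_multilinear])

text \<open>\<open>incl\<close> applies the \<open>f\<close> that \<open>ret_word\<close> leaves out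
  in slot \<open>i\<close>, so the image is the sum in \<open>multilinear_telescope\<close> with the
  same splitting in every slot, and \<open>tpow q\<close> is its last term.\<close>

lemma incl_ret:
  assumes t: "t \<in> carrier (grade T m)"
  shows "incl m (ret m t) \<oplus>\<^bsub>grade T m\<^esub> tpow q m t = t"
proof (rule T_eqI[OF T_module linear_maps_plus[OF linear_maps_comp[OF ret_linear incl_linear]
      tpow_linear[OF q_family] T_module] linear_maps_id _ t])
  fix w assume w: "w \<in> W m"
  have l: "length w = n" by (rule words_length[OF w])
  interpret N: module R "grade T m" by (rule T_module)
  let ?E = "\<lambda>i. slot_map (\<lambda>_. 0) (\<lambda>j. if j < i then q else if j = i then e else (\<lambda>_ x. x)) w"
  have "incl m (ret m (wg m w)) =
      finsum (grade T m) (\<lambda>i. incl m (qg m ({..<n} - {i}) (ret_word i w))) {..<n}"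
    unfolding ret_wg[OF w]
    by (rule linear_maps_finsum[OF incl_linear Q_module T_module])
      (use qg_closed[OF punctured ret_word_words[OF _ w]] in auto)
  also have "\<dots> = finsum (grade T m) (\<lambda>i. wg m (?E i)) {..<n}"
  proof (rule N.finsum_cong'[OF refl])
    have "?E i \<in> W m" for i
      by (rule slot_map_words[where R = R, OF w]) (use q_linear e_linear linear_maps_id in auto)
    then show "(\<lambda>i. wg m (?E i)) \<in> {..<n} \<rightarrow> carrier (grade T m)" using wg_closed by blast
    fix i assume "i \<in> {..<n}"
    then have i: "i < n" by simp
    have "apply_off f ({..<n} - {i}) (ret_word i w) = ?E i"
      unfolding apply_off_slot_map ret_word_def using i l by (intro nth_equalityI) auto
    then show "incl m (qg m ({..<n} - {i}) (ret_word i w)) = wg m (?E i)"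
      by (simp add: incl_qg[OF punctured[OF i] ret_word_words[OF i w]])
  qed
  finally have 1: "incl m (ret m (wg m w)) = finsum (grade T m) (\<lambda>i. wg m (?E i)) {..<n}" .
  have "slot_map (\<lambda>_. 0) (\<lambda>j. if j < n then q else (\<lambda>_ x. x)) w = slot_map (\<lambda>_. 0) (\<lambda>_. q) w"
    by (rule slot_map_cong) (simp add: l)
  then have 2: "tpow q m (wg m w) = wg m (slot_map (\<lambda>_. 0) (\<lambda>j. if j < n then q else (\<lambda>_ x. x)) w)"
    by (simp add: tpow_wg[OF q_family w])
  show "incl m (ret m (wg m w)) \<oplus>\<^bsub>grade T m\<^esub> tpow q m (wg m w) = wg m w"
    unfolding 1 2
    by (rule multilinear_telescope[OF wg_multilinear T_module B_module w,
          where q = "\<lambda>_. q" and e = "\<lambda>_. e" and k = n])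
      (use q_linear e_linear q_plus_e in auto)
qed

text \<open>The telescope is run a second time, now on the vertex \<open>S\<close> itself, with
  splittings chosen so that its summands correspond to those of \<open>ret\<close> on the included
  word. Corresponding summands sit at different vertices and are identified through the relations of
  the cube. The last term vanishes because \<open>S\<close> is a proper subset.\<close>

lemma ret_incl:
  assumes x: "x \<in> carrier (grade Q m)"
  shows "ret m (incl m x) = x"
proof (rule Q_eqI[OF Q_module linear_maps_comp[OF incl_linear ret_linear] linear_maps_id _ x])
  fix S w assume S: "S \<subset> {..<n}" and w: "w \<in> words (cv S) n m"
  have l: "length w = n" by (rule words_length[OF w])
  interpret N: module R "grade Q m" by (rule Q_module)
  \<comment> \<open>In the slots of \<open>S\<close> the splitting is \<open>q + f r\<close>. In the
    others it is \<open>0 + 1\<close>, which is what \<open>q + f r\<close> becomes on the image of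
    \<open>f\<close>.\<close>
  let ?q = "\<lambda>j p x. if j \<in> S then q p x else \<zero>\<^bsub>grade A p\<^esub>"
  let ?e = "\<lambda>j p x. if j \<in> S then e p x else x"
  let ?E = "\<lambda>i. slot_map (\<lambda>_. 0) (\<lambda>j. if j < i then ?q j else if j = i then ?e j else (\<lambda>_ x. x)) w"
  have A0: "(\<lambda>x. \<zero>\<^bsub>grade A p\<^esub>) \<in> linear_maps R (grade A p) (grade A p)" for p
  proof -
    interpret M: module R "grade A p" by (rule A_module)
    show ?thesis by (rule linear_mapsI) simp_all
  qed
  have ql: "?q i p \<in> linear_maps R (grade (cv S i) p) (grade (cv S i) p)" for i p
    using q_linear[of p] A0 by (simp add: cube_vertex_def)
  have el: "?e i p \<in> linear_maps R (grade (cv S i) p) (grade (cv S i) p)" for i p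
    using e_linear[of p] linear_maps_id[of R "grade A p"] by (simp add: cube_vertex_def)
  have qe: "?q i p x \<oplus>\<^bsub>grade (cv S i) p\<^esub> ?e i p x = x" if "x \<in> carrier (grade (cv S i) p)" for i p x
  proof -
    interpret M: module R "grade A p" by (rule A_module)
    show ?thesis using that q_plus_e by (auto simp: cube_vertex_def)
  qed
  have wx: "snd (w ! j) \<in> carrier (grade B (fst (w ! j)))" if "j < n" "j \<in> S" for j
    using words_nth[OF w that(1)] that(2) by (simp add: cube_vertex_def)
  have wa: "snd (w ! j) \<in> carrier (grade A (fst (w ! j)))" if "j < n" "j \<notin> S" for j
    using words_nth[OF w that(1)] that(2) by (simp add: cube_vertex_def)
  have f0: "f p \<zero>\<^bsub>grade A p\<^esub> = \<zero>\<^bsub>grade B p\<^esub>" for p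
    by (rule linear_maps_zero[OF f_linear A_module B_module])
  \<comment> \<open>Both sides come from the word \<open>?v\<close> at the vertex
    \<open>S - {i}\<close>, whose slot \<open>i\<close> holds an element of \<open>A\<close>.
    Applying \<open>f\<close> in slot \<open>i\<close>, if \<open>i\<close> is in \<open>S\<close>,
    leads to the vertex \<open>S\<close>; applying it in the slots of \<open>?D\<close> leads to the
    vertex that misses only \<open>i\<close>. The results agree by \<open>q f = 0\<close> and
    \<open>r f = 1\<close>.\<close>
  have summand: "qg m S (?E i) = qg m ({..<n} - {i}) (ret_word i (apply_off f S w))" if i: "i < n"
      for i
  proof -
    let ?S = "S - {i}" and ?D = "{..<n} - {i} - S"
    let ?v = "slot_map (\<lambda>_. 0) (\<lambda>j. if j < i then ?q j else if j =
        i then (if i \<in> S then r else (\<lambda>_ x. x)) else (\<lambda>_ x. x)) w"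
    have SD: "?S \<union> ?D = {..<n} - {i}" using S by auto
    have v: "?v \<in> words (cv ?S) n m"
      by (rule slot_map_words[where R = R, OF w])
        (use q_linear A0 r linear_maps_id in \<open>auto simp: cube_vertex_def\<close>)
    have 1: "qg m S (?E i) = qg m ?S ?v"
    proof (cases "i \<in> S")
      case True
      have "upd 0 f i ?v = ?E i" using i l True by (intro nth_equalityI) (auto simp: nth_upd)
      moreover have "insert i ?S = S" using True by auto
      ultimately show ?thesis using qg_push[of i ?S ?v m] i S v by simp
    next
      case False
      have "?E i = ?v" by (rule slot_map_cong) (use False in auto)
      then show ?thesis using False by simp
    qed
    also have "\<dots> = qg m (?S \<union> ?D) (slot_map (\<lambda>_. 0) (\<lambda>j. if j \<in> ?D then f else (\<lambda>_ x. x)) ?v)"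
      by (rule qg_push_set[OF _ _ _ v]) (use i in \<open>auto simp: SD\<close>)
    also have "slot_map (\<lambda>_. 0) (\<lambda>j. if j \<in> ?D then f else (\<lambda>_ x. x)) ?v =
        ret_word i (apply_off f S w)"
      unfolding apply_off_slot_map ret_word_def slot_map_slot_map
      by (rule slot_map_cong) (use i l wa in \<open>auto simp: f0 q_f rf\<close>)
    finally show ?thesis unfolding SD .
  qed
  have "finsum (grade Q m) (\<lambda>i. qg m S (?E i)) {..<n} \<oplus>\<^bsub>grade Q m\<^esub>
      qg m S (slot_map (\<lambda>_. 0) (\<lambda>j. if j < n then ?q j else (\<lambda>_ x. x)) w) = qg m S w"
    by (rule multilinear_telescope[OF qg_multilinear[OF S] Q_module cv_module w ql el qe]) simp_all
  moreover have "qg m S (slot_map (\<lambda>_. 0) (\<lambda>j. if j < n then ?q j else (\<lambda>_ x. x)) w) = \<zero>\<^bsub>grade Q m\<^esub>"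
  proof -
    \<comment> \<open>In a slot outside \<open>S\<close> the operator \<open>?q\<close> is zero, so
      the word in which all slots are split off has a zero entry.\<close>
    obtain j where j: "j < n" "j \<notin> S" using S by auto
    have "slot_map (\<lambda>_. 0) (\<lambda>j. if j < n then ?q j else (\<lambda>_ x. x)) w \<in> words (cv S) n m"
      by (rule slot_map_words[where R = R, OF w]) (use ql in simp_all)
    then show ?thesis
      by (rule multilinear_zero_slot[OF qg_multilinear[OF S] _ j(1) Q_module cv_module])
        (use j l in \<open>simp add: cube_vertex_def\<close>)
  qed
  moreover have "?E i \<in> words (cv S) n m" for i
    by (rule slot_map_words[where R = R, OF w]) (use ql el in \<open>simp_all add: linear_maps_id\<close>)
  then have cl: "qg m S (?E i) \<in> carrier (grade Q m)" for i by (rule qg_closed[OF S])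
  moreover have "finsum (grade Q m) (\<lambda>i. qg m S (?E i)) {..<n} \<in> carrier (grade Q m)"
    by (rule N.finsum_closed) (use cl in auto)
  ultimately have "qg m S w = finsum (grade Q m) (\<lambda>i. qg m S (?E i)) {..<n}" by simp
  also have "\<dots> = finsum (grade Q m) (\<lambda>i. qg m ({..<n} - {i}) (ret_word i (apply_off f S w))) {..<n}"
    by (rule N.finsum_cong'[OF refl]) (use cl in \<open>auto simp: summand[symmetric]\<close>)
  also have "\<dots> = ret m (incl m (qg m S w))"
    unfolding incl_qg[OF S w] ret_wg[OF apply_off_words[OF w]] by (rule refl)
  finally show "ret m (incl m (qg m S w)) = qg m S w" by simp
qed

section \<open>Differential and action on the source, through its embedding\<close>

lemma incl_inject:
  assumes "x \<in> carrier (grade Q m)" "y \<in> carrier (grade Q m)" "incl m x = incl m y"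
  shows "x = y"
  using ret_incl assms by metis

text \<open>
  Since \<open>incl\<close> is injective, a map on the generators of the cube respects its relations as soon as
  it is compatible with a linear map between tensor powers.
\<close>

lemma Q_transport:
  assumes F: "\<And>S w. S \<subset> {..<n} \<Longrightarrow> w \<in> words (cv S) n m \<Longrightarrow> F (S, w) \<in> formal_combs R (CG m')"
    and D: "D \<in> linear_maps R (grade T m) (grade T m')"
    and FD: "\<And>S w. S \<subset> {..<n} \<Longrightarrow> w \<in> words (cv S) n m \<Longrightarrow>
      incl m' (comb_eval (grade Q m') (pgen R (CG m') (CR m')) (F (S, w))) =
          D (wg m (apply_off f S w))"
  shows "presented_map R (CG m') (CR m') F \<in> linear_maps R (grade Q m) (grade Q m')"
    and "x \<in> carrier (grade Q m) \<Longrightarrow> incl m' (presented_map R (CG m') (CR m') F x) = D (incl m x)"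
proof -
  let ?c = "\<lambda>g. comb_class R (CG m') (CR m') (F g)"
  have F': "F g \<in> formal_combs R (CG m')" if "g \<in> CG m" for g
    using that F by (auto simp: cube_gens_def)
  have c: "?c \<in> CG m \<rightarrow> carrier (grade Q m')"
    unfolding grade_Q by (rule Pi_I) (rule comb_class_closed[OF R.is_cring F'])
  have ic: "incl m' (?c g) = D (incl m (pgen R (CG m) (CR m) g))" if g: "g \<in> CG m" for g
  proof -
    obtain S w where Sw: "g = (S, w)" "S \<subset> {..<n}" "w \<in> words (cv S) n m"
      using g by (auto simp: cube_gens_def)
    show ?thesis
      using FD[OF Sw(2,3)] incl_qg[OF Sw(2,3)] comb_class_eval[OF R.is_cring F'[OF g], of "CR m'"]
      by (simp add: Sw(1) grade_Q)
  qed
  have gens: "pgen R (CG m) (CR m) \<in> CG m \<rightarrow> carrier (grade Q m)"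
    unfolding grade_Q by (rule Pi_I) (rule pgen_closed[OF R.is_cring])
  have rel: "comb_eval (grade Q m') ?c \<rho> = \<zero>\<^bsub>grade Q m'\<^esub>"
    if \<rho>: "\<rho> \<in> CR m" "\<rho> \<in> formal_combs R (CG m)" for \<rho>
  proof -
    interpret N: module R "grade Q m'" by (rule Q_module)
    note Di = linear_maps_comp[OF incl_linear D]
    \<comment> \<open>\<open>incl\<close> and \<open>D\<close> are linear and pass through the
      evaluation, which ends in \<open>grade Q m\<close>, where the relator is zero.\<close>
    have "incl m' (comb_eval (grade Q m') ?c \<rho>) = comb_eval (grade T m') (\<lambda>g. incl m' (?c g)) \<rho>"
      by (rule linear_comb_eval[OF incl_linear Q_module T_module c \<rho>(2)])
    also have "\<dots> = comb_eval (grade T m') (\<lambda>g. D (incl m (pgen R (CG m) (CR m) g))) \<rho>"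
      by (rule comb_eval_cong[OF ic \<rho>(2)])
    also have "\<dots> = D (incl m (comb_eval (grade Q m) (pgen R (CG m) (CR m)) \<rho>))"
      by (rule linear_comb_eval[OF Di Q_module T_module gens \<rho>(2), symmetric])
    also have "comb_eval (grade Q m) (pgen R (CG m) (CR m)) \<rho> = \<zero>\<^bsub>grade Q m\<^esub>"
      unfolding grade_Q by (rule comb_eval_relator[OF R.is_cring \<rho>])
    also have "D (incl m \<zero>\<^bsub>grade Q m\<^esub>) = incl m' \<zero>\<^bsub>grade Q m'\<^esub>"
      using linear_maps_zero[OF Di Q_module T_module] linear_maps_zero[OF incl_linear Q_module
          T_module] by simp
    finally show ?thesis
      by (rule incl_inject[OF comb_eval_closed[OF Q_module c \<rho>(2)] N.M.zero_closed])
  qed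
  note rel' = rel[unfolded grade_Q]
  show l: "presented_map R (CG m') (CR m') F \<in> linear_maps R (grade Q m) (grade Q m')"
    unfolding grade_Q by (rule presented_map_linear[OF R.is_cring F' rel'])
  show "incl m' (presented_map R (CG m') (CR m') F x) = D (incl m x)" if "x \<in> carrier (grade Q m)"
  proof (rule Q_eqI[OF T_module linear_maps_comp[OF l incl_linear] linear_maps_comp[OF incl_linear
      D] _ that])
    fix S w assume "S \<subset> {..<n}" "w \<in> words (cv S) n m"
    then have g: "(S, w) \<in> CG m" by (rule cube_gensI)
    have "presented_map R (CG m') (CR m') F (qg m S w) = comb_class R (CG m') (CR m') (F (S, w))"
      by (rule presented_map_pgen[OF R.is_cring F' rel' g])
    then show "incl m' (presented_map R (CG m') (CR m') F (qg m S w)) = D (incl m (qg m S w))"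
      using ic[OF g] by simp
  qed
qed

text \<open>In slot \<open>i\<close> the boundary is that of \<open>A\<close> or of
  \<open>B\<close>, according to the vertex. As \<open>f\<close> is a chain map, applying it off
  \<open>S\<close> turns both into the boundary of \<open>B\<close>, and as it preserves degrees,
  the signs agree.\<close>

lemma Q_bdry:
  shows Q_bdry_linear: "bdry Q m \<in> linear_maps R (grade Q m) (grade Q (m - 1))"
    and incl_bdry: "x \<in> carrier (grade Q m) \<Longrightarrow> incl (m - 1) (bdry Q m x) = bdry T m (incl m x)"
proof -
  let ?F = "\<lambda>(S, w). map (\<lambda>(c, w'). (c, (S, w'))) (word_bdry R (cv S) w)"
  have bd: "bdry Q m = presented_map R (CG (m - 1)) (CR (m - 1)) ?F"
    by (simp add: pushout_power_source_def presented_cplx_def)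
  let ?s = "\<lambda>i w. parity_sign R (\<Sum>j<i. fst (w ! j))"
  have FS: "?F (S, w) = map (\<lambda>i. (?s i w, (S, upd (- 1) (bdry (cv S i)) i w))) [0..<n]"
    if "w \<in> words (cv S) n m" for S w
    using words_length[OF that] by (simp add: word_bdry_eq comp_def)
  have u: "upd (- 1) (bdry (cv S i)) i w \<in> words (cv S) n (m - 1)"
    if w: "w \<in> words (cv S) n m" and i: "i < n" for S w i
  proof -
    have "slot_map (\<lambda>j. if j = i then - 1 else 0) (\<lambda>j. if j = i then bdry (cv S i) else (\<lambda>_ x. x))
        w \<in> words (cv S) n (m - 1)"
      by (rule slot_map_words[where R = R, OF w])
        (use i cc_bdry[OF A] cc_bdry[OF B] linear_maps_id in \<open>auto simp: cube_vertex_def\<close>)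
    then show ?thesis using i words_length[OF w] by (simp add: upd_slot_map)
  qed
  have F: "?F (S, w) \<in> formal_combs R (CG (m - 1))" if "S \<subset> {..<n}" "w \<in> words (cv S) n m" for S w
    unfolding FS[OF that(2)] using cube_gensI[OF that(1) u[OF that(2)]]
        by (auto simp: formal_combs_def)
  have FD: "incl (m - 1) (comb_eval (grade Q (m - 1)) (pgen R (CG (m - 1)) (CR (m - 1)))
      (?F (S, w))) =
      bdry T m (wg m (apply_off f S w))" if S: "S \<subset> {..<n}" and w: "w \<in> words (cv S) n m" for S w
  proof -
    interpret N: module R "grade T (m - 1)" by (rule T_module)
    interpret Q1: module R "grade Q (m - 1)" by (rule Q_module)
    have l: "length w = n" by (rule words_length[OF w])
    note qc = qg_closed[OF S u[OF w]]
    note aw = apply_off_words[OF w]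
    have ua: "upd (- 1) (bdry B) i (apply_off f S w) \<in> W (m - 1)" if "i < n" for i
      using upd_words[OF aw that bdry_family] by simp
    have "incl (m - 1) (comb_eval (grade Q (m - 1)) (pgen R (CG (m - 1)) (CR (m - 1)))
        (?F (S, w))) =
        incl (m - 1) (finsum (grade Q (m - 1)) (\<lambda>i. ?s i w \<odot>\<^bsub>grade Q (m - 1)\<^esub> qg (m - 1) S
            (upd (- 1) (bdry (cv S i)) i w)) {..<n})"
      unfolding FS[OF w] by (subst comb_eval_map_upt[OF Q_module]) (use qc in simp_all)
    also have "\<dots> = finsum (grade T (m - 1)) (\<lambda>i. incl (m - 1) (?s i w \<odot>\<^bsub>grade Q (m - 1)\<^esub> qg (m - 1)
        S (upd (- 1) (bdry (cv S i)) i w))) {..<n}"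
      by (rule linear_maps_finsum[OF incl_linear Q_module T_module]) (use qc in auto)
    also have "\<dots> = finsum (grade T (m - 1)) (\<lambda>i. ?s i (apply_off f S w) \<odot>\<^bsub>grade T (m - 1)\<^esub>
        wg (m - 1) (upd (- 1) (bdry B) i (apply_off f S w))) {..<n}"
    proof (rule N.finsum_cong'[OF refl])
      fix i assume "i \<in> {..<n}"
      then have i: "i < n" by simp
      have "apply_off f S (upd (- 1) (bdry (cv S i)) i w) = upd (- 1) (bdry B) i (apply_off f S w)"
      proof (rule nth_equalityI)
        fix j assume "j < length (apply_off f S (upd (- 1) (bdry (cv S i)) i w))"
        then have j: "j < n" using l by (simp add: apply_off_def)
        show "apply_off f S (upd (- 1) (bdry (cv S i)) i w) ! j =
            upd (- 1) (bdry B) i (apply_off f S w) ! j"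
          using words_nth[OF w i] i j l cm_bdry[OF f, of "snd (w ! i)" "fst (w ! i)"]
          by (auto simp: apply_off_slot_map nth_upd cube_vertex_def)
      qed (simp add: apply_off_def)
      moreover have "?s i (apply_off f S w) = ?s i w"
        using i l by (intro arg_cong[of _ _ "parity_sign R"] sum.cong)
            (auto simp: apply_off_slot_map)
      ultimately show "incl (m - 1) (?s i w \<odot>\<^bsub>grade Q (m - 1)\<^esub> qg (m - 1) S
          (upd (- 1) (bdry (cv S i)) i w)) =
          ?s i (apply_off f S w) \<odot>\<^bsub>grade T (m - 1)\<^esub> wg (m - 1) (upd (- 1) (bdry B) i
              (apply_off f S w))"
        using linear_maps_smult[OF incl_linear R.parity_sign_closed qc[OF i]]
            incl_qg[OF S u[OF w i]] by simp
    qed (use wg_closed[OF ua] in auto)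
    also have "\<dots> = bdry T m (wg m (apply_off f S w))"
      using T_bdry_eq[OF wg_closed[OF aw]] Der_wg[OF bdry_family aw] by (simp add: Der_term_def)
    finally show ?thesis .
  qed
  show "bdry Q m \<in> linear_maps R (grade Q m) (grade Q (m - 1))"
    unfolding bd by (rule Q_transport(1)[OF F T_bdry_linear FD])
  show "x \<in> carrier (grade Q m) \<Longrightarrow> incl (m - 1) (bdry Q m x) = bdry T m (incl m x)"
    unfolding bd by (rule Q_transport(2)[OF F T_bdry_linear FD])
qed

abbreviation qact where "qact \<equiv> pushout_power_source_action R A B f n"

text \<open>Entry \<open>k\<close> of the permuted word comes from the slot that
  \<open>\<sigma>\<close> sends to \<open>k\<close>, so the vertex has to move along with the word.
  Applying \<open>f\<close> commutes with this and leaves the degrees, hence the Koszul sign,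
  alone.\<close>

lemma Q_act:
  assumes \<sigma>: "\<sigma> permutes {..<n}"
  shows Q_act_linear: "qact \<sigma> m \<in> linear_maps R (grade Q m) (grade Q m)"
    and incl_act: "x \<in> carrier (grade Q m) \<Longrightarrow> incl m (qact \<sigma> m x) = act \<sigma> m (incl m x)"
proof -
  let ?F = "\<lambda>(S, w). [(koszul_sign R \<sigma> w, (\<sigma> ` S, permute_word \<sigma> w))]"
  have inv: "inv_into UNIV \<sigma> i < n" if "i < n" for i
    using permutes_in_image[OF permutes_inv[OF \<sigma>], of i] that by simp
  have mem: "k \<in> \<sigma> ` S \<longleftrightarrow> inv_into UNIV \<sigma> k \<in> S" for k S
    using permutes_inverses[OF \<sigma>] by (metis image_iff)
  have \<sigma>S: "\<sigma> ` S \<subset> {..<n}" if "S \<subset> {..<n}" for S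
    using that permutes_image[OF \<sigma>] permutes_inj[OF \<sigma>] by (metis inj_image_subset_iff psubsetI
        psubset_eq inj_image_eq_iff)
  have pw: "permute_word \<sigma> w \<in> words (cv (\<sigma> ` S)) n m" if w: "w \<in> words (cv S) n m" for S w
  proof -
    have l: "length w = n" by (rule words_length[OF w])
    have "(\<Sum>i<n. fst (w ! inv_into UNIV \<sigma> i)) = (\<Sum>i<n. fst (w ! i))"
      using sum.permute[OF permutes_inv[OF \<sigma>], of "\<lambda>i. fst (w ! i)"] by (simp add: comp_def)
    moreover have "snd (w ! inv_into UNIV \<sigma> i) \<in> carrier (grade (cv (\<sigma> ` S) i)
        (fst (w ! inv_into UNIV \<sigma> i)))"
      if "i < n" for i
      using words_nth[OF w inv[OF that]] mem[of i S] by (simp add: cube_vertex_def)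
    ultimately show ?thesis using w l by (auto simp: words_iff nth_permute_word)
  qed
  have F: "?F (S, w) \<in> formal_combs R (CG m)" if "S \<subset> {..<n}" "w \<in> words (cv S) n m" for S w
    using cube_gensI[OF \<sigma>S[OF that(1)] pw[OF that(2)]] by simp
  have FD: "incl m (comb_eval (grade Q m) (pgen R (CG m) (CR m)) (?F (S, w))) =
      act \<sigma> m (wg m (apply_off f S w))"
    if S: "S \<subset> {..<n}" and w: "w \<in> words (cv S) n m" for S w
  proof -
    interpret Q: module R "grade Q m" by (rule Q_module)
    have l: "length w = n" by (rule words_length[OF w])
    note qc = qg_closed[OF \<sigma>S[OF S] pw[OF w]]
    have "apply_off f (\<sigma> ` S) (permute_word \<sigma> w) = permute_word \<sigma> (apply_off f S w)"
      unfolding apply_off_slot_map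
      using l inv mem by (intro nth_equalityI) (auto simp: nth_permute_word)
    moreover have "koszul_sign R \<sigma> (apply_off f S w) = koszul_sign R \<sigma> w"
      by (rule koszul_sign_cong, rule nth_equalityI) (auto simp: apply_off_slot_map)
    ultimately show ?thesis
      using qc linear_maps_smult[OF incl_linear koszul_sign_closed qc] incl_qg[OF \<sigma>S[OF S] pw[OF w]]
        act_wg[OF \<sigma> apply_off_words[OF w]] by simp
  qed
  show "qact \<sigma> m \<in> linear_maps R (grade Q m) (grade Q m)"
    unfolding pushout_power_source_action_def by (rule Q_transport(1)[OF F act_linear[OF \<sigma>] FD])
  show "x \<in> carrier (grade Q m) \<Longrightarrow> incl m (qact \<sigma> m x) = act \<sigma> m (incl m x)"
    unfolding pushout_power_source_action_def by (rule Q_transport(2)[OF F act_linear[OF \<sigma>] FD])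
qed

text \<open>That the boundary squares to zero on the source and that the action commutes with it
  holds after \<open>incl\<close>, hence before it. In negative degrees of the bounded case
  \<open>x = ret (incl x)\<close> is zero because the tensor power is.\<close>

lemma pushout_power_retract:
  assumes two: "\<And>m y. y \<in> carrier (grade T m) \<Longrightarrow> y \<oplus>\<^bsub>grade T m\<^esub> y = \<zero>\<^bsub>grade T m\<^esub> \<Longrightarrow> y = \<zero>\<^bsub>grade T m\<^esub>"
    and b: "in_Ch R b B"
  obtains K where "equivariant_retract R b n Q T qact act incl ret K"
proof -
  define K where "K = (\<lambda>m t. c \<odot>\<^bsub>grade T (m + 1)\<^esub> Der 1 h m (tpow q m t))"
  note K_props = T_homotopy[OF h_family q_family homotopy_q q_q q_bdry c]
  have K_linear: "K m \<in> linear_maps R (grade T m) (grade T (m + 1))" for m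
    unfolding K_def by (rule K_props(1))
  have K_bdry: "bdry T (m + 1) (K m t) \<oplus>\<^bsub>grade T m\<^esub> K (m - 1) (bdry T m t) = tpow q m t"
    if "t \<in> carrier (grade T m)" for m t
    unfolding K_def by (rule K_props(2)[OF _ _ _ that])
  have K_act: "K m (act \<sigma> m t) = act \<sigma> (m + 1) (K m t)"
    if "\<sigma> permutes {..<n}" "t \<in> carrier (grade T m)" for \<sigma> m t
    unfolding K_def by (rule K_props(3)[OF _ _ _ that])
  have T: "in_Ch R b T" by (rule T_in_Ch[OF two b])
  note Tc = in_ChD[OF T]
  note icl = linear_maps_closed[OF incl_linear] and Qcl = linear_maps_closed[OF Q_bdry_linear]
  have sq: "bdry Q (m - 1) (bdry Q m x) = \<zero>\<^bsub>grade Q (m - 2)\<^esub>" if x: "x \<in> carrier (grade Q m)" for x m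
  proof -
    interpret N: module R "grade Q (m - 2)" by (rule Q_module)
    have dd: "bdry Q (m - 1) (bdry Q m x) \<in> carrier (grade Q (m - 2))" using Qcl[OF Qcl[OF x]]
        by simp
    have "incl (m - 2) (bdry Q (m - 1) (bdry Q m x)) = bdry T (m - 1) (bdry T m (incl m x))"
      using incl_bdry[OF Qcl[OF x]] incl_bdry[OF x] by simp
    also have "\<dots> = incl (m - 2) \<zero>\<^bsub>grade Q (m - 2)\<^esub>"
      using cc_square[OF Tc icl[OF x]] linear_maps_zero[OF incl_linear Q_module T_module] by simp
    finally show ?thesis by (rule incl_inject[OF dd N.M.zero_closed])
  qed
  have "carrier (grade Q m) = {\<zero>\<^bsub>grade Q m\<^esub>}" if "b = Nonnegative" "m < 0" for m
  proof -
    interpret N: module R "grade Q m" by (rule Q_module)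
    have "x = \<zero>\<^bsub>grade Q m\<^esub>" if x: "x \<in> carrier (grade Q m)" for x
    proof -
      have "incl m x = \<zero>\<^bsub>grade T m\<^esub>" using icl[OF x] T \<open>b = Nonnegative\<close> \<open>m < 0\<close>
          by (auto simp: in_Ch_def)
      then show ?thesis using ret_incl[OF x] linear_maps_zero[OF ret_linear T_module Q_module]
          by simp
    qed
    then show ?thesis by auto
  qed
  then have Q: "in_Ch R b Q" using sq Q_bdry_linear Q_module
      by (simp add: in_Ch_def chain_complex_def)
  have act_chain: "chain_action R n Q qact"
    unfolding chain_action_def chain_map_def
  proof (intro allI impI conjI ballI)
    fix \<sigma> m assume \<sigma>: "\<sigma> permutes {..<n}"
    note acl = linear_maps_closed[OF Q_act_linear[OF \<sigma>]]
    show "qact \<sigma> m \<in> linear_maps R (grade Q m) (grade Q m)" by (rule Q_act_linear[OF \<sigma>])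
    fix x assume x: "x \<in> carrier (grade Q m)"
    have "incl (m - 1) (bdry Q m (qact \<sigma> m x)) = bdry T m (act \<sigma> m (incl m x))"
      using incl_bdry[OF acl[OF x]] incl_act[OF \<sigma> x] by simp
    also have "\<dots> = act \<sigma> (m - 1) (bdry T m (incl m x))"
      by (rule cm_bdry[OF chain_actionD[OF act_chain_action \<sigma>] icl[OF x]])
    also have "\<dots> = incl (m - 1) (qact \<sigma> (m - 1) (bdry Q m x))"
      using incl_bdry[OF x] incl_act[OF \<sigma> Qcl[OF x]] by simp
    finally show "bdry Q m (qact \<sigma> m x) = qact \<sigma> (m - 1) (bdry Q m x)"
      by (rule incl_inject[OF Qcl[OF acl[OF x]] acl[OF Qcl[OF x]]])
  qed
  have "equivariant_retract R b n Q T qact act incl ret K"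
    unfolding equivariant_retract_def
  proof (intro conjI allI impI ballI)
    show "chain_map R Q T incl" using incl_linear incl_bdry by (simp add: chain_map_def)
    fix m t assume t: "t \<in> carrier (grade T m)"
    show "t = incl m (ret m t) \<oplus>\<^bsub>grade T m\<^esub> (bdry T (m + 1) (K m t) \<oplus>\<^bsub>grade T m\<^esub> K (m - 1)
        (bdry T m t))"
      unfolding K_bdry[OF t] by (rule incl_ret[OF t, symmetric])
  qed (use Q T act_chain act_chain_action ret_linear K_linear K_act incl_act ret_incl in simp_all)
  then show ?thesis by (rule that)
qed

end

section \<open>Tensoring the retract with X and taking coinvariants\<close>

theorem theorem8p1p1:
  fixes R :: "('k, 'r) ring_scheme"
    and b :: boundedness
    and n :: nat
    and X :: "('k, 'x) cplx"
    and \<rho> :: "(nat \<Rightarrow> nat) \<Rightarrow> int \<Rightarrow> 'x \<Rightarrow> 'x"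
    and A B :: "('k, 'a) cplx"
    and f :: "int \<Rightarrow> 'a \<Rightarrow> 'a"
  assumes "field R"
    and char_zero: "\<And>m::nat. m > 0 \<Longrightarrow> [m] \<cdot>\<^bsub>R\<^esub> \<one>\<^bsub>R\<^esub> \<noteq> \<zero>\<^bsub>R\<^esub>"
    and "n \<ge> 1"
    and "in_Ch R b X" and "right_action R n X \<rho>"
    and "trivial_cofibration R b A B f"
  shows "trivial_cofibration R b
    (tensor_over_Sigma R n X \<rho> (pushout_power_source R A B f n)
       (pushout_power_source_action R A B f n))
    (tensor_over_Sigma R n X \<rho> (tensor_power R B n) (tensor_power_action R B n))
    (tensor_over_Sigma_map R n X \<rho> (tensor_power R B n) (tensor_power_action R B n)
       (pushout_power R B f n))"
proof -
  interpret R: field R by fact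
  have A_complex: "chain_complex R A" and B_Ch: "in_Ch R b B" and f: "chain_map R A B f"
    using assms(6) by (auto simp: trivial_cofibration_def in_Ch_def)
  obtain r h where r: "\<And>p. r p \<in> linear_maps R (grade B p) (grade A p)"
    and h: "\<And>p. h p \<in> linear_maps R (grade B p) (grade B (p + 1))"
    and rf: "\<And>p x. x \<in> carrier (grade A p) \<Longrightarrow> r p (f p x) = x"
    and rd: "\<And>p y. y \<in> carrier (grade B p) \<Longrightarrow> bdry A p (r p y) = r (p - 1) (bdry B p y)"
    and frh: "\<And>p y. y \<in> carrier (grade B p) \<Longrightarrow>
      y = f p (r p y) \<oplus>\<^bsub>grade B p\<^esub> (bdry B (p + 1) (h p y) \<oplus>\<^bsub>grade B p\<^esub> h (p - 1) (bdry B p y))"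
    by (rule trivial_cofibration_contraction[OF assms(1,6)]) (rule that)
  \<comment> \<open>In characteristic zero every positive integer is invertible in the field. The
    inverse of \<open>n\<close> averages the homotopy, and the inverse of 2 shows that the boundary
    of the tensor power squares to zero.\<close>
  have unit: "\<exists>c\<in>carrier R. c \<otimes>\<^bsub>R\<^esub> ([m] \<cdot>\<^bsub>R\<^esub> \<one>\<^bsub>R\<^esub>) = \<one>\<^bsub>R\<^esub>" if "m > 0" for m :: nat
    using char_zero[OF that] R.field_Units R.Units_l_inv R.Units_inv_closed by blast
  obtain c where c: "c \<in> carrier R" "c \<otimes>\<^bsub>R\<^esub> ([n] \<cdot>\<^bsub>R\<^esub> \<one>\<^bsub>R\<^esub>) = \<one>\<^bsub>R\<^esub>" using unit[of n] assms(3) by auto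
  obtain d where d: "d \<in> carrier R" "d \<otimes>\<^bsub>R\<^esub> ([(2::nat)] \<cdot>\<^bsub>R\<^esub> \<one>\<^bsub>R\<^esub>) = \<one>\<^bsub>R\<^esub>" using unit[of 2] by auto
  interpret contracted_embedding R B n A f r h c
    by unfold_locales (use A_complex in_ChD[OF B_Ch] f r h rf rd frh c in auto)
  have two: "y = \<zero>\<^bsub>grade T m\<^esub>" if y: "y \<in> carrier (grade T m)" "y \<oplus>\<^bsub>grade T m\<^esub> y = \<zero>\<^bsub>grade T m\<^esub>" for m y
  proof -
    interpret N: module R "grade T m" by (rule T_module)
    have "([(2::nat)] \<cdot>\<^bsub>R\<^esub> \<one>\<^bsub>R\<^esub>) \<odot>\<^bsub>grade T m\<^esub> y = \<zero>\<^bsub>grade T m\<^esub>"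
      using y by (simp add: numeral_2_eq_2 N.smult_l_distr)
    then have "d \<odot>\<^bsub>grade T m\<^esub> (([(2::nat)] \<cdot>\<^bsub>R\<^esub> \<one>\<^bsub>R\<^esub>) \<odot>\<^bsub>grade T m\<^esub> y) = \<zero>\<^bsub>grade T m\<^esub>" using d(1) by simp
    then show ?thesis using d y(1) by (simp add: N.smult_assoc1[symmetric])
  qed
  obtain K where K: "equivariant_retract R b n Q T qact act incl ret K"
    using pushout_power_retract[OF two B_Ch] .
  obtain s' K' where "equivariant_retract R b n (tensor_cplx R X Q) (tensor_cplx R X T)
    (tensor_action R X \<rho> Q qact) (tensor_action R X \<rho> T act) (tensor_map R X T (\<lambda>_ x. x) incl) s'
        K'"
    using tensor_equivariant_retract[OF R.is_cring assms(4,5) K] .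
  from coinvariants_trivial_cofibration[OF this] show ?thesis
    by (simp add: tensor_over_Sigma_def tensor_over_Sigma_map_def[abs_def])
qed

end
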